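(* Let $M$ be a smooth manifold, $\mathcal{U}\subseteq TM$ an open neighbourhood of the zero section, and $\theta$ a $\mathcal{U}$-admissible vertical Poisson structure on $TM$ with vertical action of $\mathbb{R}^d$, fundamental vector fields $X_1,\ldots,X_d$ and skew-symmetric matrix $\Theta$. Let $\star$ be the deformed product on smooth vectors of functions on $TM$ defined by the induced action $\alpha$ and $\Theta$. For $p\in M$ let $i_p: T_pM\to TM$ be the inclusion, and let $\star_p$ be the deformed product on smooth vectors of functions on $T_pM$ defined by $\Theta$ and the action $\alpha^p$ with fundamental vector fields $X_i^p = X_i|_{T_pM} \in \Gamma^\infty(T(T_pM))$. Then the restriction $i_p^*: C^0(TM)\to C^0(T_pM)$ induces a $^*$-homomorphism $$i_p^*: (C^0(TM)^\infty,\star)\longrightarrow (C^0(T_pM)^\infty,\star_p),$$ continuous with respect to the deformed pro-$C^*$-topologies. Moreover, the analogous statement holds for the $C^*$-algebraic cases: $i_p^*$ induces $^*$-homomorphisms $(C^0_b(TM)^\infty,\star)\to(C^0_b(T_pM)^\infty,\star_p)$ and $(C^0_\infty(TM)^\infty,\star)\to(C^0_\infty(T_pM)^\infty,\star_p)$, continuous with respect to the deformed $C^*$-topologies.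
   Context: Admissibility: a vertical Poisson structure $\theta$ on $TM$ is $\mathcal{U}$-admissible if there are a smooth action of $\mathbb{R}^d$ on $TM$ by vertical diffeomorphisms (mapping each $T_pM$ to itself), with (vertical) fundamental vector fields $X_1,\ldots,X_d$, and constants $\Theta^{ij} = -\Theta^{ji} \in \mathbb{R}$ with $\theta = \frac12\sum_{i,j}\Theta^{ij} X_i \wedge X_j$, $\operatorname{supp} X_i \subseteq \mathcal{U}$, and $\operatorname{supp} X_i \cap T_pM$ compact for all $p \in M$. $\Theta$ also denotes the skew-symmetric operator on $\mathbb{R}^d$ with matrix $(\Theta^{ij})$. Commuting complete vector fields $Z_1,\ldots,Z_d$ with flows $\phi^{Z_i}$ induce the action $\alpha_v(f) = f\circ\phi^{Z_1}_{v_1}\circ\cdots\circ\phi^{Z_d}_{v_d}$ on functions. Function algebras: for a manifold $N$, $C^0(N)$ denotes all continuous complex functions (a pro-$C^*$-algebra with the seminorms $\|f\|_L=\sup_L|f|$, $L$ compact), $C^0_b(N)$ the bounded ones and $C^0_\infty(N)$ those vanishing at infinity ($C^*$-algebras with the sup-norm). The involution is complex conjugation. Deformed product: let $\mathcal{A}$ be one of these algebras, with an action $\alpha$ of $\mathbb{R}^d$. $\mathcal{A}^\infty$ is the set of smooth vectors ($v\mapsto\alpha_v(a)$ is smooth into $\mathcal{A}$), and $a \star b = \iint \alpha_{\Theta u}(a)\,\alpha_v(b)\, e^{2\pi i u\cdot v}\,du\,dv$ for $a,b\in\mathcal{A}^\infty$. Here the oscillatory integral of a function $F$ on $\mathbb{R}^d\times\mathbb{R}^d$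 that is bounded with all derivatives is $\sum_w\iint F\varphi_w e^{2\pi i u\cdot v}\,du\,dv$, with $\{\varphi_w\}$ a smooth partition of unity consisting of lattice translates of one compactly supported smooth function. Deformed topology: $C^0_u(\mathbb{R}^d,\mathcal{A})^\infty$ denotes the smooth vectors for translation in the bounded uniformly continuous functions $\mathbb{R}^d\to\mathcal{A}$, with product $(F\star G)(x)=\iint F(x+\Theta u)G(x+v)e^{2\pi i u\cdot v}\,du\,dv$. $\mathcal{S}^{\mathcal{A}}(\mathbb{R}^d)$ is the subspace of those $f$ all of whose derivatives multiplied by any polynomial are bounded, with $\langle f,g\rangle=\int f(v)^*g(v)\,dv$ and $\|f\|_q=q(\langle f,f\rangle)^{1/2}$ for each continuous $C^*$-seminorm $q$ on $\mathcal{A}$. For $a\in\mathcal{A}^\infty$ put $\phi(a)(v)=\alpha_v(a)$ and $\mathsf{L}_{\phi(a)}g=\phi(a)\star g$ on $\mathcal{S}^{\mathcal{A}}(\mathbb{R}^d)$, and $\|a\|_{\Theta,q}=\sup\{\|\mathsf{L}_{\phi(a)}g\|_q:\|g\|_q\le1\}$. The deformed pro-$C^*$-topology on $\mathcal{A}^\infty$ is defined by all seminorms $\|\cdot\|_{\Theta,q}$; if $\mathcal{A}$ is a $C^*$-algebra, the deformed $C^*$-topology is given by $\|\cdot\|_\Theta$, where $q$ is the $C^*$-norm. *)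

theory Defs
  imports "HOL-Analysis.Analysis" "HOL-Library.Function_Algebras"
begin

section \<open>Smooth manifolds\<close>

primrec Ck_on :: "nat \<Rightarrow> 'a::real_normed_vector set \<Rightarrow> ('a \<Rightarrow> 'b::real_normed_vector) \<Rightarrow> bool" where
  "Ck_on 0 S f \<longleftrightarrow> continuous_on S f"
| "Ck_on (Suc k) S f \<longleftrightarrow> (\<forall>x\<in>S. f differentiable (at x)) \<and>
     (\<forall>v. Ck_on k S (\<lambda>x. frechet_derivative f (at x) v))"

text \<open>Only used for open \<open>S\<close>.\<close>

definition smooth_on :: "'a::real_normed_vector set \<Rightarrow> ('a \<Rightarrow> 'b::real_normed_vector) \<Rightarrow> bool" where
  "smooth_on S f \<longleftrightarrow> (\<forall>k. Ck_on k S f)"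

text \<open>A chart is a pair of its domain and its coordinate map; the values of the coordinate map
  outside the domain are irrelevant.\<close>

type_synonym ('a, 'e) chart = "'a set \<times> ('a \<Rightarrow> 'e)"

record ('a, 'e) mfd =
  mtop :: "'a topology"
  atlas :: "('a, 'e) chart set"

abbreviation points :: "('a, 'e) mfd \<Rightarrow> 'a set" where
  "points N \<equiv> topspace (mtop N)"

definition chart_inv :: "('a, 'e) chart \<Rightarrow> 'e \<Rightarrow> 'a" where
  "chart_inv c = inv_into (fst c) (snd c)"

definition smooth_manifold :: "('a, 'e::euclidean_space) mfd \<Rightarrow> bool" where
  "smooth_manifold N \<longleftrightarrow>
     Hausdorff_space (mtop N) \<and> second_countable (mtop N) \<and>
     (\<Union>c\<in>atlas N. fst c) = points N \<and>
     (\<forall>c\<in>atlas N. openin (mtop N) (fst c) \<and> open (snd c ` fst c) \<and>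
        homeomorphic_map (subtopology (mtop N) (fst c)) (top_of_set (snd c ` fst c)) (snd c)) \<and>
     (\<forall>c\<in>atlas N. \<forall>c'\<in>atlas N.
        smooth_on (snd c ` (fst c \<inter> fst c')) (snd c' \<circ> chart_inv c))"

definition smooth_map ::
  "('a, 'e::euclidean_space) mfd \<Rightarrow> ('b, 'f::euclidean_space) mfd \<Rightarrow> ('a \<Rightarrow> 'b) \<Rightarrow> bool" where
  "smooth_map N N' F \<longleftrightarrow> continuous_map (mtop N) (mtop N') F \<and>
     (\<forall>c\<in>atlas N. \<forall>c'\<in>atlas N'.
        smooth_on (snd c ` (fst c \<inter> F -` fst c')) (snd c' \<circ> F \<circ> chart_inv c))"

definition vector_mfd :: "('e::euclidean_space, 'e) mfd" where
  "vector_mfd = \<lparr>mtop = euclidean, atlas = {(UNIV, id)}\<rparr>"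

definition prod_mfd :: "('a, 'e) mfd \<Rightarrow> ('b, 'f) mfd \<Rightarrow> ('a \<times> 'b, 'e \<times> 'f) mfd" where
  "prod_mfd N N' = \<lparr>mtop = prod_topology (mtop N) (mtop N'),
     atlas = {(fst c \<times> fst c', map_prod (snd c) (snd c')) | c c'. c \<in> atlas N \<and> c' \<in> atlas N'}\<rparr>"

text \<open>A tangent vector at \<open>x\<close> is represented by its components in one chart \<open>chart_at N x\<close>
  around \<open>x\<close>, chosen once and for all. Hence each tangent space is a copy of the model space
  \<open>'e\<close>, and components in any other chart are obtained by the Jacobian of the
  coordinate change.\<close>

definition chart_at :: "('a, 'e) mfd \<Rightarrow> 'a \<Rightarrow> ('a, 'e) chart" where
  "chart_at N x = (SOME c. c \<in> atlas N \<and> x \<in> fst c)"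

definition coord :: "('a, 'e) mfd \<Rightarrow> 'a \<Rightarrow> 'a \<Rightarrow> 'e" where
  "coord N x = snd (chart_at N x)"

definition differential ::
  "('a, 'e::euclidean_space) mfd \<Rightarrow> ('b, 'f::euclidean_space) mfd \<Rightarrow> ('a \<Rightarrow> 'b) \<Rightarrow> 'a \<Rightarrow> 'e \<Rightarrow> 'f" where
  "differential N N' F x =
     frechet_derivative (coord N' (F x) \<circ> F \<circ> chart_inv (chart_at N x)) (at (coord N x x))"

text \<open>The tangent bundle: points are the pairs \<open>(p, \<xi>)\<close> with \<open>\<xi>\<close> a tangent vector at \<open>p\<close> (in the above
  sense). Its topology is the one induced by the bundle charts; in general it is not the product
  topology, as \<open>chart_at\<close> need not vary continuously. The fibre over \<open>p\<close>, with its structure of a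
  smooth manifold (as a real vector space), is \<open>vector_mfd\<close>, and its inclusion
  is \<open>\<xi> \<mapsto> (p, \<xi>)\<close>.\<close>

definition tangent_chart ::
  "('m, 'e::euclidean_space) mfd \<Rightarrow> ('m, 'e) chart \<Rightarrow> ('m \<times> 'e, 'e \<times> 'e) chart" where
  "tangent_chart M c = (fst c \<times> UNIV,
     \<lambda>(p, \<xi>). (snd c p,
       frechet_derivative (snd c \<circ> chart_inv (chart_at M p)) (at (coord M p p)) \<xi>))"

definition tangent_bundle ::
  "('m, 'e::euclidean_space) mfd \<Rightarrow> ('m \<times> 'e, 'e \<times> 'e) mfd" where
  "tangent_bundle M = \<lparr>
     mtop = topology_generated_by
       {fst (tangent_chart M c) \<inter> snd (tangent_chart M c) -` W | c W. c \<in> atlas M \<and> open W},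
     atlas = tangent_chart M ` atlas M\<rparr>"

definition fibre_incl :: "'m \<Rightarrow> 'e \<Rightarrow> 'm \<times> 'e" where
  "fibre_incl p \<xi> = (p, \<xi>)"

section \<open>Vector fields, flows and induced actions\<close>

type_synonym ('a, 'e) field = "'a \<Rightarrow> 'e"

definition integral_curve ::
  "('a, 'e::euclidean_space) mfd \<Rightarrow> ('a, 'e) field \<Rightarrow> (real \<Rightarrow> 'a) \<Rightarrow> bool" where
  "integral_curve N Z c \<longleftrightarrow> continuous_map euclideanreal (mtop N) c \<and>
     (\<forall>t. ((\<lambda>s. coord N (c t) (c s)) has_vector_derivative Z (c t)) (at t))"

text \<open>Meaningful for complete fields. \<open>induced_action N Z v f\<close> is the composition of \<open>f\<close> with the flows
  of the \<open>Z i\<close> at times \<open>v $ i\<close>, taken in increasing order of \<open>i\<close>.\<close>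

definition flow :: "('a, 'e::euclidean_space) mfd \<Rightarrow> ('a, 'e) field \<Rightarrow> real \<Rightarrow> 'a \<Rightarrow> 'a" where
  "flow N Z t x = (THE c. integral_curve N Z c \<and> c 0 = x) t"

definition induced_action ::
  "('a, 'e::euclidean_space) mfd \<Rightarrow> ('d \<Rightarrow> ('a, 'e) field) \<Rightarrow>
    real^'d::{finite,linorder} \<Rightarrow> ('a \<Rightarrow> complex) \<Rightarrow> ('a \<Rightarrow> complex)" where
  "induced_action N Z v f = (\<lambda>x. if x \<in> points N
     then f (foldr (\<lambda>i. flow N (Z i) (v $ i)) (sorted_list_of_set UNIV) x) else 0)"

definition smooth_action ::
  "('a, 'e::euclidean_space) mfd \<Rightarrow> (real^'d \<Rightarrow> 'a \<Rightarrow> 'a) \<Rightarrow> bool" where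
  "smooth_action N \<psi> \<longleftrightarrow>
     smooth_map (prod_mfd vector_mfd N) N (\<lambda>(v, x). \<psi> v x) \<and>
     (\<forall>x\<in>points N. \<psi> 0 x = x \<and> (\<forall>v w. \<psi> (v + w) x = \<psi> v (\<psi> w x)))"

definition fundamental_fields ::
  "('a, 'e::euclidean_space) mfd \<Rightarrow> (real^'d \<Rightarrow> 'a \<Rightarrow> 'a) \<Rightarrow> ('d \<Rightarrow> ('a, 'e) field) \<Rightarrow> bool" where
  "fundamental_fields N \<psi> X \<longleftrightarrow> (\<forall>i. \<forall>x\<in>points N.
     ((\<lambda>t. coord N x (\<psi> (t *\<^sub>R axis i 1) x)) has_vector_derivative X i x) (at 0))"

definition field_support :: "('a, 'e::euclidean_space) mfd \<Rightarrow> ('a, 'e) field \<Rightarrow> 'a set" where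
  "field_support N Z = mtop N closure_of {x \<in> points N. Z x \<noteq> 0}"

text \<open>The restriction of a vertical field on the tangent bundle to the fibre over \<open>p\<close>, as a field
  on that fibre.\<close>

definition fibre_field ::
  "('m, 'e::euclidean_space) mfd \<Rightarrow> 'm \<Rightarrow> ('m \<times> 'e, 'e \<times> 'e) field \<Rightarrow> ('e, 'e) field" where
  "fibre_field M p Z = (\<lambda>\<xi>. THE \<zeta>.
     differential vector_mfd (tangent_bundle M) (fibre_incl p) \<xi> \<zeta> = Z (fibre_incl p \<xi>))"

section \<open>Poisson structures and admissibility\<close>

text \<open>A bivector at a point is an alternating bilinear form on the cotangent space there.\<close>

type_synonym 'e bivector = "('e \<Rightarrow>\<^sub>L real) \<Rightarrow> ('e \<Rightarrow>\<^sub>L real) \<Rightarrow> real"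

definition wedge :: "'e::real_normed_vector \<Rightarrow> 'e \<Rightarrow> 'e bivector" where
  "wedge x y = (\<lambda>\<alpha> \<beta>. \<alpha> x * \<beta> y - \<alpha> y * \<beta> x)"

definition smooth_fun :: "('a, 'e::euclidean_space) mfd \<Rightarrow> ('a \<Rightarrow> real) \<Rightarrow> bool" where
  "smooth_fun N f \<longleftrightarrow> smooth_map N (vector_mfd :: (real, real) mfd) f"

definition bracket ::
  "('a, 'e::euclidean_space) mfd \<Rightarrow> ('a \<Rightarrow> 'e bivector) \<Rightarrow> ('a \<Rightarrow> real) \<Rightarrow> ('a \<Rightarrow> real) \<Rightarrow> 'a \<Rightarrow> real" where
  "bracket N \<theta> f g x = \<theta> x (Blinfun (differential N (vector_mfd :: (real, real) mfd) f x))
                          (Blinfun (differential N (vector_mfd :: (real, real) mfd) g x))"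

definition bivector_field :: "('a, 'e::euclidean_space) mfd \<Rightarrow> ('a \<Rightarrow> 'e bivector) \<Rightarrow> bool" where
  "bivector_field N \<theta> \<longleftrightarrow>
     (\<forall>x\<in>points N. bilinear (\<theta> x) \<and> (\<forall>\<alpha>. \<theta> x \<alpha> \<alpha> = 0)) \<and>
     (\<forall>f g. smooth_fun N f \<longrightarrow> smooth_fun N g \<longrightarrow> smooth_fun N (bracket N \<theta> f g))"

definition poisson_structure :: "('a, 'e::euclidean_space) mfd \<Rightarrow> ('a \<Rightarrow> 'e bivector) \<Rightarrow> bool" where
  "poisson_structure N \<theta> \<longleftrightarrow> bivector_field N \<theta> \<and>
     (\<forall>f g h. smooth_fun N f \<longrightarrow> smooth_fun N g \<longrightarrow> smooth_fun N h \<longrightarrow>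
       (\<forall>x\<in>points N. bracket N \<theta> f (bracket N \<theta> g h) x + bracket N \<theta> g (bracket N \<theta> h f) x
          + bracket N \<theta> h (bracket N \<theta> f g) x = 0))"

definition vertical_vectors :: "('m, 'e::euclidean_space) mfd \<Rightarrow> 'm \<times> 'e \<Rightarrow> ('e \<times> 'e) set" where
  "vertical_vectors M y = {\<zeta>. differential (tangent_bundle M) M fst y \<zeta> = 0}"

text \<open>The last condition says that each value lies in the second exterior power of the vertical
  space.\<close>

definition vertical_poisson ::
  "('m, 'e::euclidean_space) mfd \<Rightarrow> ('m \<times> 'e \<Rightarrow> ('e \<times> 'e) bivector) \<Rightarrow> bool" where
  "vertical_poisson M \<theta> \<longleftrightarrow> poisson_structure (tangent_bundle M) \<theta> \<and>
     (\<forall>y\<in>points (tangent_bundle M). \<exists>n a b.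
        (\<forall>k<n::nat. a k \<in> vertical_vectors M y \<and> b k \<in> vertical_vectors M y) \<and>
        (\<forall>\<alpha> \<beta>. \<theta> y \<alpha> \<beta> = (\<Sum>k<n. wedge (a k) (b k) \<alpha> \<beta>)))"

text \<open>\<open>\<theta>\<close> is \<open>U\<close>-admissible, as witnessed by the action \<open>\<psi>\<close>, its fundamental fields \<open>X\<close> and
  the matrix \<open>\<Theta>\<close>.\<close>

definition admissible_via ::
  "('m, 'e::euclidean_space) mfd \<Rightarrow> ('m \<times> 'e) set \<Rightarrow> ('m \<times> 'e \<Rightarrow> ('e \<times> 'e) bivector) \<Rightarrow>
    (real^'d \<Rightarrow> 'm \<times> 'e \<Rightarrow> 'm \<times> 'e) \<Rightarrow> ('d \<Rightarrow> ('m \<times> 'e, 'e \<times> 'e) field) \<Rightarrow> real^'d^'d \<Rightarrow> bool" where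
  "admissible_via M U \<theta> \<psi> X \<Theta> \<longleftrightarrow>
     smooth_action (tangent_bundle M) \<psi> \<and>
     (\<forall>v. \<forall>y\<in>points (tangent_bundle M). fst (\<psi> v y) = fst y) \<and>
     fundamental_fields (tangent_bundle M) \<psi> X \<and>
     (\<forall>i j. \<Theta> $ i $ j = - \<Theta> $ j $ i) \<and>
     (\<forall>y\<in>points (tangent_bundle M). \<forall>\<alpha> \<beta>.
        \<theta> y \<alpha> \<beta> = 1/2 * (\<Sum>i\<in>UNIV. \<Sum>j\<in>UNIV. \<Theta> $ i $ j * wedge (X i y) (X j y) \<alpha> \<beta>)) \<and>
     (\<forall>i. field_support (tangent_bundle M) (X i) \<subseteq> U \<and>
        (\<forall>p\<in>points M. compactin (mtop (tangent_bundle M))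
           (field_support (tangent_bundle M) (X i) \<inter> range (fibre_incl p))))"

section \<open>Topological algebras of functions\<close>

text \<open>A function algebra: its elements and a family of seminorms defining its topology. Elements
  of algebras of functions on a space vanish outside its carrier by convention.
  The algebraic operations are the pointwise ones.\<close>

record 'n funalg =
  elts :: "('n \<Rightarrow> complex) set"
  snorms :: "(('n \<Rightarrow> complex) \<Rightarrow> real) set"

definition cfuns :: "'n topology \<Rightarrow> ('n \<Rightarrow> complex) set" where
  "cfuns T = {f. continuous_map T euclidean f \<and> (\<forall>x. x \<notin> topspace T \<longrightarrow> f x = 0)}"

definition supnorm :: "'n set \<Rightarrow> ('n \<Rightarrow> complex) \<Rightarrow> real" where
  "supnorm L f = Sup (insert 0 ((\<lambda>x. cmod (f x)) ` L))"

definition C0 :: "'n topology \<Rightarrow> 'n funalg" where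
  "C0 T = \<lparr>elts = cfuns T, snorms = {supnorm L | L. compactin T L}\<rparr>"

definition C0b :: "'n topology \<Rightarrow> 'n funalg" where
  "C0b T = \<lparr>elts = {f \<in> cfuns T. bounded (f ` topspace T)}, snorms = {supnorm (topspace T)}\<rparr>"

definition C0inf :: "'n topology \<Rightarrow> 'n funalg" where
  "C0inf T = \<lparr>elts = {f \<in> cfuns T. \<forall>\<epsilon>>0. \<exists>K. compactin T K \<and> (\<forall>x\<in>topspace T - K. cmod (f x) < \<epsilon>)},
     snorms = {supnorm (topspace T)}\<rparr>"

definition dominated :: "'n funalg \<Rightarrow> (('n \<Rightarrow> complex) \<Rightarrow> real) \<Rightarrow> bool" where
  "dominated A q \<longleftrightarrow> (\<exists>S C. finite S \<and> S \<subseteq> snorms A \<and> (\<forall>a\<in>elts A. q a \<le> C * (\<Sum>r\<in>S. r a)))"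

definition cstar_seminorms :: "'n funalg \<Rightarrow> (('n \<Rightarrow> complex) \<Rightarrow> real) set" where
  "cstar_seminorms A = {q.
     (\<forall>a\<in>elts A. 0 \<le> q a \<and> (\<forall>c. q (\<lambda>x. c * a x) = cmod c * q a) \<and>
        q (\<lambda>x. cnj (a x) * a x) = (q a)\<^sup>2) \<and>
     (\<forall>a\<in>elts A. \<forall>b\<in>elts A. q (a + b) \<le> q a + q b \<and> q (a * b) \<le> q a * q b) \<and>
     dominated A q}"

definition continuous_dual :: "'n funalg \<Rightarrow> (('n \<Rightarrow> complex) \<Rightarrow> complex) set" where
  "continuous_dual A = {l.
     (\<forall>a\<in>elts A. \<forall>b\<in>elts A. l (a + b) = l a + l b) \<and>
     (\<forall>a\<in>elts A. \<forall>c. l (\<lambda>x. c * a x) = c * l a) \<and>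
     dominated A (\<lambda>a. cmod (l a))}"

text \<open>The integral with values in \<open>A\<close>, in the weak (Pettis) sense.\<close>

definition has_vint :: "'n funalg \<Rightarrow> ('v::euclidean_space \<Rightarrow> 'n \<Rightarrow> complex) \<Rightarrow> ('n \<Rightarrow> complex) \<Rightarrow> bool" where
  "has_vint A F I \<longleftrightarrow> (\<forall>z. F z \<in> elts A) \<and> I \<in> elts A \<and>
     (\<forall>l\<in>continuous_dual A. has_bochner_integral lborel (\<lambda>z. l (F z)) (l I))"

definition vint :: "'n funalg \<Rightarrow> ('v::euclidean_space \<Rightarrow> 'n \<Rightarrow> complex) \<Rightarrow> ('n \<Rightarrow> complex)" where
  "vint A F = (THE I. has_vint A F I)"

text \<open>Unconditional convergence of series in \<open>A\<close>.\<close>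

definition has_vsum :: "'n funalg \<Rightarrow> ('w \<Rightarrow> 'n \<Rightarrow> complex) \<Rightarrow> 'w set \<Rightarrow> ('n \<Rightarrow> complex) \<Rightarrow> bool" where
  "has_vsum A J W I \<longleftrightarrow> I \<in> elts A \<and> (\<forall>w\<in>W. J w \<in> elts A) \<and>
     (\<forall>r\<in>snorms A. ((\<lambda>S. r ((\<Sum>w\<in>S. J w) - I)) \<longlongrightarrow> 0) (finite_subsets_at_top W))"

text \<open>\<open>D [e\<^sub>k, \<dots>, e\<^sub>1]\<close> is the iterated partial derivative of \<open>F\<close> along the basis vectors
  \<open>e\<^sub>1, \<dots>, e\<^sub>k\<close>; limits are taken in \<open>A\<close>.\<close>

definition derivatives_into ::
  "'n funalg \<Rightarrow> ('v::euclidean_space \<Rightarrow> 'n \<Rightarrow> complex) \<Rightarrow> ('v list \<Rightarrow> 'v \<Rightarrow> 'n \<Rightarrow> complex) \<Rightarrow> bool" where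
  "derivatives_into A F D \<longleftrightarrow> D [] = F \<and>
     (\<forall>es. set es \<subseteq> Basis \<longrightarrow> (\<forall>x. D es x \<in> elts A \<and> (\<forall>r\<in>snorms A.
        ((\<lambda>y. r (D es y - D es x)) \<longlongrightarrow> 0) (at x) \<and>
        (\<forall>e\<in>Basis. ((\<lambda>t. r (\<lambda>n. (D es (x + t *\<^sub>R e) n - D es x n) / complex_of_real t
                             - D (e # es) x n)) \<longlongrightarrow> 0) (at 0)))))"

definition smooth_into :: "'n funalg \<Rightarrow> ('v::euclidean_space \<Rightarrow> 'n \<Rightarrow> complex) \<Rightarrow> bool" where
  "smooth_into A F \<longleftrightarrow> (\<exists>D. derivatives_into A F D)"

definition smooth_vectors ::
  "'n funalg \<Rightarrow> ('v::euclidean_space \<Rightarrow> ('n \<Rightarrow> complex) \<Rightarrow> ('n \<Rightarrow> complex)) \<Rightarrow> ('n \<Rightarrow> complex) set" where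
  "smooth_vectors A \<alpha> = {a \<in> elts A. smooth_into A (\<lambda>v. \<alpha> v a)}"

section \<open>The deformed product\<close>

definition is_lattice :: "'v::euclidean_space set \<Rightarrow> bool" where
  "is_lattice W \<longleftrightarrow> (\<exists>B. independent B \<and> span B = UNIV \<and>
     W = {\<Sum>b\<in>B. of_int (k b) *\<^sub>R b | k :: 'v \<Rightarrow> int. True})"

definition lattice_partition :: "'v::euclidean_space set \<Rightarrow> ('v \<Rightarrow> real) \<Rightarrow> bool" where
  "lattice_partition W \<phi> \<longleftrightarrow> is_lattice W \<and> smooth_on UNIV \<phi> \<and> compact (closure {z. \<phi> z \<noteq> 0}) \<and>
     (\<forall>z. 0 \<le> \<phi> z \<and> ((\<lambda>w. \<phi> (z - w)) has_sum 1) W)"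

text \<open>Oscillatory integrals are formed with respect to a lattice \<open>W\<close> and a function \<open>\<phi>\<close> whose
  translates by \<open>W\<close> are a partition of unity.\<close>

definition osc_term ::
  "((real^'d) \<times> (real^'d) \<Rightarrow> real) \<Rightarrow> ((real^'d) \<times> (real^'d) \<Rightarrow> 'n \<Rightarrow> complex) \<Rightarrow>
    (real^'d) \<times> (real^'d) \<Rightarrow> (real^'d) \<times> (real^'d) \<Rightarrow> 'n \<Rightarrow> complex" where
  "osc_term \<phi> F w = (\<lambda>(u, v) n.
     F (u, v) n * complex_of_real (\<phi> ((u, v) - w)) * exp (2 * complex_of_real pi * \<i> * complex_of_real (u \<bullet> v)))"

definition has_osc_integral ::
  "'n funalg \<Rightarrow> ((real^'d) \<times> (real^'d)) set \<Rightarrow> ((real^'d) \<times> (real^'d) \<Rightarrow> real) \<Rightarrow>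
    ((real^'d) \<times> (real^'d) \<Rightarrow> 'n \<Rightarrow> complex) \<Rightarrow> ('n \<Rightarrow> complex) \<Rightarrow> bool" where
  "has_osc_integral A W \<phi> F I \<longleftrightarrow> (\<exists>J. (\<forall>w\<in>W. has_vint A (osc_term \<phi> F w) (J w)) \<and> has_vsum A J W I)"

definition osc_integral ::
  "'n funalg \<Rightarrow> ((real^'d) \<times> (real^'d)) set \<Rightarrow> ((real^'d) \<times> (real^'d) \<Rightarrow> real) \<Rightarrow>
    ((real^'d) \<times> (real^'d) \<Rightarrow> 'n \<Rightarrow> complex) \<Rightarrow> ('n \<Rightarrow> complex)" where
  "osc_integral A W \<phi> F = (THE I. has_osc_integral A W \<phi> F I)"

definition deformed_prod ::
  "'n funalg \<Rightarrow> ((real^'d) \<times> (real^'d)) set \<Rightarrow> ((real^'d) \<times> (real^'d) \<Rightarrow> real) \<Rightarrow> real^'d^'d \<Rightarrow>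
    (real^'d \<Rightarrow> ('n \<Rightarrow> complex) \<Rightarrow> ('n \<Rightarrow> complex)) \<Rightarrow>
    ('n \<Rightarrow> complex) \<Rightarrow> ('n \<Rightarrow> complex) \<Rightarrow> ('n \<Rightarrow> complex)" where
  "deformed_prod A W \<phi> \<Theta> \<alpha> a b = osc_integral A W \<phi> (\<lambda>(u, v). \<alpha> (\<Theta> *v u) a * \<alpha> v b)"

section \<open>The deformed topology\<close>

text \<open>A function \<open>f\<close> from \<open>'v\<close> to \<open>A\<close> is treated as a function on \<open>'v \<times> 'n\<close>;
  its value at \<open>x\<close> is \<open>at_pt f x\<close>.\<close>

definition at_pt :: "('v \<times> 'n \<Rightarrow> complex) \<Rightarrow> 'v \<Rightarrow> 'n \<Rightarrow> complex" where
  "at_pt f x = (\<lambda>n. f (x, n))"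

definition Cu :: "'n funalg \<Rightarrow> ('v::euclidean_space \<times> 'n) funalg" where
  "Cu A = \<lparr>
     elts = {f. (\<forall>x. at_pt f x \<in> elts A) \<and> (\<forall>r\<in>snorms A.
       (\<exists>C. \<forall>x. r (at_pt f x) \<le> C) \<and>
       (\<forall>\<epsilon>>0. \<exists>\<delta>>0. \<forall>x y. dist x y < \<delta> \<longrightarrow> r (at_pt f x - at_pt f y) < \<epsilon>))},
     snorms = {\<lambda>f. SUP x. r (at_pt f x) | r. r \<in> snorms A}\<rparr>"

definition translation :: "'v::euclidean_space \<Rightarrow> ('v \<times> 'n \<Rightarrow> complex) \<Rightarrow> ('v \<times> 'n \<Rightarrow> complex)" where
  "translation x f = (\<lambda>(y, n). f (y + x, n))"

definition Cu_prod ::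
  "'n funalg \<Rightarrow> ((real^'d) \<times> (real^'d)) set \<Rightarrow> ((real^'d) \<times> (real^'d) \<Rightarrow> real) \<Rightarrow> real^'d^'d \<Rightarrow>
    ((real^'d) \<times> 'n \<Rightarrow> complex) \<Rightarrow> ((real^'d) \<times> 'n \<Rightarrow> complex) \<Rightarrow> ((real^'d) \<times> 'n \<Rightarrow> complex)" where
  "Cu_prod A W \<phi> \<Theta> F G = (\<lambda>(x, n).
     osc_integral A W \<phi> (\<lambda>(u, v). at_pt F (x + \<Theta> *v u) * at_pt G (x + v)) n)"

definition schwartz :: "'n funalg \<Rightarrow> ('v::euclidean_space \<times> 'n \<Rightarrow> complex) set" where
  "schwartz A = {f \<in> smooth_vectors (Cu A) translation. \<exists>D. derivatives_into A (at_pt f) D \<and>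
     (\<forall>es. set es \<subseteq> Basis \<longrightarrow> (\<forall>P. real_polynomial_function P \<longrightarrow> (\<forall>r\<in>snorms A.
        \<exists>C. \<forall>x. r (\<lambda>n. complex_of_real (P x) * D es x n) \<le> C)))}"

definition schwartz_inner ::
  "'n funalg \<Rightarrow> ('v::euclidean_space \<times> 'n \<Rightarrow> complex) \<Rightarrow> ('v \<times> 'n \<Rightarrow> complex) \<Rightarrow> ('n \<Rightarrow> complex)" where
  "schwartz_inner A f g = vint A (\<lambda>v n. cnj (f (v, n)) * g (v, n))"

definition schwartz_norm ::
  "'n funalg \<Rightarrow> (('n \<Rightarrow> complex) \<Rightarrow> real) \<Rightarrow> ('v::euclidean_space \<times> 'n \<Rightarrow> complex) \<Rightarrow> real" where
  "schwartz_norm A q f = sqrt (q (schwartz_inner A f f))"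

definition orbit_map ::
  "('v \<Rightarrow> ('n \<Rightarrow> complex) \<Rightarrow> ('n \<Rightarrow> complex)) \<Rightarrow> ('n \<Rightarrow> complex) \<Rightarrow> ('v \<times> 'n \<Rightarrow> complex)" where
  "orbit_map \<alpha> a = (\<lambda>(v, n). \<alpha> v a n)"

text \<open>The operator seminorm is taken in \<open>[0, \<infinity>]\<close>, so that the supremum always makes sense.\<close>

definition deformed_seminorm ::
  "'n funalg \<Rightarrow> ((real^'d) \<times> (real^'d)) set \<Rightarrow> ((real^'d) \<times> (real^'d) \<Rightarrow> real) \<Rightarrow> real^'d^'d \<Rightarrow>
    (real^'d \<Rightarrow> ('n \<Rightarrow> complex) \<Rightarrow> ('n \<Rightarrow> complex)) \<Rightarrow>
    (('n \<Rightarrow> complex) \<Rightarrow> real) \<Rightarrow> ('n \<Rightarrow> complex) \<Rightarrow> ennreal" where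
  "deformed_seminorm A W \<phi> \<Theta> \<alpha> q a =
     (SUP g\<in>{g \<in> schwartz A. schwartz_norm A q g \<le> 1}.
        ennreal (schwartz_norm A q (Cu_prod A W \<phi> \<Theta> (orbit_map \<alpha> a) g)))"

definition seminorm_open ::
  "('n \<Rightarrow> complex) set \<Rightarrow> (('n \<Rightarrow> complex) \<Rightarrow> ennreal) set \<Rightarrow> ('n \<Rightarrow> complex) set \<Rightarrow> bool" where
  "seminorm_open V R U \<longleftrightarrow> U \<subseteq> V \<and>
     (\<forall>a\<in>U. \<exists>S \<epsilon>. finite S \<and> S \<subseteq> R \<and> 0 < \<epsilon> \<and> (\<forall>b\<in>V. (\<forall>r\<in>S. r (b - a) < \<epsilon>) \<longrightarrow> b \<in> U))"

definition seminorm_topology ::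
  "('n \<Rightarrow> complex) set \<Rightarrow> (('n \<Rightarrow> complex) \<Rightarrow> ennreal) set \<Rightarrow> ('n \<Rightarrow> complex) topology" where
  "seminorm_topology V R = topology (seminorm_open V R)"

lemma istopology_seminorm_open: "istopology (seminorm_open V R)"
  unfolding istopology_def
proof (intro conjI allI impI)
  fix U U' assume *: "seminorm_open V R U" "seminorm_open V R U'"
  show "seminorm_open V R (U \<inter> U')"
    unfolding seminorm_open_def
  proof (intro conjI ballI)
    show "U \<inter> U' \<subseteq> V" using * by (auto simp: seminorm_open_def)
    fix a assume a: "a \<in> U \<inter> U'"
    obtain S \<epsilon> where 1: "finite S" "S \<subseteq> R" "0 < \<epsilon>" "\<forall>b\<in>V. (\<forall>r\<in>S. r (b - a) < \<epsilon>) \<longrightarrow> b \<in> U"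
      using *(1) a unfolding seminorm_open_def by (meson IntD1)
    obtain S' \<epsilon>' where 2: "finite S'" "S' \<subseteq> R" "0 < \<epsilon>'" "\<forall>b\<in>V. (\<forall>r\<in>S'. r (b - a) < \<epsilon>') \<longrightarrow> b \<in> U'"
      using *(2) a unfolding seminorm_open_def by (meson IntD2)
    show "\<exists>S \<epsilon>. finite S \<and> S \<subseteq> R \<and> 0 < \<epsilon> \<and> (\<forall>b\<in>V. (\<forall>r\<in>S. r (b - a) < \<epsilon>) \<longrightarrow> b \<in> U \<inter> U')"
      by (rule exI[of _ "S \<union> S'"], rule exI[of _ "min \<epsilon> \<epsilon>'"]) (use 1 2 in auto)
  qed
next
  fix \<U> assume *: "\<forall>U\<in>\<U>. seminorm_open V R U"
  show "seminorm_open V R (\<Union>\<U>)"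
    unfolding seminorm_open_def
  proof (intro conjI ballI)
    show "\<Union>\<U> \<subseteq> V" using * by (auto simp: seminorm_open_def)
    fix a assume "a \<in> \<Union>\<U>"
    then obtain U where U: "U \<in> \<U>" "a \<in> U" by blast
    then obtain S \<epsilon> where "finite S" "S \<subseteq> R" "0 < \<epsilon>" "\<forall>b\<in>V. (\<forall>r\<in>S. r (b - a) < \<epsilon>) \<longrightarrow> b \<in> U"
      using * unfolding seminorm_open_def by meson
    with U show "\<exists>S \<epsilon>. finite S \<and> S \<subseteq> R \<and> 0 < \<epsilon> \<and> (\<forall>b\<in>V. (\<forall>r\<in>S. r (b - a) < \<epsilon>) \<longrightarrow> b \<in> \<Union>\<U>)"
      by (intro exI[of _ S] exI[of _ \<epsilon>]) blast
  qed
qed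

lemma openin_seminorm_topology: "openin (seminorm_topology V R) U \<longleftrightarrow> seminorm_open V R U"
  unfolding seminorm_topology_def by (simp add: topology_inverse'[OF istopology_seminorm_open])

lemma topspace_seminorm_topology: "topspace (seminorm_topology V R) = V"
proof -
  have "seminorm_open V R V"
    unfolding seminorm_open_def by (auto intro!: exI[of _ "{}"] exI[of _ "1::ennreal"])
  then show ?thesis
    unfolding topspace_def openin_seminorm_topology by (auto simp: seminorm_open_def)
qed

definition deformed_topology ::
  "'n funalg \<Rightarrow> (('n \<Rightarrow> complex) \<Rightarrow> real) set \<Rightarrow>
    ((real^'d) \<times> (real^'d)) set \<Rightarrow> ((real^'d) \<times> (real^'d) \<Rightarrow> real) \<Rightarrow> real^'d^'d \<Rightarrow>
    (real^'d \<Rightarrow> ('n \<Rightarrow> complex) \<Rightarrow> ('n \<Rightarrow> complex)) \<Rightarrow> ('n \<Rightarrow> complex) topology" where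
  "deformed_topology A Q W \<phi> \<Theta> \<alpha> =
     seminorm_topology (smooth_vectors A \<alpha>) (deformed_seminorm A W \<phi> \<Theta> \<alpha> ` Q)"

definition deformed_star_hom ::
  "((real^'d) \<times> (real^'d)) set \<Rightarrow> ((real^'d) \<times> (real^'d) \<Rightarrow> real) \<Rightarrow> real^'d^'d \<Rightarrow>
    'n funalg \<Rightarrow> (real^'d \<Rightarrow> ('n \<Rightarrow> complex) \<Rightarrow> ('n \<Rightarrow> complex)) \<Rightarrow>
    'k funalg \<Rightarrow> (real^'d \<Rightarrow> ('k \<Rightarrow> complex) \<Rightarrow> ('k \<Rightarrow> complex)) \<Rightarrow>
    (('n \<Rightarrow> complex) \<Rightarrow> ('k \<Rightarrow> complex)) \<Rightarrow> bool" where
  "deformed_star_hom W \<phi> \<Theta> A \<alpha> B \<beta> h \<longleftrightarrow>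
     (\<forall>a\<in>smooth_vectors A \<alpha>. h a \<in> smooth_vectors B \<beta> \<and>
        (\<forall>c. h (\<lambda>x. c * a x) = (\<lambda>x. c * h a x)) \<and>
        h (\<lambda>x. cnj (a x)) = (\<lambda>x. cnj (h a x))) \<and>
     (\<forall>a\<in>smooth_vectors A \<alpha>. \<forall>b\<in>smooth_vectors A \<alpha>.
        h (a + b) = h a + h b \<and>
        h (deformed_prod A W \<phi> \<Theta> \<alpha> a b) = deformed_prod B W \<phi> \<Theta> \<beta> (h a) (h b))"

definition fibre_restrict :: "'m \<Rightarrow> ('m \<times> 'e \<Rightarrow> complex) \<Rightarrow> ('e \<Rightarrow> complex)" where
  "fibre_restrict p f = f \<circ> fibre_incl p"

end

theory Submission
  imports Defs "HOL-Probability.Sinc_Integral"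
begin

text \<open>
  Restriction to the fibre over \<open>p\<close> is a pointwise operation, so it respects the algebraic structure;
  what has to be shown is that it intertwines the two actions, that it commutes with oscillatory
  integrals, and that it does not increase the deformed seminorms.

  The actions. On the tangent bundle the flow of \<open>X i\<close> is \<open>t \<mapsto> \<psi> (t *\<^sub>R axis i 1)\<close>: an integral curve
  that is pulled back by the inverse of this motion has derivative 0 in every chart, hence is
  constant (\<open>integral_curve_eq_orbit\<close>). A curve in the fibre is an integral curve of the restricted
  field if and only if its image in the tangent bundle is one of \<open>X i\<close> (\<open>integral_curve_fibre_iff\<close>).
  Therefore both induced actions are composition with \<open>\<psi> v\<close> (\<open>induced_action_equivariant\<close>).

  The products. Oscillatory integrals are limits in the topology of the algebra. If the one for
  \<open>a \<star> b\<close> exists over the tangent bundle, then its restriction is the oscillatory integral over the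
  fibre, because a continuous linear map carries weak integrals to weak integrals and convergent
  series to convergent series (locale \<open>weighted_composition\<close>). Existence rests on two facts.
  First, all derivatives of the orbit map of a smooth vector are bounded (\<open>orbit_smooth_bound\<close>).
  For \<open>C0\<close> this requires that every compact set lies in an invariant compact set
  (\<open>invariant_compact\<close>), and here the compactness of the supports in the fibres enters: a large
  sphere in \<open>T\<^sub>pM\<close> misses the supports, the same holds over all nearby points, and an orbit
  that meets such a sphere is a single point. Second, integration by parts against the phase makes
  the term with index \<open>w\<close> decay faster than every power of \<open>w\<close>, uniformly on the sets that define
  the seminorms (\<open>oscillatory_decay\<close>, \<open>has_osc_integral_exists\<close>).

  The seminorms. The deformed seminorm of \<open>a\<close> is the norm of the operator \<open>g \<mapsto> \<phi>(a) \<star> g\<close> on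
  Schwartz functions. In a bundle chart the fibre over \<open>p\<close> is a retract of its neighbourhood; with a
  cutoff \<open>\<eta>\<close> this extends each Schwartz function \<open>g'\<close> with values in functions on the fibre to one
  with values in functions on the tangent bundle, without increasing its norm. As the product with
  the extension restricts to the product with \<open>g'\<close>, the operator norm of the restriction of \<open>a\<close> is
  at most that of \<open>a\<close> (\<open>deformed_seminorm_le\<close>). On the tangent bundle one uses the seminorm
  \<open>q' \<circ> i\<^sub>p\<^sup>*\<close> for each seminorm \<open>q'\<close> on the fibre in the case of \<open>C0\<close>, and the supremum norm in
  the other two cases.
\<close>

section \<open>Integrals over Euclidean space\<close>

lemma integrable_continuous_compact_support:
  fixes f :: "'z::euclidean_space \<Rightarrow> complex"
  assumes "continuous_on UNIV f" "\<And>z. norm (z - w) > R \<Longrightarrow> f z = 0"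
  shows "integrable lborel f"
proof -
  have "integrable lborel (\<lambda>z. indicator (cball w R) z *\<^sub>R f z)"
    by (rule borel_integrable_compact) (auto intro: continuous_on_subset[OF assms(1)])
  moreover have "(\<lambda>z. indicator (cball w R) z *\<^sub>R f z) = f"
    using assms(2) by (auto simp: indicator_def fun_eq_iff dist_norm norm_minus_commute)
  ultimately show ?thesis by simp
qed

text \<open>An integrable majorant of the weight in \<open>lattice_weight_le_product_weight\<close>; its integral factors into
one-dimensional ones.\<close>

definition product_weight :: "'v::euclidean_space \<Rightarrow> real" where
  "product_weight z = (\<Prod>b\<in>Basis. inverse (1 + (z \<bullet> b)\<^sup>2))"

lemma integrable_product_weight: "integrable lborel product_weight"
proof -
  have 1: "integrable lborel (\<lambda>x::real. inverse (1 + x\<^sup>2))"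
    using integrable_inverse_1_plus_square by (simp add: set_integrable_def)
  have fin: "(\<integral>\<^sup>+x. ennreal (inverse (1 + x\<^sup>2)) \<partial>lborel) < \<infinity>"
    using 1 by (subst (asm) integrable_iff_bounded) (auto simp: abs_of_nonneg)
  have "(\<integral>\<^sup>+z. ennreal (product_weight z) \<partial>(lborel :: 'a measure)) =
      (\<integral>\<^sup>+z. (\<Prod>b\<in>(Basis::'a set). ennreal (inverse (1 + (z \<bullet> b)\<^sup>2))) \<partial>lborel)"
    unfolding product_weight_def by (intro nn_integral_cong) (simp add: prod_ennreal)
  also have "\<dots> = (\<Prod>b\<in>(Basis::'a set). \<integral>\<^sup>+x. ennreal (inverse (1 + x\<^sup>2)) \<partial>lborel)"
    by (rule nn_integral_lborel_prod) auto
  also have "\<dots> < \<infinity>" using fin by (simp add: power_less_top_ennreal)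
  finally show ?thesis
    unfolding product_weight_def[abs_def]
    by (subst integrable_iff_bounded) (auto simp: abs_of_nonneg prod_nonneg)
qed

lemma has_vector_derivative_iff_quotient:
  "(f has_vector_derivative D) (at x) \<longleftrightarrow> ((\<lambda>t. (f (x + t) - f x) /\<^sub>R t) \<longlongrightarrow> D) (at 0)"
proof -
  have "((\<lambda>t. (f (x + t) - f x) /\<^sub>R t) \<longlongrightarrow> D) (at 0) \<longleftrightarrow>
      ((\<lambda>t. norm ((f (x + t) - f x) /\<^sub>R t - D)) \<longlongrightarrow> 0) (at 0)"
    by (simp add: LIM_zero_iff tendsto_norm_zero_iff)
  also have "\<dots> \<longleftrightarrow> ((\<lambda>t. norm (f (x + t) - f x - t *\<^sub>R D) / norm t) \<longlongrightarrow> 0) (at 0)"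
  proof (rule filterlim_cong[OF refl refl])
    have "norm ((f (x + t) - f x) /\<^sub>R t - D) = norm (f (x + t) - f x - t *\<^sub>R D) / norm t" if "t \<noteq> 0" for t
    proof -
      have "(f (x + t) - f x) /\<^sub>R t - D = (f (x + t) - f x - t *\<^sub>R D) /\<^sub>R t"
        using that by (simp add: scaleR_diff_right)
      then show ?thesis by (simp add: divide_inverse mult.commute)
    qed
    then show "\<forall>\<^sub>F t in at 0. norm ((f (x + t) - f x) /\<^sub>R t - D) = norm (f (x + t) - f x - t *\<^sub>R D) / norm t"
      by (auto simp: eventually_at_filter)
  qed
  finally show ?thesis
    by (auto simp: has_vector_derivative_def has_derivative_at bounded_linear_scaleR_left)
qed

lemma lattice_weight_le_product_weight:
  fixes z :: "'v::euclidean_space"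
  shows "inverse ((1 + (norm z)\<^sup>2) ^ DIM('v)) \<le> product_weight z"
proof -
  have "(1 + (z \<bullet> b)\<^sup>2) \<le> 1 + (norm z)\<^sup>2" if "b \<in> Basis" for b
    using Basis_le_norm[OF that, of z] power_mono[of "\<bar>z \<bullet> b\<bar>" "norm z" 2] by auto
  then have "(\<Prod>b\<in>(Basis::'v set). 1 + (z \<bullet> b)\<^sup>2) \<le> (\<Prod>b\<in>(Basis::'v set). 1 + (norm z)\<^sup>2)"
    by (intro prod_mono) auto
  then have "inverse ((1 + (norm z)\<^sup>2) ^ DIM('v)) \<le> inverse (\<Prod>b\<in>(Basis::'v set). 1 + (z \<bullet> b)\<^sup>2)"
    by (intro le_imp_inverse_le prod_pos) (auto intro: add_pos_nonneg)
  then show ?thesis by (simp add: product_weight_def prod_inversef[symmetric] comp_def)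
qed

text \<open>The difference quotients of \<open>H\<close> in direction \<open>e\<close> integrate to 0 because Lebesgue measure is invariant
under translations, and dominated convergence passes to the derivative. In this form no choice of
coordinates is involved.\<close>

lemma integral_directional_derivative_eq_0:
  fixes H :: "'z::euclidean_space \<Rightarrow> complex"
  assumes D: "\<And>z. (H has_derivative D z) (at z)"
    and c: "continuous_on UNIV (\<lambda>z. D z e)"
    and supp: "\<And>z. norm (z - w) > R \<Longrightarrow> H z = 0"
  shows "(\<integral>z. D z e \<partial>lborel) = 0"
proof -
  have cH: "continuous_on UNIV H"
    using D has_derivative_continuous_on by (metis has_derivative_at_withinI)
  have D0: "D z e = 0" if "norm (z - w) > R" for z
  proof -
    have "open {z. norm (z - w) > R}" by (intro open_Collect_less continuous_intros)
    then have "\<forall>\<^sub>F y in nhds z. norm (y - w) > R" using that eventually_nhds_in_open by force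
    then have "(H has_derivative (\<lambda>_. 0)) (at z)"
      by (intro has_derivative_transform_eventually[OF has_derivative_const[of 0]])
        (use supp that in \<open>auto elim!: eventually_mono simp: eventually_at_filter\<close>)
    then show ?thesis using D has_derivative_unique by metis
  qed
  have "\<exists>B. \<forall>z. norm (D z e) \<le> B"
  proof -
    have "bounded ((\<lambda>z. D z e) ` cball w R)"
      by (intro compact_imp_bounded compact_continuous_image continuous_on_subset[OF c]) auto
    then obtain B where "\<forall>z\<in>cball w R. norm (D z e) \<le> B" by (auto simp: bounded_iff)
    then have "norm (D z e) \<le> max B 0" for z
      using D0[of z] by (cases "z \<in> cball w R") (force simp: dist_norm norm_minus_commute)+
    then show ?thesis by blast
  qed
  then obtain B where B: "\<And>z. norm (D z e) \<le> B" by blast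
  have B0: "0 \<le> B" using B norm_ge_zero order_trans by blast
  define q where "q n z = (H (z + (1 / real (Suc n)) *\<^sub>R e) - H z) /\<^sub>R (1 / real (Suc n))" for n z
  have iH: "integrable lborel H" by (rule integrable_continuous_compact_support[OF cH supp])
  have iHt: "integrable lborel (\<lambda>z. H (z + y))" for y
    by (rule integrable_continuous_compact_support[where w="w - y" and R=R])
      (use supp in \<open>auto intro!: continuous_on_compose2[OF cH] continuous_on_add simp: algebra_simps\<close>)
  have tr: "(\<integral>z. H (z + y) \<partial>lborel) = (\<integral>z. H z \<partial>lborel)" for y
  proof -
    have "(\<integral>z. H z \<partial>lborel) = (\<integral>z. H z \<partial>distr lborel borel ((+) y))"
      by (simp add: lborel_distr_plus)
    also have "\<dots> = (\<integral>z. H (y + z) \<partial>lborel)"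
      using cH by (intro integral_distr) (auto intro: borel_measurable_continuous_onI)
    finally show ?thesis by (simp add: add.commute)
  qed
  have q0: "(\<integral>z. q n z \<partial>lborel) = 0" for n
    unfolding q_def using iH iHt by (simp add: tr)
  have lim: "(\<lambda>n. q n z) \<longlonglongrightarrow> D z e" for z
  proof -
    have "((\<lambda>t. H (z + t *\<^sub>R e)) has_vector_derivative D z e) (at 0)"
    proof -
      have "((\<lambda>t. z + t *\<^sub>R e) has_vector_derivative e) (at 0)"
        by (auto intro!: derivative_eq_intros)
      moreover have "(H has_derivative D z) (at (z + 0 *\<^sub>R e))" using D by simp
      ultimately show ?thesis
        using vector_derivative_diff_chain_within[of "\<lambda>t. z + t *\<^sub>R e" e 0 UNIV H "D z"]
        by (auto simp: o_def has_derivative_at_withinI)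
    qed
    then have "((\<lambda>t. (H (z + t *\<^sub>R e) - H z) /\<^sub>R t) \<longlongrightarrow> D z e) (at 0)"
      by (simp add: has_vector_derivative_iff_quotient)
    moreover have "filterlim (\<lambda>n. 1 / real (Suc n)) (at 0) sequentially"
      using LIMSEQ_inverse_real_of_nat by (auto simp: filterlim_at inverse_eq_divide)
    ultimately show ?thesis unfolding q_def by (rule filterlim_compose)
  qed
  have bd: "norm (q n z) \<le> B * indicator (cball w (R + norm e)) z" for n z
  proof (cases "z \<in> cball w (R + norm e)")
    case True
    have "norm (H (z + (1 / real (Suc n)) *\<^sub>R e) - H z) \<le> norm (1 / real (Suc n)) * B"
    proof -
      have "norm (H (z + (1 / real (Suc n)) *\<^sub>R e) - H (z + 0 *\<^sub>R e)) \<le> B * norm (1 / real (Suc n) - 0)"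
      proof (rule differentiable_bound[where S=UNIV and f="\<lambda>t. H (z + t *\<^sub>R e)" and f'="\<lambda>t h. h *\<^sub>R D (z + t *\<^sub>R e) e"])
        fix t :: real
        show "((\<lambda>t. H (z + t *\<^sub>R e)) has_derivative (\<lambda>h. h *\<^sub>R D (z + t *\<^sub>R e) e)) (at t within UNIV)"
        proof -
          have "((\<lambda>t. z + t *\<^sub>R e) has_derivative (\<lambda>h. h *\<^sub>R e)) (at t within UNIV)"
            by (auto intro!: derivative_eq_intros)
          from has_derivative_compose[OF this, of H "D (z + t *\<^sub>R e)"] D
          show ?thesis by (simp add: linear_scale[OF has_derivative_linear[OF D]])
        qed
        show "onorm (\<lambda>h. h *\<^sub>R D (z + t *\<^sub>R e) e) \<le> B"
          by (rule onorm_bound) (simp_all add: B B0 mult.commute[of B] mult_left_mono)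
      qed auto
      then show ?thesis by (simp add: mult.commute)
    qed
    then show ?thesis using True
      by (simp only: q_def norm_scaleR) (simp add: field_simps)
  next
    case False
    then have "norm (z - w) > R" "norm (z + (1 / real (Suc n)) *\<^sub>R e - w) > R"
    proof -
      have *: "norm (z - w) > R + norm e" using False by (simp add: dist_norm norm_minus_commute)
      then show "norm (z - w) > R" by (smt (verit) norm_ge_zero)
      have "norm ((1 / real (Suc n)) *\<^sub>R e) \<le> norm e" by (simp add: divide_le_eq mult_right_le_one_le mult_le_cancel_left1)
      then show "norm (z + (1 / real (Suc n)) *\<^sub>R e - w) > R"
        using * norm_triangle_ineq4[of "z + (1 / real (Suc n)) *\<^sub>R e - w" "(1 / real (Suc n)) *\<^sub>R e"] by simp
    qed
    then show ?thesis using False supp by (simp add: q_def B0)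
  qed
  have "(\<lambda>n. \<integral>z. q n z \<partial>lborel) \<longlonglongrightarrow> (\<integral>z. D z e \<partial>lborel)"
  proof (rule integral_dominated_convergence[where w="\<lambda>z. B * indicator (cball w (R + norm e)) z"])
    show "q n \<in> borel_measurable lborel" for n
      unfolding q_def using iH iHt by measurable
    show "(\<lambda>z. D z e) \<in> borel_measurable lborel" using c by (simp add: borel_measurable_continuous_onI)
    show "integrable lborel (\<lambda>z. B * indicator (cball w (R + norm e)) z)"
      by (intro integrable_mult_right integrable_real_indicator) (use emeasure_lborel_cball_finite[of w "R + norm e"] in auto)
  qed (use lim bd in auto)
  then show ?thesis unfolding q0 by (simp add: LIMSEQ_const_iff)
qed

section \<open>Families with uniformly controlled derivatives\<close>

text \<open>The functions \<open>f i\<close> are of class \<open>C\<^sup>k\<close>, and each of their directional derivatives up to order \<open>k\<close> is at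
most a constant multiple of \<open>\<omega> i\<close>, with a constant that does not depend on \<open>i\<close>. The index will be a
point of the space on which the algebra lives (together with a translation parameter), so that
uniformity in \<open>i\<close> turns estimates for scalar functions into estimates of seminorms.\<close>

primrec Ck_family ::
  "nat \<Rightarrow> 'i set \<Rightarrow> ('i \<Rightarrow> 'z::euclidean_space \<Rightarrow> real) \<Rightarrow> ('i \<Rightarrow> 'z \<Rightarrow> complex) \<Rightarrow> bool" where
  "Ck_family 0 I \<omega> f \<longleftrightarrow>
     (\<forall>i\<in>I. continuous_on UNIV (f i)) \<and> (\<exists>C\<ge>0. \<forall>i\<in>I. \<forall>z. norm (f i z) \<le> C * \<omega> i z)"
| "Ck_family (Suc k) I \<omega> f \<longleftrightarrow> (\<exists>C\<ge>0. \<forall>i\<in>I. \<forall>z. norm (f i z) \<le> C * \<omega> i z) \<and>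
     (\<exists>f'. (\<forall>i\<in>I. \<forall>z. (f i has_derivative (\<lambda>e. f' e i z)) (at z)) \<and> (\<forall>e. Ck_family k I \<omega> (f' e)))"

lemma Ck_family_continuous:
  assumes "Ck_family k I \<omega> f" "i \<in> I"
  shows "continuous_on UNIV (f i)"
proof (cases k)
  case (Suc k)
  then obtain f' where "\<forall>i\<in>I. \<forall>z. (f i has_derivative (\<lambda>e. f' e i z)) (at z)" using assms by auto
  then show ?thesis using assms(2)
    by (intro has_derivative_continuous_on[of UNIV "f i" "\<lambda>z e. f' e i z"]) auto
qed (use assms in auto)

lemma Ck_family_bound:
  assumes "Ck_family k I \<omega> f"
  shows "\<exists>C\<ge>0. \<forall>i\<in>I. \<forall>z. norm (f i z) \<le> C * \<omega> i z"
  using assms by (cases k) auto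

lemma Ck_family_Suc_derivative:
  assumes "Ck_family (Suc k) I \<omega> f"
  shows "\<exists>f'. (\<forall>i\<in>I. \<forall>z. (f i has_derivative (\<lambda>e. f' e i z)) (at z)) \<and> (\<forall>e. Ck_family k I \<omega> (f' e))"
  using assms by simp

lemma Ck_family_SucI:
  assumes "0 \<le> C" "\<And>i z. i \<in> I \<Longrightarrow> norm (f i z) \<le> C * \<omega> i z"
    and "\<And>i z. i \<in> I \<Longrightarrow> (f i has_derivative (\<lambda>e. f' e i z)) (at z)"
    and "\<And>e. Ck_family k I \<omega> (f' e)"
  shows "Ck_family (Suc k) I \<omega> f"
  unfolding Ck_family.simps using assms by (intro conjI exI[of _ C] exI[of _ f']) auto

lemma Ck_family_SucD: "Ck_family (Suc k) I \<omega> f \<Longrightarrow> Ck_family k I \<omega> f"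
proof (induction k arbitrary: f)
  case 0
  then show ?case using Ck_family_continuous[OF 0] Ck_family_bound[OF 0] by simp
next
  case (Suc k)
  obtain f' where "\<forall>i\<in>I. \<forall>z. (f i has_derivative (\<lambda>e. f' e i z)) (at z)"
      "\<forall>e. Ck_family (Suc k) I \<omega> (f' e)"
      using Ck_family_Suc_derivative[OF Suc.prems] by blast
    note f' = this[rule_format]
  obtain C where "0 \<le> C" "\<forall>i\<in>I. \<forall>z. norm (f i z) \<le> C * \<omega> i z"
    using Ck_family_bound[OF Suc.prems] by blast
  then show ?case using f' Suc.IH by (intro Ck_family_SucI[of C I f \<omega> f']) auto
qed

lemma Ck_family_weight_mono:
  assumes "Ck_family k I \<omega> f" "0 \<le> B" "\<And>i z. i \<in> I \<Longrightarrow> \<omega> i z \<le> B * \<omega>' i z"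
  shows "Ck_family k I \<omega>' f"
proof -
  have *: "\<exists>C\<ge>0. \<forall>i\<in>I. \<forall>z. norm (f i z) \<le> C * \<omega>' i z" if f: "Ck_family k I \<omega> f" for k f
  proof -
    obtain C where C: "0 \<le> C" "\<forall>i\<in>I. \<forall>z. norm (f i z) \<le> C * \<omega> i z"
      using Ck_family_bound[OF f] by blast
    have "norm (f i z) \<le> (C * B) * \<omega>' i z" if "i \<in> I" for i z
      using C(2)[rule_format, OF that, of z] mult_left_mono[OF assms(3)[OF that, of z] C(1)]
      by (simp add: mult.assoc)
    then show ?thesis using C(1) assms(2) by (intro exI[of _ "C * B"]) auto
  qed
  show ?thesis using assms(1)
  proof (induction k arbitrary: f)
    case 0
    then show ?case using *[OF 0] by simp
  next
    case (Suc k)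
    obtain f' where "\<forall>i\<in>I. \<forall>z. (f i has_derivative (\<lambda>e. f' e i z)) (at z)"
      "\<forall>e. Ck_family k I \<omega> (f' e)"
      using Ck_family_Suc_derivative[OF Suc.prems] by blast
    note f' = this[rule_format]
    obtain C where "0 \<le> C" "\<forall>i\<in>I. \<forall>z. norm (f i z) \<le> C * \<omega>' i z" using *[OF Suc.prems] by blast
    then show ?case using f' Suc.IH by (intro Ck_family_SucI[of C I f \<omega>' f']) auto
  qed
qed

lemma Ck_family_add:
  assumes "Ck_family k I \<omega> f" "Ck_family k I \<omega> g"
  shows "Ck_family k I \<omega> (\<lambda>i z. f i z + g i z)"
  using assms
proof (induction k arbitrary: f g)
  have bd: "\<exists>C\<ge>0. \<forall>i\<in>I. \<forall>z. norm (f i z + g i z) \<le> C * \<omega> i z"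
    if fg: "Ck_family k I \<omega> f" "Ck_family k I \<omega> g" for k f g
  proof -
    obtain C C' where C: "0 \<le> C" "\<forall>i\<in>I. \<forall>z. norm (f i z) \<le> C * \<omega> i z"
      and C': "0 \<le> C'" "\<forall>i\<in>I. \<forall>z. norm (g i z) \<le> C' * \<omega> i z"
      using Ck_family_bound[OF fg(1)] Ck_family_bound[OF fg(2)] by blast
    have "norm (f i z + g i z) \<le> (C + C') * \<omega> i z" if "i \<in> I" for i z
      using C(2)[rule_format, OF that, of z] C'(2)[rule_format, OF that, of z]
        norm_triangle_ineq[of "f i z" "g i z"]
      by (simp add: distrib_right)
    then show ?thesis using C(1) C'(1) by (intro exI[of _ "C + C'"]) auto
  qed
  {
    case 0
    then show ?case using bd[OF 0] by (auto intro!: continuous_intros)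
  next
    case (Suc k)
    obtain f' where "\<forall>i\<in>I. \<forall>z. (f i has_derivative (\<lambda>e. f' e i z)) (at z)"
      "\<forall>e. Ck_family k I \<omega> (f' e)"
      using Ck_family_Suc_derivative[OF Suc.prems(1)] by blast
    note f' = this[rule_format]
    obtain g' where "\<forall>i\<in>I. \<forall>z. (g i has_derivative (\<lambda>e. g' e i z)) (at z)"
      "\<forall>e. Ck_family k I \<omega> (g' e)"
      using Ck_family_Suc_derivative[OF Suc.prems(2)] by blast
    note g' = this[rule_format]
    obtain C where "0 \<le> C" "\<forall>i\<in>I. \<forall>z. norm (f i z + g i z) \<le> C * \<omega> i z"
      using bd[OF Suc.prems] by blast
    then show ?case using f' g' Suc.IH
      by (intro Ck_family_SucI[where C=C and f'="\<lambda>e i z. f' e i z + g' e i z"] has_derivative_add) auto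
  }
qed

lemma Ck_family_mult:
  assumes "Ck_family k I \<omega> f" "Ck_family k I \<omega>' g"
    and nn: "\<And>i z. i \<in> I \<Longrightarrow> 0 \<le> \<omega> i z"
  shows "Ck_family k I (\<lambda>i z. \<omega> i z * \<omega>' i z) (\<lambda>i z. f i z * g i z)"
  using assms(1,2)
proof (induction k arbitrary: f g)
  have bd: "\<exists>C\<ge>0. \<forall>i\<in>I. \<forall>z. norm (f i z * g i z) \<le> C * (\<omega> i z * \<omega>' i z)"
    if fg: "Ck_family k I \<omega> f" "Ck_family k I \<omega>' g" for k f g
  proof -
    obtain C C' where C: "0 \<le> C" "\<forall>i\<in>I. \<forall>z. norm (f i z) \<le> C * \<omega> i z"
      and C': "0 \<le> C'" "\<forall>i\<in>I. \<forall>z. norm (g i z) \<le> C' * \<omega>' i z"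
      using Ck_family_bound[OF fg(1)] Ck_family_bound[OF fg(2)] by blast
    have "norm (f i z * g i z) \<le> (C * C') * (\<omega> i z * \<omega>' i z)" if "i \<in> I" for i z
      using mult_mono[OF C(2)[rule_format, OF that, of z] C'(2)[rule_format, OF that, of z]]
        C(1) nn[OF that] by (simp add: norm_mult mult_ac)
    then show ?thesis using C(1) C'(1) by (intro exI[of _ "C * C'"]) auto
  qed
  {
    case 0
    then show ?case using bd[OF 0] by (auto intro!: continuous_intros)
  next
    case (Suc k)
    obtain f' where "\<forall>i\<in>I. \<forall>z. (f i has_derivative (\<lambda>e. f' e i z)) (at z)"
      "\<forall>e. Ck_family k I \<omega> (f' e)"
      using Ck_family_Suc_derivative[OF Suc.prems(1)] by blast
    note f' = this[rule_format]
    obtain g' where "\<forall>i\<in>I. \<forall>z. (g i has_derivative (\<lambda>e. g' e i z)) (at z)"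
      "\<forall>e. Ck_family k I \<omega>' (g' e)"
      using Ck_family_Suc_derivative[OF Suc.prems(2)] by blast
    note g' = this[rule_format]
    obtain C where "0 \<le> C" "\<forall>i\<in>I. \<forall>z. norm (f i z * g i z) \<le> C * (\<omega> i z * \<omega>' i z)"
      using bd[OF Suc.prems] by blast
    then show ?case using f' g' Suc.IH Suc.prems[THEN Ck_family_SucD]
      by (intro Ck_family_SucI[where C=C and f'="\<lambda>e i z. f i z * g' e i z + f' e i z * g i z"]
          has_derivative_mult Ck_family_add) auto
  }
qed

text \<open>The translation \<open>c j\<close> may depend on the index: this absorbs the shift by \<open>x\<close> in \<open>F (x + \<Theta> u)\<close> into the
index set.\<close>

lemma Ck_family_reparam:
  fixes l :: "'z::euclidean_space \<Rightarrow> 'y::euclidean_space"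
  assumes "Ck_family k I \<omega> f" "bounded_linear l" "\<And>j. j \<in> J \<Longrightarrow> s j \<in> I"
  shows "Ck_family k J (\<lambda>j z. \<omega> (s j) (c j + l z)) (\<lambda>j z. f (s j) (c j + l z))"
  using assms(1)
proof (induction k arbitrary: f)
  have bd: "\<exists>C\<ge>0. \<forall>i\<in>J. \<forall>z. norm (f (s i) (c i + l z)) \<le> C * \<omega> (s i) (c i + l z)"
    if f: "Ck_family k I \<omega> f" for k f
    using Ck_family_bound[OF f] assms(3) by blast
  {
    case 0
    have "continuous_on UNIV (\<lambda>z. f (s i) (c i + l z))" if "i \<in> J" for i
    proof -
      have "continuous_on UNIV (f (s i))" using Ck_family_continuous[OF 0] assms(3)[OF that] by auto
      then show "continuous_on UNIV (\<lambda>z. f (s i) (c i + l z))"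
        by (rule continuous_on_compose2)
          (use linear_continuous_on[OF assms(2)] in \<open>auto intro!: continuous_on_add continuous_on_const\<close>)
    qed
    then show ?case using bd[OF 0] by simp
  next
    case (Suc k)
    obtain f' where "\<forall>i\<in>I. \<forall>z. (f i has_derivative (\<lambda>e. f' e i z)) (at z)"
      "\<forall>e. Ck_family k I \<omega> (f' e)"
      using Ck_family_Suc_derivative[OF Suc.prems] by blast
    note f' = this[rule_format]
    have "((\<lambda>z. f (s i) (c i + l z)) has_derivative (\<lambda>e. f' (l e) (s i) (c i + l z))) (at z)" if "i \<in> J" for i z
    proof -
      have "((\<lambda>z. c i + l z) has_derivative l) (at z)"
        using has_derivative_add[OF has_derivative_const[of "c i"] bounded_linear_imp_has_derivative[OF assms(2)]] by simp
      then show ?thesis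
        using has_derivative_compose[of "\<lambda>z. c i + l z" l z UNIV "f (s i)"] f'(1) assms(3)[OF that] by auto
    qed
    moreover obtain C where "0 \<le> C" "\<forall>i\<in>J. \<forall>z. norm (f (s i) (c i + l z)) \<le> C * \<omega> (s i) (c i + l z)"
      using bd[OF Suc.prems] by blast
    ultimately show ?case using Suc.IH[OF f'(2)]
      by (intro Ck_family_SucI[where C=C and f'="\<lambda>e i z. f' (l e) (s i) (c i + l z)"]) auto
  }
qed

lemma Ck_family_const: "Ck_family k I (\<lambda>_ _. 1) (\<lambda>_ _. c)"
proof (induction k arbitrary: c)
  case (Suc k)
  show ?case
    by (rule Ck_family_SucI[where C="norm c" and f'="\<lambda>_ _ _. 0"]) (use Suc in auto)
next
  case 0
  show ?case by (auto intro!: exI[of _ "norm c"])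
qed

lemma Ck_family_cmult:
  assumes "Ck_family k I \<omega> f"
  shows "Ck_family k I \<omega> (\<lambda>i z. c * f i z)"
  using Ck_family_mult[OF Ck_family_const assms] by simp

lemma Ck_family_zero: "(\<And>i z. i \<in> I \<Longrightarrow> 0 \<le> \<omega> i z) \<Longrightarrow> Ck_family k I \<omega> (\<lambda>_ _. 0)"
proof (induction k)
  case (Suc k)
  then show ?case by (intro Ck_family_SucI[where C=0 and f'="\<lambda>_ _ _. 0"]) auto
qed (auto intro: exI[of _ 0])

lemma Ck_family_sum:
  assumes "finite B" "\<And>b. b \<in> B \<Longrightarrow> Ck_family k I \<omega> (f b)" "\<And>i z. i \<in> I \<Longrightarrow> 0 \<le> \<omega> i z"
  shows "Ck_family k I \<omega> (\<lambda>i z. \<Sum>b\<in>B. f b i z)"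
  using assms(1,2)
proof (induction B rule: finite_induct)
  case empty
  show ?case using Ck_family_zero[of I \<omega> k, OF assms(3)] by simp
next
  case (insert b B)
  have "Ck_family k I \<omega> (\<lambda>i z. f b i z + (\<Sum>b\<in>B. f b i z))"
    by (rule Ck_family_add[OF insert.prems[OF insertI1] insert.IH[OF insert.prems[OF insertI2]]])
  then show ?case unfolding sum.insert[OF insert.hyps] .
qed

lemma linearization_bound:
  fixes g :: "real \<Rightarrow> 'b::real_normed_vector"
  assumes "\<And>t. t \<in> closed_segment 0 a \<Longrightarrow> (g has_vector_derivative g' t) (at t)"
    and "\<And>t. t \<in> closed_segment 0 a \<Longrightarrow> norm (g' t - D) \<le> B"
  shows "norm (g a - g 0 - a *\<^sub>R D) \<le> B * \<bar>a\<bar>"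
proof -
  have "norm ((g a - a *\<^sub>R D) - (g 0 - 0 *\<^sub>R D)) \<le> B * norm (a - 0)"
  proof (rule differentiable_bound[where S="closed_segment 0 a" and f="\<lambda>t. g t - t *\<^sub>R D" and f'="\<lambda>t h. h *\<^sub>R (g' t - D)"])
    fix t assume t: "t \<in> closed_segment 0 a"
    show "((\<lambda>t. g t - t *\<^sub>R D) has_derivative (\<lambda>h. h *\<^sub>R (g' t - D))) (at t within closed_segment 0 a)"
    proof -
      have "(g has_derivative (\<lambda>h. h *\<^sub>R g' t)) (at t within closed_segment 0 a)"
        using assms(1)[OF t] unfolding has_vector_derivative_def by (rule has_derivative_at_withinI)
      moreover have "((\<lambda>t. t *\<^sub>R D) has_derivative (\<lambda>h. h *\<^sub>R D)) (at t within closed_segment 0 a)"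
        by (rule has_derivative_scaleR_left[OF has_derivative_ident])
      ultimately show ?thesis unfolding scaleR_diff_right by (rule has_derivative_diff)
    qed
    have "0 \<le> B" using assms(2)[OF t] norm_ge_zero order_trans by blast
    then show "onorm (\<lambda>h. h *\<^sub>R (g' t - D)) \<le> B"
      by (intro onorm_bound) (auto simp: mult.commute[of B] intro: mult_left_mono assms(2)[OF t])
  qed auto
  then show ?thesis by (simp add: algebra_simps)
qed

text \<open>The increment from \<open>x\<close> to \<open>x + h\<close> is split into steps along the basis vectors; in each step the mean
value inequality compares it with the partial derivative at \<open>x\<close>, by continuity of the latter.\<close>

lemma has_derivative_continuous_partials:
  fixes f :: "'z::euclidean_space \<Rightarrow> 'b::real_normed_vector"
  assumes d: "\<And>x b. b \<in> Basis \<Longrightarrow> ((\<lambda>t. f (x + t *\<^sub>R b)) has_vector_derivative d b x) (at 0)"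
    and c: "\<And>b. b \<in> Basis \<Longrightarrow> continuous_on UNIV (d b)"
  shows "(f has_derivative (\<lambda>e. \<Sum>b\<in>Basis. (e \<bullet> b) *\<^sub>R d b x)) (at x)"
proof -
  \<comment> \<open>The intermediate points lie within \<open>DIM('z) * |h|\<close> of \<open>x\<close>; the last step adds at most \<open>|h|\<close>.\<close>
  define n where "n = real DIM('z) + 1"
  have n: "n > 0" by (simp add: n_def add_pos_pos)
  have part: "((\<lambda>t. f (y + t *\<^sub>R b)) has_vector_derivative d b (y + t *\<^sub>R b)) (at t)" if "b \<in> Basis" for y b t
    using d[OF that, of "y + t *\<^sub>R b"]
    unfolding has_vector_derivative_iff_quotient by (simp add: algebra_simps)
  have step: "S \<subseteq> Basis \<Longrightarrow> \<forall>\<epsilon>>0. \<exists>\<delta>>0. \<forall>h. norm h < \<delta> \<longrightarrow>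
      norm (f (x + (\<Sum>b\<in>S. (h \<bullet> b) *\<^sub>R b)) - f x - (\<Sum>b\<in>S. (h \<bullet> b) *\<^sub>R d b x)) \<le> \<epsilon> * norm h"
    if "finite S" for S
    using that
  proof (induction S rule: finite_induct)
    case (insert b S)
    show ?case
    proof (intro allI impI)
      fix \<epsilon> :: real assume \<epsilon>: "\<epsilon> > 0"
      have b: "b \<in> Basis" "S \<subseteq> Basis" using insert.prems by auto
      obtain \<delta>1 where \<delta>1: "\<delta>1 > 0" "\<And>h. norm h < \<delta>1 \<Longrightarrow>
        norm (f (x + (\<Sum>b\<in>S. (h \<bullet> b) *\<^sub>R b)) - f x - (\<Sum>b\<in>S. (h \<bullet> b) *\<^sub>R d b x)) \<le> \<epsilon>/2 * norm h"
        using insert.IH[OF b(2)] \<epsilon> half_gt_zero by blast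
      have "isCont (d b) x" using c[OF b(1)] by (simp add: continuous_on_eq_continuous_at)
      then obtain \<delta>2 where \<delta>2: "\<delta>2 > 0" "\<And>y. dist y x < \<delta>2 \<Longrightarrow> dist (d b y) (d b x) < \<epsilon>/2"
        using \<epsilon> unfolding continuous_at_eps_delta by (metis half_gt_zero)
      show "\<exists>\<delta>>0. \<forall>h. norm h < \<delta> \<longrightarrow>
        norm (f (x + (\<Sum>b\<in>insert b S. (h \<bullet> b) *\<^sub>R b)) - f x - (\<Sum>b\<in>insert b S. (h \<bullet> b) *\<^sub>R d b x)) \<le> \<epsilon> * norm h"
      proof (intro exI[of _ "min \<delta>1 (\<delta>2 / n)"] conjI allI impI)
        show "0 < min \<delta>1 (\<delta>2 / n)" using \<delta>1 \<delta>2 n by simp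
        fix h :: 'z assume h: "norm h < min \<delta>1 (\<delta>2 / n)"
        define y where "y = x + (\<Sum>b\<in>S. (h \<bullet> b) *\<^sub>R b)"
        have yx: "norm (y - x) \<le> real DIM('z) * norm h"
        proof -
          have "norm (y - x) \<le> (\<Sum>b\<in>S. norm h)"
            unfolding y_def add_diff_cancel_left'
            by (intro sum_norm_le) (use b(2) in \<open>auto simp: Basis_le_norm subset_iff\<close>)
          also have "\<dots> \<le> real DIM('z) * norm h"
            using card_mono[OF finite_Basis b(2)] by (simp add: mult_right_mono)
          finally show ?thesis .
        qed
        have *: "norm (f (y + (h \<bullet> b) *\<^sub>R b) - f (y + 0 *\<^sub>R b) - (h \<bullet> b) *\<^sub>R d b x) \<le> (\<epsilon>/2) * \<bar>h \<bullet> b\<bar>"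
        proof (rule linearization_bound[where g="\<lambda>t. f (y + t *\<^sub>R b)" and g'="\<lambda>t. d b (y + t *\<^sub>R b)"])
          fix t assume "t \<in> closed_segment 0 (h \<bullet> b)"
          then have "\<bar>t\<bar> \<le> \<bar>h \<bullet> b\<bar>" by (auto simp: closed_segment_eq_real_ivl split: if_splits)
          then have t: "\<bar>t\<bar> \<le> norm h" using Basis_le_norm[OF b(1), of h] by simp
          have "norm (y + t *\<^sub>R b - x) \<le> norm (y - x) + \<bar>t\<bar>"
            using norm_triangle_ineq[of "y - x" "t *\<^sub>R b"] b(1) by (simp add: algebra_simps)
          also have "\<dots> \<le> n * norm h" using yx t by (simp add: n_def algebra_simps)
          also have "\<dots> < \<delta>2" using h n by (simp add: field_simps)
          finally show "norm (d b (y + t *\<^sub>R b) - d b x) \<le> \<epsilon>/2" using \<delta>2(2) by (force simp: dist_norm)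
        qed (rule part[OF b(1)])
        have 1: "norm (f (y + (h \<bullet> b) *\<^sub>R b) - f y - (h \<bullet> b) *\<^sub>R d b x) \<le> \<epsilon>/2 * norm h"
        proof -
          have "\<epsilon>/2 * \<bar>h \<bullet> b\<bar> \<le> \<epsilon>/2 * norm h"
            using Basis_le_norm[OF b(1), of h] \<epsilon> by (intro mult_left_mono) auto
          with * show ?thesis by simp
        qed
        have 2: "norm (f y - f x - (\<Sum>b\<in>S. (h \<bullet> b) *\<^sub>R d b x)) \<le> \<epsilon>/2 * norm h"
          using \<delta>1(2) h unfolding y_def by simp
        have e1: "(\<Sum>b\<in>insert b S. (h \<bullet> b) *\<^sub>R b) = (h \<bullet> b) *\<^sub>R b + (\<Sum>b\<in>S. (h \<bullet> b) *\<^sub>R b)"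
          "(\<Sum>b\<in>insert b S. (h \<bullet> b) *\<^sub>R d b x) = (h \<bullet> b) *\<^sub>R d b x + (\<Sum>b\<in>S. (h \<bullet> b) *\<^sub>R d b x)"
          using insert.hyps by simp_all
        have e2: "x + ((h \<bullet> b) *\<^sub>R b + (\<Sum>b\<in>S. (h \<bullet> b) *\<^sub>R b)) = y + (h \<bullet> b) *\<^sub>R b"
          by (simp add: y_def add_ac)
        have eq: "f (x + (\<Sum>b\<in>insert b S. (h \<bullet> b) *\<^sub>R b)) - f x - (\<Sum>b\<in>insert b S. (h \<bullet> b) *\<^sub>R d b x)
          = (f (y + (h \<bullet> b) *\<^sub>R b) - f y - (h \<bullet> b) *\<^sub>R d b x) + (f y - f x - (\<Sum>b\<in>S. (h \<bullet> b) *\<^sub>R d b x))"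
          unfolding e1 e2 by simp
        show "norm (f (x + (\<Sum>b\<in>insert b S. (h \<bullet> b) *\<^sub>R b)) - f x - (\<Sum>b\<in>insert b S. (h \<bullet> b) *\<^sub>R d b x)) \<le> \<epsilon> * norm h"
          unfolding eq using norm_triangle_mono[OF 1 2] by (simp add: field_simps)
      qed
    qed
  next
    case empty
    have "0 \<le> \<epsilon> * norm h" if "\<epsilon> > 0" for \<epsilon> and h :: 'z using that by simp
    then show ?case by (intro allI impI exI[of _ 1]) simp
  qed
  have lin: "bounded_linear (\<lambda>e. \<Sum>b\<in>Basis. (e \<bullet> b) *\<^sub>R d b x)"
    by (intro bounded_linear_sum bounded_linear_scaleR_const bounded_linear_inner_left)
  show ?thesis unfolding has_derivative_at_alt
  proof (intro conjI lin allI impI)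
    fix \<epsilon> :: real assume "\<epsilon> > 0"
    then obtain \<delta> where \<delta>: "\<delta> > 0" "\<And>h. norm h < \<delta> \<Longrightarrow>
      norm (f (x + (\<Sum>b\<in>Basis. (h \<bullet> b) *\<^sub>R b)) - f x - (\<Sum>b\<in>Basis. (h \<bullet> b) *\<^sub>R d b x)) \<le> \<epsilon> * norm h"
      using step[OF finite_Basis subset_refl] by blast
    show "\<exists>\<delta>>0. \<forall>y. norm (y - x) < \<delta> \<longrightarrow>
      norm (f y - f x - (\<Sum>b\<in>Basis. ((y - x) \<bullet> b) *\<^sub>R d b x)) \<le> \<epsilon> * norm (y - x)"
    proof (intro exI[of _ \<delta>] conjI allI impI \<delta>(1))
      fix y assume "norm (y - x) < \<delta>"
      from \<delta>(2)[OF this] show "norm (f y - f x - (\<Sum>b\<in>Basis. ((y - x) \<bullet> b) *\<^sub>R d b x)) \<le> \<epsilon> * norm (y - x)"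
        unfolding euclidean_representation by simp
    qed
  qed
qed

text \<open>Smoothness of maps into an algebra is formulated by iterated partial derivatives along basis vectors,
whereas the substitution \<open>u \<mapsto> x + \<Theta> u\<close> mixes directions and calls for total derivatives.\<close>

lemma Ck_family_of_partials:
  fixes d :: "'z::euclidean_space list \<Rightarrow> 'i \<Rightarrow> 'z \<Rightarrow> complex"
  assumes c: "\<And>es i. set es \<subseteq> Basis \<Longrightarrow> i \<in> I \<Longrightarrow> continuous_on UNIV (d es i)"
    and d: "\<And>es i b z. set es \<subseteq> Basis \<Longrightarrow> i \<in> I \<Longrightarrow> b \<in> Basis \<Longrightarrow>
       ((\<lambda>t. d es i (z + t *\<^sub>R b)) has_vector_derivative d (b # es) i z) (at 0)"
    and bd: "\<And>es. set es \<subseteq> Basis \<Longrightarrow> \<exists>C\<ge>0. \<forall>i\<in>I. \<forall>z. norm (d es i z) \<le> C * \<omega> i z"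
    and \<omega>: "\<And>i z. i \<in> I \<Longrightarrow> 0 \<le> \<omega> i z"
  shows "set es \<subseteq> Basis \<Longrightarrow> Ck_family k I \<omega> (d es)"
proof (induction k arbitrary: es)
  case 0
  then show ?case using c[OF 0] bd[OF 0] by simp
next
  case (Suc k)
  obtain C where C: "0 \<le> C" "\<forall>i\<in>I. \<forall>z. norm (d es i z) \<le> C * \<omega> i z" using bd[OF Suc.prems] by blast
  have "Ck_family k I \<omega> (\<lambda>i z. \<Sum>b\<in>Basis. complex_of_real (e \<bullet> b) * d (b # es) i z)" for e
    by (intro Ck_family_sum Ck_family_cmult Suc.IH \<omega>) (use Suc.prems in auto)
  moreover have "(d es i has_derivative (\<lambda>e. \<Sum>b\<in>Basis. complex_of_real (e \<bullet> b) * d (b # es) i z)) (at z)"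
    if "i \<in> I" for i z
    using has_derivative_continuous_partials[of "d es i" "\<lambda>b. d (b # es) i" z] Suc.prems that d c
    by (simp add: scaleR_conv_of_real)
  ultimately show ?case using C
    by (intro Ck_family_SucI[where C=C and f'="\<lambda>e i z. \<Sum>b\<in>Basis. complex_of_real (e \<bullet> b) * d (b # es) i z"]) auto
qed

section \<open>Oscillatory estimates\<close>

definition phase :: "'v::euclidean_space \<times> 'v \<Rightarrow> complex" where
  "phase z = exp (2 * complex_of_real pi * \<i> * complex_of_real (fst z \<bullet> snd z))"

lemma norm_phase [simp]: "norm (phase z) = 1"
  unfolding phase_def by (simp add: norm_exp_eq_Re)

lemma phase_has_derivative:
  "(phase has_derivative
     (\<lambda>e. 2 * complex_of_real pi * \<i> * complex_of_real (z \<bullet> prod.swap e) * phase z)) (at z)"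
proof -
  have 1: "((\<lambda>z. fst z \<bullet> snd z) has_derivative (\<lambda>e. z \<bullet> prod.swap e)) (at z)"
    by (rule has_derivative_eq_rhs, rule derivative_intros)
      (auto intro!: derivative_intros simp: inner_prod_def inner_commute add.commute)
  have 2: "((\<lambda>z. 2 * complex_of_real pi * \<i> * complex_of_real (fst z \<bullet> snd z)) has_derivative
      (\<lambda>e. 2 * complex_of_real pi * \<i> * complex_of_real (z \<bullet> prod.swap e))) (at z)"
    by (intro has_derivative_mult_right has_derivative_of_real 1)
  have "(exp has_derivative (\<lambda>h. exp (2 * complex_of_real pi * \<i> * complex_of_real (fst z \<bullet> snd z)) * h))
      (at (2 * complex_of_real pi * \<i> * complex_of_real (fst z \<bullet> snd z)))"
    using DERIV_exp unfolding has_field_derivative_def by blast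
  from has_derivative_compose[OF 2 this] show ?thesis
    unfolding phase_def[abs_def] by (simp add: mult_ac)
qed

lemma continuous_phase: "continuous_on A phase"
  unfolding phase_def by (intro continuous_intros)

text \<open>The derivative of the phase at \<open>z\<close> in the direction \<open>prod.swap b\<close> is \<open>2\<pi>i (z \<bullet> b)\<close> times the phase.
Splitting \<open>z \<bullet> b = w \<bullet> b + (z - w) \<bullet> b\<close> isolates the constant \<open>w \<bullet> b\<close>; the remainder multiplies the
cutoff, on whose support it is bounded.\<close>

lemma oscillatory_integration_by_parts:
  fixes f \<kappa> :: "'v::euclidean_space \<times> 'v \<Rightarrow> complex"
  assumes f: "\<And>z. (f has_derivative (\<lambda>e. f' e z)) (at z)" "continuous_on UNIV (f' (prod.swap b))"
    and \<kappa>: "\<And>z. (\<kappa> has_derivative (\<lambda>e. \<kappa>' e z)) (at z)" "continuous_on UNIV (\<kappa>' (prod.swap b))"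
    and supp: "\<And>z. norm z > R \<Longrightarrow> \<kappa> z = 0" "\<And>z. norm z > R \<Longrightarrow> \<kappa>' (prod.swap b) z = 0"
  shows "2 * complex_of_real pi * \<i> * complex_of_real (w \<bullet> b) * (\<integral>z. f z * \<kappa> (z - w) * phase z \<partial>lborel) =
    - ((\<integral>z. f' (prod.swap b) z * \<kappa> (z - w) * phase z \<partial>lborel)
     + (\<integral>z. f z * \<kappa>' (prod.swap b) (z - w) * phase z \<partial>lborel)
     + 2 * complex_of_real pi * \<i> * (\<integral>z. f z * (complex_of_real ((z - w) \<bullet> b) * \<kappa> (z - w)) * phase z \<partial>lborel))"
proof -
  define s where "s = prod.swap b"
  define k where "k = 2 * complex_of_real pi * \<i>"
  have cf: "continuous_on UNIV f" 
    using f(1) by (intro has_derivative_continuous_on[of UNIV f "\<lambda>z e. f' e z"]) auto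
  have c\<kappa>: "continuous_on UNIV \<kappa>"
    using \<kappa>(1) by (intro has_derivative_continuous_on[of UNIV \<kappa> "\<lambda>z e. \<kappa>' e z"]) auto
  have ct: "continuous_on UNIV (\<lambda>z. g (z - w))" if "continuous_on UNIV g" for g :: "'v \<times> 'v \<Rightarrow> complex"
    by (rule continuous_on_compose2[OF that]) (auto intro!: continuous_intros)
  let ?D = "\<lambda>z e. (f z * \<kappa> (z - w)) * (k * complex_of_real (z \<bullet> prod.swap e) * phase z)
     + (f z * \<kappa>' e (z - w) + f' e z * \<kappa> (z - w)) * phase z"
  have d: "((\<lambda>z. f z * \<kappa> (z - w) * phase z) has_derivative ?D z) (at z)" for z
  proof -
    have "((\<lambda>z. z - w) has_derivative (\<lambda>e. e)) (at z)"
      by (auto intro!: derivative_eq_intros)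
    from has_derivative_compose[OF this \<kappa>(1)]
    have "((\<lambda>z. \<kappa> (z - w)) has_derivative (\<lambda>e. \<kappa>' e (z - w))) (at z)" .
    from has_derivative_mult[OF has_derivative_mult[OF f(1) this] phase_has_derivative]
    show ?thesis unfolding k_def .
  qed
  let ?I1 = "\<lambda>z. f' s z * \<kappa> (z - w) * phase z"
  let ?I2 = "\<lambda>z. f z * \<kappa>' s (z - w) * phase z"
  let ?I3 = "\<lambda>z. f z * (complex_of_real ((z - w) \<bullet> b) * \<kappa> (z - w)) * phase z"
  let ?I4 = "\<lambda>z. f z * \<kappa> (z - w) * phase z"
  have i: "integrable lborel ?I1" "integrable lborel ?I2" "integrable lborel ?I3" "integrable lborel ?I4"
    using f(2) \<kappa>(2) unfolding s_def
    by (intro integrable_continuous_compact_support[where w=w and R=R] continuous_intros cf c\<kappa> ct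
        continuous_phase; simp add: supp)+
  have Ds: "?D z s = ?I1 z + ?I2 z + k * ?I3 z + k * complex_of_real (w \<bullet> b) * ?I4 z" for z
    by (simp add: s_def inner_diff_left algebra_simps)
  have "(\<integral>z. ?D z s \<partial>lborel) = 0"
  proof (rule integral_directional_derivative_eq_0[OF d, where w=w and R=R])
    show "continuous_on UNIV (\<lambda>z. ?D z s)"
      using f(2) \<kappa>(2) by (auto intro!: continuous_intros cf c\<kappa> ct continuous_phase simp: s_def)
    show "f z * \<kappa> (z - w) * phase z = 0" if "R < norm (z - w)" for z
      using supp(1)[OF that] by simp
  qed
  then have "(\<integral>z. ?I1 z \<partial>lborel) + (\<integral>z. ?I2 z \<partial>lborel) + k * (\<integral>z. ?I3 z \<partial>lborel)
     + k * complex_of_real (w \<bullet> b) * (\<integral>z. ?I4 z \<partial>lborel) = 0"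
    unfolding Ds using i by simp
  then show ?thesis unfolding s_def k_def by (simp add: add_eq_0_iff2 add.commute)
qed

text \<open>Using the indicator of a ball as weight makes the class of cutoffs closed under derivatives and under
multiplication by coordinates, by the general lemmas on \<open>Ck_family\<close>.\<close>

definition cutoff :: "nat \<Rightarrow> real \<Rightarrow> ('z::euclidean_space \<Rightarrow> complex) \<Rightarrow> bool" where
  "cutoff k R \<kappa> \<longleftrightarrow> Ck_family k (UNIV :: unit set) (\<lambda>_. indicator (cball 0 R)) (\<lambda>_. \<kappa>)"

lemma cutoff_vanishes: 
  assumes "cutoff k R \<kappa>" "norm z > R"
  shows "\<kappa> z = 0"
proof -
  obtain C where "\<forall>z. norm (\<kappa> z) \<le> C * indicator (cball 0 R) z"
    using Ck_family_bound[OF assms(1)[unfolded cutoff_def]] by blast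
  from this[rule_format, of z] show ?thesis using assms(2) by simp
qed

lemma Ck_family_coordinate:
  "Ck_family k I (\<lambda>_ z. 1 + norm z) (\<lambda>_ z. complex_of_real (z \<bullet> b))"
proof -
  have bd: "norm (complex_of_real (z \<bullet> b)) \<le> norm b * (1 + norm z)" for z
    using order_trans[OF Cauchy_Schwarz_ineq2[of z b], of "norm b + norm b * norm z"]
    by (simp add: algebra_simps)
  show ?thesis
  proof (cases k)
    case 0
    show ?thesis unfolding 0 Ck_family.simps
      using bd by (auto intro!: continuous_intros exI[of _ "norm b"])
  next
    case (Suc j)
    show ?thesis unfolding Suc
    proof (rule Ck_family_SucI[where C="norm b" and f'="\<lambda>e _ _. complex_of_real (e \<bullet> b)"])
      show "Ck_family j I (\<lambda>_ z. 1 + norm z) (\<lambda>_ _. complex_of_real (e \<bullet> b))" for e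
        by (rule Ck_family_weight_mono[OF Ck_family_const, where B=1]) auto
      show "((\<lambda>z. complex_of_real (z \<bullet> b)) has_derivative (\<lambda>e. complex_of_real (e \<bullet> b))) (at z)" for z
        by (intro has_derivative_of_real has_derivative_inner_left has_derivative_ident)
    qed (use bd in auto)
  qed
qed

lemma cutoff_coordinate_mult:
  assumes "cutoff k R \<kappa>" "0 \<le> R"
  shows "cutoff k R (\<lambda>z. complex_of_real (z \<bullet> b) * \<kappa> z)"
proof -
  have "Ck_family k UNIV (\<lambda>(_::unit) z. (1 + norm z) * indicator (cball 0 R) z)
      (\<lambda>_ z. complex_of_real (z \<bullet> b) * \<kappa> z)"
    by (rule Ck_family_mult[OF Ck_family_coordinate assms(1)[unfolded cutoff_def]]) auto
  then show ?thesis unfolding cutoff_def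
    by (rule Ck_family_weight_mono[where B="1 + R"]) (use assms(2) in \<open>auto simp: indicator_def\<close>)
qed

lemma cutoff_Suc_derivative:
  assumes "cutoff (Suc k) R \<kappa>"
  shows "\<exists>\<kappa>'. (\<forall>z. (\<kappa> has_derivative (\<lambda>e. \<kappa>' e z)) (at z)) \<and> (\<forall>e. cutoff k R (\<kappa>' e))"
proof -
  obtain \<kappa>' where "\<forall>i\<in>(UNIV::unit set). \<forall>z. (\<kappa> has_derivative (\<lambda>e. \<kappa>' e i z)) (at z)"
    "\<forall>e. Ck_family k (UNIV::unit set) (\<lambda>_. indicator (cball 0 R)) (\<kappa>' e)"
    using Ck_family_Suc_derivative[OF assms[unfolded cutoff_def]] by blast
  moreover have "\<kappa>' e = (\<lambda>_. \<kappa>' e ())" for e by (rule ext) simp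
  ultimately show ?thesis
    by (intro exI[of _ "\<lambda>e. \<kappa>' e ()"]) (simp add: cutoff_def)
qed

lemma cutoff_SucD: "cutoff (Suc k) R \<kappa> \<Longrightarrow> cutoff k R \<kappa>"
  unfolding cutoff_def by (rule Ck_family_SucD)

lemma cutoff_continuous: "cutoff k R \<kappa> \<Longrightarrow> continuous_on UNIV \<kappa>"
  unfolding cutoff_def using Ck_family_continuous[OF _ UNIV_I] .

text \<open>Each integration by parts trades a factor \<open>w \<bullet> b\<close> for three integrals of the same form, in which
\<open>f\<close> or \<open>\<kappa>\<close> is replaced by a derivative, or \<open>\<kappa>\<close> is multiplied by a coordinate. Hence the induction
on the number of factors runs over all \<open>f\<close> and \<open>\<kappa>\<close>.\<close>

lemma oscillatory_decay_coordinate: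
  fixes f :: "'i \<Rightarrow> 'v::euclidean_space \<times> 'v \<Rightarrow> complex"
  assumes "Ck_family k I (\<lambda>i z. c i * (1 + norm z) ^ m) f" "cutoff k R \<kappa>"
    and c: "\<And>i. i \<in> I \<Longrightarrow> 0 \<le> c i" and R: "0 \<le> R"
  shows "\<exists>C\<ge>0. \<forall>i\<in>I. \<forall>w. \<bar>w \<bullet> b\<bar> ^ k * norm (\<integral>z. f i z * \<kappa> (z - w) * phase z \<partial>lborel)
           \<le> C * (c i * (1 + norm w) ^ m)"
  using assms(1,2)
proof (induction k arbitrary: f \<kappa>)
  case 0
  obtain C where C: "0 \<le> C" "\<forall>i\<in>I. \<forall>z. norm (f i z) \<le> C * (c i * (1 + norm z) ^ m)"
    using Ck_family_bound[OF 0(1)] by blast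
  obtain C' where C': "0 \<le> C'" "\<forall>z. norm (\<kappa> z) \<le> C' * indicator (cball 0 R) z"
    using Ck_family_bound[OF 0(2)[unfolded cutoff_def]] by blast
  define V where "V = measure lborel (cball (0::'v\<times>'v) R)"
  have "norm (\<integral>z. f i z * \<kappa> (z - w) * phase z \<partial>lborel) \<le> (C * C' * (1 + R) ^ m * V) * (c i * (1 + norm w) ^ m)"
    if i: "i \<in> I" for i w
  proof -
    define K where "K = C * C' * (1 + R) ^ m * (c i * (1 + norm w) ^ m)"
    have K: "0 \<le> K" unfolding K_def using C(1) C'(1) R c[OF i] by simp
    have bd: "norm (f i z * \<kappa> (z - w) * phase z) \<le> K * indicator (cball w R) z" for z
    proof (cases "norm (z - w) \<le> R")
      case True
      have "1 + norm z \<le> (1 + norm w) + R" using True norm_triangle_ineq2[of z w] by simp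
      also have "\<dots> \<le> (1 + R) * (1 + norm w)" using R by (simp add: algebra_simps)
      finally have "(1 + norm z) ^ m \<le> ((1 + R) * (1 + norm w)) ^ m" by (intro power_mono) auto
      then have "norm (f i z) \<le> C * (c i * ((1 + R) ^ m * (1 + norm w) ^ m))"
        using C(2)[rule_format, OF i, of z] C(1) c[OF i]
        by (smt (verit, best) mult_left_mono power_mult_distrib)
      moreover have "norm (\<kappa> (z - w)) \<le> C'" using C'(2)[rule_format, of "z - w"] True by simp
      ultimately have "norm (f i z) * norm (\<kappa> (z - w)) \<le> (C * (c i * ((1 + R) ^ m * (1 + norm w) ^ m))) * C'"
        using C(1) c[OF i] R by (intro mult_mono) auto
      then show ?thesis using True by (simp add: norm_mult K_def dist_norm norm_minus_commute mult_ac)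
    next
      case False
      then have "\<kappa> (z - w) = 0" using cutoff_vanishes[OF 0(2)] by simp
      then show ?thesis using K by simp
    qed
    have "norm (\<integral>z. f i z * \<kappa> (z - w) * phase z \<partial>lborel) \<le> (\<integral>z. K * indicator (cball w R) z \<partial>lborel)"
    proof (rule order_trans[OF integral_norm_bound integral_mono[OF integrable_norm]])
      show "integrable lborel (\<lambda>z. f i z * \<kappa> (z - w) * phase z)"
        using Ck_family_continuous[OF 0(1) i] cutoff_continuous[OF 0(2)] cutoff_vanishes[OF 0(2)]
        by (intro integrable_continuous_compact_support[where w=w and R=R] continuous_intros continuous_phase
           continuous_on_compose2[of UNIV \<kappa> UNIV "\<lambda>z. z - w"]) auto
      show "integrable lborel (\<lambda>z. K * indicator (cball w R) z)"
        using emeasure_lborel_cball_finite[of w R]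
        by (intro integrable_mult_right integrable_real_indicator) auto
    qed (rule bd)
    also have "\<dots> = K * V" using R by (simp add: V_def content_cball)
    finally show ?thesis by (simp add: K_def mult_ac)
  qed
  then show ?case using C(1) C'(1) R by (intro exI[of _ "C * C' * (1 + R) ^ m * V"]) (auto simp: V_def)
next
  case (Suc k)
  obtain f' where f': "\<forall>i\<in>I. \<forall>z. (f i has_derivative (\<lambda>e. f' e i z)) (at z)"
    "\<forall>e. Ck_family k I (\<lambda>i z. c i * (1 + norm z) ^ m) (f' e)"
    using Ck_family_Suc_derivative[OF Suc.prems(1)] by blast
  obtain \<kappa>' where "\<forall>z. (\<kappa> has_derivative (\<lambda>e. \<kappa>' e z)) (at z)" "\<forall>e. cutoff k R (\<kappa>' e)"
    using cutoff_Suc_derivative[OF Suc.prems(2)] by blast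
  note \<kappa>' = this[rule_format]
  let ?J = "\<lambda>f \<kappa> w. \<integral>z. f z * \<kappa> (z - w) * phase z \<partial>lborel"
  let ?s = "prod.swap b"
  let ?x\<kappa> = "\<lambda>z. complex_of_real (z \<bullet> b) * \<kappa> z"
  note f0 = Ck_family_SucD[OF Suc.prems(1)] and \<kappa>0 = cutoff_SucD[OF Suc.prems(2)]
  obtain C1 where C1: "C1 \<ge> 0" "\<forall>i\<in>I. \<forall>w. \<bar>w \<bullet> b\<bar> ^ k * norm (?J (f' ?s i) \<kappa> w) \<le> C1 * (c i * (1 + norm w) ^ m)"
    using Suc.IH[OF f'(2)[rule_format] \<kappa>0] by blast
  obtain C2 where C2: "C2 \<ge> 0" "\<forall>i\<in>I. \<forall>w. \<bar>w \<bullet> b\<bar> ^ k * norm (?J (f i) (\<kappa>' ?s) w) \<le> C2 * (c i * (1 + norm w) ^ m)"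
    using Suc.IH[OF f0 \<kappa>'(2)] by blast
  obtain C3 where C3: "C3 \<ge> 0" "\<forall>i\<in>I. \<forall>w. \<bar>w \<bullet> b\<bar> ^ k * norm (?J (f i) ?x\<kappa> w) \<le> C3 * (c i * (1 + norm w) ^ m)"
    using Suc.IH[OF f0 cutoff_coordinate_mult[OF \<kappa>0 R]] by blast
  have "\<bar>w \<bullet> b\<bar> ^ Suc k * norm (?J (f i) \<kappa> w) \<le> (C1 + C2 + C3) * (c i * (1 + norm w) ^ m)" if i: "i \<in> I" for i w
  proof -
    have ibp: "2 * complex_of_real pi * \<i> * complex_of_real (w \<bullet> b) * ?J (f i) \<kappa> w =
       - (?J (f' ?s i) \<kappa> w + ?J (f i) (\<kappa>' ?s) w + 2 * complex_of_real pi * \<i> * ?J (f i) ?x\<kappa> w)"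
    proof (rule oscillatory_integration_by_parts[where R=R])
      show "(f i has_derivative (\<lambda>e. f' e i z)) (at z)" for z using f'(1) i by blast
      show "continuous_on UNIV (f' ?s i)" using Ck_family_continuous[OF f'(2)[rule_format] i] .
      show "continuous_on UNIV (\<kappa>' ?s)" by (rule cutoff_continuous[OF \<kappa>'(2)])
    qed (use \<kappa>' cutoff_vanishes[OF Suc.prems(2)] cutoff_vanishes[OF \<kappa>'(2)] in auto)
    have pi1: "1 \<le> 2 * pi" using pi_gt3 by simp
    have "2 * pi * (\<bar>w \<bullet> b\<bar> * norm (?J (f i) \<kappa> w)) =
        norm (2 * complex_of_real pi * \<i> * complex_of_real (w \<bullet> b) * ?J (f i) \<kappa> w)"
      by (simp add: norm_mult)
    also have "\<dots> \<le> norm (?J (f' ?s i) \<kappa> w) + norm (?J (f i) (\<kappa>' ?s) w) + 2 * pi * norm (?J (f i) ?x\<kappa> w)"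
      unfolding ibp norm_minus_cancel
      by (rule order_trans[OF norm_triangle_ineq add_mono[OF norm_triangle_ineq]]) (simp add: norm_mult)
    also have "\<dots> \<le> 2 * pi * (norm (?J (f' ?s i) \<kappa> w) + norm (?J (f i) (\<kappa>' ?s) w) + norm (?J (f i) ?x\<kappa> w))"
      unfolding distrib_left
      by (intro add_mono order_refl) (use mult_right_mono[OF pi1 norm_ge_zero] in simp_all)
    finally have "\<bar>w \<bullet> b\<bar> * norm (?J (f i) \<kappa> w) \<le> norm (?J (f' ?s i) \<kappa> w) + norm (?J (f i) (\<kappa>' ?s) w) + norm (?J (f i) ?x\<kappa> w)"
      by (rule mult_left_le_imp_le) simp
    then have "\<bar>w \<bullet> b\<bar> ^ k * (\<bar>w \<bullet> b\<bar> * norm (?J (f i) \<kappa> w)) \<le>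
       \<bar>w \<bullet> b\<bar> ^ k * (norm (?J (f' ?s i) \<kappa> w) + norm (?J (f i) (\<kappa>' ?s) w) + norm (?J (f i) ?x\<kappa> w))"
      by (rule mult_left_mono) simp
    also have "\<dots> \<le> C1 * (c i * (1 + norm w) ^ m) + C2 * (c i * (1 + norm w) ^ m) + C3 * (c i * (1 + norm w) ^ m)"
      unfolding distrib_left
      by (intro add_mono C1(2)[rule_format, OF i] C2(2)[rule_format, OF i] C3(2)[rule_format, OF i])
    finally show ?thesis by (simp add: algebra_simps)
  qed
  then show ?case using C1(1) C2(1) C3(1) by (intro exI[of _ "C1 + C2 + C3"]) auto
qed

definition lattice_weight :: "'z::euclidean_space \<Rightarrow> real" where
  "lattice_weight w = inverse ((1 + (norm w)\<^sup>2) ^ DIM('z))"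

lemma lattice_weight_nonneg: "0 \<le> lattice_weight w"
  by (simp add: lattice_weight_def)

text \<open>The number of integrations by parts exceeds the growth exponent \<open>m\<close> by twice the dimension, which
leaves a summable weight.\<close>

lemma oscillatory_decay:
  fixes f :: "'i \<Rightarrow> 'v::euclidean_space \<times> 'v \<Rightarrow> complex"
  assumes f: "\<And>k. Ck_family k I (\<lambda>i z. c i * (1 + norm z) ^ m) f"
    and \<kappa>: "\<And>k. cutoff k R \<kappa>"
    and c: "\<And>i. i \<in> I \<Longrightarrow> 0 \<le> c i" and R: "0 \<le> R"
  shows "\<exists>C\<ge>0. \<forall>i\<in>I. \<forall>w. norm (\<integral>z. f i z * \<kappa> (z - w) * phase z \<partial>lborel) \<le> C * c i * lattice_weight w"
proof -
  define n where "n = DIM('v \<times> 'v)"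
  have n: "n > 0" by (simp add: n_def)
  define k where "k = m + 2 * n"
  let ?J = "\<lambda>i w. \<integral>z. f i z * \<kappa> (z - w) * phase z \<partial>lborel"
  have "\<forall>b. \<exists>C\<ge>0. \<forall>i\<in>I. \<forall>w. \<bar>w \<bullet> b\<bar> ^ k * norm (?J i w) \<le> C * (c i * (1 + norm w) ^ m)"
    using oscillatory_decay_coordinate[OF f \<kappa> c R] by blast
  from choice[OF this] obtain C where "\<forall>b. 0 \<le> C b \<and> (\<forall>i\<in>I. \<forall>w. \<bar>w \<bullet> b\<bar> ^ k * norm (?J i w) \<le> C b * (c i * (1 + norm w) ^ m))"
    by blast
  then have C: "C b \<ge> 0" "i \<in> I \<Longrightarrow> \<bar>w \<bullet> b\<bar> ^ k * norm (?J i w) \<le> C b * (c i * (1 + norm w) ^ m)" for b i w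
    by blast+
  \<comment> \<open>The exponent 0 takes care of the summand 1 in \<open>(1 + |w|)\<^sup>k \<le> 2\<^sup>k (1 + |w|\<^sup>k)\<close>.\<close>
  obtain C0 where C0: "C0 \<ge> 0" "\<forall>i\<in>I. \<forall>w. \<bar>w \<bullet> 0\<bar> ^ 0 * norm (?J i w) \<le> C0 * (c i * (1 + norm w) ^ m)"
    using oscillatory_decay_coordinate[OF f[of 0] \<kappa>[of 0] c R] by blast
  have C0': "norm (?J i w) \<le> C0 * (c i * (1 + norm w) ^ m)" if "i \<in> I" for i w
    using C0(2)[rule_format, OF that, of w] by simp
  define B where "B = 2 ^ k * (C0 + real n ^ k * (\<Sum>b\<in>Basis. C b))"
  have "norm (?J i w) \<le> B * c i * lattice_weight w" if i: "i \<in> I" for i w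
  proof -
    have 1: "(1 + norm w) ^ k \<le> 2 ^ k * (1 + norm w ^ k)"
    proof -
      have "1 + norm w \<le> 2 * max 1 (norm w)" by simp
      then have "(1 + norm w) ^ k \<le> (2 * max 1 (norm w)) ^ k" by (intro power_mono) auto
      also have "\<dots> = 2 ^ k * (max 1 (norm w)) ^ k" by (simp add: power_mult_distrib)
      also have "(max 1 (norm w)) ^ k \<le> 1 + norm w ^ k" by (auto simp: max_def)
      finally show ?thesis by simp
    qed
    have 2: "norm w ^ k \<le> real n ^ k * (\<Sum>b\<in>Basis. \<bar>w \<bullet> b\<bar> ^ k)"
    proof -
      obtain b where b: "b \<in> Basis" "\<And>b'. b' \<in> Basis \<Longrightarrow> \<bar>w \<bullet> b'\<bar> \<le> \<bar>w \<bullet> b\<bar>"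
        using Max_in[of "(\<lambda>b. \<bar>w \<bullet> b\<bar>) ` Basis"] Max_ge[of "(\<lambda>b. \<bar>w \<bullet> b\<bar>) ` Basis"]
        by (metis (no_types, lifting) finite_Basis finite_imageI imageE imageI image_is_empty nonempty_Basis)
      have "norm w \<le> (\<Sum>b\<in>Basis. \<bar>w \<bullet> b\<bar>)" by (rule norm_le_l1)
      also have "\<dots> \<le> real n * \<bar>w \<bullet> b\<bar>" 
        unfolding n_def by (rule sum_bounded_above) (rule b(2))
      finally have "norm w ^ k \<le> real n ^ k * \<bar>w \<bullet> b\<bar> ^ k"
        using power_mono[of "norm w"] by (simp add: power_mult_distrib[symmetric])
      also have "\<bar>w \<bullet> b\<bar> ^ k \<le> (\<Sum>b\<in>Basis. \<bar>w \<bullet> b\<bar> ^ k)"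
        using b(1) by (intro member_le_sum) auto
      finally show ?thesis by (simp add: mult_left_mono)
    qed
    have "(1 + norm w) ^ k * norm (?J i w) \<le> 2 ^ k * (1 + real n ^ k * (\<Sum>b\<in>Basis. \<bar>w \<bullet> b\<bar> ^ k)) * norm (?J i w)"
      using 1 2 by (intro mult_right_mono) (auto intro: order_trans[OF 1] mult_left_mono)
    also have "\<dots> = 2 ^ k * (norm (?J i w) + real n ^ k * (\<Sum>b\<in>Basis. \<bar>w \<bullet> b\<bar> ^ k * norm (?J i w)))"
      by (simp add: algebra_simps sum_distrib_right sum_distrib_left)
    also have "\<dots> \<le> 2 ^ k * (C0 * (c i * (1 + norm w) ^ m) + real n ^ k * (\<Sum>b\<in>Basis. C b * (c i * (1 + norm w) ^ m)))"
      using C(2)[OF i] C0'[OF i] by (intro mult_left_mono add_mono sum_mono) auto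
    also have "\<dots> = B * c i * (1 + norm w) ^ m"
      by (simp add: B_def algebra_simps sum_distrib_right sum_distrib_left)
    finally have "(1 + norm w) ^ m * ((1 + norm w) ^ (2 * n) * norm (?J i w)) \<le> (1 + norm w) ^ m * (B * c i)"
      by (simp add: k_def power_add mult_ac)
    then have 3: "(1 + norm w) ^ (2 * n) * norm (?J i w) \<le> B * c i"
      by (rule mult_left_le_imp_le) (simp add: add_pos_nonneg)
    have "(1 + (norm w)\<^sup>2) ^ n \<le> ((1 + norm w)\<^sup>2) ^ n"
      by (intro power_mono) (auto simp: power2_eq_square algebra_simps)
    then have "(1 + (norm w)\<^sup>2) ^ n * norm (?J i w) \<le> B * c i"
      using 3 by (simp add: power_mult[symmetric]) (meson mult_right_mono norm_ge_zero order_trans)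
    then show ?thesis
      unfolding lattice_weight_def n_def[symmetric]
      by (simp add: field_simps add_pos_nonneg)
  qed
  moreover have "B \<ge> 0" unfolding B_def using C C0 by (simp add: sum_nonneg)
  ultimately show ?thesis by blast
qed

text \<open>A form of Peetre's inequality, from \<open>1 + |z|\<^sup>2 \<le> 2 (1 + R\<^sup>2) (1 + |w|\<^sup>2)\<close>.\<close>

lemma lattice_weight_le:
  fixes z w :: "'z::euclidean_space"
  assumes "norm (z - w) \<le> R"
  shows "lattice_weight w \<le> (2 * (1 + R\<^sup>2)) ^ DIM('z) * lattice_weight z"
proof -
  have "(norm z)\<^sup>2 \<le> (norm w + R)\<^sup>2"
    using assms norm_triangle_sub[of z w] by (intro power_mono) auto
  also have "\<dots> \<le> 2 * (norm w)\<^sup>2 + 2 * R\<^sup>2"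
    using zero_le_power2[of "norm w - R"] by (simp add: power2_eq_square algebra_simps)
  finally have "1 + (norm z)\<^sup>2 \<le> (2 * (1 + R\<^sup>2)) * (1 + (norm w)\<^sup>2)"
    using mult_nonneg_nonneg[OF zero_le_power2[of R] zero_le_power2[of "norm w"]]
    unfolding distrib_left distrib_right by linarith
  then have "(1 + (norm z)\<^sup>2) ^ DIM('z) \<le> ((2 * (1 + R\<^sup>2)) * (1 + (norm w)\<^sup>2)) ^ DIM('z)"
    by (intro power_mono) auto
  then have "(1 + (norm z)\<^sup>2) ^ DIM('z) \<le> (2 * (1 + R\<^sup>2)) ^ DIM('z) * (1 + (norm w)\<^sup>2) ^ DIM('z)"
    by (simp only: power_mult_distrib)
  moreover have "(1 + (norm z)\<^sup>2) ^ DIM('z) > 0" "(1 + (norm w)\<^sup>2) ^ DIM('z) > 0"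
    by (simp_all add: add_pos_nonneg)
  ultimately show ?thesis
    unfolding lattice_weight_def by (simp add: field_simps)
qed

lemma integral_pos_of_continuous:
  fixes \<phi> :: "'z::euclidean_space \<Rightarrow> real"
  assumes c: "continuous_on UNIV \<phi>" and nn: "\<And>z. 0 \<le> \<phi> z" and i: "integrable lborel \<phi>" and z0: "\<phi> z0 \<noteq> 0"
  shows "0 < (\<integral>z. \<phi> z \<partial>lborel)"
proof -
  have p: "0 < \<phi> z0" using nn[of z0] z0 by simp
  have "isCont \<phi> z0" using c by (simp add: continuous_on_eq_continuous_at)
  then obtain d where d: "d > 0" "\<And>y. dist y z0 < d \<Longrightarrow> dist (\<phi> y) (\<phi> z0) < \<phi> z0 / 2"
    using p unfolding continuous_at_eps_delta by (metis half_gt_zero)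
  have "0 < \<phi> z0 / 2 * measure lborel (ball z0 d)" using d(1) p by (simp add: content_ball_pos)
  also have "\<dots> = (\<integral>z. \<phi> z0 / 2 * indicator (ball z0 d) z \<partial>lborel)" by simp
  also have "\<dots> \<le> (\<integral>z. \<phi> z \<partial>lborel)"
  proof (rule integral_mono[OF _ i])
    show "integrable lborel (\<lambda>z. \<phi> z0 / 2 * indicator (ball z0 d) z)"
      using emeasure_lborel_ball_finite[of z0 d] by (intro integrable_mult_right integrable_real_indicator) auto
    show "\<phi> z0 / 2 * indicator (ball z0 d) z \<le> \<phi> z" for z
      using d(2)[of z] nn[of z] by (auto simp: indicator_def dist_commute dist_real_def abs_if split: if_splits)
  qed
  finally show ?thesis .
qed

text \<open>All translates \<open>\<phi> (z - w)\<close> have the same integral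
\<open>k > 0\<close>, on the support of such a translate the weights at \<open>w\<close> and at \<open>z\<close> are comparable, and the
translates add up to 1; so \<open>k\<close> times a partial sum of the weights is at most a multiple of the
integral of the weight.\<close>

lemma summable_lattice_weight:
  fixes \<phi> :: "'z::euclidean_space \<Rightarrow> real"
  assumes c: "continuous_on UNIV \<phi>" and nn: "\<And>z. 0 \<le> \<phi> z"
    and supp: "\<And>z. norm z > R \<Longrightarrow> \<phi> z = 0" and sum1: "\<And>z. ((\<lambda>w. \<phi> (z - w)) has_sum 1) W"
  shows "lattice_weight summable_on W"
proof -
  have i: "integrable lborel (\<lambda>z. \<phi> (z - w))" for w
  proof -
    have "integrable lborel (\<lambda>z. complex_of_real (\<phi> (z - w)))"
      by (rule integrable_continuous_compact_support[where w=w and R=R])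
        (use supp in \<open>auto intro!: continuous_intros continuous_on_compose2[OF c]\<close>)
    from integrable_Re[OF this] show ?thesis by simp
  qed
  obtain z0 where "\<phi> z0 \<noteq> 0"
  proof -
    have "\<exists>z. \<phi> z \<noteq> 0"
    proof (rule ccontr)
      assume "\<not> (\<exists>z. \<phi> z \<noteq> 0)"
      then have "((\<lambda>w. 0::real) has_sum 1) W" using sum1[of 0] by simp
      then show False using has_sum_unique[OF _ has_sum_0[of W "\<lambda>_. 0"]] by fastforce
    qed
    then show thesis using that by blast
  qed
  define k where "k = (\<integral>z. \<phi> z \<partial>lborel)"
  have kw: "(\<integral>z. \<phi> (z - w) \<partial>lborel) = k" for w
  proof -
    have "k = (\<integral>z. \<phi> z \<partial>distr lborel borel ((+) (- w)))" by (simp add: k_def lborel_distr_plus)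
    also have "\<dots> = (\<integral>z. \<phi> (- w + z) \<partial>lborel)"
      using c by (intro integral_distr) (auto intro: borel_measurable_continuous_onI)
    finally show ?thesis by simp
  qed
  have k: "k > 0" unfolding k_def
    using integral_pos_of_continuous[OF c nn _ \<open>\<phi> z0 \<noteq> 0\<close>] i[of 0] by simp
  define A where "A = (2 * (1 + R\<^sup>2)) ^ DIM('z)"
  have A: "A \<ge> 0" by (simp add: A_def)
  have le: "lattice_weight z \<le> product_weight z" for z :: 'z
    unfolding lattice_weight_def by (rule lattice_weight_le_product_weight)
  define P where "P = (\<integral>z. product_weight z \<partial>(lborel :: 'z measure))"
  have bd: "sum lattice_weight S \<le> A * P / k" if S: "finite S" "S \<subseteq> W" for S
  proof -
    have "k * sum lattice_weight S = (\<Sum>w\<in>S. \<integral>z. \<phi> (z - w) * lattice_weight w \<partial>lborel)"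
      by (simp add: kw sum_distrib_left)
    also have "\<dots> = (\<integral>z. (\<Sum>w\<in>S. \<phi> (z - w) * lattice_weight w) \<partial>lborel)"
      by (intro Bochner_Integration.integral_sum[symmetric] integrable_mult_left i)
    also have "\<dots> \<le> (\<integral>z. A * product_weight z \<partial>(lborel :: 'z measure))"
    proof (rule integral_mono)
      show "integrable lborel (\<lambda>z. \<Sum>w\<in>S. \<phi> (z - w) * lattice_weight w)"
        by (intro Bochner_Integration.integrable_sum integrable_mult_left i)
      show "integrable lborel (\<lambda>z::'z. A * product_weight z)"
        by (intro integrable_mult_right integrable_product_weight)
      fix z :: 'z
      have "\<phi> (z - w) * lattice_weight w \<le> \<phi> (z - w) * (A * lattice_weight z)" for w
      proof (cases "norm (z - w) \<le> R")
        case True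
        then show ?thesis using lattice_weight_le[OF True] nn by (intro mult_left_mono) (auto simp: A_def)
      qed (use supp in simp)
      then have "(\<Sum>w\<in>S. \<phi> (z - w) * lattice_weight w) \<le> (\<Sum>w\<in>S. \<phi> (z - w)) * (A * lattice_weight z)"
        by (simp add: sum_distrib_right sum_mono)
      also have "(\<Sum>w\<in>S. \<phi> (z - w)) \<le> 1"
        by (rule finite_sum_le_has_sum[OF sum1[of z] S]) (rule nn)
      then have "(\<Sum>w\<in>S. \<phi> (z - w)) * (A * lattice_weight z) \<le> 1 * (A * lattice_weight z)"
        by (intro mult_right_mono mult_nonneg_nonneg lattice_weight_nonneg A) auto
      also have "\<dots> \<le> A * product_weight z" using A le by (simp add: mult_left_mono)
      finally show "(\<Sum>w\<in>S. \<phi> (z - w) * lattice_weight w) \<le> A * product_weight z" .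
    qed
    also have "\<dots> = A * P" by (simp add: P_def)
    finally show ?thesis using k by (simp add: field_simps)
  qed
  show ?thesis
    by (rule nonneg_bdd_above_summable_on) (auto simp: lattice_weight_nonneg bdd_above_def intro: bd)
qed

text \<open>The derivatives vanish outside the ball as well, because its complement is open.\<close>

lemma cutoff_of_smooth:
  fixes \<phi> :: "'z::euclidean_space \<Rightarrow> real"
  assumes "Ck_on k UNIV \<phi>" "\<And>z. norm z > R \<Longrightarrow> \<phi> z = 0"
  shows "cutoff k R (\<lambda>z. complex_of_real (\<phi> z))"
  using assms
proof (induction k arbitrary: \<phi>)
  have bd: "\<exists>C\<ge>0. \<forall>z. norm (complex_of_real (\<phi> z)) \<le> C * indicator (cball 0 R) z"
    if c: "continuous_on UNIV \<phi>" and 0: "\<And>z. norm z > R \<Longrightarrow> \<phi> z = 0" for \<phi> :: "'z \<Rightarrow> real"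
  proof -
    have "bounded (\<phi> ` cball 0 R)"
      by (intro compact_imp_bounded compact_continuous_image continuous_on_subset[OF c]) auto
    then obtain C where C: "\<forall>z\<in>cball 0 R. norm (\<phi> z) \<le> C" by (auto simp: bounded_iff)
    have "norm (complex_of_real (\<phi> z)) \<le> max C 0 * indicator (cball 0 R) z" for z
    proof (cases "norm z > R")
      case False
      then have "norm (\<phi> z) \<le> C" using C by auto
      then show ?thesis using False by simp
    qed (use 0 in simp)
    then show ?thesis by (intro exI[of _ "max C 0"]) auto
  qed
  {
    case 0
    then show ?case using bd[of \<phi>] unfolding cutoff_def Ck_family.simps
      by (auto intro!: continuous_intros)
  next
    case (Suc k)
    have d: "(\<phi> has_derivative frechet_derivative \<phi> (at z)) (at z)" for z
      using Suc.prems(1) by (simp add: frechet_derivative_works)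
    have c: "continuous_on UNIV \<phi>"
      using d by (intro has_derivative_continuous_on[of UNIV \<phi> "\<lambda>z. frechet_derivative \<phi> (at z)"]) auto
    have z: "frechet_derivative \<phi> (at z) e = 0" if "norm z > R" for z e
    proof -
      have "open {z::'z. norm z > R}" by (intro open_Collect_less continuous_intros)
      then have "\<forall>\<^sub>F y in nhds z. norm y > R" using that eventually_nhds_in_open by force
      then have "(\<phi> has_derivative (\<lambda>_. 0)) (at z)"
        by (intro has_derivative_transform_eventually[OF has_derivative_const[of 0]])
          (use Suc.prems(2) that in \<open>auto elim!: eventually_mono simp: eventually_at_filter\<close>)
      then show ?thesis using d has_derivative_unique by metis
    qed
    have *: "cutoff k R (\<lambda>z. complex_of_real (frechet_derivative \<phi> (at z) e))" for e
      using Suc.prems(1) z by (intro Suc.IH) auto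
    obtain C where "C \<ge> 0" "\<forall>z. norm (complex_of_real (\<phi> z)) \<le> C * indicator (cball 0 R) z"
      using bd[OF c Suc.prems(2)] by blast
    then show ?case unfolding cutoff_def
      using *[unfolded cutoff_def] has_derivative_of_real[OF d]
      by (intro Ck_family_SucI[where C=C and f'="\<lambda>e _ z. complex_of_real (frechet_derivative \<phi> (at z) e)"]) auto
  }
qed

section \<open>Vector-valued integrals in algebras of functions\<close>

text \<open>One and the same Riemann sum works for all functions \<open>F\<close> whose modulus of continuity is controlled by
\<open>\<delta>\<close> and whose size is controlled by \<open>m\<close>. Applied to \<open>F = l \<circ> G\<close>, it treats all functionals \<open>l\<close> that
are continuous for one seminorm simultaneously, in particular all point evaluations.\<close>

lemma riemann_sum_approximation:
  fixes \<delta> :: "'v::euclidean_space \<Rightarrow> 'v \<Rightarrow> real"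
  assumes \<delta>: "\<And>z. ((\<lambda>y. \<delta> y z) \<longlongrightarrow> 0) (at z)"
    and m: "integrable lborel m" "\<And>z. 0 \<le> m z" and \<epsilon>: "\<epsilon> > 0"
  shows "\<exists>N c (e :: nat \<Rightarrow> 'v). \<forall>(F :: 'v \<Rightarrow> complex) C. 0 \<le> C \<longrightarrow> (\<forall>y z. norm (F y - F z) \<le> C * \<delta> y z) \<longrightarrow>
    (\<forall>z. norm (F z) \<le> C * m z) \<longrightarrow>
    integrable lborel F \<and> norm ((\<integral>z. F z \<partial>lborel) - (\<Sum>i<N. complex_of_real (c i) * F (e i))) \<le> C * \<epsilon>"
proof -
  have "(\<lambda>n. \<integral>z. m z * indicator (- cball 0 (real n)) z \<partial>lborel) \<longlonglongrightarrow> (\<integral>z. 0 \<partial>(lborel :: 'v measure))"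
  proof (rule integral_dominated_convergence[where w=m])
    show "AE z in lborel. (\<lambda>n. m z * indicator (- cball 0 (real n)) z) \<longlonglongrightarrow> 0"
    proof (rule AE_I2)
      fix z :: 'v
      obtain k where "norm z \<le> real k" using real_arch_simple by blast
      then have "\<forall>\<^sub>F n in sequentially. m z * indicator (- cball 0 (real n)) z = 0"
        by (auto simp: eventually_sequentially intro!: exI[of _ k])
      then show "(\<lambda>n. m z * indicator (- cball 0 (real n)) z) \<longlonglongrightarrow> 0"
        by (rule tendsto_eventually)
    qed
    show "AE z in lborel. norm (m z * indicator (- cball 0 (real n)) z) \<le> m z" for n
      using m(2) by (auto simp: indicator_def)
  qed (use m in auto)
  then have "(\<lambda>n. \<integral>z. m z * indicator (- cball 0 (real n)) z \<partial>lborel) \<longlonglongrightarrow> 0" by simp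
  then have "\<forall>\<^sub>F n in sequentially. (\<integral>z. m z * indicator (- cball 0 (real n)) z \<partial>lborel) < \<epsilon>/2"
    using \<epsilon> by (intro order_tendstoD) auto
  then obtain R :: nat where R: "(\<integral>z. m z * indicator (- cball 0 (real R)) z \<partial>lborel) < \<epsilon>/2"
    by (auto simp: eventually_sequentially)
  define K where "K = cball (0::'v) (real R)"
  \<comment> \<open>The added 1 keeps \<open>V\<close> positive when \<open>K\<close> has measure 0, as it does for \<open>R = 0\<close>.\<close>
  define V where "V = measure lborel K + 1"
  have V: "V > 0" by (simp add: V_def add_nonneg_pos)
  \<comment> \<open>Half of \<open>\<epsilon>\<close> is spent outside \<open>K\<close>, where the step function below vanishes, and half inside.\<close>
  define \<eta> where "\<eta> = \<epsilon> / (2 * V)"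
  have \<eta>: "\<eta> > 0" using \<epsilon> V by (simp add: \<eta>_def)
  have "\<exists>d>0. \<forall>y. y \<noteq> z \<longrightarrow> dist y z < d \<longrightarrow> \<delta> y z < \<eta>" for z
    using order_tendstoD(2)[OF \<delta> \<eta>, of z] unfolding eventually_at by auto
  then obtain d where d: "\<And>z. d z > 0" "\<And>y z. y \<noteq> z \<Longrightarrow> dist y z < d z \<Longrightarrow> \<delta> y z < \<eta>" by metis
  have "compact K" by (simp add: K_def)
  then obtain J where J: "J \<subseteq> K" "finite J" "K \<subseteq> (\<Union>z\<in>J. ball z (d z))"
    by (rule compactE_image[where C=K and f="\<lambda>z. ball z (d z)"]) (use d(1) in auto)
  obtain N and e :: "nat \<Rightarrow> 'v" where e: "J = e ` {i. i < N}"
    using finite_imp_nat_seg_image_inj_on[OF J(2)] by blast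
  define U where "U i = (if i < N then ball (e i) (d (e i)) else {})" for i
  define B where "B i = K \<inter> disjointed U i" for i
  have UK: "K \<subseteq> (\<Union>i. U i)" using J(3) unfolding e U_def by auto
  have BN: "i < N" if "z \<in> B i" for z i
    using that disjointed_subset[of U i] by (auto simp: B_def U_def split: if_splits)
  have BU: "z \<in> ball (e i) (d (e i))" if "z \<in> B i" for z i
    using that disjointed_subset[of U i] by (auto simp: B_def U_def split: if_splits)
  have Bex: "\<exists>i<N. z \<in> B i" if zK: "z \<in> K" for z
  proof -
    have "z \<in> (\<Union>i. disjointed U i)" using UK zK UN_disjointed_eq[of U] by auto
    then obtain i where "z \<in> disjointed U i" by blast
    then have "z \<in> B i" using zK by (simp add: B_def)
    then show ?thesis using BN by blast
  qed
  have Bdisj: "z \<notin> B j" if "z \<in> B i" "i \<noteq> j" for z i j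
    using that disjoint_family_disjointed[of U] unfolding disjoint_family_on_def B_def by blast
  have Bm: "B i \<in> sets borel" for i
  proof -
    have "range (disjointed U) \<subseteq> sets borel"
      by (rule sets.range_disjointed_sets) (auto simp: U_def)
    then show ?thesis unfolding B_def K_def by auto
  qed
  have Bfin: "emeasure lborel (B i) < \<infinity>" for i
  proof -
    have "emeasure lborel (B i) \<le> emeasure lborel K" by (intro emeasure_mono) (auto simp: B_def K_def)
    also have "\<dots> < \<infinity>" unfolding K_def by (rule emeasure_lborel_cball_finite)
    finally show ?thesis .
  qed
  define c where "c i = measure lborel (B i)" for i
  show ?thesis
  proof (rule exI[of _ N], rule exI[of _ c], rule exI[of _ e], intro allI impI)
    fix F :: "'v \<Rightarrow> complex" and C :: real
    assume C: "0 \<le> C" and F: "\<forall>y z. norm (F y - F z) \<le> C * \<delta> y z" and Fm: "\<forall>z. norm (F z) \<le> C * m z"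
    have cont: "continuous_on UNIV F"
      unfolding continuous_on_def
    proof
      fix z
      have "((\<lambda>y. C * \<delta> y z) \<longlongrightarrow> 0) (at z)" using tendsto_mult_right_zero[OF \<delta>] .
      then have "((\<lambda>y. F y - F z) \<longlongrightarrow> 0) (at z)"
        by (rule Lim_null_comparison[rotated]) (use F in auto)
      then show "(F \<longlongrightarrow> F z) (at z within UNIV)" by (simp add: LIM_zero_iff)
    qed
    have iF: "integrable lborel F"
    proof (rule Bochner_Integration.integrable_bound[OF integrable_mult_right[OF m(1), of C]])
      show "F \<in> borel_measurable lborel" using cont by (simp add: borel_measurable_continuous_onI)
      show "AE z in lborel. norm (F z) \<le> norm (C * m z)" using Fm C m(2) by auto
    qed
    define S where "S z = (\<Sum>i<N. indicator (B i) z *\<^sub>R F (e i))" for z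
    have iB: "integrable lborel (\<lambda>z. indicator (B i) z *\<^sub>R F (e i))" for i
      using Bm Bfin by (intro integrable_scaleR_left integrable_real_indicator) auto
    have iS: "integrable lborel S" unfolding S_def by (intro Bochner_Integration.integrable_sum iB)
    have intS: "(\<integral>z. S z \<partial>lborel) = (\<Sum>i<N. complex_of_real (c i) * F (e i))"
    proof -
      have "(\<integral>z. S z \<partial>lborel) = (\<Sum>i<N. \<integral>z. indicator (B i) z *\<^sub>R F (e i) \<partial>lborel)"
        unfolding S_def by (rule Bochner_Integration.integral_sum[OF iB])
      also have "\<dots> = (\<Sum>i<N. complex_of_real (c i) * F (e i))"
        using Bm Bfin by (intro sum.cong refl) (simp add: c_def scaleR_conv_of_real)
      finally show ?thesis .
    qed
    have i1: "integrable lborel (\<lambda>z. (C * \<eta>) * indicator K z)"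
      unfolding K_def using emeasure_lborel_cball_finite by (intro integrable_mult_right integrable_real_indicator) auto
    have i2: "integrable lborel (\<lambda>z. C * (m z * indicator (- K) z))"
    proof -
      have "integrable lborel (\<lambda>z. indicator (- K) z *\<^sub>R m z)"
        by (rule integrable_mult_indicator[OF _ m(1)]) (simp add: K_def)
      then show ?thesis by (intro integrable_mult_right) (simp add: mult.commute)
    qed
    have pt: "norm (F z - S z) \<le> (C * \<eta>) * indicator K z + C * (m z * indicator (- K) z)" for z
    proof (cases "z \<in> K")
      case True
      then obtain i where i: "i < N" "z \<in> B i" using Bex by blast
      have "S z = (\<Sum>j\<in>{i}. indicator (B j) z *\<^sub>R F (e j))"
        unfolding S_def by (rule sum.mono_neutral_right) (use i Bdisj in \<open>auto simp: indicator_def\<close>)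
      then have "S z = F (e i)" using i by simp
      moreover have "norm (F z - F (e i)) \<le> C * \<eta>"
      proof (cases "z = e i")
        case False
        then have "\<delta> z (e i) < \<eta>" using d(2) BU[OF i(2)] by (auto simp: dist_commute)
        then show ?thesis using F C by (meson less_imp_le mult_left_mono order_trans)
      qed (use C \<eta> in simp)
      ultimately show ?thesis using True by simp
    next
      case False
      then have "S z = 0" unfolding S_def by (intro sum.neutral) (auto simp: B_def)
      then show ?thesis using False Fm by simp
    qed
    have "norm ((\<integral>z. F z \<partial>lborel) - (\<Sum>i<N. complex_of_real (c i) * F (e i))) = norm (\<integral>z. F z - S z \<partial>lborel)"
      using iF iS intS by simp
    also have "\<dots> \<le> (\<integral>z. (C * \<eta>) * indicator K z + C * (m z * indicator (- K) z) \<partial>lborel)"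
      using iF iS i1 i2
      by (intro order_trans[OF integral_norm_bound integral_mono[OF integrable_norm]] pt
         Bochner_Integration.integrable_diff Bochner_Integration.integrable_add)
    also have "\<dots> = C * \<eta> * measure lborel K + C * (\<integral>z. m z * indicator (- K) z \<partial>lborel)"
    proof -
      have "(\<integral>z. C * (m z * indicator (- K) z) \<partial>lborel) = C * (\<integral>z. m z * indicator (- K) z \<partial>lborel)"
        by simp
      then show ?thesis using i1 i2 by (subst Bochner_Integration.integral_add) (simp_all add: K_def)
    qed
    also have "\<dots> \<le> C * (\<epsilon>/2) + C * (\<epsilon>/2)"
    proof (rule add_mono)
      have "\<eta> * measure lborel K \<le> \<eta> * V" using \<eta> by (intro mult_left_mono) (auto simp: V_def)
      also have "\<eta> * V = \<epsilon>/2" using V by (simp add: \<eta>_def)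
      finally show "C * \<eta> * measure lborel K \<le> C * (\<epsilon>/2)" using C by (simp add: mult_left_mono mult.assoc)
      show "C * (\<integral>z. m z * indicator (- K) z \<partial>lborel) \<le> C * (\<epsilon>/2)"
        using R C unfolding K_def by (intro mult_left_mono) auto
    qed
    also have "\<dots> = C * \<epsilon>" by simp
    finally show "integrable lborel F \<and> norm ((\<integral>z. F z \<partial>lborel) - (\<Sum>i<N. complex_of_real (c i) * F (e i))) \<le> C * \<epsilon>"
      using iF by simp
  qed
qed

lemma supnorm_le:
  assumes "\<And>x. x \<in> L \<Longrightarrow> norm (f x) \<le> C" "0 \<le> C"
  shows "supnorm L f \<le> C"
  unfolding supnorm_def using assms by (intro cSup_least) auto

lemma norm_le_supnorm:
  assumes "\<exists>C. \<forall>x\<in>L. norm (f x) \<le> C" "x \<in> L"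
  shows "norm (f x) \<le> supnorm L f"
proof -
  obtain C where "\<forall>x\<in>L. norm (f x) \<le> C" using assms(1) by blast
  then have "bdd_above (insert 0 ((\<lambda>x. norm (f x)) ` L))" by auto
  then show ?thesis unfolding supnorm_def using assms(2) by (intro cSup_upper) auto
qed

lemma supnorm_nonneg:
  assumes "\<exists>C. \<forall>x\<in>L. norm (f x) \<le> C"
  shows "0 \<le> supnorm L f"
proof -
  obtain C where "\<forall>x\<in>L. norm (f x) \<le> C" using assms by blast
  then have "bdd_above (insert 0 ((\<lambda>x. norm (f x)) ` L))" by auto
  then show ?thesis unfolding supnorm_def by (intro cSup_upper) auto
qed

lemma sum_fun_apply: "(\<Sum>w\<in>S. J w) x = (\<Sum>w\<in>S. J w x)"
  for J :: "'w \<Rightarrow> 'a \<Rightarrow> 'b::comm_monoid_add"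
  by (induction S rule: infinite_finite_induct) (auto simp: zero_fun_def plus_fun_def)

text \<open>The common shape of the three algebras: the seminorms are the suprema over the members of a directed
family \<open>\<L>\<close> of sets, namely all compact sets for \<open>C0\<close>, and the whole space alone for \<open>C0b\<close> and
\<open>C0inf\<close>. The last assumption is completeness, stated with pointwise bounds since the supremum of an
unbounded function has no meaning.\<close>

locale sup_algebra =
  fixes T :: "'n topology" and \<L> :: "'n set set" and A :: "'n funalg"
  assumes snorms_eq: "snorms A = supnorm ` \<L>"
    and sets_subset: "L \<in> \<L> \<Longrightarrow> L \<subseteq> topspace T"
    and sets_cover: "x \<in> topspace T \<Longrightarrow> \<exists>L\<in>\<L>. x \<in> L"
    and sets_nonempty: "\<L> \<noteq> {}"
    and sets_directed: "L \<in> \<L> \<Longrightarrow> L' \<in> \<L> \<Longrightarrow> \<exists>L''\<in>\<L>. L \<union> L' \<subseteq> L''"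
    and elts_outside: "a \<in> elts A \<Longrightarrow> x \<notin> topspace T \<Longrightarrow> a x = 0"
    and elts_bounded: "a \<in> elts A \<Longrightarrow> L \<in> \<L> \<Longrightarrow> \<exists>C. \<forall>x\<in>L. norm (a x) \<le> C"
    and elts_zero: "(\<lambda>_. 0) \<in> elts A"
    and elts_add: "a \<in> elts A \<Longrightarrow> b \<in> elts A \<Longrightarrow> (\<lambda>x. a x + b x) \<in> elts A"
    and elts_cmult: "a \<in> elts A \<Longrightarrow> (\<lambda>x. c * a x) \<in> elts A"
    and elts_mult: "a \<in> elts A \<Longrightarrow> b \<in> elts A \<Longrightarrow> (\<lambda>x. a x * b x) \<in> elts A"
    and elts_cnj: "a \<in> elts A \<Longrightarrow> (\<lambda>x. cnj (a x)) \<in> elts A"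
    and elts_complete: "\<lbrakk>\<And>x. x \<notin> topspace T \<Longrightarrow> f x = 0;
        \<And>L \<epsilon>. L \<in> \<L> \<Longrightarrow> \<epsilon> > 0 \<Longrightarrow> \<exists>g\<in>elts A. \<forall>x\<in>L. norm (f x - g x) \<le> \<epsilon>\<rbrakk> \<Longrightarrow> f \<in> elts A"
begin

lemma elts_diff: "a \<in> elts A \<Longrightarrow> b \<in> elts A \<Longrightarrow> (\<lambda>x. a x - b x) \<in> elts A"
  using elts_add[OF _ elts_cmult[of b "-1"]] by simp

lemma elts_diff': "a \<in> elts A \<Longrightarrow> b \<in> elts A \<Longrightarrow> a - b \<in> elts A"
  using elts_diff by (simp add: fun_diff_def)

lemma elts_mult': "a \<in> elts A \<Longrightarrow> b \<in> elts A \<Longrightarrow> a * b \<in> elts A"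
  using elts_mult by (simp add: times_fun_def)

lemma elts_sum: "(\<And>i. i \<in> I \<Longrightarrow> f i \<in> elts A) \<Longrightarrow> (\<lambda>x. \<Sum>i\<in>I. f i x) \<in> elts A"
  by (induction I rule: infinite_finite_induct) (auto intro: elts_zero elts_add)

lemma norm_le_snorm: "a \<in> elts A \<Longrightarrow> L \<in> \<L> \<Longrightarrow> x \<in> L \<Longrightarrow> norm (a x) \<le> supnorm L a"
  by (rule norm_le_supnorm[OF elts_bounded])

lemma snorm_nonneg: "a \<in> elts A \<Longrightarrow> L \<in> \<L> \<Longrightarrow> 0 \<le> supnorm L a"
  by (rule supnorm_nonneg[OF elts_bounded])

lemma finite_sets_directed:
  "finite F \<Longrightarrow> F \<subseteq> \<L> \<Longrightarrow> \<exists>L\<in>\<L>. \<forall>L'\<in>F. L' \<subseteq> L"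
proof (induction F rule: finite_induct)
  case empty
  then show ?case using sets_nonempty by blast
next
  case (insert L0 F)
  then obtain L where L: "L \<in> \<L>" "\<forall>L'\<in>F. L' \<subseteq> L" by blast
  obtain L2 where "L2 \<in> \<L>" "L0 \<union> L \<subseteq> L2" using sets_directed[of L0 L] L(1) insert.prems by blast
  then show ?case using L(2) by (intro bexI[of _ L2]) auto
qed

lemma snorm_mono: "a \<in> elts A \<Longrightarrow> L \<in> \<L> \<Longrightarrow> L' \<subseteq> L \<Longrightarrow> supnorm L' a \<le> supnorm L a"
  by (rule supnorm_le) (auto intro: norm_le_snorm snorm_nonneg)

lemma dominated_iff:
  "dominated A q \<longleftrightarrow> (\<exists>L\<in>\<L>. \<exists>C\<ge>0. \<forall>a\<in>elts A. q a \<le> C * supnorm L a)"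
proof
  assume "dominated A q"
  then obtain S C where S: "finite S" "S \<subseteq> snorms A" "\<forall>a\<in>elts A. q a \<le> C * (\<Sum>r\<in>S. r a)"
    unfolding dominated_def by blast
  obtain F where F: "F \<subseteq> \<L>" "finite F" "S = supnorm ` F"
    using S(1,2) finite_subset_image[of S supnorm \<L>] by (auto simp: snorms_eq)
  obtain L where L: "L \<in> \<L>" "\<forall>L'\<in>F. L' \<subseteq> L" using finite_sets_directed[OF F(2,1)] by blast
  have "q a \<le> (\<bar>C\<bar> * card S) * supnorm L a" if a: "a \<in> elts A" for a
  proof -
    have "(\<Sum>r\<in>S. r a) \<le> (\<Sum>r\<in>S. supnorm L a)"
      using F L snorm_mono[OF a L(1)] by (intro sum_mono) auto
    then have 1: "(\<Sum>r\<in>S. r a) \<le> card S * supnorm L a" by simp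
    have 0: "0 \<le> (\<Sum>r\<in>S. r a)" using F snorm_nonneg[OF a] by (intro sum_nonneg) auto
    have "q a \<le> C * (\<Sum>r\<in>S. r a)" using S(3) a by blast
    also have "\<dots> \<le> \<bar>C\<bar> * (\<Sum>r\<in>S. r a)" using 0 by (intro mult_right_mono) auto
    also have "\<dots> \<le> \<bar>C\<bar> * (card S * supnorm L a)" using 1 by (intro mult_left_mono) auto
    finally show ?thesis by simp
  qed
  then show "\<exists>L\<in>\<L>. \<exists>C\<ge>0. \<forall>a\<in>elts A. q a \<le> C * supnorm L a"
    using L(1) by (intro bexI[of _ L] exI[of _ "\<bar>C\<bar> * card S"]) auto
next
  assume "\<exists>L\<in>\<L>. \<exists>C\<ge>0. \<forall>a\<in>elts A. q a \<le> C * supnorm L a"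
  then obtain L C where "L \<in> \<L>" "\<forall>a\<in>elts A. q a \<le> C * supnorm L a" by blast
  then show "dominated A q" unfolding dominated_def
    by (intro exI[of _ "{supnorm L}"] exI[of _ C]) (auto simp: snorms_eq)
qed

lemma uniform_limit_iff_snorm:
  assumes "\<And>y. G y \<in> elts A" "I \<in> elts A" "L \<in> \<L>"
  shows "uniform_limit L G I F \<longleftrightarrow> ((\<lambda>y. supnorm L (\<lambda>x. G y x - I x)) \<longlongrightarrow> 0) F"
proof
  assume u: "uniform_limit L G I F"
  show "((\<lambda>y. supnorm L (\<lambda>x. G y x - I x)) \<longlongrightarrow> 0) F"
  proof (rule tendstoI)
    fix e :: real assume e: "e > 0"
    have "\<forall>\<^sub>F y in F. \<forall>x\<in>L. dist (G y x) (I x) < e/2" by (rule uniform_limitD[OF u]) (use e in simp)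
    then show "\<forall>\<^sub>F y in F. dist (supnorm L (\<lambda>x. G y x - I x)) 0 < e"
    proof eventually_elim
      case (elim y)
      have "supnorm L (\<lambda>x. G y x - I x) \<le> e/2"
        by (rule supnorm_le) (use elim e in \<open>auto simp: dist_norm less_imp_le\<close>)
      then show ?case using e snorm_nonneg[OF elts_diff[OF assms(1,2)] assms(3), of y] by simp
    qed
  qed
next
  assume t: "((\<lambda>y. supnorm L (\<lambda>x. G y x - I x)) \<longlongrightarrow> 0) F"
  show "uniform_limit L G I F"
  proof (rule uniform_limitI)
    fix e :: real assume "e > 0"
    from order_tendstoD(2)[OF t this] show "\<forall>\<^sub>F y in F. \<forall>x\<in>L. dist (G y x) (I x) < e"
      by eventually_elim
        (auto simp: dist_norm intro: le_less_trans[OF norm_le_snorm[OF elts_diff[OF assms(1,2)] assms(3)]])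
  qed
qed

lemma evaluation_in_dual: "x \<in> topspace T \<Longrightarrow> (\<lambda>a. a x) \<in> continuous_dual A"
proof -
  assume "x \<in> topspace T"
  then obtain L where "L \<in> \<L>" "x \<in> L" using sets_cover by blast
  then have "dominated A (\<lambda>a. norm (a x))"
    unfolding dominated_iff using norm_le_snorm by (intro bexI[of _ L] exI[of _ 1]) auto
  then show ?thesis unfolding continuous_dual_def by (auto simp: plus_fun_def)
qed

text \<open>Point evaluations are continuous functionals; therefore weak integrals are pointwise integrals, and
they are unique.\<close>

lemma has_vint_pointwise:
  assumes "has_vint A F I" "x \<in> topspace T"
  shows "has_bochner_integral lborel (\<lambda>z. F z x) (I x)"
proof -
  have "\<forall>l\<in>continuous_dual A. has_bochner_integral lborel (\<lambda>z. l (F z)) (l I)"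
    using assms(1) unfolding has_vint_def by blast
  from bspec[OF this evaluation_in_dual[OF assms(2)]] show ?thesis .
qed

lemma has_vint_unique:
  assumes "has_vint A F I" "has_vint A F I'"
  shows "I = I'"
proof
  fix x
  show "I x = I' x"
  proof (cases "x \<in> topspace T")
    case True
    then show ?thesis
      using has_bochner_integral_eq[OF has_vint_pointwise[OF assms(1)] has_vint_pointwise[OF assms(2)]] by blast
  next
    case False
    then show ?thesis using assms elts_outside unfolding has_vint_def by metis
  qed
qed

lemma vint_eq: "has_vint A F I \<Longrightarrow> vint A F = I"
  unfolding vint_def using has_vint_unique by blast

lemma has_vsum_pointwise:
  assumes "has_vsum A J W I"
  shows "((\<lambda>w. J w x) has_sum I x) W"
proof (cases "x \<in> topspace T")
  case True
  then obtain L where L: "L \<in> \<L>" "x \<in> L" using sets_cover by blast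
  have I: "I \<in> elts A" "\<And>w. w \<in> W \<Longrightarrow> J w \<in> elts A" using assms unfolding has_vsum_def by auto
  have "((\<lambda>S. supnorm L ((\<Sum>w\<in>S. J w) - I)) \<longlongrightarrow> 0) (finite_subsets_at_top W)"
    using assms L unfolding has_vsum_def snorms_eq by blast
  then have "((\<lambda>S. (\<Sum>w\<in>S. J w x) - I x) \<longlongrightarrow> 0) (finite_subsets_at_top W)"
  proof (rule Lim_null_comparison[rotated])
    have "norm ((\<Sum>w\<in>S. J w x) - I x) \<le> supnorm L ((\<Sum>w\<in>S. J w) - I)" if "S \<subseteq> W" for S
    proof -
      have "(\<Sum>w\<in>S. J w) - I = (\<lambda>x. (\<Sum>w\<in>S. J w x) - I x)" by (simp add: fun_diff_def sum_fun_apply)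
      moreover have "(\<lambda>x. (\<Sum>w\<in>S. J w x) - I x) \<in> elts A"
        using I that by (intro elts_diff elts_sum) auto
      ultimately show ?thesis using norm_le_snorm[OF _ L, of "\<lambda>x. (\<Sum>w\<in>S. J w x) - I x"] by simp
    qed
    then show "\<forall>\<^sub>F S in finite_subsets_at_top W. norm ((\<Sum>w\<in>S. J w x) - I x) \<le> supnorm L ((\<Sum>w\<in>S. J w) - I)"
      using eventually_finite_subsets_at_top_weakI by (metis (mono_tags, lifting))
  qed
  then show ?thesis unfolding has_sum_def by (simp add: LIM_zero_iff)
next
  case False
  have "J w x = 0" if "w \<in> W" for w using assms that False elts_outside unfolding has_vsum_def by blast
  moreover have "I x = 0" using assms False elts_outside unfolding has_vsum_def by blast
  ultimately show ?thesis using has_sum_0 by metis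
qed

lemma has_osc_integral_unique:
  assumes "has_osc_integral A W \<phi> F I" "has_osc_integral A W \<phi> F I'"
  shows "I = I'"
proof -
  obtain J J' where J: "\<forall>w\<in>W. has_vint A (osc_term \<phi> F w) (J w)" "has_vsum A J W I"
    and J': "\<forall>w\<in>W. has_vint A (osc_term \<phi> F w) (J' w)" "has_vsum A J' W I'"
    using assms unfolding has_osc_integral_def by blast
  have eq: "J w = J' w" if "w \<in> W" for w using J(1) J'(1) that has_vint_unique by blast
  have "I x = I' x" for x
  proof -
    have "((\<lambda>w. J w x) has_sum I' x) W"
      using has_vsum_pointwise[OF J'(2), of x] eq by (simp cong: has_sum_cong)
    then show ?thesis using has_vsum_pointwise[OF J(2), of x] has_sum_unique by blast
  qed
  then show ?thesis by blast
qed

lemma osc_integral_eq: "has_osc_integral A W \<phi> F I \<Longrightarrow> osc_integral A W \<phi> F = I"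
  unfolding osc_integral_def using has_osc_integral_unique by blast

text \<open>The pointwise integral belongs to \<open>A\<close>, being a limit of Riemann sums uniformly on each \<open>L\<close>. The same
Riemann sums approximate the integral of \<open>l \<circ> G\<close> for a functional \<open>l\<close> bounded by the supremum over
\<open>L\<close>, so that \<open>l\<close> commutes with the integral.\<close>

lemma has_vint_lebesgue:
  fixes G :: "'v::euclidean_space \<Rightarrow> 'n \<Rightarrow> complex"
  assumes G: "\<And>z. G z \<in> elts A" and cont: "\<And>L z. L \<in> \<L> \<Longrightarrow> uniform_limit L G (G z) (at z)"
    and maj: "\<And>L. L \<in> \<L> \<Longrightarrow> \<exists>m. integrable lborel m \<and> (\<forall>z. \<forall>x\<in>L. norm (G z x) \<le> m z)"
  shows "has_vint A G (\<lambda>x. \<integral>z. G z x \<partial>lborel)"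
proof -
  define I where "I x = (\<integral>z. G z x \<partial>lborel)" for x
  have approx: "\<exists>N c (e :: nat \<Rightarrow> 'v). \<forall>(F :: 'v \<Rightarrow> complex) C. 0 \<le> C \<longrightarrow>
      (\<forall>y z. norm (F y - F z) \<le> C * supnorm L (\<lambda>x. G y x - G z x)) \<longrightarrow>
      (\<forall>z. norm (F z) \<le> C * supnorm L (G z)) \<longrightarrow>
      integrable lborel F \<and> norm ((\<integral>z. F z \<partial>lborel) - (\<Sum>i<N. complex_of_real (c i) * F (e i))) \<le> C * \<epsilon>"
    if L: "L \<in> \<L>" and \<epsilon>: "\<epsilon> > 0" for L \<epsilon>
  proof -
    obtain m where m: "integrable lborel m" "\<forall>z. \<forall>x\<in>L. norm (G z x) \<le> m z" using maj[OF L] by blast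
    have 1: "((\<lambda>y. supnorm L (\<lambda>x. G y x - G z x)) \<longlongrightarrow> 0) (at z)" for z
      using cont[OF L, of z] uniform_limit_iff_snorm[of G "G z" L "at z", OF G G L] by blast
    have 2: "supnorm L (G z) \<le> \<bar>m z\<bar>" for z
      by (rule supnorm_le) (use m(2) in \<open>auto intro: order_trans[OF _ abs_ge_self]\<close>)
    obtain N c and e :: "nat \<Rightarrow> 'v" where *: "\<And>(F :: 'v \<Rightarrow> complex) C. 0 \<le> C \<Longrightarrow>
      (\<forall>y z. norm (F y - F z) \<le> C * supnorm L (\<lambda>x. G y x - G z x)) \<Longrightarrow>
      (\<forall>z. norm (F z) \<le> C * \<bar>m z\<bar>) \<Longrightarrow>
      integrable lborel F \<and> norm ((\<integral>z. F z \<partial>lborel) - (\<Sum>i<N. complex_of_real (c i) * F (e i))) \<le> C * \<epsilon>"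
      using riemann_sum_approximation[OF 1 integrable_abs[OF m(1)] abs_ge_zero \<epsilon>] by blast
    show ?thesis
    proof (rule exI[of _ N], rule exI[of _ c], rule exI[of _ e], intro allI impI)
      fix F :: "'v \<Rightarrow> complex" and C :: real
      assume C: "0 \<le> C" "\<forall>y z. norm (F y - F z) \<le> C * supnorm L (\<lambda>x. G y x - G z x)"
        "\<forall>z. norm (F z) \<le> C * supnorm L (G z)"
      have "\<forall>z. norm (F z) \<le> C * \<bar>m z\<bar>" using C(3) mult_left_mono[OF 2 C(1)] order_trans by blast
      then show "integrable lborel F \<and> norm ((\<integral>z. F z \<partial>lborel) - (\<Sum>i<N. complex_of_real (c i) * F (e i))) \<le> C * \<epsilon>"
        using *[OF C(1,2)] by blast
    qed
  qed
  have rs: "(\<lambda>x. \<Sum>i<N. complex_of_real (c i) * G (e i) x) \<in> elts A" for N :: nat and c and e :: "nat \<Rightarrow> 'v"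
    by (intro elts_sum elts_cmult G)
  have pt: "norm (I x - (\<Sum>i<N. complex_of_real (c i) * G (e i) x)) \<le> \<epsilon>"
    if *: "\<forall>(F :: 'v \<Rightarrow> complex) C. 0 \<le> C \<longrightarrow>
      (\<forall>y z. norm (F y - F z) \<le> C * supnorm L (\<lambda>x. G y x - G z x)) \<longrightarrow>
      (\<forall>z. norm (F z) \<le> C * supnorm L (G z)) \<longrightarrow>
      integrable lborel F \<and> norm ((\<integral>z. F z \<partial>lborel) - (\<Sum>i<N. complex_of_real (c i) * F (e i))) \<le> C * \<epsilon>"
      and L: "L \<in> \<L>" "x \<in> L" for L N c x \<epsilon> and e :: "nat \<Rightarrow> 'v"
    using *[rule_format, of 1 "\<lambda>z. G z x"] norm_le_snorm[OF elts_diff[OF G G] L] norm_le_snorm[OF G L]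
    unfolding I_def by simp
  have I: "I \<in> elts A"
  proof (rule elts_complete)
    show "I x = 0" if "x \<notin> topspace T" for x using elts_outside[OF G that] by (simp add: I_def)
    fix L \<epsilon> assume L: "L \<in> \<L>" and e: "(\<epsilon>::real) > 0"
    from approx[OF this] pt[OF _ L] rs
    show "\<exists>g\<in>elts A. \<forall>x\<in>L. norm (I x - g x) \<le> \<epsilon>" by meson
  qed
  have "has_bochner_integral lborel (\<lambda>z. l (G z)) (l I)" if l: "l \<in> continuous_dual A" for l
  proof -
    have lin: "\<And>a b. a \<in> elts A \<Longrightarrow> b \<in> elts A \<Longrightarrow> l (\<lambda>x. a x + b x) = l a + l b"
      "\<And>a c. a \<in> elts A \<Longrightarrow> l (\<lambda>x. c * a x) = c * l a" and dom: "dominated A (\<lambda>a. norm (l a))"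
      using l unfolding continuous_dual_def plus_fun_def by auto
    have lin_diff: "l (\<lambda>x. a x - b x) = l a - l b" if "a \<in> elts A" "b \<in> elts A" for a b
      using lin(1)[OF that(1) elts_cmult[OF that(2), of "-1"]] lin(2)[OF that(2), of "-1"] by simp
    have l0: "l (\<lambda>_. 0) = 0" using lin(2)[OF elts_zero, of 0] by simp
    have lin_sum: "l (\<lambda>x. \<Sum>i<N. complex_of_real (c i) * G (e i) x) = (\<Sum>i<N. complex_of_real (c i) * l (G (e i)))"
      for N :: nat and c and e :: "nat \<Rightarrow> 'v"
      by (induction N) (simp_all add: l0 lin elts_cmult G rs)
    obtain L C where L: "L \<in> \<L>" and C: "C \<ge> 0" "\<And>a. a \<in> elts A \<Longrightarrow> norm (l a) \<le> C * supnorm L a"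
      using dom unfolding dominated_iff by blast
    have b1: "\<forall>y z. norm (l (G y) - l (G z)) \<le> C * supnorm L (\<lambda>x. G y x - G z x)"
      using C(2)[OF elts_diff[OF G G]] by (simp add: lin_diff G)
    have b2: "\<forall>z. norm (l (G z)) \<le> C * supnorm L (G z)" using C(2) G by blast
    have int: "integrable lborel (\<lambda>z. l (G z))"
    proof -
      obtain N c and ev :: "nat \<Rightarrow> 'v" where *: "\<forall>(F :: 'v \<Rightarrow> complex) C. 0 \<le> C \<longrightarrow>
        (\<forall>y z. norm (F y - F z) \<le> C * supnorm L (\<lambda>x. G y x - G z x)) \<longrightarrow>
        (\<forall>z. norm (F z) \<le> C * supnorm L (G z)) \<longrightarrow>
        integrable lborel F \<and> norm ((\<integral>z. F z \<partial>lborel) - (\<Sum>i<N. complex_of_real (c i) * F (ev i))) \<le> C * 1"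
        using approx[OF L zero_less_one] by blast
      show ?thesis using *[rule_format, of C "\<lambda>z. l (G z)"] C(1) b1 b2 by blast
    qed
    have *: "norm ((\<integral>z. l (G z) \<partial>lborel) - l I) \<le> 0 + e" if e: "e > 0" for e
    proof -
      define \<epsilon> where "\<epsilon> = e / (2 * (C + 1))"
      have \<epsilon>: "\<epsilon> > 0" using e C(1) by (simp add: \<epsilon>_def)
      obtain N c and ev :: "nat \<Rightarrow> 'v" where rs_approx: "\<forall>(F :: 'v \<Rightarrow> complex) C. 0 \<le> C \<longrightarrow>
        (\<forall>y z. norm (F y - F z) \<le> C * supnorm L (\<lambda>x. G y x - G z x)) \<longrightarrow>
        (\<forall>z. norm (F z) \<le> C * supnorm L (G z)) \<longrightarrow>
        integrable lborel F \<and> norm ((\<integral>z. F z \<partial>lborel) - (\<Sum>i<N. complex_of_real (c i) * F (ev i))) \<le> C * \<epsilon>"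
        using approx[OF L \<epsilon>] by blast
      let ?S = "\<lambda>x. \<Sum>i<N. complex_of_real (c i) * G (ev i) x"
      have 1: "norm ((\<integral>z. l (G z) \<partial>lborel) - l ?S) \<le> C * \<epsilon>"
        using rs_approx[rule_format, of C "\<lambda>z. l (G z)"] C(1) b1 b2 by (simp add: lin_sum)
      have "supnorm L (\<lambda>x. I x - ?S x) \<le> \<epsilon>"
        by (rule supnorm_le) (use pt[OF rs_approx L] \<epsilon> in auto)
      then have "C * supnorm L (\<lambda>x. I x - ?S x) \<le> C * \<epsilon>" using C(1) by (intro mult_left_mono)
      then have 2: "norm (l I - l ?S) \<le> C * \<epsilon>"
        using C(2)[OF elts_diff[OF I rs], of c ev N] unfolding lin_diff[OF I rs] by linarith
      have "norm ((\<integral>z. l (G z) \<partial>lborel) - l I) \<le> C * \<epsilon> + C * \<epsilon>"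
        using norm_triangle_mono[OF 1 2[unfolded norm_minus_commute[of "l I"]]] by simp
      also have "\<dots> \<le> 2 * (C + 1) * \<epsilon>" using \<epsilon> by (simp add: algebra_simps)
      also have "\<dots> = e" using C(1) by (simp add: \<epsilon>_def)
      finally show ?thesis by simp
    qed
    have "norm ((\<integral>z. l (G z) \<partial>lborel) - l I) \<le> 0" by (rule field_le_epsilon[OF *])
    then have "(\<integral>z. l (G z) \<partial>lborel) = l I" by simp
    with int show ?thesis unfolding has_bochner_integral_iff by blast
  qed
  then have "has_vint A G I" unfolding has_vint_def using G I by blast
  moreover have "I = (\<lambda>x. \<integral>z. G z x \<partial>lborel)" by (rule ext) (rule I_def)
  ultimately show ?thesis by simp
qed

end

section \<open>Oscillatory integrals of smooth functions\<close>

lemma uniform_limit_scalar: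
  fixes g :: "'v::euclidean_space \<Rightarrow> complex"
  assumes "continuous_on UNIV g"
  shows "uniform_limit L (\<lambda>y _. g y) (\<lambda>_. g z) (at z)"
proof (rule uniform_limitI)
  fix e :: real assume "e > 0"
  moreover have "(g \<longlongrightarrow> g z) (at z)" using assms by (simp add: continuous_on_def)
  ultimately show "\<forall>\<^sub>F n in at z. \<forall>x\<in>L. dist (g n) (g z) < e"
    using tendstoD[of g "g z" "at z" e] by (auto elim!: eventually_mono)
qed

lemma Ck_family_Lipschitz:
  assumes "Ck_family (Suc 0) I (\<lambda>_ _. 1) f"
  shows "\<exists>C\<ge>0. \<forall>i\<in>I. \<forall>x y. norm (f i x - f i y) \<le> C * norm (x - y)"
proof -
  obtain f' where "\<forall>i\<in>I. \<forall>z. (f i has_derivative (\<lambda>e. f' e i z)) (at z)" "\<forall>e. Ck_family 0 I (\<lambda>_ _. 1) (f' e)"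
    using Ck_family_Suc_derivative[OF assms] by blast
  note f' = this[rule_format]
  have "\<forall>b. \<exists>C\<ge>0. \<forall>i\<in>I. \<forall>z. norm (f' b i z) \<le> C * 1" using Ck_family_bound[OF f'(2)] by blast
  from choice[OF this] obtain C where C: "\<And>b. 0 \<le> C b" "\<And>b i z. i \<in> I \<Longrightarrow> norm (f' b i z) \<le> C b" by auto
  define K where "K = sum C Basis"
  have K: "K \<ge> 0" unfolding K_def using C(1) by (simp add: sum_nonneg)
  have "norm (f i x - f i y) \<le> K * norm (x - y)" if i: "i \<in> I" for i x y
  proof (rule differentiable_bound[where S=UNIV and f'="\<lambda>z e. f' e i z"])
    fix z
    show "(f i has_derivative (\<lambda>e. f' e i z)) (at z within UNIV)" using f'(1)[OF i] by simp
    show "onorm (\<lambda>e. f' e i z) \<le> K"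
    proof (rule onorm_bound[OF K])
      fix e
      have lin: "linear (\<lambda>e. f' e i z)" using has_derivative_linear[OF f'(1)[OF i]] .
      have "f' e i z = f' (\<Sum>b\<in>Basis. (e \<bullet> b) *\<^sub>R b) i z" by (simp add: euclidean_representation)
      also have "\<dots> = (\<Sum>b\<in>Basis. (e \<bullet> b) *\<^sub>R f' b i z)"
        by (simp add: linear_sum[OF lin] linear_scale[OF lin])
      also have "norm \<dots> \<le> (\<Sum>b\<in>Basis. norm e * C b)"
      proof (rule sum_norm_le)
        fix b :: 'b assume "b \<in> Basis"
        then have "\<bar>e \<bullet> b\<bar> * norm (f' b i z) \<le> norm e * C b"
          using Basis_le_norm C(2)[OF i] by (intro mult_mono) auto
        then show "norm ((e \<bullet> b) *\<^sub>R f' b i z) \<le> norm e * C b" by simp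
      qed
      also have "\<dots> = K * norm e" by (simp add: K_def sum_distrib_left mult.commute)
      finally show "norm (f' e i z) \<le> K * norm e" .
    qed
  qed auto
  then show ?thesis using K by blast
qed

lemma osc_term_eq: "osc_term \<phi> F w z n = F z n * complex_of_real (\<phi> (z - w)) * phase z"
  unfolding osc_term_def phase_def by (cases z) simp

lemma lattice_partition_cutoff:
  fixes \<phi> :: "'z::euclidean_space \<Rightarrow> real"
  assumes "lattice_partition W \<phi>"
  shows "\<exists>R\<ge>0. (\<forall>k. cutoff k R (\<lambda>z. complex_of_real (\<phi> z))) \<and> (\<forall>z. norm z > R \<longrightarrow> \<phi> z = 0)"
    and "lattice_weight summable_on W"
proof -
  have "bounded (closure {z. \<phi> z \<noteq> 0})" using assms unfolding lattice_partition_def by (simp add: compact_imp_bounded)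
  then obtain R where R: "\<forall>z\<in>closure {z. \<phi> z \<noteq> 0}. norm z \<le> R" unfolding bounded_iff by blast
  have 0: "\<phi> z = 0" if "norm z > max R 0" for z
  proof (rule ccontr)
    assume "\<phi> z \<noteq> 0"
    then have "norm z \<le> R" using R closure_subset[of "{z. \<phi> z \<noteq> 0}"] by blast
    then show False using that by simp
  qed
  have Ck: "Ck_on k UNIV \<phi>" for k using assms unfolding lattice_partition_def smooth_on_def by blast
  show "\<exists>R\<ge>0. (\<forall>k. cutoff k R (\<lambda>z. complex_of_real (\<phi> z))) \<and> (\<forall>z. norm z > R \<longrightarrow> \<phi> z = 0)"
    using cutoff_of_smooth[OF Ck 0, of "max R 0"] 0 by (intro exI[of _ "max R 0"]) simp
  have "continuous_on UNIV \<phi>" using Ck[of 0] by simp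
  then show "lattice_weight summable_on W"
    by (rule summable_lattice_weight[where R="max R 0"])
      (use assms 0 in \<open>auto simp: lattice_partition_def\<close>)
qed

text \<open>The tail estimate, in terms of the dominating series only, yields convergence uniformly in all
parameters on which the dominating series does not depend.\<close>

lemma dominated_infsum:
  fixes J :: "'w \<Rightarrow> complex"
  assumes "\<And>w. w \<in> W \<Longrightarrow> norm (J w) \<le> \<kappa> w" "\<kappa> summable_on W"
  shows "(J has_sum infsum J W) W" "norm (infsum J W) \<le> infsum \<kappa> W"
    and "finite S \<Longrightarrow> S \<subseteq> W \<Longrightarrow> norm (infsum J W - sum J S) \<le> infsum \<kappa> W - sum \<kappa> S"
proof -
  have a: "(\<lambda>w. norm (J w)) summable_on W"
    using assms(2) by (rule summable_on_comparison_test) (use assms(1) in auto)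
  then have s: "J summable_on W" by (rule abs_summable_summable)
  then show "(J has_sum infsum J W) W" by simp
  show bd: "norm (infsum J W) \<le> infsum \<kappa> W"
    using norm_infsum_bound[OF a] infsum_mono[OF a assms(2,1)] by simp
  assume S: "finite S" "S \<subseteq> W"
  have "infsum J W - sum J S = infsum J (W - S)" using infsum_Diff[OF s _ S(2)] S(1) by simp
  moreover have "infsum \<kappa> W - sum \<kappa> S = infsum \<kappa> (W - S)" using infsum_Diff[OF assms(2) _ S(2)] S(1) by simp
  moreover have "norm (infsum J (W - S)) \<le> infsum \<kappa> (W - S)"
  proof -
    have a': "(\<lambda>w. norm (J w)) summable_on (W - S)" by (rule summable_on_subset_banach[OF a]) auto
    have "\<kappa> summable_on (W - S)" by (rule summable_on_subset_banach[OF assms(2)]) auto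
    then show ?thesis using norm_infsum_bound[OF a'] infsum_mono[OF a', of \<kappa>] assms(1) by force
  qed
  ultimately show "norm (infsum J W - sum J S) \<le> infsum \<kappa> W - sum \<kappa> S" by simp
qed

context sup_algebra
begin

text \<open>All derivatives of the \<open>A\<close>-valued function \<open>F\<close> are bounded by multiples of the scalar weight \<open>\<omega>\<close> in
every seminorm: \<open>\<omega> = 1\<close> for orbit maps, and a decaying \<open>\<omega>\<close> for Schwartz functions.\<close>

definition smooth_bound :: "('v::euclidean_space \<Rightarrow> real) \<Rightarrow> ('v \<Rightarrow> 'n \<Rightarrow> complex) \<Rightarrow> bool" where
  "smooth_bound \<omega> F \<longleftrightarrow> (\<forall>v. F v \<in> elts A) \<and> (\<forall>L\<in>\<L>. \<forall>k. Ck_family k L (\<lambda>_. \<omega>) (\<lambda>n v. F v n))"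

lemma derivatives_into_smooth_bound:
  fixes F :: "'v::euclidean_space \<Rightarrow> 'n \<Rightarrow> complex"
  assumes D: "derivatives_into A F D"
    and bd: "\<And>L es. L \<in> \<L> \<Longrightarrow> set es \<subseteq> Basis \<Longrightarrow> \<exists>C\<ge>0. \<forall>n\<in>L. \<forall>v. norm (D es v n) \<le> C * \<omega> v"
    and \<omega>: "\<And>v. 0 \<le> \<omega> v"
  shows "smooth_bound \<omega> F"
proof -
  have F: "F = D []" using D unfolding derivatives_into_def by simp
  have mem: "D es x \<in> elts A" if "set es \<subseteq> Basis" for es x using D that unfolding derivatives_into_def by blast
  have lim: "((\<lambda>y. D es y n) \<longlongrightarrow> D es x n) (at x)" if es: "set es \<subseteq> Basis" and L: "L \<in> \<L>" "n \<in> L" for es x n L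
  proof -
    have "((\<lambda>y. supnorm L (D es y - D es x)) \<longlongrightarrow> 0) (at x)"
      using D es L unfolding derivatives_into_def snorms_eq by blast
    then have "((\<lambda>y. D es y n - D es x n) \<longlongrightarrow> 0) (at x)"
      by (rule Lim_null_comparison[rotated])
        (use norm_le_snorm[OF elts_diff'[OF mem[OF es] mem[OF es]] L] in \<open>auto simp: fun_diff_def\<close>)
    then show ?thesis by (simp add: LIM_zero_iff)
  qed
  have der: "((\<lambda>t. D es (x + t *\<^sub>R b) n) has_vector_derivative D (b # es) x n) (at 0)"
    if es: "set es \<subseteq> Basis" and b: "b \<in> Basis" and L: "L \<in> \<L>" "n \<in> L" for es x b n L
  proof -
    let ?q = "\<lambda>t n. (D es (x + t *\<^sub>R b) n - D es x n) / complex_of_real t - D (b # es) x n"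
    have q: "?q t \<in> elts A" for t
    proof -
      have "(\<lambda>n. inverse (complex_of_real t) * (D es (x + t *\<^sub>R b) n - D es x n) - D (b # es) x n) \<in> elts A"
        using es b by (intro elts_diff elts_cmult mem) auto
      then show ?thesis by (simp add: field_simps)
    qed
    have "((\<lambda>t. supnorm L (?q t)) \<longlongrightarrow> 0) (at 0)"
      using D es b L unfolding derivatives_into_def snorms_eq by blast
    then have "((\<lambda>t. ?q t n) \<longlongrightarrow> 0) (at 0)"
      by (rule Lim_null_comparison[rotated]) (use norm_le_snorm[OF q L] in auto)
    then have "((\<lambda>t. (D es (x + t *\<^sub>R b) n - D es x n) / complex_of_real t) \<longlongrightarrow> D (b # es) x n) (at 0)"
      by (simp add: LIM_zero_iff)
    then show ?thesis unfolding has_vector_derivative_iff_quotient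
      by (simp add: scaleR_conv_of_real field_simps)
  qed
  have "Ck_family k L (\<lambda>_. \<omega>) (\<lambda>n v. D [] v n)" if L: "L \<in> \<L>" for L k
  proof (rule Ck_family_of_partials[where d="\<lambda>es n v. D es v n"])
    show "continuous_on UNIV (\<lambda>v. D es v i)" if "set es \<subseteq> Basis" "i \<in> L" for es i
      using lim[OF that(1) L that(2)] by (auto simp: continuous_on_def)
    show "((\<lambda>t. D es (z + t *\<^sub>R b) i) has_vector_derivative D (b # es) z i) (at 0)"
      if "set es \<subseteq> Basis" "i \<in> L" "b \<in> Basis" for es i b z
      using der[OF that(1) that(3) L that(2)] .
    show "\<exists>C\<ge>0. \<forall>i\<in>L. \<forall>z. norm (D es z i) \<le> C * \<omega> z" if "set es \<subseteq> Basis" for es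
      using bd[OF L that] .
  qed (use \<omega> in auto)
  then show ?thesis unfolding smooth_bound_def F using mem by auto
qed

lemma smooth_bound_elts: "smooth_bound \<omega> F \<Longrightarrow> F v \<in> elts A"
  unfolding smooth_bound_def by blast

lemma smooth_bound_bound:
  assumes "smooth_bound \<omega> F" "L \<in> \<L>"
  shows "\<exists>C\<ge>0. \<forall>n\<in>L. \<forall>v. norm (F v n) \<le> C * \<omega> v"
  using Ck_family_bound assms unfolding smooth_bound_def by blast

lemma smooth_bound_mono:
  fixes F :: "'v::euclidean_space \<Rightarrow> 'n \<Rightarrow> complex"
  assumes "smooth_bound \<omega> F" "\<And>v. \<omega> v \<le> \<omega>' v"
  shows "smooth_bound \<omega>' F"
proof -
  have "Ck_family k L (\<lambda>_. \<omega>') f" if "Ck_family k L (\<lambda>_. \<omega>) f" for k L and f :: "'n \<Rightarrow> 'v \<Rightarrow> complex"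
    by (rule Ck_family_weight_mono[OF that, of 1]) (use assms(2) in simp_all)
  then show ?thesis using assms(1) unfolding smooth_bound_def by blast
qed

lemma smooth_bound_Lipschitz:
  assumes "smooth_bound (\<lambda>_. 1) F" "L \<in> \<L>"
  shows "\<exists>C\<ge>0. \<forall>n\<in>L. \<forall>x y. norm (F x n - F y n) \<le> C * norm (x - y)"
  using Ck_family_Lipschitz assms unfolding smooth_bound_def by blast

lemma uniform_limit_of_Lipschitz:
  fixes F :: "'v::euclidean_space \<Rightarrow> 'n \<Rightarrow> complex"
  assumes "\<forall>n\<in>L. \<forall>x y. norm (F x n - F y n) \<le> C * norm (x - y)"
  shows "uniform_limit L F (F z) (at z)"
proof (rule uniform_limitI)
  fix e :: real assume e: "e > 0"
  have "((\<lambda>y. C * norm (y - z)) \<longlongrightarrow> C * norm (z - z)) (at z)" by (intro tendsto_intros)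
  then have "\<forall>\<^sub>F y in at z. C * norm (y - z) < e" using e by (intro order_tendstoD) auto
  then show "\<forall>\<^sub>F y in at z. \<forall>x\<in>L. dist (F y x) (F z x) < e"
  proof eventually_elim
    case (elim y)
    then show ?case using assms le_less_trans unfolding dist_norm by blast
  qed
qed

text \<open>Each term is the weak integral of a continuous function with compact support. On every \<open>L\<close> the
term with index \<open>w\<close> is bounded by a multiple of \<open>lattice_weight w\<close>, so the series converges
unconditionally in \<open>A\<close>.\<close>

lemma has_osc_integral_exists:
  fixes F :: "(real^'d) \<times> (real^'d) \<Rightarrow> 'n \<Rightarrow> complex"
  assumes W: "lattice_partition W \<phi>"
    and F: "\<And>z. F z \<in> elts A" and cont: "\<And>L z. L \<in> \<L> \<Longrightarrow> uniform_limit L F (F z) (at z)"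
    and Ck: "\<And>L k. L \<in> \<L> \<Longrightarrow> Ck_family k L (\<lambda>_ _. 1) (\<lambda>n z. F z n)"
  shows "has_osc_integral A W \<phi> F (\<lambda>n. \<Sum>\<^sub>\<infinity>w\<in>W. \<integral>z. osc_term \<phi> F w z n \<partial>lborel)"
proof -
  define J where "J w n = (\<integral>z. osc_term \<phi> F w z n \<partial>lborel)" for w n
  define I where "I n = (\<Sum>\<^sub>\<infinity>w\<in>W. J w n)" for n
  obtain R where R: "R \<ge> 0" "\<And>k. cutoff k R (\<lambda>z. complex_of_real (\<phi> z))" "\<And>z. norm z > R \<Longrightarrow> \<phi> z = 0"
    using lattice_partition_cutoff(1)[OF W] by blast
  note sumW = lattice_partition_cutoff(2)[OF W]
  have c\<phi>: "continuous_on UNIV (\<lambda>z. complex_of_real (\<phi> z))" by (rule cutoff_continuous[OF R(2)])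
  define g where "g w z = complex_of_real (\<phi> (z - w)) * phase z" for w z
  have ot: "osc_term \<phi> F w z = (\<lambda>n. F z n * g w z)" for w z
    by (rule ext) (simp add: osc_term_eq g_def)
  have g: "continuous_on UNIV (g w)" for w
    unfolding g_def by (intro continuous_intros continuous_phase continuous_on_compose2[OF c\<phi>]) auto
  have vint: "has_vint A (osc_term \<phi> F w) (J w)" for w
    unfolding J_def
  proof (rule has_vint_lebesgue)
    show mem: "osc_term \<phi> F w z \<in> elts A" for z
      unfolding ot using elts_cmult[OF F, of "g w z" z] by (simp add: mult.commute)
    fix L assume L: "L \<in> \<L>"
    show "uniform_limit L (osc_term \<phi> F w) (osc_term \<phi> F w z) (at z)" for z
      unfolding ot[abs_def]
    proof (rule uniform_lim_mult[OF cont[OF L] uniform_limit_scalar[OF g]])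
      show "bounded (F z ` L)" using elts_bounded[OF F L] by (auto simp: bounded_iff)
      show "bounded ((\<lambda>_. g w z) ` L)" by (rule bounded_subset[of "{g w z}"]) auto
    qed
    obtain C where C: "C \<ge> 0" "\<forall>n\<in>L. \<forall>z. norm (F z n) \<le> C * 1"
      using Ck_family_bound[OF Ck[OF L, of 0]] by blast
    have "bounded (g w ` cball w R)"
      by (intro compact_imp_bounded compact_continuous_image continuous_on_subset[OF g]) auto
    then obtain B where B: "\<forall>z\<in>cball w R. norm (g w z) \<le> B" by (auto simp: bounded_iff)
    have "norm (osc_term \<phi> F w z n) \<le> (C * B) * indicator (cball w R) z" if "n \<in> L" for z n
    proof (cases "z \<in> cball w R")
      case True
      then have "norm (F z n) * norm (g w z) \<le> C * B"
        using C(2)[rule_format, OF that, of z] C(1) B[rule_format, OF True] by (intro mult_mono) simp_all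
      then show ?thesis using True by (simp add: ot norm_mult)
    next
      case False
      then have "g w z = 0" using R(3)[of "z - w"] by (simp add: g_def dist_norm norm_minus_commute)
      then show ?thesis using False by (simp add: ot)
    qed
    moreover have "integrable lborel (\<lambda>z. (C * B) * indicator (cball w R) z)"
      using emeasure_lborel_cball_finite[of w R] by (intro integrable_mult_right integrable_real_indicator) auto
    ultimately show "\<exists>m. integrable lborel m \<and> (\<forall>z. \<forall>x\<in>L. norm (osc_term \<phi> F w z x) \<le> m z)" by blast
  qed
  have Jm: "J w \<in> elts A" for w using vint unfolding has_vint_def by blast
  have Jb: "\<exists>C\<ge>0. \<forall>n\<in>L. \<forall>w. norm (J w n) \<le> C * lattice_weight w" if L: "L \<in> \<L>" for L
  proof -
    have "Ck_family k L (\<lambda>_ z. 1 * (1 + norm z) ^ 0) (\<lambda>n z. F z n)" for k using Ck[OF L] by simp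
    from oscillatory_decay[OF this R(2) _ R(1)]
    show ?thesis unfolding J_def osc_term_eq by simp
  qed
  have approx: "\<exists>C\<ge>0. \<forall>n\<in>L. \<forall>S. finite S \<longrightarrow> S \<subseteq> W \<longrightarrow>
       norm (I n - (\<Sum>w\<in>S. J w n)) \<le> C * (infsum lattice_weight W - sum lattice_weight S)" if L: "L \<in> \<L>" for L
  proof -
    obtain C where C: "C \<ge> 0" "\<forall>n\<in>L. \<forall>w. norm (J w n) \<le> C * lattice_weight w" using Jb[OF L] by blast
    have s: "(\<lambda>w. C * lattice_weight w) summable_on W" using sumW by (rule summable_on_cmult_right)
    have "norm (I n - (\<Sum>w\<in>S. J w n)) \<le> C * (infsum lattice_weight W - sum lattice_weight S)"
      if "n \<in> L" "finite S" "S \<subseteq> W" for n S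
      using dominated_infsum(3)[OF _ s that(2,3), of "\<lambda>w. J w n"] C(2) that(1)
      unfolding I_def by (simp add: infsum_cmult_right sumW sum_distrib_left right_diff_distrib)
    then show ?thesis using C(1) by blast
  qed
  have small: "\<exists>S. finite S \<and> S \<subseteq> W \<and> (\<forall>S'. finite S' \<longrightarrow> S \<subseteq> S' \<longrightarrow> S' \<subseteq> W \<longrightarrow>
      C * (infsum lattice_weight W - sum lattice_weight S') \<le> e)" if "e > 0" "C \<ge> 0" for e C
  proof -
    have "((\<lambda>S. C * (infsum lattice_weight W - sum lattice_weight S)) \<longlongrightarrow>
        C * (infsum lattice_weight W - infsum lattice_weight W)) (finite_subsets_at_top W)"
      using has_sum_infsum[OF sumW] unfolding has_sum_def by (intro tendsto_intros)
    then have "\<forall>\<^sub>F S in finite_subsets_at_top W. C * (infsum lattice_weight W - sum lattice_weight S) < e"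
      using that(1) by (intro order_tendstoD) auto
    then show ?thesis unfolding eventually_finite_subsets_at_top by (meson less_imp_le)
  qed
  have Im: "I \<in> elts A"
  proof (rule elts_complete)
    show "I n = 0" if "n \<notin> topspace T" for n
      unfolding I_def using elts_outside[OF Jm that] by simp
    fix L e assume L: "L \<in> \<L>" and e: "(e::real) > 0"
    obtain C where C: "C \<ge> 0" "\<forall>n\<in>L. \<forall>S. finite S \<longrightarrow> S \<subseteq> W \<longrightarrow>
       norm (I n - (\<Sum>w\<in>S. J w n)) \<le> C * (infsum lattice_weight W - sum lattice_weight S)"
      using approx[OF L] by blast
    obtain S where "finite S" "S \<subseteq> W" "C * (infsum lattice_weight W - sum lattice_weight S) \<le> e"
      using small[OF e C(1)] by blast
    then show "\<exists>g\<in>elts A. \<forall>x\<in>L. norm (I x - g x) \<le> e"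
      using C(2) by (intro bexI[of _ "\<lambda>x. \<Sum>w\<in>S. J w x"] elts_sum Jm) force
  qed
  have "has_vsum A J W I" unfolding has_vsum_def
  proof (intro conjI ballI Im Jm)
    fix r assume "r \<in> snorms A"
    then obtain L where L: "L \<in> \<L>" "r = supnorm L" by (auto simp: snorms_eq)
    obtain C where C: "C \<ge> 0" "\<forall>n\<in>L. \<forall>S. finite S \<longrightarrow> S \<subseteq> W \<longrightarrow>
       norm (I n - (\<Sum>w\<in>S. J w n)) \<le> C * (infsum lattice_weight W - sum lattice_weight S)"
      using approx[OF L(1)] by blast
    show "((\<lambda>S. r (sum J S - I)) \<longlongrightarrow> 0) (finite_subsets_at_top W)"
    proof (rule tendstoI)
      fix e :: real assume e: "e > 0"
      obtain S where S: "finite S" "S \<subseteq> W" "\<forall>S'. finite S' \<longrightarrow> S \<subseteq> S' \<longrightarrow> S' \<subseteq> W \<longrightarrow>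
          C * (infsum lattice_weight W - sum lattice_weight S') \<le> e/2"
        using small[OF half_gt_zero[OF e] C(1)] by blast
      have "dist (r (sum J S' - I)) 0 < e" if S': "finite S'" "S \<subseteq> S'" "S' \<subseteq> W" for S'
      proof -
        have eq: "sum J S' - I = (\<lambda>n. (\<Sum>w\<in>S'. J w n) - I n)" by (simp add: fun_diff_def sum_fun_apply)
        have m: "(\<lambda>n. (\<Sum>w\<in>S'. J w n) - I n) \<in> elts A" by (intro elts_diff elts_sum Jm Im)
        have "supnorm L (\<lambda>n. (\<Sum>w\<in>S'. J w n) - I n) \<le> e/2"
        proof (rule supnorm_le)
          fix n assume "n \<in> L"
          then have "norm (I n - (\<Sum>w\<in>S'. J w n)) \<le> e/2" using C(2) S' S(3) by (meson order_trans)
          then show "norm ((\<Sum>w\<in>S'. J w n) - I n) \<le> e/2" by (simp add: norm_minus_commute)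
        qed (use e in simp)
        then show ?thesis using snorm_nonneg[OF m L(1)] e unfolding L(2) eq by simp
      qed
      then show "\<forall>\<^sub>F S in finite_subsets_at_top W. dist (r (sum J S - I)) 0 < e"
        unfolding eventually_finite_subsets_at_top using S(1,2) by blast
    qed
  qed
  then show ?thesis unfolding has_osc_integral_def using vint
    by (intro exI[of _ J]) (simp add: I_def[abs_def] J_def[abs_def])
qed

end

section \<open>Twisted products of smooth functions\<close>

text \<open>The integrand of the product of two \<open>A\<close>-valued functions at \<open>x\<close>. For orbit maps and \<open>x = 0\<close> it is the
integrand of the deformed product.\<close>

definition twist ::
  "real^'d^'d \<Rightarrow> (real^'d \<Rightarrow> 'n \<Rightarrow> complex) \<Rightarrow> (real^'d \<Rightarrow> 'n \<Rightarrow> complex) \<Rightarrow> real^'d \<Rightarrow>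
    (real^'d) \<times> (real^'d) \<Rightarrow> 'n \<Rightarrow> complex" where
  "twist \<Theta> F G x = (\<lambda>(u, v). F (x + \<Theta> *v u) * G (x + v))"

lemma twist_apply: "twist \<Theta> F G x z n = F (x + \<Theta> *v fst z) n * G (x + snd z) n"
  by (cases z) (simp add: twist_def times_fun_def)

definition twist_integral ::
  "((real^'d) \<times> (real^'d)) set \<Rightarrow> ((real^'d) \<times> (real^'d) \<Rightarrow> real) \<Rightarrow>
   real^'d^'d \<Rightarrow> (real^'d \<Rightarrow> 'n \<Rightarrow> complex) \<Rightarrow> (real^'d \<Rightarrow> 'n \<Rightarrow> complex) \<Rightarrow> real^'d \<Rightarrow> 'n \<Rightarrow> complex" where
  "twist_integral W \<phi> \<Theta> F G x n = (\<Sum>\<^sub>\<infinity>w\<in>W. \<integral>z. osc_term \<phi> (twist \<Theta> F G x) w z n \<partial>lborel)"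

lemma lattice_weight_le_1: "lattice_weight v \<le> 1"
  unfolding lattice_weight_def by (simp add: inverse_le_1_iff one_le_power)

context sup_algebra
begin

lemma twist_Ck:
  assumes F: "smooth_bound (\<lambda>_. 1) F" and G: "smooth_bound \<omega> G" and L: "L \<in> \<L>"
  shows "Ck_family k (UNIV \<times> L) (\<lambda>(x, n) z. \<omega> (x + snd z)) (\<lambda>(x, n) z. twist \<Theta> F G x z n)"
proof -
  have F': "Ck_family k L (\<lambda>_ _. 1) (\<lambda>n v. F v n)" and G': "Ck_family k L (\<lambda>_. \<omega>) (\<lambda>n v. G v n)"
    using F G L unfolding smooth_bound_def by blast+
  have l: "bounded_linear (\<lambda>z. \<Theta> *v fst z)"
    by (rule bounded_linear_compose[OF matrix_vector_mul_bounded_linear bounded_linear_fst])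
  have 1: "Ck_family k (UNIV \<times> L) (\<lambda>i z. 1) (\<lambda>i z. F (fst i + \<Theta> *v fst z) (snd i))"
    by (rule Ck_family_reparam[OF F' l, where s=snd and c=fst]) auto
  have 2: "Ck_family k (UNIV \<times> L) (\<lambda>i z. \<omega> (fst i + snd z)) (\<lambda>i z. G (fst i + snd z) (snd i))"
    by (rule Ck_family_reparam[OF G' bounded_linear_snd, where s=snd and c=fst]) auto
  show ?thesis using Ck_family_mult[OF 1 2] by (simp add: twist_apply case_prod_beta')
qed

lemma twist_smooth_bound:
  assumes F: "smooth_bound (\<lambda>_. 1) F" and G: "smooth_bound (\<lambda>_. 1) G"
  shows "smooth_bound (\<lambda>_. 1) (twist \<Theta> F G x)"
  unfolding smooth_bound_def
proof (intro conjI allI ballI)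
  show "twist \<Theta> F G x z \<in> elts A" for z
    using elts_mult'[OF smooth_bound_elts[OF F] smooth_bound_elts[OF G]]
    by (cases z) (simp add: twist_def)
  fix L k assume "L \<in> \<L>"
  from twist_Ck[OF F G this, of k \<Theta>]
  have "Ck_family k L (\<lambda>n z. 1) (\<lambda>n z. twist \<Theta> F G x (0 + z) n)"
    using Ck_family_reparam[OF _ bounded_linear_ident, where I="UNIV \<times> L" and s="\<lambda>n. (x, n)" and c="\<lambda>_. 0" and J=L
       and \<omega>="\<lambda>_ _. 1" and f="\<lambda>(x, n) z. twist \<Theta> F G x z n" and k=k]
    by (simp add: case_prod_beta')
  then show "Ck_family k L (\<lambda>_ _. 1) (\<lambda>n z. twist \<Theta> F G x z n)" by simp
qed

lemma twist_has_osc_integral: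
  assumes W: "lattice_partition W \<phi>" and F: "smooth_bound (\<lambda>_. 1) F" and G: "smooth_bound (\<lambda>_. 1) G"
  shows "has_osc_integral A W \<phi> (twist \<Theta> F G x) (twist_integral W \<phi> \<Theta> F G x)"
proof -
  note b = twist_smooth_bound[OF F G, of \<Theta> x]
  have "has_osc_integral A W \<phi> (twist \<Theta> F G x)
     (\<lambda>n. \<Sum>\<^sub>\<infinity>w\<in>W. \<integral>z. osc_term \<phi> (twist \<Theta> F G x) w z n \<partial>lborel)"
  proof (rule has_osc_integral_exists[OF W])
    show "twist \<Theta> F G x z \<in> elts A" for z by (rule smooth_bound_elts[OF b])
    show "uniform_limit L (twist \<Theta> F G x) (twist \<Theta> F G x z) (at z)" if "L \<in> \<L>" for L z
      using smooth_bound_Lipschitz[OF b that] uniform_limit_of_Lipschitz by blast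
    show "Ck_family k L (\<lambda>_ _. 1) (\<lambda>n z. twist \<Theta> F G x z n)" if "L \<in> \<L>" for k L
      using b that unfolding smooth_bound_def by blast
  qed
  then show ?thesis unfolding twist_integral_def[abs_def] .
qed

lemma twist_integral_elts:
  assumes "lattice_partition W \<phi>" "smooth_bound (\<lambda>_. 1) F" "smooth_bound (\<lambda>_. 1) G"
  shows "twist_integral W \<phi> \<Theta> F G x \<in> elts A"
  using twist_has_osc_integral[OF assms] unfolding has_osc_integral_def has_vsum_def by blast

text \<open>The weight of \<open>G\<close> at \<open>x + v\<close> is split into a factor that depends on \<open>x\<close>, which becomes part of the
result, and a factor of polynomial growth in \<open>v\<close>, which the oscillation absorbs.\<close>

lemma twist_term_bound:
  fixes F G :: "real^'d \<Rightarrow> 'n \<Rightarrow> complex"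
  assumes W: "lattice_partition W \<phi>" and F: "smooth_bound (\<lambda>_. 1) F" and G: "smooth_bound \<omega> G"
    and L: "L \<in> \<L>" and \<omega>: "\<And>v. 0 \<le> \<omega> v" and c: "\<And>x. 0 \<le> c x" and B: "0 \<le> B"
    and le: "\<And>x v. \<omega> (x + v) \<le> B * (c x * (1 + norm v) ^ m)"
  shows "\<exists>C\<ge>0. \<forall>n\<in>L. \<forall>x w. norm (\<integral>z. osc_term \<phi> (twist \<Theta> F G x) w z n \<partial>lborel) \<le> C * c x * lattice_weight w"
proof -
  obtain R where R: "R \<ge> 0" "\<And>k. cutoff k R (\<lambda>z. complex_of_real (\<phi> z))"
    using lattice_partition_cutoff(1)[OF W] by blast
  have "Ck_family k (UNIV \<times> L) (\<lambda>i z. c (fst i) * (1 + norm z) ^ m) (\<lambda>(x, n) z. twist \<Theta> F G x z n)" for k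
  proof (rule Ck_family_weight_mono[OF twist_Ck[OF F G L] B])
    fix i and z :: "(real^'d) \<times> (real^'d)"
    have "(1 + norm (snd z)) ^ m \<le> (1 + norm z) ^ m"
      using norm_snd_le[of "snd z" "fst z"] by (intro power_mono) auto
    then have "B * (c (fst i) * (1 + norm (snd z)) ^ m) \<le> B * (c (fst i) * (1 + norm z) ^ m)"
      using B c by (intro mult_left_mono) auto
    then show "(case i of (x, n) \<Rightarrow> \<lambda>z. \<omega> (x + snd z)) z \<le> B * (c (fst i) * (1 + norm z) ^ m)"
      using le[of "fst i" "snd z"] by (simp add: case_prod_beta')
  qed
  from oscillatory_decay[OF this R(2) _ R(1)] c
  obtain C where C: "C \<ge> 0" "\<forall>i\<in>UNIV \<times> L. \<forall>w. norm (\<integral>z. (case i of (x, n) \<Rightarrow> \<lambda>z. twist \<Theta> F G x z n) z *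
     complex_of_real (\<phi> (z - w)) * phase z \<partial>lborel) \<le> C * c (fst i) * lattice_weight w"
    by blast
  have "norm (\<integral>z. osc_term \<phi> (twist \<Theta> F G x) w z n \<partial>lborel) \<le> C * c x * lattice_weight w" if "n \<in> L" for n x w
    using C(2)[rule_format, of "(x, n)" w] that by (simp add: osc_term_eq)
  then show ?thesis using C(1) by blast
qed

text \<open>By \<open>lattice_weight_le\<close>, \<open>lattice_weight (x + v)\<close> is at most \<open>lattice_weight x\<close> times a quantity of
polynomial growth in \<open>v\<close>; hence the product with a decaying function decays at the same rate.\<close>

lemma twist_integral_decay:
  fixes F G :: "real^'d \<Rightarrow> 'n \<Rightarrow> complex"
  assumes W: "lattice_partition W \<phi>" and F: "smooth_bound (\<lambda>_. 1) F" and G: "smooth_bound lattice_weight G"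
    and L: "L \<in> \<L>"
  shows "\<exists>C\<ge>0. \<forall>n\<in>L. \<forall>x. norm (twist_integral W \<phi> \<Theta> F G x n) \<le> C * lattice_weight x"
proof -
  have le: "lattice_weight (x + v) \<le> 2 ^ DIM(real^'d) * (lattice_weight x * (1 + norm v) ^ (2 * DIM(real^'d)))"
    for x v :: "real^'d"
  proof -
    have "lattice_weight (x + v) \<le> (2 * (1 + (norm v)\<^sup>2)) ^ DIM(real^'d) * lattice_weight x"
      by (rule lattice_weight_le) simp
    also have "\<dots> \<le> (2 * (1 + norm v)\<^sup>2) ^ DIM(real^'d) * lattice_weight x"
      by (intro mult_right_mono power_mono lattice_weight_nonneg) (auto simp: power2_eq_square algebra_simps)
    finally show ?thesis
      unfolding power_mult_distrib power_mult[of "1 + norm v" 2] by (simp only: mult_ac)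
  qed
  obtain C where C: "C \<ge> 0" "\<forall>n\<in>L. \<forall>x w. norm (\<integral>z. osc_term \<phi> (twist \<Theta> F G x) w z n \<partial>lborel) \<le> C * lattice_weight x * lattice_weight w"
    using twist_term_bound[OF W F G L lattice_weight_nonneg lattice_weight_nonneg _ le, of \<Theta>] by auto
  note sumW = lattice_partition_cutoff(2)[OF W]
  have "norm (twist_integral W \<phi> \<Theta> F G x n) \<le> (C * infsum lattice_weight W) * lattice_weight x" if "n \<in> L" for n x
  proof -
    have s: "(\<lambda>w. C * lattice_weight x * lattice_weight w) summable_on W" using sumW by (rule summable_on_cmult_right)
    have "norm (twist_integral W \<phi> \<Theta> F G x n) \<le> (\<Sum>\<^sub>\<infinity>w\<in>W. C * lattice_weight x * lattice_weight w)"
      unfolding twist_integral_def by (rule dominated_infsum(2)[OF _ s]) (use C(2) that in blast)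
    also have "\<dots> = C * lattice_weight x * infsum lattice_weight W"
      by (rule infsum_cmult_right) (rule sumW)
    finally show ?thesis by (simp add: mult_ac)
  qed
  moreover have "0 \<le> infsum lattice_weight W" by (intro infsum_nonneg lattice_weight_nonneg)
  ultimately show ?thesis using C(1) by (intro exI[of _ "C * infsum lattice_weight W"]) auto
qed

lemma twist_term_Lipschitz:
  assumes W: "lattice_partition W \<phi>" and F: "smooth_bound (\<lambda>_. 1) F" and G: "smooth_bound (\<lambda>_. 1) G" and L: "L \<in> \<L>"
  shows "\<exists>K\<ge>0. \<forall>n\<in>L. \<forall>x y. norm ((\<integral>z. osc_term \<phi> (twist \<Theta> F G x) w z n \<partial>lborel) -
     (\<integral>z. osc_term \<phi> (twist \<Theta> F G y) w z n \<partial>lborel)) \<le> K * norm (x - y)"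
proof -
  obtain R where R: "R \<ge> 0" "\<And>k. cutoff k R (\<lambda>z. complex_of_real (\<phi> z))" "\<And>z. norm z > R \<Longrightarrow> \<phi> z = 0"
    using lattice_partition_cutoff(1)[OF W] by blast
  have c\<phi>: "continuous_on UNIV (\<lambda>z. complex_of_real (\<phi> z))" by (rule cutoff_continuous[OF R(2)])
  have c\<phi>w: "continuous_on UNIV (\<lambda>z. complex_of_real (\<phi> (z - w)))"
    by (rule continuous_on_compose2[OF c\<phi>]) (auto intro!: continuous_intros)
  obtain CF where CF: "CF \<ge> 0" "\<forall>n\<in>L. \<forall>v. norm (F v n) \<le> CF * 1" using smooth_bound_bound[OF F L] by blast
  obtain CG where CG: "CG \<ge> 0" "\<forall>n\<in>L. \<forall>v. norm (G v n) \<le> CG * 1" using smooth_bound_bound[OF G L] by blast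
  obtain LF where LF: "LF \<ge> 0" "\<forall>n\<in>L. \<forall>x y. norm (F x n - F y n) \<le> LF * norm (x - y)" using smooth_bound_Lipschitz[OF F L] by blast
  obtain LG where LG: "LG \<ge> 0" "\<forall>n\<in>L. \<forall>x y. norm (G x n - G y n) \<le> LG * norm (x - y)" using smooth_bound_Lipschitz[OF G L] by blast
  define M where "M = LF * CG + CF * LG"
  have tw: "norm (twist \<Theta> F G x z n - twist \<Theta> F G y z n) \<le> M * norm (x - y)" if n: "n \<in> L" for n x y z
  proof -
    let ?a = "F (x + \<Theta> *v fst z) n" and ?a' = "F (y + \<Theta> *v fst z) n"
      and ?b = "G (x + snd z) n" and ?b' = "G (y + snd z) n"
    have eq: "?a * ?b - ?a' * ?b' = (?a - ?a') * ?b + ?a' * (?b - ?b')" by (simp add: algebra_simps)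
    have "norm (?a * ?b - ?a' * ?b') \<le> norm (?a - ?a') * norm ?b + norm ?a' * norm (?b - ?b')"
      unfolding eq norm_mult[symmetric] by (rule norm_triangle_ineq)
    also have "\<dots> \<le> (LF * norm (x - y)) * CG + CF * (LG * norm (x - y))"
    proof (intro add_mono mult_mono)
      show "norm (?a - ?a') \<le> LF * norm (x - y)"
        using LF(2)[rule_format, OF n, of "x + \<Theta> *v fst z" "y + \<Theta> *v fst z"] by simp
      show "norm (?b - ?b') \<le> LG * norm (x - y)"
        using LG(2)[rule_format, OF n, of "x + snd z" "y + snd z"] by simp
    qed (use CF CG LF(1) n in \<open>auto intro: mult_nonneg_nonneg\<close>)
    finally show ?thesis by (simp add: twist_apply M_def algebra_simps)
  qed
  have iint: "integrable lborel (\<lambda>z. osc_term \<phi> (twist \<Theta> F G x) w z n)" if n: "n \<in> L" for x n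
  proof -
    have "Ck_family 0 L (\<lambda>_ _. 1) (\<lambda>n z. twist \<Theta> F G x z n)"
      using twist_smooth_bound[OF F G, of \<Theta> x] L unfolding smooth_bound_def by blast
    from Ck_family_continuous[OF this n]
    have "continuous_on UNIV (\<lambda>z. twist \<Theta> F G x z n)" .
    then show ?thesis unfolding osc_term_eq
      by (intro integrable_continuous_compact_support[where w=w and R=R] continuous_intros continuous_phase c\<phi>w)
        (use R(3) in simp_all)
  qed
  have i\<phi>: "integrable lborel (\<lambda>z. norm (complex_of_real (\<phi> (z - w))))"
    by (intro integrable_norm integrable_continuous_compact_support[where w=w and R=R] c\<phi>w) (use R(3) in simp)
  define P where "P = (\<integral>z. norm (complex_of_real (\<phi> (z - w))) \<partial>lborel)"
  have P: "P \<ge> 0" unfolding P_def by simp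
  have "norm ((\<integral>z. osc_term \<phi> (twist \<Theta> F G x) w z n \<partial>lborel) -
     (\<integral>z. osc_term \<phi> (twist \<Theta> F G y) w z n \<partial>lborel)) \<le> (M * P) * norm (x - y)" if n: "n \<in> L" for n x y
  proof -
    have "norm ((\<integral>z. osc_term \<phi> (twist \<Theta> F G x) w z n \<partial>lborel) - (\<integral>z. osc_term \<phi> (twist \<Theta> F G y) w z n \<partial>lborel))
      = norm (\<integral>z. osc_term \<phi> (twist \<Theta> F G x) w z n - osc_term \<phi> (twist \<Theta> F G y) w z n \<partial>lborel)"
      using iint[OF n] by simp
    also have "\<dots> \<le> (\<integral>z. (M * norm (x - y)) * norm (complex_of_real (\<phi> (z - w))) \<partial>lborel)"
    proof (rule order_trans[OF integral_norm_bound integral_mono[OF integrable_norm]])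
      fix z
      have "osc_term \<phi> (twist \<Theta> F G x) w z n - osc_term \<phi> (twist \<Theta> F G y) w z n =
        (twist \<Theta> F G x z n - twist \<Theta> F G y z n) * complex_of_real (\<phi> (z - w)) * phase z"
        by (simp add: osc_term_eq algebra_simps)
      then show "norm (osc_term \<phi> (twist \<Theta> F G x) w z n - osc_term \<phi> (twist \<Theta> F G y) w z n)
          \<le> (M * norm (x - y)) * norm (complex_of_real (\<phi> (z - w)))"
        using mult_right_mono[OF tw[OF n, of x z y], of "norm (complex_of_real (\<phi> (z - w)))"]
        by (simp add: norm_mult)
    qed (use iint[OF n] i\<phi> in \<open>auto intro: Bochner_Integration.integrable_diff integrable_mult_right\<close>)
    also have "\<dots> = (M * P) * norm (x - y)" by (simp add: P_def)
    finally show ?thesis .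
  qed
  moreover have "M \<ge> 0" unfolding M_def using CF(1) CG(1) LF(1) LG(1) by simp
  ultimately show ?thesis using P by (intro exI[of _ "M * P"]) auto
qed

text \<open>Every term of the series is Lipschitz in \<open>x\<close>, and the series converges uniformly in \<open>x\<close>.\<close>

lemma twist_integral_continuous:
  assumes W: "lattice_partition W \<phi>" and F: "smooth_bound (\<lambda>_. 1) F" and G: "smooth_bound (\<lambda>_. 1) G" and L: "L \<in> \<L>"
  shows "uniform_limit L (twist_integral W \<phi> \<Theta> F G) (twist_integral W \<phi> \<Theta> F G x) (at x)"
proof (rule uniform_limitI)
  fix e :: real assume e: "e > 0"
  define J where "J x w n = (\<integral>z. osc_term \<phi> (twist \<Theta> F G x) w z n \<partial>lborel)" for x w n
  have I: "twist_integral W \<phi> \<Theta> F G x n = infsum (\<lambda>w. J x w n) W" for x n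
    by (simp add: twist_integral_def J_def)
  note sumW = lattice_partition_cutoff(2)[OF W]
  obtain C where C: "C \<ge> 0" "\<forall>n\<in>L. \<forall>x w. norm (J x w n) \<le> C * 1 * lattice_weight w"
    using twist_term_bound[OF W F G L, of "\<lambda>_. 1" 1 0 \<Theta>] unfolding J_def by auto
  have s: "(\<lambda>w. C * lattice_weight w) summable_on W" using sumW by (rule summable_on_cmult_right)
  have "\<forall>\<^sub>F S in finite_subsets_at_top W. sum (\<lambda>w. C * lattice_weight w) S > infsum (\<lambda>w. C * lattice_weight w) W - e/4"
    using has_sum_infsum[OF s] e unfolding has_sum_def by (intro order_tendstoD) auto
  then obtain S where S: "finite S" "S \<subseteq> W" "sum (\<lambda>w. C * lattice_weight w) S > infsum (\<lambda>w. C * lattice_weight w) W - e/4"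
    unfolding eventually_finite_subsets_at_top by blast
  have tail: "norm (infsum (\<lambda>w. J x w n) W - (\<Sum>w\<in>S. J x w n)) < e/4" if "n \<in> L" for n x
    using dominated_infsum(3)[OF _ s S(1,2), of "\<lambda>w. J x w n"] C(2) that S(3) by force
  have "\<forall>w. \<exists>K\<ge>0. \<forall>n\<in>L. \<forall>x y. norm (J x w n - J y w n) \<le> K * norm (x - y)"
    unfolding J_def using twist_term_Lipschitz[OF W F G L] by blast
  from choice[OF this] obtain K where K: "\<And>w. 0 \<le> K w" "\<And>w n x y. n \<in> L \<Longrightarrow> norm (J x w n - J y w n) \<le> K w * norm (x - y)"
    by blast
  have "((\<lambda>y. sum K S * norm (y - x)) \<longlongrightarrow> sum K S * norm (x - x)) (at x)" by (intro tendsto_intros)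
  then have "\<forall>\<^sub>F y in at x. sum K S * norm (y - x) < e/4" using e by (intro order_tendstoD) auto
  then show "\<forall>\<^sub>F y in at x. \<forall>n\<in>L. dist (twist_integral W \<phi> \<Theta> F G y n) (twist_integral W \<phi> \<Theta> F G x n) < e"
  proof eventually_elim
    case (elim y)
    show ?case
    proof
      fix n assume n: "n \<in> L"
      have "norm ((\<Sum>w\<in>S. J y w n) - (\<Sum>w\<in>S. J x w n)) \<le> (\<Sum>w\<in>S. K w * norm (y - x))"
        unfolding sum_subtractf[symmetric] by (rule sum_norm_le) (rule K(2)[OF n])
      also have "\<dots> < e/4" using elim by (simp add: sum_distrib_right)
      finally have "norm ((\<Sum>w\<in>S. J y w n) - (\<Sum>w\<in>S. J x w n)) < e/4" .
      moreover have "norm (a - b) < e" if "norm (a - c) < e/4" "norm (b - d) < e/4" "norm (c - d) < e/4" for a b c d :: complex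
      proof -
        have "norm (a - b) \<le> norm (a - c) + norm (c - d) + norm (d - b)"
          using norm_triangle_ineq[of "a - c" "c - d"] norm_triangle_ineq[of "a - d" "d - b"] by simp
        then show ?thesis using that e by (simp add: norm_minus_commute)
      qed
      ultimately show "dist (twist_integral W \<phi> \<Theta> F G y n) (twist_integral W \<phi> \<Theta> F G x n) < e"
        using tail[OF n, of y] tail[OF n, of x] unfolding I dist_norm by blast
    qed
  qed
qed

text \<open>The existence of \<open>\<langle>F, F\<rangle>\<close>. Decay of \<open>F\<close> at the rate of \<open>lattice_weight\<close> suffices, so this applies
both to Schwartz functions and to their products with orbit maps.\<close>

lemma square_has_vint:
  fixes F :: "'v::euclidean_space \<Rightarrow> 'n \<Rightarrow> complex"
  assumes F: "\<And>v. F v \<in> elts A" and cont: "\<And>L v. L \<in> \<L> \<Longrightarrow> uniform_limit L F (F v) (at v)"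
    and decay: "\<And>L. L \<in> \<L> \<Longrightarrow> \<exists>C\<ge>0. \<forall>n\<in>L. \<forall>v. norm (F v n) \<le> C * lattice_weight v"
  shows "has_vint A (\<lambda>v n. cnj (F v n) * F v n) (\<lambda>n. \<integral>v. cnj (F v n) * F v n \<partial>lborel)"
proof (rule has_vint_lebesgue)
  show "(\<lambda>n. cnj (F v n) * F v n) \<in> elts A" for v by (intro elts_mult elts_cnj F)
  fix L assume L: "L \<in> \<L>"
  show "uniform_limit L (\<lambda>v n. cnj (F v n) * F v n) (\<lambda>n. cnj (F v n) * F v n) (at v)" for v
  proof (rule uniform_lim_mult[OF _ cont[OF L]])
    show "uniform_limit L (\<lambda>v n. cnj (F v n)) (\<lambda>n. cnj (F v n)) (at v)"
    proof (rule uniform_limitI)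
      fix e :: real assume "e > 0"
      from uniform_limitD[OF cont[OF L] this]
      show "\<forall>\<^sub>F y in at v. \<forall>x\<in>L. dist (cnj (F y x)) (cnj (F v x)) < e"
        by eventually_elim (simp add: dist_norm complex_cnj_diff[symmetric] del: complex_cnj_diff)
    qed
    show "bounded (F v ` L)" using elts_bounded[OF F L] by (auto simp: bounded_iff)
    show "bounded ((\<lambda>n. cnj (F v n)) ` L)" using elts_bounded[OF F L] by (auto simp: bounded_iff)
  qed
  obtain C where C: "C \<ge> 0" "\<forall>n\<in>L. \<forall>v. norm (F v n) \<le> C * lattice_weight v" using decay[OF L] by blast
  have "norm (cnj (F v n) * F v n) \<le> C\<^sup>2 * product_weight v" if "n \<in> L" for v n
  proof -
    have "norm (F v n) \<le> C * product_weight v"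
      using C(2)[rule_format, OF that, of v] lattice_weight_le_product_weight[of v] C(1)
      unfolding lattice_weight_def by (meson mult_left_mono order_trans)
    moreover have "norm (F v n) \<le> C * 1"
      using C(2)[rule_format, OF that, of v] lattice_weight_le_1[of v] C(1) by (meson mult_left_mono order_trans)
    ultimately have "norm (F v n) * norm (F v n) \<le> (C * 1) * (C * product_weight v)"
      using C(1) by (intro mult_mono) auto
    then show ?thesis by (simp add: norm_mult power2_eq_square mult_ac)
  qed
  moreover have "integrable lborel (\<lambda>v::'v. C\<^sup>2 * product_weight v)"
    by (intro integrable_mult_right integrable_product_weight)
  ultimately show "\<exists>m. integrable lborel m \<and> (\<forall>v. \<forall>n\<in>L. norm (cnj (F v n) * F v n) \<le> m v)" by blast
qed

text \<open>The reciprocal of \<open>lattice_weight\<close> is a polynomial function.\<close>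

lemma schwartz_smooth_bound:
  fixes g :: "'v::euclidean_space \<times> 'n \<Rightarrow> complex"
  assumes "g \<in> schwartz A"
  shows "smooth_bound lattice_weight (at_pt g)"
proof -
  let ?dec = "\<lambda>D. \<forall>es. set es \<subseteq> Basis \<longrightarrow> (\<forall>P. real_polynomial_function P \<longrightarrow> (\<forall>r\<in>snorms A.
        \<exists>C. \<forall>x. r (\<lambda>n. complex_of_real (P x) * D es x n) \<le> C))"
  have "\<exists>D. derivatives_into A (at_pt g) D \<and> ?dec D"
    using assms unfolding schwartz_def mem_Collect_eq by (rule conjunct2)
  then obtain D where "derivatives_into A (at_pt g) D \<and> ?dec D" ..
  then have D: "derivatives_into A (at_pt g) D" and dec: "?dec D" by (rule conjunct1, rule conjunct2)
  define P where "P x = (1 + (norm x)\<^sup>2) ^ DIM('v)" for x :: 'v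
  have P: "real_polynomial_function P"
  proof -
    have "real_polynomial_function (\<lambda>x::'v. \<Sum>b\<in>Basis. (x \<bullet> b)\<^sup>2)"
      by (intro real_polynomial_function_sum real_polynomial_function_power
         real_polynomial_function.intros(1) bounded_linear_inner_left) auto
    moreover have "(norm x)\<^sup>2 = (\<Sum>b\<in>Basis. (x \<bullet> b)\<^sup>2)" for x :: 'v
      unfolding power2_norm_eq_inner by (subst euclidean_inner) (simp add: power2_eq_square)
    ultimately have n2: "real_polynomial_function (\<lambda>x::'v. (norm x)\<^sup>2)" by simp
    show ?thesis unfolding P_def
      by (rule real_polynomial_function_power[OF real_polynomial_function.intros(3)[OF real_polynomial_function.intros(2) n2]])
  qed
  have Pw: "lattice_weight x = inverse (P x)" "P x > 0" for x
    unfolding P_def lattice_weight_def by (simp_all add: add_pos_nonneg)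
  show ?thesis
  proof (rule derivatives_into_smooth_bound[OF D _ lattice_weight_nonneg])
    fix L and es :: "'v list" assume L: "L \<in> \<L>" and es: "set es \<subseteq> Basis"
    obtain C where C: "\<forall>x. supnorm L (\<lambda>n. complex_of_real (P x) * D es x n) \<le> C"
      using dec[rule_format, OF es P, of "supnorm L"] L unfolding snorms_eq by blast
    have m: "(\<lambda>n. complex_of_real (P x) * D es x n) \<in> elts A" for x
      using D es unfolding derivatives_into_def by (intro elts_cmult) blast
    have "norm (D es x n) \<le> max C 0 * lattice_weight x" if "n \<in> L" for n x
    proof -
      have "norm (complex_of_real (P x) * D es x n) \<le> max C 0"
        using norm_le_snorm[OF m L that, of x] C[rule_format, of x] by simp
      then have "P x * norm (D es x n) \<le> max C 0" using Pw(2)[of x] by (simp add: norm_mult)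
      then have "norm (D es x n) \<le> max C 0 / P x" using Pw(2)[of x] by (simp add: pos_le_divide_eq mult.commute)
      then show ?thesis unfolding Pw(1) by (simp add: divide_inverse)
    qed
    then show "\<exists>C\<ge>0. \<forall>n\<in>L. \<forall>v. norm (D es v n) \<le> C * lattice_weight v"
      by (intro exI[of _ "max C 0"]) auto
  qed
qed

end

section \<open>Continuous weighted composition operators\<close>

text \<open>Restriction to the fibre (with \<open>\<kappa> = 1\<close>) and extension off the fibre (with a cutoff as \<open>\<kappa>\<close>) are both of
this form.\<close>

definition wcomp :: "('k \<Rightarrow> complex) \<Rightarrow> ('k \<Rightarrow> 'n) \<Rightarrow> ('n \<Rightarrow> complex) \<Rightarrow> 'k \<Rightarrow> complex" where
  "wcomp \<kappa> \<rho> f = (\<lambda>k. \<kappa> k * f (\<rho> k))"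

lemma wcomp_add: "wcomp \<kappa> \<rho> (\<lambda>n. a n + b n) = (\<lambda>k. wcomp \<kappa> \<rho> a k + wcomp \<kappa> \<rho> b k)"
  by (simp add: wcomp_def algebra_simps)

lemma wcomp_diff: "wcomp \<kappa> \<rho> (a - b) = wcomp \<kappa> \<rho> a - wcomp \<kappa> \<rho> b"
  by (simp add: wcomp_def algebra_simps fun_diff_def)

lemma wcomp_cmult: "wcomp \<kappa> \<rho> (\<lambda>n. c * a n) = (\<lambda>k. c * wcomp \<kappa> \<rho> a k)"
  by (simp add: wcomp_def algebra_simps)

text \<open>The algebras are arbitrary here because the lemma serves twice: for the algebras of functions themselves
and for the algebras \<open>Cu\<close> built over them.\<close>

lemma derivatives_into_wcomp:
  fixes F :: "'v::euclidean_space \<Rightarrow> 'n \<Rightarrow> complex"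
  assumes D: "derivatives_into A F D"
    and diff: "\<And>a b. a \<in> elts A \<Longrightarrow> b \<in> elts A \<Longrightarrow> a - b \<in> elts A"
    and cmult: "\<And>a c. a \<in> elts A \<Longrightarrow> (\<lambda>n. c * a n) \<in> elts A"
    and mem: "\<And>a. a \<in> elts A \<Longrightarrow> wcomp \<kappa> \<rho> a \<in> elts B"
    and bd: "\<And>r. r \<in> snorms B \<Longrightarrow> \<exists>r'\<in>snorms A. \<exists>C. \<forall>a\<in>elts A. 0 \<le> r (wcomp \<kappa> \<rho> a) \<and> r (wcomp \<kappa> \<rho> a) \<le> C * r' a"
  shows "derivatives_into B (\<lambda>v. wcomp \<kappa> \<rho> (F v)) (\<lambda>es v. wcomp \<kappa> \<rho> (D es v))"
  unfolding derivatives_into_def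
proof (intro conjI allI impI ballI)
  show "(\<lambda>v. wcomp \<kappa> \<rho> (D [] v)) = (\<lambda>v. wcomp \<kappa> \<rho> (F v))" using D unfolding derivatives_into_def by simp
  fix es :: "'v list" and x assume es: "set es \<subseteq> Basis"
  have m: "D es x \<in> elts A" if "set es \<subseteq> Basis" for es x using D that unfolding derivatives_into_def by blast
  show "wcomp \<kappa> \<rho> (D es x) \<in> elts B" by (rule mem[OF m[OF es]])
  fix r assume r: "r \<in> snorms B"
  obtain r' C where r': "r' \<in> snorms A" "\<forall>a\<in>elts A. 0 \<le> r (wcomp \<kappa> \<rho> a) \<and> r (wcomp \<kappa> \<rho> a) \<le> C * r' a"
    using bd[OF r] by blast
  have lim: "((\<lambda>y. r (wcomp \<kappa> \<rho> (G y))) \<longlongrightarrow> 0) Fl"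
    if "\<And>y. G y \<in> elts A" "((\<lambda>y. r' (G y)) \<longlongrightarrow> 0) Fl" for G :: "'y \<Rightarrow> 'n \<Rightarrow> complex" and Fl
  proof (rule tendsto_sandwich[where f="\<lambda>_. 0" and h="\<lambda>y. C * r' (G y)"])
    show "((\<lambda>y. C * r' (G y)) \<longlongrightarrow> 0) Fl" using tendsto_mult_right_zero[OF that(2)] .
    show "((\<lambda>y. 0) \<longlongrightarrow> (0::real)) Fl" by simp
  qed (use r'(2) that(1) in auto)
  have "((\<lambda>y. r' (D es y - D es x)) \<longlongrightarrow> 0) (at x)" using D es r'(1) unfolding derivatives_into_def by blast
  from lim[of "\<lambda>y. D es y - D es x", OF diff[OF m[OF es] m[OF es]] this]
  show "((\<lambda>y. r (wcomp \<kappa> \<rho> (D es y) - wcomp \<kappa> \<rho> (D es x))) \<longlongrightarrow> 0) (at x)" by (simp add: wcomp_diff)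
  fix e :: 'v assume e: "e \<in> Basis"
  let ?q = "\<lambda>t n. (D es (x + t *\<^sub>R e) n - D es x n) / complex_of_real t - D (e # es) x n"
  have q: "?q t \<in> elts A" for t
  proof -
    have "(\<lambda>n. inverse (complex_of_real t) * (D es (x + t *\<^sub>R e) - D es x) n) - D (e # es) x \<in> elts A"
      using es e by (intro diff cmult m) auto
    then show ?thesis by (simp add: fun_diff_def divide_inverse mult.commute)
  qed
  have "((\<lambda>t. r' (?q t)) \<longlongrightarrow> 0) (at 0)" using D es e r'(1) unfolding derivatives_into_def by blast
  from lim[of ?q, OF q this]
  show "((\<lambda>t. r (\<lambda>n. (wcomp \<kappa> \<rho> (D es (x + t *\<^sub>R e)) n - wcomp \<kappa> \<rho> (D es x) n) / complex_of_real t -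
      wcomp \<kappa> \<rho> (D (e # es) x) n)) \<longlongrightarrow> 0) (at 0)"
    by (simp add: wcomp_def algebra_simps diff_divide_distrib)
qed

context sup_algebra
begin

lemma snorm_diff_le:
  assumes "a \<in> elts A" "b \<in> elts A" "L \<in> \<L>"
  shows "supnorm L (a - b) \<le> supnorm L a + supnorm L b"
proof (rule supnorm_le)
  show "norm ((a - b) x) \<le> supnorm L a + supnorm L b" if "x \<in> L" for x
    using norm_triangle_ineq4[of "a x" "b x"] norm_le_snorm[OF assms(1,3) that] norm_le_snorm[OF assms(2,3) that]
    by (simp add: fun_diff_def)
  show "0 \<le> supnorm L a + supnorm L b" using snorm_nonneg assms by simp
qed

lemma snorm_cmult_le:
  assumes "a \<in> elts A" "L \<in> \<L>"
  shows "supnorm L (\<lambda>x. c * a x) \<le> norm c * supnorm L a"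
proof (rule supnorm_le)
  show "norm (c * a x) \<le> norm c * supnorm L a" if "x \<in> L" for x
    using norm_le_snorm[OF assms that] by (simp add: norm_mult mult_left_mono)
  show "0 \<le> norm c * supnorm L a" using snorm_nonneg assms by simp
qed

lemma Cu_elts:
  "f \<in> elts (Cu A) \<longleftrightarrow> (\<forall>x. at_pt f x \<in> elts A) \<and> (\<forall>L\<in>\<L>. (\<exists>C. \<forall>x. supnorm L (at_pt f x) \<le> C) \<and>
     (\<forall>\<epsilon>>0. \<exists>\<delta>>0. \<forall>x y. dist x y < \<delta> \<longrightarrow> supnorm L (at_pt f x - at_pt f y) < \<epsilon>))"
  unfolding Cu_def by (simp add: snorms_eq)

lemma Cu_diff:
  fixes f g :: "'v::euclidean_space \<times> 'n \<Rightarrow> complex"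
  assumes f: "f \<in> elts (Cu A)" and g: "g \<in> elts (Cu A)"
  shows "f - g \<in> elts (Cu A)"
  unfolding Cu_elts
proof (intro conjI allI ballI impI)
  have at: "at_pt (f - g) x = at_pt f x - at_pt g x" for x by (simp add: at_pt_def fun_diff_def)
  have fm: "at_pt f x \<in> elts A" and gm: "at_pt g x \<in> elts A" for x using f g unfolding Cu_elts by blast+
  show "at_pt (f - g) x \<in> elts A" for x unfolding at by (rule elts_diff'[OF fm gm])
  fix L assume L: "L \<in> \<L>"
  obtain C C' where "\<forall>x. supnorm L (at_pt f x) \<le> C" "\<forall>x. supnorm L (at_pt g x) \<le> C'"
    using f g L unfolding Cu_elts by blast
  then have "supnorm L (at_pt (f - g) x) \<le> C + C'" for x
    unfolding at using snorm_diff_le[OF fm gm L, of x x] by (meson add_mono order_trans)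
  then show "\<exists>C. \<forall>x. supnorm L (at_pt (f - g) x) \<le> C" by blast
  fix \<epsilon> :: real assume "\<epsilon> > 0"
  then have e: "\<epsilon>/2 > 0" by simp
  obtain \<delta> where \<delta>: "\<delta> > 0" "\<forall>x y. dist x y < \<delta> \<longrightarrow> supnorm L (at_pt f x - at_pt f y) < \<epsilon>/2"
    using f L e unfolding Cu_elts by blast
  obtain \<delta>' where \<delta>': "\<delta>' > 0" "\<forall>x y. dist x y < \<delta>' \<longrightarrow> supnorm L (at_pt g x - at_pt g y) < \<epsilon>/2"
    using g L e unfolding Cu_elts by blast
  have "supnorm L (at_pt (f - g) x - at_pt (f - g) y) < \<epsilon>" if "dist x y < min \<delta> \<delta>'" for x y
  proof -
    have "at_pt (f - g) x - at_pt (f - g) y = (at_pt f x - at_pt f y) - (at_pt g x - at_pt g y)"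
      by (simp add: at)
    then have "supnorm L (at_pt (f - g) x - at_pt (f - g) y) \<le>
        supnorm L (at_pt f x - at_pt f y) + supnorm L (at_pt g x - at_pt g y)"
      using snorm_diff_le[OF elts_diff'[OF fm fm] elts_diff'[OF gm gm] L] by metis
    moreover have "supnorm L (at_pt f x - at_pt f y) < \<epsilon>/2" "supnorm L (at_pt g x - at_pt g y) < \<epsilon>/2"
      using that \<delta>(2) \<delta>'(2) by auto
    ultimately show ?thesis by linarith
  qed
  then show "\<exists>\<delta>>0. \<forall>x y. dist x y < \<delta> \<longrightarrow> supnorm L (at_pt (f - g) x - at_pt (f - g) y) < \<epsilon>"
    using \<delta>(1) \<delta>'(1) by (intro exI[of _ "min \<delta> \<delta>'"]) auto
qed

end

text \<open>Continuity, in the form \<open>wcomp_bound\<close>, lets the operator pass through derivatives, weak integrals and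
unconditionally convergent series.\<close>

locale weighted_composition = dom: sup_algebra S \<K> A + cod: sup_algebra T \<L> B
  for S :: "'n topology" and \<K> A and T :: "'k topology" and \<L> B +
  fixes \<kappa> :: "'k \<Rightarrow> complex" and \<rho> :: "'k \<Rightarrow> 'n"
  assumes wcomp_mem: "a \<in> elts A \<Longrightarrow> wcomp \<kappa> \<rho> a \<in> elts B"
    and wcomp_bound: "L \<in> \<L> \<Longrightarrow> \<exists>K\<in>\<K>. \<exists>C\<ge>0. \<forall>a\<in>elts A. supnorm L (wcomp \<kappa> \<rho> a) \<le> C * supnorm K a"
begin

lemma wcomp_snorm:
  assumes "r \<in> snorms B"
  shows "\<exists>r'\<in>snorms A. \<exists>C\<ge>0. \<forall>a\<in>elts A. 0 \<le> r (wcomp \<kappa> \<rho> a) \<and> r (wcomp \<kappa> \<rho> a) \<le> C * r' a"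
proof -
  obtain L where L: "L \<in> \<L>" "r = supnorm L" using assms by (auto simp: cod.snorms_eq)
  obtain K C where "K \<in> \<K>" "C \<ge> 0" "\<forall>a\<in>elts A. supnorm L (wcomp \<kappa> \<rho> a) \<le> C * supnorm K a"
    using wcomp_bound[OF L(1)] by blast
  then show ?thesis using L cod.snorm_nonneg[OF wcomp_mem L(1)]
    by (intro bexI[of _ "supnorm K"] exI[of _ C]) (auto simp: dom.snorms_eq)
qed

lemma derivatives:
  assumes "derivatives_into A F D"
  shows "derivatives_into B (\<lambda>v. wcomp \<kappa> \<rho> (F v)) (\<lambda>es v. wcomp \<kappa> \<rho> (D es v))"
proof (rule derivatives_into_wcomp[OF assms dom.elts_diff' dom.elts_cmult wcomp_mem])
  show "\<exists>r'\<in>snorms A. \<exists>C. \<forall>a\<in>elts A. 0 \<le> r (wcomp \<kappa> \<rho> a) \<and> r (wcomp \<kappa> \<rho> a) \<le> C * r' a"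
    if "r \<in> snorms B" for r using wcomp_snorm[OF that] by blast
qed

lemma dominated_comp:
  assumes "dominated B q"
  shows "dominated A (\<lambda>a. q (wcomp \<kappa> \<rho> a))"
proof -
  obtain L C where L: "L \<in> \<L>" "C \<ge> 0" "\<forall>b\<in>elts B. q b \<le> C * supnorm L b"
    using assms unfolding cod.dominated_iff by blast
  obtain K C' where K: "K \<in> \<K>" "C' \<ge> 0" "\<forall>a\<in>elts A. supnorm L (wcomp \<kappa> \<rho> a) \<le> C' * supnorm K a"
    using wcomp_bound[OF L(1)] by blast
  have "q (wcomp \<kappa> \<rho> a) \<le> (C * C') * supnorm K a" if a: "a \<in> elts A" for a
    using L(3)[rule_format, OF wcomp_mem[OF a]] mult_left_mono[OF K(3)[rule_format, OF a] L(2)]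
    by (simp add: mult.assoc)
  then show ?thesis unfolding dom.dominated_iff using K(1,2) L(2)
    by (intro bexI[of _ K] exI[of _ "C * C'"]) auto
qed

text \<open>Composition with functionals: this is why the operator commutes with weak integrals.\<close>

lemma dual_comp:
  assumes l: "l \<in> continuous_dual B"
  shows "(\<lambda>a. l (wcomp \<kappa> \<rho> a)) \<in> continuous_dual A"
proof -
  have add: "\<And>a b. a \<in> elts B \<Longrightarrow> b \<in> elts B \<Longrightarrow> l (a + b) = l a + l b"
    and cm: "\<And>a c. a \<in> elts B \<Longrightarrow> l (\<lambda>x. c * a x) = c * l a" and dm: "dominated B (\<lambda>a. norm (l a))"
    using l unfolding continuous_dual_def by auto
  have w: "wcomp \<kappa> \<rho> (a + b) = wcomp \<kappa> \<rho> a + wcomp \<kappa> \<rho> b" for a b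
    by (simp add: plus_fun_def wcomp_add)
  show ?thesis unfolding continuous_dual_def mem_Collect_eq
    using dominated_comp[OF dm] by (auto simp: w wcomp_cmult add cm wcomp_mem)
qed

lemma has_vint:
  assumes "has_vint A F I"
  shows "has_vint B (\<lambda>v. wcomp \<kappa> \<rho> (F v)) (wcomp \<kappa> \<rho> I)"
  unfolding has_vint_def
proof (intro conjI allI ballI)
  show "wcomp \<kappa> \<rho> (F z) \<in> elts B" for z using assms wcomp_mem unfolding has_vint_def by blast
  show "wcomp \<kappa> \<rho> I \<in> elts B" using assms wcomp_mem unfolding has_vint_def by blast
  fix l assume "l \<in> continuous_dual B"
  moreover have "\<forall>l\<in>continuous_dual A. has_bochner_integral lborel (\<lambda>z. l (F z)) (l I)"
    using assms unfolding has_vint_def by blast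
  ultimately show "has_bochner_integral lborel (\<lambda>z. l (wcomp \<kappa> \<rho> (F z))) (l (wcomp \<kappa> \<rho> I))"
    using bspec[OF _ dual_comp] by fast
qed

lemma vint:
  assumes "has_vint A F I"
  shows "vint B (\<lambda>v. wcomp \<kappa> \<rho> (F v)) = wcomp \<kappa> \<rho> (vint A F)"
  using cod.vint_eq[OF has_vint[OF assms]] dom.vint_eq[OF assms] by simp

lemma has_vsum:
  assumes "has_vsum A J W I"
  shows "has_vsum B (\<lambda>w. wcomp \<kappa> \<rho> (J w)) W (wcomp \<kappa> \<rho> I)"
  unfolding has_vsum_def
proof (intro conjI ballI)
  have m: "I \<in> elts A" "\<And>w. w \<in> W \<Longrightarrow> J w \<in> elts A" using assms unfolding has_vsum_def by blast+
  show "wcomp \<kappa> \<rho> I \<in> elts B" using m wcomp_mem by blast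
  show "wcomp \<kappa> \<rho> (J w) \<in> elts B" if "w \<in> W" for w using m that wcomp_mem by blast
  fix r assume "r \<in> snorms B"
  then obtain r' C where r': "r' \<in> snorms A" "\<forall>a\<in>elts A. 0 \<le> r (wcomp \<kappa> \<rho> a) \<and> r (wcomp \<kappa> \<rho> a) \<le> C * r' a"
    using wcomp_snorm by blast
  have lim: "((\<lambda>S. r' (sum J S - I)) \<longlongrightarrow> 0) (finite_subsets_at_top W)"
    using assms r'(1) unfolding has_vsum_def by blast
  have sm: "wcomp \<kappa> \<rho> (sum J S) = (\<Sum>w\<in>S. wcomp \<kappa> \<rho> (J w))" for S
    by (rule ext) (simp add: sum_fun_apply wcomp_def sum_distrib_left)
  have e: "sum J S - I \<in> elts A" if "S \<subseteq> W" for S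
  proof -
    have "sum J S = (\<lambda>x. \<Sum>w\<in>S. J w x)" by (rule ext) (simp add: sum_fun_apply)
    then show ?thesis using dom.elts_sum[of S J] m that by (intro dom.elts_diff') auto
  qed
  have ev: "\<forall>\<^sub>F S in finite_subsets_at_top W. S \<subseteq> W" by (rule eventually_finite_subsets_at_top_weakI)
  show "((\<lambda>S. r ((\<Sum>w\<in>S. wcomp \<kappa> \<rho> (J w)) - wcomp \<kappa> \<rho> I)) \<longlongrightarrow> 0) (finite_subsets_at_top W)"
    unfolding sm[symmetric] wcomp_diff[symmetric]
  proof (rule tendsto_sandwich[where f="\<lambda>_. 0" and h="\<lambda>S. C * r' (sum J S - I)"])
    show "((\<lambda>S. C * r' (sum J S - I)) \<longlongrightarrow> 0) (finite_subsets_at_top W)" using tendsto_mult_right_zero[OF lim] .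
    show "\<forall>\<^sub>F S in finite_subsets_at_top W. 0 \<le> r (wcomp \<kappa> \<rho> (sum J S - I))"
      using ev by eventually_elim (use r'(2) e in blast)
    show "\<forall>\<^sub>F S in finite_subsets_at_top W. r (wcomp \<kappa> \<rho> (sum J S - I)) \<le> C * r' (sum J S - I)"
      using ev by eventually_elim (use r'(2) e in blast)
  qed simp
qed

lemma has_osc_integral:
  assumes "has_osc_integral A W \<phi> F I"
  shows "has_osc_integral B W \<phi> (\<lambda>z. wcomp \<kappa> \<rho> (F z)) (wcomp \<kappa> \<rho> I)"
proof -
  obtain J where J: "\<forall>w\<in>W. has_vint A (osc_term \<phi> F w) (J w)" "has_vsum A J W I"
    using assms unfolding has_osc_integral_def by blast
  have eq: "osc_term \<phi> (\<lambda>z. wcomp \<kappa> \<rho> (F z)) w = (\<lambda>z. wcomp \<kappa> \<rho> (osc_term \<phi> F w z))" for w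
    by (intro ext) (simp add: osc_term_eq wcomp_def mult_ac)
  show ?thesis unfolding has_osc_integral_def
  proof (intro exI[of _ "\<lambda>w. wcomp \<kappa> \<rho> (J w)"] conjI ballI)
    show "has_vint B (osc_term \<phi> (\<lambda>z. wcomp \<kappa> \<rho> (F z)) w) (wcomp \<kappa> \<rho> (J w))" if "w \<in> W" for w
      unfolding eq by (rule has_vint[OF J(1)[rule_format, OF that]])
  qed (rule has_vsum[OF J(2)])
qed

lemma osc_integral:
  assumes "has_osc_integral A W \<phi> F I"
  shows "osc_integral B W \<phi> (\<lambda>z. wcomp \<kappa> \<rho> (F z)) = wcomp \<kappa> \<rho> (osc_integral A W \<phi> F)"
  using cod.osc_integral_eq[OF has_osc_integral[OF assms]] dom.osc_integral_eq[OF assms] by simp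

abbreviation cu_op :: "('v \<times> 'n \<Rightarrow> complex) \<Rightarrow> 'v \<times> 'k \<Rightarrow> complex" where
  "cu_op \<equiv> wcomp (\<lambda>(v, k). \<kappa> k) (\<lambda>(v, k). (v, \<rho> k))"

lemma at_pt_cu_op: "at_pt (cu_op f) x = wcomp \<kappa> \<rho> (at_pt f x)"
  by (simp add: at_pt_def wcomp_def)

lemma cu_op_mem:
  fixes f :: "'v::euclidean_space \<times> 'n \<Rightarrow> complex"
  assumes f: "f \<in> elts (Cu A)"
  shows "cu_op f \<in> elts (Cu B)"
  unfolding cod.Cu_elts at_pt_cu_op
proof (intro conjI allI ballI impI)
  have fm: "at_pt f x \<in> elts A" for x using f unfolding dom.Cu_elts by blast
  show "wcomp \<kappa> \<rho> (at_pt f x) \<in> elts B" for x by (rule wcomp_mem[OF fm])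
  fix L assume "L \<in> \<L>"
  then obtain K C where K: "K \<in> \<K>" "C \<ge> 0" "\<forall>a\<in>elts A. supnorm L (wcomp \<kappa> \<rho> a) \<le> C * supnorm K a"
    using wcomp_bound by blast
  obtain C' where "\<forall>x. supnorm K (at_pt f x) \<le> C'" using f K(1) unfolding dom.Cu_elts by blast
  then have "supnorm L (wcomp \<kappa> \<rho> (at_pt f x)) \<le> C * C'" for x
    using K(3) fm K(2) by (meson mult_left_mono order_trans)
  then show "\<exists>C. \<forall>x. supnorm L (wcomp \<kappa> \<rho> (at_pt f x)) \<le> C" by blast
  fix \<epsilon> :: real assume \<epsilon>: "\<epsilon> > 0"
  define \<eta> where "\<eta> = \<epsilon> / (C + 1)"
  have \<eta>: "\<eta> > 0" using \<epsilon> K(2) by (simp add: \<eta>_def)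
  have C\<eta>: "C * \<eta> < \<epsilon>" using \<epsilon> K(2) by (simp add: \<eta>_def field_simps)
  obtain \<delta> where \<delta>: "\<delta> > 0" "\<forall>x y. dist x y < \<delta> \<longrightarrow> supnorm K (at_pt f x - at_pt f y) < \<eta>"
    using f K(1) \<eta> unfolding dom.Cu_elts by blast
  have "supnorm L (wcomp \<kappa> \<rho> (at_pt f x) - wcomp \<kappa> \<rho> (at_pt f y)) < \<epsilon>" if "dist x y < \<delta>" for x y
  proof -
    have "supnorm L (wcomp \<kappa> \<rho> (at_pt f x - at_pt f y)) \<le> C * supnorm K (at_pt f x - at_pt f y)"
      using K(3) dom.elts_diff'[OF fm fm] by blast
    also have "\<dots> \<le> C * \<eta>" using \<delta>(2) that K(2) by (intro mult_left_mono) (auto intro: less_imp_le)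
    finally show ?thesis using C\<eta> by (simp add: wcomp_diff)
  qed
  then show "\<exists>\<delta>>0. \<forall>x y. dist x y < \<delta> \<longrightarrow> supnorm L (wcomp \<kappa> \<rho> (at_pt f x) - wcomp \<kappa> \<rho> (at_pt f y)) < \<epsilon>"
    using \<delta>(1) by blast
qed

lemma cu_op_snorm:
  fixes r :: "('v::euclidean_space \<times> 'k \<Rightarrow> complex) \<Rightarrow> real"
  assumes "r \<in> snorms (Cu B)"
  shows "\<exists>r'\<in>snorms (Cu A). \<exists>C. \<forall>f\<in>elts (Cu A). 0 \<le> r (cu_op f) \<and> r (cu_op f) \<le> C * r' f"
proof -
  obtain L where L: "L \<in> \<L>" "r = (\<lambda>f. SUP x. supnorm L (at_pt f x))"
    using assms unfolding Cu_def by (auto simp: cod.snorms_eq)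
  obtain K C where K: "K \<in> \<K>" "C \<ge> 0" "\<forall>a\<in>elts A. supnorm L (wcomp \<kappa> \<rho> a) \<le> C * supnorm K a"
    using wcomp_bound[OF L(1)] by blast
  let ?r' = "\<lambda>f :: 'v \<times> 'n \<Rightarrow> complex. SUP x. supnorm K (at_pt f x)"
  have "?r' \<in> snorms (Cu A)" unfolding Cu_def using K(1) by (auto simp: dom.snorms_eq)
  moreover have "0 \<le> r (cu_op f) \<and> r (cu_op f) \<le> C * ?r' f" if f: "f \<in> elts (Cu A)" for f
  proof
    have fm: "at_pt f x \<in> elts A" for x using f unfolding dom.Cu_elts by blast
    have bK: "bdd_above (range (\<lambda>x. supnorm K (at_pt f x)))"
      using f K(1) unfolding dom.Cu_elts bdd_above_def by blast
    have bL: "bdd_above (range (\<lambda>x. supnorm L (wcomp \<kappa> \<rho> (at_pt f x))))"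
      using cu_op_mem[OF f] L(1) unfolding cod.Cu_elts at_pt_cu_op bdd_above_def by blast
    have "0 \<le> supnorm L (wcomp \<kappa> \<rho> (at_pt f 0))" by (rule cod.snorm_nonneg[OF wcomp_mem[OF fm] L(1)])
    also have "\<dots> \<le> r (cu_op f)" unfolding L(2) at_pt_cu_op by (rule cSUP_upper[OF UNIV_I bL])
    finally show "0 \<le> r (cu_op f)" .
    show "r (cu_op f) \<le> C * ?r' f" unfolding L(2) at_pt_cu_op
    proof (rule cSUP_least)
      fix x
      have "supnorm L (wcomp \<kappa> \<rho> (at_pt f x)) \<le> C * supnorm K (at_pt f x)" using K(3) fm by blast
      also have "\<dots> \<le> C * ?r' f" by (rule mult_left_mono[OF cSUP_upper[OF UNIV_I bK] K(2)])
      finally show "supnorm L (wcomp \<kappa> \<rho> (at_pt f x)) \<le> C * ?r' f" .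
    qed simp
  qed
  ultimately show ?thesis by (intro bexI[of _ ?r'] exI[of _ C]) auto
qed

text \<open>Both halves of the definition of Schwartz functions have to be transported: smoothness for the translation
action, which refers to the seminorms of \<open>Cu\<close>, and decay of the derivatives.\<close>

lemma schwartz:
  fixes g :: "'v::euclidean_space \<times> 'n \<Rightarrow> complex"
  assumes g: "g \<in> schwartz A"
  shows "cu_op g \<in> schwartz B"
proof -
  have gc: "g \<in> elts (Cu A)" and gs: "smooth_into (Cu A) (\<lambda>v. translation v g)"
    using g unfolding schwartz_def smooth_vectors_def by auto
  obtain D where D: "derivatives_into (Cu A) (\<lambda>v. translation v g) D" using gs unfolding smooth_into_def by blast
  \<comment> \<open>Multiplication by a constant is itself a weighted composition, which yields closure of \<open>Cu A\<close> under it.\<close>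
  have cm: "(\<lambda>n. c * a n) \<in> elts (Cu A)" if "a \<in> elts (Cu A)" for a :: "'v \<times> 'n \<Rightarrow> complex" and c
  proof -
    interpret id_op: weighted_composition S \<K> A S \<K> A "\<lambda>_. c" "\<lambda>n. n"
      by unfold_locales (auto simp: wcomp_def dom.elts_cmult intro!: dom.snorm_cmult_le bexI[of _ _ \<K>] exI[of _ "norm c"])
    show ?thesis using id_op.cu_op_mem[OF that] by (simp add: wcomp_def case_prod_beta')
  qed
  have "derivatives_into (Cu B) (\<lambda>v. cu_op (translation v g)) (\<lambda>es v. cu_op (D es v))"
    by (rule derivatives_into_wcomp[OF D dom.Cu_diff cm cu_op_mem cu_op_snorm])
  moreover have "cu_op (translation v g) = translation v (cu_op g)" for v
    by (rule ext) (simp add: translation_def wcomp_def case_prod_beta')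
  ultimately have sm: "cu_op g \<in> smooth_vectors (Cu B) translation"
    unfolding smooth_vectors_def smooth_into_def using cu_op_mem[OF gc] by auto
  let ?dec = "\<lambda>D. \<forall>es. set es \<subseteq> Basis \<longrightarrow> (\<forall>P. real_polynomial_function P \<longrightarrow> (\<forall>r\<in>snorms A.
        \<exists>C. \<forall>x. r (\<lambda>n. complex_of_real (P x) * D es x n) \<le> C))"
  have "\<exists>D. derivatives_into A (at_pt g) D \<and> ?dec D"
    using g unfolding schwartz_def mem_Collect_eq by (rule conjunct2)
  then obtain D where "derivatives_into A (at_pt g) D \<and> ?dec D" ..
  then have D: "derivatives_into A (at_pt g) D" and dec: "?dec D" by (rule conjunct1, rule conjunct2)
  have D': "derivatives_into B (at_pt (cu_op g)) (\<lambda>es v. wcomp \<kappa> \<rho> (D es v))"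
    using derivatives[OF D] by (simp add: at_pt_cu_op[abs_def])
  have dec': "\<exists>C. \<forall>x. r (\<lambda>n. complex_of_real (P x) * wcomp \<kappa> \<rho> (D es x) n) \<le> C"
    if es: "set es \<subseteq> Basis" and P: "real_polynomial_function P" and r: "r \<in> snorms B" for es P r
  proof -
    obtain r' C where r': "r' \<in> snorms A" "C \<ge> 0" "\<forall>a\<in>elts A. 0 \<le> r (wcomp \<kappa> \<rho> a) \<and> r (wcomp \<kappa> \<rho> a) \<le> C * r' a"
      using wcomp_snorm[OF r] by blast
    obtain C' where C': "\<forall>x. r' (\<lambda>n. complex_of_real (P x) * D es x n) \<le> C'"
      using dec[rule_format, OF es P r'(1)] by blast
    have m: "(\<lambda>n. complex_of_real (P x) * D es x n) \<in> elts A" for x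
      using D es unfolding derivatives_into_def by (intro dom.elts_cmult) blast
    have "r (\<lambda>n. complex_of_real (P x) * wcomp \<kappa> \<rho> (D es x) n) \<le> C * C'" for x
      unfolding wcomp_cmult[symmetric]
      using r'(3) m C' r'(2) by (meson mult_left_mono order_trans)
    then show ?thesis by blast
  qed
  show ?thesis unfolding schwartz_def mem_Collect_eq using sm D' dec' by blast
qed

end

section \<open>Continuity for topologies given by seminorms\<close>

lemma continuous_map_seminorm_topology:
  assumes h: "\<And>a. a \<in> V \<Longrightarrow> h a \<in> V'"
    and diff: "\<And>a b. a \<in> V \<Longrightarrow> b \<in> V \<Longrightarrow> b - a \<in> V \<and> h (b - a) = h b - h a"
    and bd: "\<And>r'. r' \<in> R' \<Longrightarrow> \<exists>r\<in>R. \<forall>a\<in>V. r' (h a) \<le> r a"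
  shows "continuous_map (seminorm_topology V R) (seminorm_topology V' R') h"
  unfolding continuous_map topspace_seminorm_topology openin_seminorm_topology
proof (intro conjI allI impI)
  show "h ` V \<subseteq> V'" using h by blast
  fix U assume U: "seminorm_open V' R' U"
  show "seminorm_open V R {x \<in> V. h x \<in> U}"
    unfolding seminorm_open_def
  proof (intro conjI ballI)
    fix a assume "a \<in> {x \<in> V. h x \<in> U}"
    then have a: "a \<in> V" "h a \<in> U" by auto
    obtain S \<epsilon> where S: "finite S" "S \<subseteq> R'" "0 < \<epsilon>" "\<forall>b\<in>V'. (\<forall>r\<in>S. r (b - h a) < \<epsilon>) \<longrightarrow> b \<in> U"
      using U a(2) unfolding seminorm_open_def by blast
    have "\<forall>r'\<in>R'. \<exists>r. r \<in> R \<and> (\<forall>a\<in>V. r' (h a) \<le> r a)" using bd by blast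
    from bchoice[OF this] obtain \<sigma> where \<sigma>: "\<forall>r'\<in>R'. \<sigma> r' \<in> R \<and> (\<forall>a\<in>V. r' (h a) \<le> \<sigma> r' a)" by blast
    have "b \<in> {x \<in> V. h x \<in> U}" if b: "b \<in> V" "\<forall>r\<in>\<sigma> ` S. r (b - a) < \<epsilon>" for b
    proof -
      have "r (h b - h a) < \<epsilon>" if r: "r \<in> S" for r
      proof -
        have "r (h (b - a)) \<le> \<sigma> r (b - a)" using \<sigma> S(2) r diff[OF a(1) b(1)] by blast
        also have "\<dots> < \<epsilon>" using b(2) r by blast
        finally show ?thesis using diff[OF a(1) b(1)] by simp
      qed
      then show ?thesis using S(4) h b(1) by blast
    qed
    moreover have "\<sigma> ` S \<subseteq> R" using \<sigma> S(2) by blast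
    ultimately show "\<exists>S \<epsilon>. finite S \<and> S \<subseteq> R \<and> 0 < \<epsilon> \<and> (\<forall>b\<in>V. (\<forall>r\<in>S. r (b - a) < \<epsilon>) \<longrightarrow> b \<in> {x \<in> V. h x \<in> U})"
      using S(1,3) by (intro exI[of _ "\<sigma> ` S"] exI[of _ \<epsilon>]) blast
  qed auto
qed

text \<open>Neighbourhoods in the deformed topology are described by differences, so these have to be smooth vectors
again.\<close>

lemma (in sup_algebra) smooth_vectors_diff:
  fixes \<alpha> :: "'v::euclidean_space \<Rightarrow> ('n \<Rightarrow> complex) \<Rightarrow> 'n \<Rightarrow> complex"
  assumes a: "a \<in> smooth_vectors A \<alpha>" and b: "b \<in> smooth_vectors A \<alpha>"
    and lin: "\<And>v. \<alpha> v (b - a) = \<alpha> v b - \<alpha> v a"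
  shows "b - a \<in> smooth_vectors A \<alpha>"
proof -
  obtain D where D: "derivatives_into A (\<lambda>v. \<alpha> v a) D" using a unfolding smooth_vectors_def smooth_into_def by blast
  obtain D' where D': "derivatives_into A (\<lambda>v. \<alpha> v b) D'" using b unfolding smooth_vectors_def smooth_into_def by blast
  let ?D = "\<lambda>es v. D' es v - D es v"
  have m: "D es x \<in> elts A" "D' es x \<in> elts A" if "set es \<subseteq> Basis" for es x
    using D D' that unfolding derivatives_into_def by blast+
  have lim: "((\<lambda>y. supnorm L (G' y - G y)) \<longlongrightarrow> 0) F"
    if "L \<in> \<L>" "\<And>y. G y \<in> elts A" "\<And>y. G' y \<in> elts A"
      "((\<lambda>y. supnorm L (G y)) \<longlongrightarrow> 0) F" "((\<lambda>y. supnorm L (G' y)) \<longlongrightarrow> 0) F"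
    for L F and G G' :: "'y \<Rightarrow> 'n \<Rightarrow> complex"
  proof (rule tendsto_sandwich[where f="\<lambda>_. 0" and h="\<lambda>y. supnorm L (G' y) + supnorm L (G y)"])
    show "((\<lambda>y. supnorm L (G' y) + supnorm L (G y)) \<longlongrightarrow> 0) F" using tendsto_add[OF that(5,4)] by simp
  qed (use snorm_nonneg[OF elts_diff'[OF that(3,2)] that(1)] snorm_diff_le[OF that(3,2,1)] in auto)
  have "derivatives_into A (\<lambda>v. \<alpha> v (b - a)) ?D"
    unfolding derivatives_into_def
  proof (intro conjI allI impI ballI)
    show "?D [] = (\<lambda>v. \<alpha> v (b - a))" using D D' unfolding derivatives_into_def lin by simp
    fix es :: "'v list" and x r
    assume es: "set es \<subseteq> Basis"
    show "?D es x \<in> elts A" by (rule elts_diff'[OF m(2)[OF es] m(1)[OF es]])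
    assume "r \<in> snorms A"
    then obtain L where L: "L \<in> \<L>" "r = supnorm L" by (auto simp: snorms_eq)
    have s: "supnorm L \<in> snorms A" using L by (auto simp: snorms_eq)
    have "((\<lambda>y. supnorm L ((D' es y - D' es x) - (D es y - D es x))) \<longlongrightarrow> 0) (at x)"
      by (rule lim[OF L(1)]) (use D D' es s m[OF es] in \<open>auto simp: derivatives_into_def intro: elts_diff'\<close>)
    then show "((\<lambda>y. r (?D es y - ?D es x)) \<longlongrightarrow> 0) (at x)" unfolding L(2) by (simp add: algebra_simps)
    fix e :: "'v" assume e: "e \<in> Basis"
    let ?q = "\<lambda>D t n. (D es (x + t *\<^sub>R e) n - D es x n) / complex_of_real t - D (e # es) x n"
    have q: "?q G t \<in> elts A" if "\<And>es x. set es \<subseteq> Basis \<Longrightarrow> G es x \<in> elts A" for t and G :: "'v list \<Rightarrow> 'v \<Rightarrow> 'n \<Rightarrow> complex"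
    proof -
      have "(\<lambda>n. inverse (complex_of_real t) * (G es (x + t *\<^sub>R e) - G es x) n) - G (e # es) x \<in> elts A"
        using es e by (intro elts_diff' elts_cmult that) auto
      then show ?thesis by (simp add: fun_diff_def divide_inverse mult.commute)
    qed
    have "((\<lambda>t. supnorm L (?q D' t - ?q D t)) \<longlongrightarrow> 0) (at 0)"
    proof (rule lim[OF L(1) q[of D, OF m(1)] q[of D', OF m(2)]])
      show "((\<lambda>t. supnorm L (?q D t)) \<longlongrightarrow> 0) (at 0)" using D es e s unfolding derivatives_into_def by blast
      show "((\<lambda>t. supnorm L (?q D' t)) \<longlongrightarrow> 0) (at 0)" using D' es e s unfolding derivatives_into_def by blast
    qed
    moreover have "?q D' t - ?q D t = ?q ?D t" for t
      by (rule ext) (simp add: fun_diff_def diff_divide_distrib)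
    ultimately show "((\<lambda>t. r (?q ?D t)) \<longlongrightarrow> 0) (at 0)" unfolding L(2) by simp
  qed
  moreover have "b - a \<in> elts A" using a b elts_diff' unfolding smooth_vectors_def by blast
  ultimately show ?thesis unfolding smooth_vectors_def smooth_into_def by blast
qed

section \<open>Equivariant restriction to a retract\<close>

text \<open>Restriction along \<open>\<iota>\<close>, with actions that it intertwines. Boundedness of the orbit maps makes the deformed
product over \<open>S\<close> exist.\<close>

locale equivariant_restriction =
  res: weighted_composition S \<K> A T \<L> B "\<lambda>_. 1" \<iota>
  for S :: "'n topology" and \<K> A and T :: "'k topology" and \<L> B and \<iota> :: "'k \<Rightarrow> 'n" +
  fixes W :: "((real^'d) \<times> (real^'d)) set" and \<phi> and \<Theta> :: "real^'d^'d"
    and \<alpha> :: "real^'d \<Rightarrow> ('n \<Rightarrow> complex) \<Rightarrow> 'n \<Rightarrow> complex"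
    and \<beta> :: "real^'d \<Rightarrow> ('k \<Rightarrow> complex) \<Rightarrow> 'k \<Rightarrow> complex"
    and h :: "('n \<Rightarrow> complex) \<Rightarrow> 'k \<Rightarrow> complex"
  assumes W: "lattice_partition W \<phi>"
    and h_def: "h = wcomp (\<lambda>_. 1) \<iota>"
    and equivariant: "\<beta> v (h a) = h (\<alpha> v a)"
    and bounded_orbits: "a \<in> smooth_vectors A \<alpha> \<Longrightarrow> res.dom.smooth_bound (\<lambda>_. 1) (\<lambda>v. \<alpha> v a)"
    and action_diff: "\<alpha> v (b - a) = \<alpha> v b - \<alpha> v a"
begin

lemma h_mult: "h (a * b) = h a * h b"
  by (simp add: h_def wcomp_def times_fun_def)

lemma h_smooth:
  assumes "a \<in> smooth_vectors A \<alpha>"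
  shows "h a \<in> smooth_vectors B \<beta>"
proof -
  obtain D where "derivatives_into A (\<lambda>v. \<alpha> v a) D" and a: "a \<in> elts A"
    using assms unfolding smooth_vectors_def smooth_into_def by blast
  from res.derivatives[OF this(1)]
  have "derivatives_into B (\<lambda>v. \<beta> v (h a)) (\<lambda>es v. h (D es v))" by (simp add: equivariant) (simp add: h_def)
  then show ?thesis using res.wcomp_mem[OF a] unfolding smooth_vectors_def smooth_into_def h_def by blast
qed

lemma h_deformed_prod:
  assumes "a \<in> smooth_vectors A \<alpha>" "b \<in> smooth_vectors A \<alpha>"
  shows "h (deformed_prod A W \<phi> \<Theta> \<alpha> a b) = deformed_prod B W \<phi> \<Theta> \<beta> (h a) (h b)"
proof -
  have tw: "twist \<Theta> (\<lambda>v. \<alpha> v a) (\<lambda>v. \<alpha> v b) 0 = (\<lambda>(u, v). \<alpha> (\<Theta> *v u) a * \<alpha> v b)"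
    by (simp add: twist_def)
  have "has_osc_integral A W \<phi> (\<lambda>(u, v). \<alpha> (\<Theta> *v u) a * \<alpha> v b) (twist_integral W \<phi> \<Theta> (\<lambda>v. \<alpha> v a) (\<lambda>v. \<alpha> v b) 0)"
    unfolding tw[symmetric] by (rule res.dom.twist_has_osc_integral[OF W bounded_orbits[OF assms(1)] bounded_orbits[OF assms(2)]])
  from res.osc_integral[OF this]
  have "h (deformed_prod A W \<phi> \<Theta> \<alpha> a b) = osc_integral B W \<phi> (\<lambda>z. h ((\<lambda>(u, v). \<alpha> (\<Theta> *v u) a * \<alpha> v b) z))"
    unfolding deformed_prod_def h_def by simp
  also have "(\<lambda>z. h ((\<lambda>(u, v). \<alpha> (\<Theta> *v u) a * \<alpha> v b) z)) = (\<lambda>(u, v). \<beta> (\<Theta> *v u) (h a) * \<beta> v (h b))"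
    by (rule ext) (simp add: case_prod_beta' h_mult equivariant)
  finally show ?thesis unfolding deformed_prod_def .
qed

lemma star_hom: "deformed_star_hom W \<phi> \<Theta> A \<alpha> B \<beta> h"
  unfolding deformed_star_hom_def
  using h_smooth h_deformed_prod by (auto simp: h_def wcomp_def plus_fun_def)

end

text \<open>The functions \<open>\<rho>\<close> and \<open>\<eta>\<close> provide a right inverse \<open>f \<mapsto> \<eta> \<cdot> (f \<circ> \<rho>)\<close> of the restriction. The weight
\<open>\<eta>\<^sup>2\<close> occurs because the inner product of extended functions involves \<open>|\<eta> g|\<^sup>2\<close>.\<close>

locale equivariant_retract =
  equivariant_restriction S \<K> A T \<L> B \<iota> W \<phi> \<Theta> \<alpha> \<beta> h +
  ext: weighted_composition T \<L> B S \<K> A "\<lambda>n. complex_of_real (\<eta> n)" \<rho> +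
  ext2: weighted_composition T \<L> B S \<K> A "\<lambda>n. complex_of_real ((\<eta> n)\<^sup>2)" \<rho>
  for S :: "'n topology" and \<K> A and T :: "'k topology" and \<L> B and \<iota> :: "'k \<Rightarrow> 'n"
    and W :: "((real^'d) \<times> (real^'d)) set" and \<phi> and \<Theta> :: "real^'d^'d" and \<alpha> \<beta> h
    and \<eta> :: "'n \<Rightarrow> real" and \<rho> :: "'n \<Rightarrow> 'k" +
  assumes retract: "\<rho> (\<iota> k) = k" "\<eta> (\<iota> k) = 1"
begin

text \<open>A test function \<open>g'\<close> for \<open>h a\<close> is extended to \<open>g\<close>. The second hypothesis says that extending does not
increase the norm, so \<open>g\<close> is a test function for \<open>a\<close>. As \<open>h\<close> maps the product of the orbit map of \<open>a\<close>
with \<open>g\<close> to that of the orbit map of \<open>h a\<close> with \<open>g'\<close>, the first hypothesis compares the results. The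
inner products and oscillatory integrals are defined by definite description, so their existence
over \<open>S\<close> is established first.\<close>

lemma deformed_seminorm_le:
  assumes a: "a \<in> smooth_vectors A \<alpha>"
    and q: "\<And>a. a \<in> elts A \<Longrightarrow> q' (h a) \<le> q a"
    and q': "\<And>b. b \<in> elts B \<Longrightarrow> q (wcomp (\<lambda>n. complex_of_real ((\<eta> n)\<^sup>2)) \<rho> b) \<le> q' b"
  shows "deformed_seminorm B W \<phi> \<Theta> \<beta> q' (h a) \<le> deformed_seminorm A W \<phi> \<Theta> \<alpha> q a"
  unfolding deformed_seminorm_def
proof (rule SUP_least)
  fix g' :: "(real^'d) \<times> 'k \<Rightarrow> complex"
  assume "g' \<in> {g \<in> schwartz B. schwartz_norm B q' g \<le> 1}"
  then have g': "g' \<in> schwartz B" "schwartz_norm B q' g' \<le> 1" by auto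
  define g where "g = ext.cu_op g'"
  have g: "g \<in> schwartz A" unfolding g_def by (rule ext.schwartz[OF g'(1)])
  have gb: "res.dom.smooth_bound lattice_weight (at_pt g)" by (rule res.dom.schwartz_smooth_bound[OF g])
  have gb1: "res.dom.smooth_bound (\<lambda>_. 1) (at_pt g)" by (rule res.dom.smooth_bound_mono[OF gb lattice_weight_le_1])
  have gb': "res.cod.smooth_bound lattice_weight (at_pt g')" by (rule res.cod.schwartz_smooth_bound[OF g'(1)])
  have gb1': "res.cod.smooth_bound (\<lambda>_. 1) (at_pt g')" by (rule res.cod.smooth_bound_mono[OF gb' lattice_weight_le_1])
  have "has_vint B (\<lambda>v n. cnj (at_pt g' v n) * at_pt g' v n) (\<lambda>n. \<integral>v. cnj (at_pt g' v n) * at_pt g' v n \<partial>lborel)"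
  proof (rule res.cod.square_has_vint)
    show "at_pt g' v \<in> elts B" for v by (rule res.cod.smooth_bound_elts[OF gb'])
    show "uniform_limit L (at_pt g') (at_pt g' v) (at v)" if "L \<in> \<L>" for L v
      using res.cod.smooth_bound_Lipschitz[OF gb1' that] res.cod.uniform_limit_of_Lipschitz by blast
    show "\<exists>C\<ge>0. \<forall>n\<in>L. \<forall>v. norm (at_pt g' v n) \<le> C * lattice_weight v" if "L \<in> \<L>" for L
      by (rule res.cod.smooth_bound_bound[OF gb' that])
  qed
  then have vg': "has_vint B (\<lambda>v n. cnj (g' (v, n)) * g' (v, n)) (\<lambda>n. \<integral>v. cnj (g' (v, n)) * g' (v, n) \<partial>lborel)"
    by (simp add: at_pt_def)
  have "schwartz_inner A g g = wcomp (\<lambda>n. complex_of_real ((\<eta> n)\<^sup>2)) \<rho> (schwartz_inner B g' g')"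
    unfolding schwartz_inner_def ext2.vint[OF vg', symmetric]
    by (rule arg_cong[where f="vint A"]) (auto simp: g_def wcomp_def power2_eq_square mult_ac intro!: ext)
  moreover have "schwartz_inner B g' g' \<in> elts B"
    using vg' res.cod.vint_eq[OF vg'] unfolding schwartz_inner_def has_vint_def by simp
  ultimately have "schwartz_norm A q g \<le> schwartz_norm B q' g'"
    unfolding schwartz_norm_def using q' by simp
  then have gn: "schwartz_norm A q g \<le> 1" using g'(2) by simp
  let ?F = "\<lambda>v. \<alpha> v a"
  have Fb: "res.dom.smooth_bound (\<lambda>_. 1) ?F" by (rule bounded_orbits[OF a])
  define P where "P = twist_integral W \<phi> \<Theta> ?F (at_pt g)"
  note osc = res.dom.twist_has_osc_integral[OF W Fb gb1, of \<Theta>, folded P_def]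
  have CuA: "Cu_prod A W \<phi> \<Theta> (orbit_map \<alpha> a) g = (\<lambda>(x, n). P x n)"
  proof -
    have "(\<lambda>(u, v). at_pt (orbit_map \<alpha> a) (x + \<Theta> *v u) * at_pt g (x + v)) = twist \<Theta> ?F (at_pt g) x" for x
      by (simp add: twist_def at_pt_def orbit_map_def)
    then show ?thesis unfolding Cu_prod_def by (simp add: res.dom.osc_integral_eq[OF osc])
  qed
  have CuB: "Cu_prod B W \<phi> \<Theta> (orbit_map \<beta> (h a)) g' = (\<lambda>(x, n). h (P x) n)"
  proof -
    have hg: "h (at_pt g v) = at_pt g' v" for v
      unfolding h_def g_def by (rule ext) (simp add: at_pt_def wcomp_def retract)
    have "(\<lambda>(u, v). at_pt (orbit_map \<beta> (h a)) (x + \<Theta> *v u) * at_pt g' (x + v)) =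
        (\<lambda>z. h (twist \<Theta> ?F (at_pt g) x z))" for x
      by (rule ext) (simp add: twist_def case_prod_beta' h_mult hg, simp add: at_pt_def orbit_map_def equivariant)
    moreover have "osc_integral B W \<phi> (\<lambda>z. h (twist \<Theta> ?F (at_pt g) x z)) = h (P x)" for x
      using res.osc_integral[OF osc] res.dom.osc_integral_eq[OF osc] unfolding h_def by simp
    ultimately show ?thesis unfolding Cu_prod_def by simp
  qed
  have vP: "has_vint A (\<lambda>v n. cnj (P v n) * P v n) (\<lambda>n. \<integral>v. cnj (P v n) * P v n \<partial>lborel)"
  proof (rule res.dom.square_has_vint)
    show "P v \<in> elts A" for v unfolding P_def by (rule res.dom.twist_integral_elts[OF W Fb gb1])
    show "uniform_limit L P (P v) (at v)" if "L \<in> \<K>" for L v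
      unfolding P_def by (rule res.dom.twist_integral_continuous[OF W Fb gb1 that])
    show "\<exists>C\<ge>0. \<forall>n\<in>L. \<forall>v. norm (P v n) \<le> C * lattice_weight v" if "L \<in> \<K>" for L
      unfolding P_def by (rule res.dom.twist_integral_decay[OF W Fb gb that])
  qed
  have "schwartz_inner B (\<lambda>(x, n). h (P x) n) (\<lambda>(x, n). h (P x) n) = h (schwartz_inner A (\<lambda>(x, n). P x n) (\<lambda>(x, n). P x n))"
    unfolding schwartz_inner_def using res.vint[OF vP] by (simp add: h_def wcomp_def)
  moreover have "schwartz_inner A (\<lambda>(x, n). P x n) (\<lambda>(x, n). P x n) \<in> elts A"
    using vP res.dom.vint_eq[OF vP] unfolding schwartz_inner_def has_vint_def by simp
  ultimately have "schwartz_norm B q' (Cu_prod B W \<phi> \<Theta> (orbit_map \<beta> (h a)) g') \<le>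
      schwartz_norm A q (Cu_prod A W \<phi> \<Theta> (orbit_map \<alpha> a) g)"
    unfolding schwartz_norm_def CuA CuB using q by simp
  then have "ennreal (schwartz_norm B q' (Cu_prod B W \<phi> \<Theta> (orbit_map \<beta> (h a)) g')) \<le>
      ennreal (schwartz_norm A q (Cu_prod A W \<phi> \<Theta> (orbit_map \<alpha> a) g))"
    by (rule ennreal_leI)
  also have "\<dots> \<le> (SUP g\<in>{g \<in> schwartz A. schwartz_norm A q g \<le> 1}.
      ennreal (schwartz_norm A q (Cu_prod A W \<phi> \<Theta> (orbit_map \<alpha> a) g)))"
    using g gn by (intro SUP_upper) auto
  finally show "ennreal (schwartz_norm B q' (Cu_prod B W \<phi> \<Theta> (orbit_map \<beta> (h a)) g')) \<le>
    (SUP g\<in>{g \<in> schwartz A. schwartz_norm A q g \<le> 1}.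
      ennreal (schwartz_norm A q (Cu_prod A W \<phi> \<Theta> (orbit_map \<alpha> a) g)))" .
qed

lemma continuous_deformed_topology:
  assumes "\<And>q'. q' \<in> Q' \<Longrightarrow> \<exists>q\<in>Q. (\<forall>a\<in>elts A. q' (h a) \<le> q a) \<and>
     (\<forall>b\<in>elts B. q (wcomp (\<lambda>n. complex_of_real ((\<eta> n)\<^sup>2)) \<rho> b) \<le> q' b)"
  shows "continuous_map (deformed_topology A Q W \<phi> \<Theta> \<alpha>) (deformed_topology B Q' W \<phi> \<Theta> \<beta>) h"
  unfolding deformed_topology_def
proof (rule continuous_map_seminorm_topology)
  show "h a \<in> smooth_vectors B \<beta>" if "a \<in> smooth_vectors A \<alpha>" for a by (rule h_smooth[OF that])
  show "b - a \<in> smooth_vectors A \<alpha> \<and> h (b - a) = h b - h a"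
    if "a \<in> smooth_vectors A \<alpha>" "b \<in> smooth_vectors A \<alpha>" for a b
  proof
    show "b - a \<in> smooth_vectors A \<alpha>"
      by (rule res.dom.smooth_vectors_diff[where \<alpha>=\<alpha>]) (rule that action_diff)+
    show "h (b - a) = h b - h a" by (simp add: h_def wcomp_diff)
  qed
  fix r' assume "r' \<in> deformed_seminorm B W \<phi> \<Theta> \<beta> ` Q'"
  then obtain q' where q': "q' \<in> Q'" "r' = deformed_seminorm B W \<phi> \<Theta> \<beta> q'" by blast
  obtain q where q0: "q \<in> Q" "(\<forall>a\<in>elts A. q' (h a) \<le> q a) \<and>
     (\<forall>b\<in>elts B. q (wcomp (\<lambda>n. complex_of_real ((\<eta> n)\<^sup>2)) \<rho> b) \<le> q' b)"
    using assms[OF q'(1)] by (rule bexE)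
  note q = q0(1) conjunct1[OF q0(2)] conjunct2[OF q0(2)]
  have "r' (h a) \<le> deformed_seminorm A W \<phi> \<Theta> \<alpha> q a" if "a \<in> smooth_vectors A \<alpha>" for a
    unfolding q'(2)
    by (rule deformed_seminorm_le[OF that]) (rule q(2)[rule_format], assumption, rule q(3)[rule_format], assumption)
  then show "\<exists>r\<in>deformed_seminorm A W \<phi> \<Theta> \<alpha> ` Q. \<forall>a\<in>smooth_vectors A \<alpha>. r' (h a) \<le> r a"
    using q(1) by (intro bexI[of _ "deformed_seminorm A W \<phi> \<Theta> \<alpha> q"]) auto
qed

end

section \<open>Flows of fundamental vector fields\<close>

text \<open>The properties of an atlas on which the uniqueness of flows rests, isolated so that for the tangent bundle
only these have to be checked.\<close>

definition charted :: "('a, 'e::euclidean_space) mfd \<Rightarrow> bool" where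
  "charted N \<longleftrightarrow> (\<Union>c\<in>atlas N. fst c) = points N \<and>
     (\<forall>c\<in>atlas N. openin (mtop N) (fst c) \<and> inj_on (snd c) (fst c))"

lemma chart_at_works:
  assumes "charted N" "x \<in> points N"
  shows "chart_at N x \<in> atlas N" "x \<in> fst (chart_at N x)"
proof -
  have "\<exists>c. c \<in> atlas N \<and> x \<in> fst c" using assms unfolding charted_def by blast
  then have "chart_at N x \<in> atlas N \<and> x \<in> fst (chart_at N x)"
    unfolding chart_at_def by (rule someI_ex)
  then show "chart_at N x \<in> atlas N" "x \<in> fst (chart_at N x)" by auto
qed

lemma smooth_action_chart_differentiable:
  fixes \<psi> :: "real^'d \<Rightarrow> 'a \<Rightarrow> 'a" and N :: "('a, 'e::euclidean_space) mfd"
  assumes N: "charted N" and \<psi>: "smooth_action N \<psi>"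
    and c: "c \<in> atlas N" "x \<in> fst c" and c': "c' \<in> atlas N" "\<psi> v x \<in> fst c'"
  shows "\<exists>G. G differentiable (at (v, snd c x)) \<and> (\<forall>w. \<forall>y\<in>fst c. G (w, snd c y) = snd c' (\<psi> w y))"
proof -
  let ?c = "(UNIV \<times> fst c, map_prod id (snd c)) :: ((real^'d) \<times> 'a, (real^'d) \<times> 'e) chart"
  let ?F = "\<lambda>(v, x). \<psi> v x"
  let ?G = "snd c' \<circ> ?F \<circ> chart_inv ?c"
  have inj: "inj_on (snd c) (fst c)" using N c(1) unfolding charted_def by blast
  have "?c \<in> atlas (prod_mfd vector_mfd N)"
    unfolding prod_mfd_def vector_mfd_def using c(1) by force
  then have "smooth_on (snd ?c ` (fst ?c \<inter> ?F -` fst c')) ?G"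
    using \<psi> c'(1) unfolding smooth_action_def smooth_map_def by blast
  then have "Ck_on (Suc 0) (snd ?c ` (fst ?c \<inter> ?F -` fst c')) ?G" unfolding smooth_on_def by blast
  then have "\<forall>z\<in>snd ?c ` (fst ?c \<inter> ?F -` fst c'). ?G differentiable (at z)"
    unfolding Ck_on.simps by (rule conjunct1)
  moreover have "(v, snd c x) \<in> snd ?c ` (fst ?c \<inter> ?F -` fst c')"
    using c(2) c'(2) by (intro image_eqI[of _ _ "(v, x)"]) auto
  ultimately have "?G differentiable (at (v, snd c x))" by (rule bspec)
  moreover have "?G (w, snd c y) = snd c' (\<psi> w y)" if y: "y \<in> fst c" for w y
  proof -
    have "inj_on (map_prod id (snd c)) ((UNIV :: (real^'d) set) \<times> fst c)"
      using inj by (auto simp: inj_on_def)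
    then have "chart_inv ?c (map_prod id (snd c) (w, y)) = (w, y)"
      unfolding chart_inv_def using inv_into_f_f[of "map_prod id (snd c)" "(UNIV :: (real^'d) set) \<times> fst c" "(w, y)"] y
      by (simp only: fst_conv snd_conv mem_Times_iff UNIV_I)
    then show ?thesis by simp
  qed
  ultimately show ?thesis by (intro exI[of _ ?G]) simp
qed

lemma smooth_action_continuous:
  assumes \<psi>: "smooth_action N \<psi>" and f: "continuous_map X euclidean f" and g: "continuous_map X (mtop N) g"
  shows "continuous_map X (mtop N) (\<lambda>t. \<psi> (f t) (g t))"
proof -
  have "continuous_map (prod_topology euclidean (mtop N)) (mtop N) (\<lambda>(v, x). \<psi> v x)"
    using \<psi> unfolding smooth_action_def smooth_map_def prod_mfd_def vector_mfd_def by simp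
  from continuous_map_compose[OF _ this, of X "\<lambda>t. (f t, g t)"] f g
  show ?thesis by (simp add: o_def continuous_map_paired)
qed

lemma smooth_action_points:
  assumes "smooth_action N \<psi>" "x \<in> points N"
  shows "\<psi> v x \<in> points N"
proof -
  have "continuous_map (prod_topology euclidean (mtop N)) (mtop N) (\<lambda>(v, x). \<psi> v x)"
    using assms(1) unfolding smooth_action_def smooth_map_def prod_mfd_def vector_mfd_def by simp
  from continuous_map_image_subset_topspace[OF this] show ?thesis using assms(2) by auto
qed

lemma integral_curve_points: "integral_curve N Z c \<Longrightarrow> c t \<in> points N"
  unfolding integral_curve_def using continuous_map_image_subset_topspace by fastforce

lemma continuous_map_real_eventually:
  assumes "continuous_map euclideanreal X c" "openin X U" "c t \<in> U"
  shows "\<forall>\<^sub>F s in nhds t. c s \<in> U"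
proof -
  have "openin euclideanreal {s \<in> topspace euclideanreal. c s \<in> U}"
    using assms(1,2) by (rule openin_continuous_map_preimage)
  then have "open {s. c s \<in> U}" by simp
  then show ?thesis using assms(3) eventually_nhds_in_open by fastforce
qed

lemma has_vector_derivative_transform_nhds:
  assumes "(f has_vector_derivative f') (at t)" "\<forall>\<^sub>F s in nhds t. f s = g s"
  shows "(g has_vector_derivative f') (at t)"
proof -
  have "\<forall>\<^sub>F s in at t. f s = g s" using assms(2) by (auto simp: eventually_at_filter elim!: eventually_mono)
  moreover have "f t = g t" by (rule eventually_nhds_x_imp_x[OF assms(2)])
  ultimately show ?thesis
    using assms(1) has_derivative_transform_eventually[of f _ t UNIV g] unfolding has_vector_derivative_def by simp
qed

text \<open>The fundamental field is the derivative of the action at time 0; the group law moves this to any time.\<close>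

lemma orbit_integral_curve:
  assumes N: "charted N" and \<psi>: "smooth_action N \<psi>" and X: "fundamental_fields N \<psi> X" and x: "x \<in> points N"
  shows "integral_curve N (X i) (\<lambda>t. \<psi> (t *\<^sub>R axis i 1) x)"
  unfolding integral_curve_def
proof (intro conjI allI)
  show "continuous_map euclideanreal (mtop N) (\<lambda>t. \<psi> (t *\<^sub>R axis i 1) x)"
    by (rule smooth_action_continuous[OF \<psi>]) (auto intro!: continuous_intros simp: x)
  fix t
  let ?y = "\<psi> (t *\<^sub>R axis i 1) x"
  have y: "?y \<in> points N" by (rule smooth_action_points[OF \<psi> x])
  have "((\<lambda>s. coord N ?y (\<psi> (s *\<^sub>R axis i 1) ?y)) has_vector_derivative X i ?y) (at (t - t))"
    using X y unfolding fundamental_fields_def by simp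
  then have "((\<lambda>s. coord N ?y (\<psi> (s *\<^sub>R axis i 1) ?y)) \<circ> (\<lambda>s. s - t) has_vector_derivative (1 *\<^sub>R X i ?y)) (at t)"
    by (intro vector_diff_chain_at) (auto intro!: derivative_eq_intros)
  moreover have "\<psi> ((s - t) *\<^sub>R axis i 1) ?y = \<psi> (s *\<^sub>R axis i 1) x" for s
  proof -
    have "\<psi> ((s - t) *\<^sub>R axis i 1 + t *\<^sub>R axis i 1) x = \<psi> ((s - t) *\<^sub>R axis i 1) ?y"
      using \<psi> x unfolding smooth_action_def by blast
    then show ?thesis by (simp add: scaleR_left_distrib[symmetric])
  qed
  ultimately show "((\<lambda>s. coord N ?y (\<psi> (s *\<^sub>R axis i 1) x)) has_vector_derivative X i ?y) (at t)"
    by (simp add: o_def)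
qed

text \<open>Let \<open>G (v, \<cdot>)\<close> be \<open>\<psi> v\<close> in charts around \<open>c t\<close> and around its image under \<open>\<psi> (- t *\<^sub>R axis i 1)\<close>. Moving
along the group and moving along the orbit of \<open>c t\<close> describe the same curve
\<open>s \<mapsto> \<psi> ((s - t) *\<^sub>R axis i 1) (c t)\<close>, so the derivatives of \<open>G\<close> in these two directions agree. The
derivative of the pulled back curve is their difference. This replaces the uniqueness theorem for
ordinary differential equations.\<close>

lemma integral_curve_pulled_back_derivative:
  fixes \<psi> :: "real^'d \<Rightarrow> 'a \<Rightarrow> 'a" and N :: "('a, 'e::euclidean_space) mfd"
  assumes N: "charted N" and \<psi>: "smooth_action N \<psi>" and X: "fundamental_fields N \<psi> X"
    and c: "integral_curve N (X i) c" and b: "b \<in> atlas N" "\<psi> (- t *\<^sub>R axis i 1) (c t) \<in> fst b"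
  shows "((\<lambda>s. snd b (\<psi> (- s *\<^sub>R axis i 1) (c s))) has_vector_derivative 0) (at t)"
proof -
  define e :: "real^'d" where "e = axis i 1"
  define y where "y = c t"
  define a where "a = chart_at N y"
  have y: "y \<in> points N" unfolding y_def by (rule integral_curve_points[OF c])
  have a: "a \<in> atlas N" "y \<in> fst a" unfolding a_def by (rule chart_at_works[OF N y])+
  have oa: "openin (mtop N) (fst a)" using N a(1) unfolding charted_def by blast
  have bz: "\<psi> (- t *\<^sub>R e) y \<in> fst b" using b(2) by (simp add: e_def y_def)
  obtain G where G0: "G differentiable (at (- t *\<^sub>R e, snd a y))"
    "\<forall>w. \<forall>y\<in>fst a. G (w, snd a y) = snd b (\<psi> w y)"
    using smooth_action_chart_differentiable[OF N \<psi> a b(1) bz] by blast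
  note G = G0(1) G0(2)[rule_format]
  obtain D where D: "(G has_derivative D) (at (- t *\<^sub>R e, snd a y))"
    using G(1) unfolding differentiable_def by blast
  have lin: "linear D" by (rule has_derivative_linear[OF D])
  have chain: "((\<lambda>s. G (p s)) has_vector_derivative D p') (at r)"
    if "(p has_vector_derivative p') (at r)" "p r = (- t *\<^sub>R e, snd a y)" for p p' r
    using vector_derivative_diff_chain_within[of p p' r UNIV G D] that D
    by (simp add: o_def has_derivative_at_withinI)
  have ev: "\<forall>\<^sub>F s in nhds r. \<psi> ((s - r) *\<^sub>R e) y \<in> fst a" for r
  proof -
    have "continuous_map euclideanreal (mtop N) (\<lambda>s. \<psi> ((s - r) *\<^sub>R e) y)"
      by (rule smooth_action_continuous[OF \<psi>]) (auto intro!: continuous_intros simp: y)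
    moreover have "\<psi> ((r - r) *\<^sub>R e) y \<in> fst a" using \<psi> y a(2) unfolding smooth_action_def by simp
    ultimately show ?thesis using continuous_map_real_eventually[OF _ oa] by blast
  qed
  have Xy: "((\<lambda>s. snd a (\<psi> (s *\<^sub>R e) y)) has_vector_derivative X i y) (at 0)"
    using X y unfolding fundamental_fields_def coord_def a_def e_def by blast
  have D1: "((\<lambda>s. snd b (\<psi> ((- t + s) *\<^sub>R e) y)) has_vector_derivative D (e, 0)) (at 0)"
  proof -
    have "((\<lambda>s. ((- t + s) *\<^sub>R e, snd a y)) has_vector_derivative (e, 0)) (at 0)"
      by (intro has_vector_derivative_Pair has_vector_derivative_const) (auto intro!: derivative_eq_intros)
    from chain[OF this] show ?thesis using G(2)[OF a(2)] by simp
  qed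
  have D2: "((\<lambda>s. snd b (\<psi> ((- t + s) *\<^sub>R e) y)) has_vector_derivative D (0, X i y)) (at 0)"
  proof (rule has_vector_derivative_transform_nhds)
    have "((\<lambda>s. (- t *\<^sub>R e, snd a (\<psi> (s *\<^sub>R e) y))) has_vector_derivative (0, X i y)) (at 0)"
      by (intro has_vector_derivative_Pair has_vector_derivative_const Xy)
    from chain[OF this]
    show "((\<lambda>s. G (- t *\<^sub>R e, snd a (\<psi> (s *\<^sub>R e) y))) has_vector_derivative D (0, X i y)) (at 0)"
      using \<psi> y unfolding smooth_action_def by simp
    show "\<forall>\<^sub>F s in nhds 0. G (- t *\<^sub>R e, snd a (\<psi> (s *\<^sub>R e) y)) = snd b (\<psi> ((- t + s) *\<^sub>R e) y)"
      using ev[of 0]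
    proof eventually_elim
      case (elim s)
      have "\<psi> (- t *\<^sub>R e + s *\<^sub>R e) y = \<psi> (- t *\<^sub>R e) (\<psi> (s *\<^sub>R e) y)"
        using \<psi> y unfolding smooth_action_def by blast
      then show ?case using G(2) elim by (simp add: scaleR_left_distrib scaleR_left_diff_distrib)
    qed
  qed
  have eq: "D (e, 0) = D (0, X i y)" by (rule vector_derivative_unique_at[OF D1 D2])
  have "((\<lambda>s. snd a (c s)) has_vector_derivative X i y) (at t)"
    using c unfolding integral_curve_def coord_def a_def y_def by blast
  then have "((\<lambda>s. (- s *\<^sub>R e, snd a (c s))) has_vector_derivative (- e, X i y)) (at t)"
    by (intro has_vector_derivative_Pair) (auto intro!: derivative_eq_intros)
  from chain[OF this] have "((\<lambda>s. G (- s *\<^sub>R e, snd a (c s))) has_vector_derivative D (- e, X i y)) (at t)"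
    by (simp add: y_def)
  moreover have "D (- e, X i y) = 0"
  proof -
    have "D (- e, X i y) = D ((0, X i y) - (e, 0))" by simp
    also have "\<dots> = 0" unfolding linear_diff[OF lin] using eq by simp
    finally show ?thesis .
  qed
  ultimately have "((\<lambda>s. G (- s *\<^sub>R e, snd a (c s))) has_vector_derivative 0) (at t)" by simp
  moreover have "\<forall>\<^sub>F s in nhds t. G (- s *\<^sub>R e, snd a (c s)) = snd b (\<psi> (- s *\<^sub>R e) (c s))"
  proof -
    have "continuous_map euclideanreal (mtop N) c" using c unfolding integral_curve_def by blast
    then have "\<forall>\<^sub>F s in nhds t. c s \<in> fst a"
      by (rule continuous_map_real_eventually[OF _ oa]) (use a(2) y_def in simp)
    then show ?thesis by eventually_elim (rule G(2))
  qed
  ultimately show ?thesis unfolding e_def by (rule has_vector_derivative_transform_nhds)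
qed

text \<open>The pulled back curve is locally constant in charts, and the real line is connected.\<close>

lemma integral_curve_eq_orbit:
  fixes \<psi> :: "real^'d \<Rightarrow> 'a \<Rightarrow> 'a" and N :: "('a, 'e::euclidean_space) mfd"
  assumes N: "charted N" and \<psi>: "smooth_action N \<psi>" and X: "fundamental_fields N \<psi> X"
    and c: "integral_curve N (X i) c"
  shows "c t = \<psi> (t *\<^sub>R axis i 1) (c 0)"
proof -
  define g where "g s = \<psi> (- s *\<^sub>R axis i 1) (c s)" for s
  have cp: "c s \<in> points N" for s by (rule integral_curve_points[OF c])
  have gp: "g s \<in> points N" for s unfolding g_def by (rule smooth_action_points[OF \<psi> cp])
  have gc: "continuous_map euclideanreal (mtop N) g"
    unfolding g_def by (rule smooth_action_continuous[OF \<psi>])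
      (use c in \<open>auto intro!: continuous_intros simp: integral_curve_def\<close>)
  have "g 0 = g t"
  proof (rule connected_local_const[of UNIV])
    show "\<forall>a\<in>UNIV. \<forall>\<^sub>F b in at a within UNIV. g a = g b"
    proof
      fix a :: real
      define b where "b = chart_at N (g a)"
      have b: "b \<in> atlas N" "g a \<in> fst b" unfolding b_def by (rule chart_at_works[OF N gp])+
      have ob: "openin (mtop N) (fst b)" and ib: "inj_on (snd b) (fst b)" using N b(1) unfolding charted_def by blast+
      have "\<forall>\<^sub>F s in nhds a. g s \<in> fst b" by (rule continuous_map_real_eventually[OF gc ob b(2)])
      then obtain r where r: "r > 0" "\<And>s. dist s a < r \<Longrightarrow> g s \<in> fst b"
        unfolding eventually_nhds_metric by blast
      have "\<exists>k. \<forall>s\<in>ball a r. snd b (g s) = k"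
      proof (rule has_derivative_zero_constant)
        fix s assume "s \<in> ball a r"
        then have "g s \<in> fst b" using r(2) by (simp add: dist_commute)
        then have "((\<lambda>s. snd b (g s)) has_vector_derivative 0) (at s)"
          unfolding g_def by (rule integral_curve_pulled_back_derivative[OF N \<psi> X c b(1)])
        then show "((\<lambda>s. snd b (g s)) has_derivative (\<lambda>h. 0)) (at s within ball a r)"
          unfolding has_vector_derivative_def by (auto intro: has_derivative_at_withinI)
      qed simp
      then have "g s = g a" if "dist s a < r" for s
        using inj_onD[OF ib] r that by (metis dist_commute dist_self mem_ball)
      then show "\<forall>\<^sub>F b in at a within UNIV. g a = g b"
        unfolding eventually_at using r(1) by metis
    qed
  qed auto
  moreover have "g 0 = c 0" unfolding g_def using \<psi> cp unfolding smooth_action_def by simp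
  moreover have "\<psi> (t *\<^sub>R axis i 1) (g t) = c t"
  proof -
    have "\<psi> (t *\<^sub>R axis i 1 + - t *\<^sub>R axis i 1) (c t) = \<psi> (t *\<^sub>R axis i 1) (g t)"
      unfolding g_def using \<psi> cp unfolding smooth_action_def by blast
    moreover have "\<psi> 0 (c t) = c t" using \<psi> cp unfolding smooth_action_def by blast
    ultimately show ?thesis by simp
  qed
  ultimately show ?thesis by simp
qed

lemma flow_eq_orbit:
  assumes "charted N" "smooth_action N \<psi>" "fundamental_fields N \<psi> X" "x \<in> points N"
  shows "flow N (X i) t x = \<psi> (t *\<^sub>R axis i 1) x"
proof -
  have "(THE c. integral_curve N (X i) c \<and> c 0 = x) = (\<lambda>t. \<psi> (t *\<^sub>R axis i 1) x)"
  proof (rule the_equality)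
    have "\<psi> 0 x = x" using assms unfolding smooth_action_def by blast
    then show "integral_curve N (X i) (\<lambda>t. \<psi> (t *\<^sub>R axis i 1) x) \<and> \<psi> (0 *\<^sub>R axis i 1) x = x"
      using orbit_integral_curve[OF assms] by simp
    show "c = (\<lambda>t. \<psi> (t *\<^sub>R axis i 1) x)" if "integral_curve N (X i) c \<and> c 0 = x" for c
      using integral_curve_eq_orbit[OF assms(1-3), of i c] that by auto
  qed
  then show ?thesis unfolding flow_def by simp
qed

text \<open>The composition of the flows in any fixed order is \<open>\<psi> v\<close>, as \<open>v\<close> is the sum of its coordinate vectors.\<close>

lemma action_of_coordinates:
  fixes v :: "real^'d::{finite,linorder}"
  assumes \<psi>: "smooth_action N \<psi>" and x: "x \<in> points N"
  shows "foldr (\<lambda>i. \<psi> ((v $ i) *\<^sub>R axis i 1)) (sorted_list_of_set UNIV) x = \<psi> v x"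
proof -
  have "distinct is \<Longrightarrow> foldr (\<lambda>i. \<psi> ((v $ i) *\<^sub>R axis i 1)) is x = \<psi> (\<Sum>i\<in>set is. (v $ i) *\<^sub>R axis i 1) x" for "is"
  proof (induction "is")
    case Nil
    then show ?case using \<psi> x unfolding smooth_action_def by simp
  next
    case (Cons i "is")
    then show ?case using \<psi> x unfolding smooth_action_def by simp
  qed
  from this[of "sorted_list_of_set UNIV"] show ?thesis
    using basis_expansion[of v] by (simp add: scalar_mult_eq_scaleR)
qed

lemma induced_action_eq:
  assumes "charted N" "smooth_action N \<psi>" "fundamental_fields N \<psi> X" "x \<in> points N"
  shows "induced_action N X v f x = f (\<psi> v x)"
proof -
  have "foldr (\<lambda>i. flow N (X i) (v $ i)) is x = foldr (\<lambda>i. \<psi> ((v $ i) *\<^sub>R axis i 1)) is x \<and>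
      foldr (\<lambda>i. \<psi> ((v $ i) *\<^sub>R axis i 1)) is x \<in> points N" for "is"
    by (induction "is") (use assms flow_eq_orbit[OF assms(1-3)] smooth_action_points[OF assms(2)] in auto)
  then show ?thesis unfolding induced_action_def
    using assms(4) action_of_coordinates[OF assms(2,4)] by simp
qed

section \<open>Charts of the tangent bundle\<close>

locale smooth_mfd =
  fixes M :: "('m, 'e::euclidean_space) mfd"
  assumes smooth: "smooth_manifold M"
begin

lemma Hausdorff: "Hausdorff_space (mtop M)"
  using smooth unfolding smooth_manifold_def by blast

lemma chart_cover: "(\<Union>c\<in>atlas M. fst c) = points M"
  using smooth unfolding smooth_manifold_def by blast

lemma chart_props:
  assumes "c \<in> atlas M"
  shows "openin (mtop M) (fst c)" "open (snd c ` fst c)"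
    "homeomorphic_map (subtopology (mtop M) (fst c)) (top_of_set (snd c ` fst c)) (snd c)"
    "fst c \<subseteq> points M"
  using assms smooth openin_subset unfolding smooth_manifold_def by blast+

lemma chart_inj: 
  assumes "c \<in> atlas M"
  shows "inj_on (snd c) (fst c)"
  using homeomorphic_imp_injective_map[OF chart_props(3)[OF assms]] chart_props(4)[OF assms]
  by (simp add: Int_absorb1)

lemma charted: "charted M"
  unfolding charted_def using chart_cover chart_props(1) chart_inj by blast

lemma chart_at: "p \<in> points M \<Longrightarrow> chart_at M p \<in> atlas M \<and> p \<in> fst (chart_at M p)"
  using chart_at_works[OF charted] by blast

lemma chart_inv_left: "c \<in> atlas M \<Longrightarrow> x \<in> fst c \<Longrightarrow> chart_inv c (snd c x) = x"
  unfolding chart_inv_def by (rule inv_into_f_f[OF chart_inj])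

lemma chart_image_open:
  assumes "c \<in> atlas M" "openin (mtop M) V"
  shows "open (snd c ` (fst c \<inter> V))"
proof -
  have "openin (subtopology (mtop M) (fst c)) (fst c \<inter> V)"
    using assms(2) by (auto simp: openin_subtopology)
  then have "openin (top_of_set (snd c ` fst c)) (snd c ` (fst c \<inter> V))"
    using homeomorphic_imp_open_map[OF chart_props(3)[OF assms(1)]] unfolding open_map_def by blast
  then show ?thesis using chart_props(2)[OF assms(1)] openin_open_eq by blast
qed

text \<open>The change of components at \<open>p\<close> of a tangent vector when passing from \<open>c\<close> to \<open>c'\<close>.\<close>

definition jacobian :: "('m, 'e) chart \<Rightarrow> ('m, 'e) chart \<Rightarrow> 'm \<Rightarrow> 'e \<Rightarrow> 'e" where
  "jacobian c c' p = frechet_derivative (snd c' \<circ> chart_inv c) (at (snd c p))"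

lemma transition_Ck:
  assumes "c \<in> atlas M" "c' \<in> atlas M"
  shows "Ck_on k (snd c ` (fst c \<inter> fst c')) (snd c' \<circ> chart_inv c)"
  using assms smooth unfolding smooth_manifold_def smooth_on_def by blast

lemma jacobian_derivative:
  assumes "c \<in> atlas M" "c' \<in> atlas M" "p \<in> fst c" "p \<in> fst c'"
  shows "((snd c' \<circ> chart_inv c) has_derivative jacobian c c' p) (at (snd c p))"
  using transition_Ck[OF assms(1,2), of "Suc 0"] assms(3,4)
  unfolding jacobian_def frechet_derivative_works[symmetric] by simp

lemma jacobian_cocycle:
  assumes c: "c \<in> atlas M" "c' \<in> atlas M" "c'' \<in> atlas M" and p: "p \<in> fst c" "p \<in> fst c'" "p \<in> fst c''"
  shows "jacobian c c'' p = jacobian c' c'' p \<circ> jacobian c c' p"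
proof -
  have "((snd c'' \<circ> chart_inv c') has_derivative jacobian c' c'' p) (at ((snd c' \<circ> chart_inv c) (snd c p)))"
    using jacobian_derivative[OF c(2,3) p(2,3)] chart_inv_left[OF c(1) p(1)] by simp
  from diff_chain_at[OF jacobian_derivative[OF c(1,2) p(1,2)] this]
  have 1: "((snd c'' \<circ> chart_inv c' \<circ> (snd c' \<circ> chart_inv c)) has_derivative jacobian c' c'' p \<circ> jacobian c c' p) (at (snd c p))" .
  have "((snd c'' \<circ> chart_inv c) has_derivative jacobian c' c'' p \<circ> jacobian c c' p) (at (snd c p))"
  proof (rule has_derivative_transform_within_open[OF 1])
    show "open (snd c ` (fst c \<inter> fst c'))" by (rule chart_image_open[OF c(1) chart_props(1)[OF c(2)]])
    show "snd c p \<in> snd c ` (fst c \<inter> fst c')" using p by blast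
    fix x assume "x \<in> snd c ` (fst c \<inter> fst c')"
    then obtain q where "q \<in> fst c" "q \<in> fst c'" "x = snd c q" by blast
    then show "(snd c'' \<circ> chart_inv c' \<circ> (snd c' \<circ> chart_inv c)) x = (snd c'' \<circ> chart_inv c) x"
      using chart_inv_left[OF c(1)] chart_inv_left[OF c(2)] by simp
  qed
  from has_derivative_unique[OF jacobian_derivative[OF c(1,3) p(1,3)] this] show ?thesis .
qed

lemma jacobian_self:
  assumes c: "c \<in> atlas M" "p \<in> fst c"
  shows "jacobian c c p = (\<lambda>\<xi>. \<xi>)"
proof -
  have "((snd c \<circ> chart_inv c) has_derivative (\<lambda>\<xi>. \<xi>)) (at (snd c p))"
  proof (rule has_derivative_transform_within_open[OF has_derivative_ident])
    show "open (snd c ` fst c)" by (rule chart_props(2)[OF c(1)])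
    show "snd c p \<in> snd c ` fst c" using c by blast
    show "x = (snd c \<circ> chart_inv c) x" if "x \<in> snd c ` fst c" for x
      using that chart_inv_left[OF c(1)] by auto
  qed
  from has_derivative_unique[OF jacobian_derivative[OF c(1,1,2,2)] this] show ?thesis .
qed

lemma jacobian_inverse:
  assumes "c \<in> atlas M" "c' \<in> atlas M" "p \<in> fst c" "p \<in> fst c'"
  shows "jacobian c' c p (jacobian c c' p \<xi>) = \<xi>"
  using jacobian_cocycle[OF assms(1,2,1) assms(3,4,3)] jacobian_self[OF assms(1,3)] by (metis comp_apply)

lemma jacobian_linear:
  assumes "c \<in> atlas M" "c' \<in> atlas M" "p \<in> fst c" "p \<in> fst c'"
  shows "bounded_linear (jacobian c c' p)"
  using jacobian_derivative[OF assms] by (rule has_derivative_bounded_linear)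

abbreviation "TM \<equiv> tangent_bundle M"
abbreviation "bundle_coord c \<equiv> snd (tangent_chart M c)"

lemma bundle_coord_eq: "bundle_coord c (p, \<xi>) = (snd c p, jacobian (chart_at M p) c p \<xi>)"
  unfolding tangent_chart_def jacobian_def coord_def by simp

lemma fst_tangent_chart [simp]: "fst (tangent_chart M c) = fst c \<times> UNIV"
  by (simp add: tangent_chart_def)

lemma bundle_coord_inj:
  assumes c: "c \<in> atlas M"
  shows "inj_on (bundle_coord c) (fst c \<times> UNIV)"
proof (rule inj_onI, clarify)
  fix p q :: 'm and \<xi> \<eta> :: 'e
  assume *: "p \<in> fst c" "q \<in> fst c" "bundle_coord c (p, \<xi>) = bundle_coord c (q, \<eta>)"
  then have "p = q" using inj_onD[OF chart_inj[OF c]] by (simp add: bundle_coord_eq)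
  moreover have "\<xi> = \<eta>"
    using * \<open>p = q\<close> jacobian_inverse[of "chart_at M p" c p] chart_at[of p] chart_props(4)[OF c] c
    unfolding bundle_coord_eq by (metis Pair_inject subsetD)
  ultimately show "p = q \<and> \<xi> = \<eta>" by simp
qed

lemma bundle_coord_surj:
  assumes c: "c \<in> atlas M"
  shows "bundle_coord c ` (fst c \<times> UNIV) = snd c ` fst c \<times> UNIV"
proof
  show "bundle_coord c ` (fst c \<times> UNIV) \<subseteq> snd c ` fst c \<times> UNIV" by (auto simp: bundle_coord_eq)
  show "snd c ` fst c \<times> UNIV \<subseteq> bundle_coord c ` (fst c \<times> UNIV)"
  proof clarify
    fix p and \<eta> :: 'e assume p: "p \<in> fst c"
    have a: "chart_at M p \<in> atlas M" "p \<in> fst (chart_at M p)" using chart_at chart_props(4)[OF c] p by blast+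
    have "bundle_coord c (p, jacobian c (chart_at M p) p \<eta>) = (snd c p, \<eta>)"
      unfolding bundle_coord_eq using jacobian_inverse[OF c a(1) p a(2)] by simp
    then show "(snd c p, \<eta>) \<in> bundle_coord c ` (fst c \<times> UNIV)" using p by (metis SigmaI UNIV_I imageI)
  qed
qed

lemma chart_domain_generator:
  "c \<in> atlas M \<Longrightarrow> fst c \<times> UNIV \<in> {fst (tangent_chart M c) \<inter> bundle_coord c -` W | c W. c \<in> atlas M \<and> open W}"
  unfolding mem_Collect_eq by (intro exI[of _ c] exI[of _ UNIV]) simp

lemma TM_topspace: "points TM = points M \<times> UNIV"
proof -
  have "points TM = \<Union> {fst (tangent_chart M c) \<inter> bundle_coord c -` W | c W. c \<in> atlas M \<and> open W}"
    unfolding tangent_bundle_def by (simp add: topology_generated_by_topspace)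
  also have "\<dots> = (\<Union>c\<in>atlas M. fst c \<times> UNIV)"
  proof
    show "(\<Union>c\<in>atlas M. fst c \<times> UNIV) \<subseteq> \<Union> {fst (tangent_chart M c) \<inter> bundle_coord c -` W | c W. c \<in> atlas M \<and> open W}"
      by (intro UN_least Union_upper chart_domain_generator)
  qed auto
  also have "\<dots> = points M \<times> UNIV" using chart_cover by blast
  finally show ?thesis .
qed

lemma TM_basic_open:
  assumes "c \<in> atlas M" "open V"
  shows "openin (mtop TM) (fst c \<times> UNIV \<inter> bundle_coord c -` V)"
proof -
  have "fst c \<times> UNIV \<inter> bundle_coord c -` V \<in> {fst (tangent_chart M c) \<inter> bundle_coord c -` W | c W. c \<in> atlas M \<and> open W}"
    unfolding mem_Collect_eq using assms by (intro exI[of _ c] exI[of _ V]) simp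
  then show ?thesis unfolding tangent_bundle_def by (simp add: topology_generated_by_Basis)
qed

lemma TM_chart_domain_open: "c \<in> atlas M \<Longrightarrow> openin (mtop TM) (fst c \<times> UNIV)"
  using TM_basic_open[of c UNIV] by simp

lemma TM_charted: "charted TM"
  unfolding charted_def
proof
  have a: "atlas TM = tangent_chart M ` atlas M" by (simp add: tangent_bundle_def)
  show "(\<Union>c\<in>atlas TM. fst c) = points TM" unfolding TM_topspace a using chart_cover by auto
  show "\<forall>c\<in>atlas TM. openin (mtop TM) (fst c) \<and> inj_on (snd c) (fst c)"
    unfolding a using TM_chart_domain_open bundle_coord_inj by simp
qed

lemma bundle_coord_continuous:
  assumes "c \<in> atlas M"
  shows "continuous_map (subtopology (mtop TM) (fst c \<times> UNIV)) euclidean (bundle_coord c)"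
  unfolding continuous_map
proof (intro conjI allI impI)
  fix V :: "('e \<times> 'e) set" assume "openin euclidean V"
  then have "openin (mtop TM) (fst c \<times> UNIV \<inter> bundle_coord c -` V)" using TM_basic_open[OF assms] by simp
  moreover have "{x \<in> topspace (subtopology (mtop TM) (fst c \<times> UNIV)). bundle_coord c x \<in> V} = fst c \<times> UNIV \<inter> bundle_coord c -` V"
    using chart_props(4)[OF assms] by (auto simp: TM_topspace)
  ultimately show "openin (subtopology (mtop TM) (fst c \<times> UNIV)) {x \<in> topspace (subtopology (mtop TM) (fst c \<times> UNIV)). bundle_coord c x \<in> V}"
    unfolding openin_subtopology by (intro exI[of _ "fst c \<times> UNIV \<inter> bundle_coord c -` V"]) auto
qed simp

definition bundle_point :: "('m, 'e) chart \<Rightarrow> 'e \<times> 'e \<Rightarrow> 'm \<times> 'e" where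
  "bundle_point c = inv_into (fst c \<times> UNIV) (bundle_coord c)"

lemma bundle_point_left: "c \<in> atlas M \<Longrightarrow> y \<in> fst c \<times> UNIV \<Longrightarrow> bundle_point c (bundle_coord c y) = y"
  unfolding bundle_point_def by (rule inv_into_f_f[OF bundle_coord_inj])

lemma bundle_point_right:
  assumes "c \<in> atlas M" "z \<in> snd c ` fst c \<times> UNIV"
  shows "bundle_coord c (bundle_point c z) = z \<and> bundle_point c z \<in> fst c \<times> UNIV"
proof -
  have z: "z \<in> bundle_coord c ` (fst c \<times> UNIV)" using bundle_coord_surj[OF assms(1)] assms(2) by simp
  show ?thesis unfolding bundle_point_def
    by (rule conjI[OF f_inv_into_f[OF z] inv_into_into[OF z]])
qed

text \<open>Between two bundle charts the coordinate change is \<open>(x, \<eta>) \<mapsto> (\<tau> x, D\<tau> x \<eta>)\<close>.\<close>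

lemma bundle_transition:
  assumes c: "c \<in> atlas M" "c' \<in> atlas M" and p: "p \<in> fst c" "p \<in> fst c'"
  shows "bundle_coord c' (p, \<xi>) = ((snd c' \<circ> chart_inv c) (fst (bundle_coord c (p, \<xi>))), jacobian c c' p (snd (bundle_coord c (p, \<xi>))))"
proof -
  have a: "chart_at M p \<in> atlas M" "p \<in> fst (chart_at M p)" using chart_at chart_props(4)[OF c(1)] p by blast+
  show ?thesis unfolding bundle_coord_eq
    using jacobian_cocycle[OF a(1) c a(2) p] chart_inv_left[OF c(1) p(1)] by simp
qed

text \<open>The topology of the tangent bundle is generated by preimages under all bundle charts, so the inverse of
one of them is continuous as soon as the coordinate changes are. Expanding the vector component
in a basis reduces the joint continuity of \<open>D\<tau> x \<eta>\<close> to that of the partial derivatives of \<open>\<tau>\<close>.\<close>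

lemma bundle_point_continuous:
  assumes c: "c \<in> atlas M"
  shows "continuous_map (top_of_set (snd c ` fst c \<times> UNIV)) (mtop TM) (bundle_point c)"
proof -
  have "continuous_map (top_of_set (snd c ` fst c \<times> UNIV))
    (topology_generated_by {fst (tangent_chart M c) \<inter> bundle_coord c -` W | c W. c \<in> atlas M \<and> open W}) (bundle_point c)"
  proof (rule continuous_on_generated_topo)
    fix U assume "U \<in> {fst (tangent_chart M c) \<inter> bundle_coord c -` W | c W. c \<in> atlas M \<and> open W}"
    then obtain c' V where c': "c' \<in> atlas M" "open V" "U = fst c' \<times> UNIV \<inter> bundle_coord c' -` V" by auto
    define O1 where "O1 = snd c ` (fst c \<inter> fst c')"
    have O1: "open O1" unfolding O1_def by (rule chart_image_open[OF c chart_props(1)[OF c'(1)]])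
    define \<tau> where "\<tau> = snd c' \<circ> chart_inv c"
    define G where "G z = (\<tau> (fst z), \<Sum>b\<in>Basis. (snd z \<bullet> b) *\<^sub>R frechet_derivative \<tau> (at (fst z)) b)" for z
    have Ck1: "Ck_on (Suc 0) O1 \<tau>" unfolding O1_def \<tau>_def by (rule transition_Ck[OF c c'(1)])
    have \<tau>c: "continuous_on O1 \<tau>" using transition_Ck[OF c c'(1), of 0] by (simp add: O1_def \<tau>_def)
    have Dc: "continuous_on O1 (\<lambda>x. frechet_derivative \<tau> (at x) b)" for b using Ck1 by simp
    have cG: "continuous_on (O1 \<times> UNIV) G" unfolding G_def
      by (intro continuous_intros continuous_on_compose2[OF \<tau>c] continuous_on_compose2[OF Dc]) auto
    have G: "bundle_coord c' (bundle_point c z) = G z" if z: "z \<in> O1 \<times> UNIV" for z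
    proof -
      obtain x \<eta> where z': "z = (x, \<eta>)" by (cases z)
      have zi: "z \<in> snd c ` fst c \<times> UNIV" using z by (auto simp: O1_def)
      obtain p \<xi> where y: "bundle_point c z = (p, \<xi>)" by (cases "bundle_point c z")
      have p: "p \<in> fst c" "bundle_coord c (p, \<xi>) = z" using bundle_point_right[OF c zi] y by auto
      have x: "x = snd c p" using p(2) by (simp add: bundle_coord_eq z')
      have p': "p \<in> fst c'" using z p(1) inj_onD[OF chart_inj[OF c]] unfolding z' x O1_def by auto
      have lin: "linear (jacobian c c' p)" using jacobian_linear[OF c c'(1) p(1) p'] by (rule bounded_linear.linear)
      have "jacobian c c' p \<eta> = jacobian c c' p (\<Sum>b\<in>Basis. (\<eta> \<bullet> b) *\<^sub>R b)" by (simp add: euclidean_representation)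
      also have "\<dots> = (\<Sum>b\<in>Basis. (\<eta> \<bullet> b) *\<^sub>R jacobian c c' p b)" by (simp add: linear_sum[OF lin] linear_scale[OF lin])
      finally show ?thesis unfolding y bundle_transition[OF c c'(1) p(1) p'] p(2)
        by (simp add: G_def z' \<tau>_def x jacobian_def)
    qed
    have "open (O1 \<times> UNIV \<inter> G -` V)"
      using cG c'(2) O1 by (intro continuous_open_preimage) (auto intro: open_Times)
    moreover have "bundle_point c -` U \<inter> topspace (top_of_set (snd c ` fst c \<times> UNIV)) = O1 \<times> UNIV \<inter> G -` V"
    proof (intro set_eqI iffI)
      fix z assume "z \<in> bundle_point c -` U \<inter> topspace (top_of_set (snd c ` fst c \<times> UNIV))"
      then have z: "bundle_point c z \<in> fst c' \<times> UNIV" "bundle_coord c' (bundle_point c z) \<in> V" "z \<in> snd c ` fst c \<times> UNIV" unfolding c'(3) by auto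
      have "fst z = snd c (fst (bundle_point c z))" using bundle_point_right[OF c z(3)] bundle_coord_eq by (metis fst_conv prod.collapse)
      then have "z \<in> O1 \<times> UNIV" unfolding O1_def using z(1) bundle_point_right[OF c z(3)] by (cases z) auto
      then show "z \<in> O1 \<times> UNIV \<inter> G -` V" using z(2) G by simp
    next
      fix z assume z: "z \<in> O1 \<times> UNIV \<inter> G -` V"
      then have zi: "z \<in> snd c ` fst c \<times> UNIV" by (auto simp: O1_def)
      have "fst z = snd c (fst (bundle_point c z))" using bundle_point_right[OF c zi] bundle_coord_eq by (metis fst_conv prod.collapse)
      moreover obtain q where q: "q \<in> fst c" "q \<in> fst c'" "fst z = snd c q" using z by (auto simp: O1_def)
      ultimately have "q = fst (bundle_point c z)"
        using inj_onD[OF chart_inj[OF c], of q "fst (bundle_point c z)"] bundle_point_right[OF c zi] by (auto simp: mem_Times_iff)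
      then have "fst (bundle_point c z) \<in> fst c'" using q(2) by simp
      then show "z \<in> bundle_point c -` U \<inter> topspace (top_of_set (snd c ` fst c \<times> UNIV))"
        unfolding c'(3) using z G[of z] zi by (auto simp: mem_Times_iff)
    qed
    ultimately show "openin (top_of_set (snd c ` fst c \<times> UNIV)) (bundle_point c -` U \<inter> topspace (top_of_set (snd c ` fst c \<times> UNIV)))"
      by (metis Int_lower2 open_openin openin_subset_topspace_eq open_subset topspace_euclidean_subtopology)
  next
    have "bundle_point c ` (snd c ` fst c \<times> UNIV) \<subseteq> fst c \<times> UNIV" using bundle_point_right[OF c] by blast
    also have "\<dots> \<subseteq> \<Union> {fst (tangent_chart M c) \<inter> bundle_coord c -` W | c W. c \<in> atlas M \<and> open W}"
      by (rule Union_upper[OF chart_domain_generator[OF c]])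
    finally show "bundle_point c ` topspace (top_of_set (snd c ` fst c \<times> UNIV)) \<subseteq> \<Union> {fst (tangent_chart M c) \<inter> bundle_coord c -` W | c W. c \<in> atlas M \<and> open W}"
      by simp
  qed
  then show ?thesis by (simp add: tangent_bundle_def)
qed

lemma bundle_point_compact:
  assumes "c \<in> atlas M" "compact K" "K \<subseteq> snd c ` fst c \<times> UNIV"
  shows "compactin (mtop TM) (bundle_point c ` K)"
  by (rule image_compactin[OF _ bundle_point_continuous[OF assms(1)]])
    (use assms(2,3) in \<open>simp add: compactin_subtopology\<close>)

lemma bundle_coord_image_open:
  assumes c: "c \<in> atlas M" and V: "openin (mtop TM) V"
  shows "open (bundle_coord c ` (fst c \<times> UNIV \<inter> V))"
proof -
  have "openin (top_of_set (snd c ` fst c \<times> UNIV)) {z \<in> topspace (top_of_set (snd c ` fst c \<times> UNIV)). bundle_point c z \<in> V}"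
    by (rule openin_continuous_map_preimage[OF bundle_point_continuous[OF c] V])
  moreover have "open (snd c ` fst c \<times> (UNIV :: 'e set))" using chart_props(2)[OF c] by (simp add: open_Times)
  ultimately have "open {z \<in> snd c ` fst c \<times> UNIV. bundle_point c z \<in> V}" using openin_open_eq by fastforce
  moreover have "{z \<in> snd c ` fst c \<times> UNIV. bundle_point c z \<in> V} = bundle_coord c ` (fst c \<times> UNIV \<inter> V)"
  proof (intro set_eqI iffI)
    fix z assume "z \<in> {z \<in> snd c ` fst c \<times> UNIV. bundle_point c z \<in> V}"
    then show "z \<in> bundle_coord c ` (fst c \<times> UNIV \<inter> V)"
      using bundle_point_right[OF c, of z] by (intro image_eqI[of _ _ "bundle_point c z"]) auto
  next
    fix z assume "z \<in> bundle_coord c ` (fst c \<times> UNIV \<inter> V)"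
    then show "z \<in> {z \<in> snd c ` fst c \<times> UNIV. bundle_point c z \<in> V}"
      using bundle_coord_surj[OF c] bundle_point_left[OF c] by auto
  qed
  ultimately show ?thesis by simp
qed

lemma fst_continuous: "continuous_map (mtop TM) (mtop M) fst"
  unfolding continuous_map
proof (intro conjI allI impI)
  show "fst ` topspace (mtop TM) \<subseteq> topspace (mtop M)" by (auto simp: TM_topspace)
  fix V assume V: "openin (mtop M) V"
  have "{y \<in> topspace (mtop TM). fst y \<in> V} = (\<Union>c\<in>atlas M. fst c \<times> UNIV \<inter> bundle_coord c -` (snd c ` (fst c \<inter> V) \<times> UNIV))"
  proof (intro set_eqI iffI)
    fix y assume "y \<in> {y \<in> topspace (mtop TM). fst y \<in> V}"
    then obtain p \<xi> where y: "y = (p, \<xi>)" "p \<in> points M" "p \<in> V" by (auto simp: TM_topspace)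
    then obtain c where "c \<in> atlas M" "p \<in> fst c" using chart_cover by blast
    then show "y \<in> (\<Union>c\<in>atlas M. fst c \<times> UNIV \<inter> bundle_coord c -` (snd c ` (fst c \<inter> V) \<times> UNIV))"
      using y by (auto simp: bundle_coord_eq)
  next
    fix y assume "y \<in> (\<Union>c\<in>atlas M. fst c \<times> UNIV \<inter> bundle_coord c -` (snd c ` (fst c \<inter> V) \<times> UNIV))"
    then obtain c p \<xi> where c: "c \<in> atlas M" "y = (p, \<xi>)" "p \<in> fst c" "snd c p \<in> snd c ` (fst c \<inter> V)"
      by (auto simp: bundle_coord_eq)
    then have "p \<in> V" using inj_onD[OF chart_inj[OF c(1)]] by auto
    then show "y \<in> {y \<in> topspace (mtop TM). fst y \<in> V}" using c chart_props(4)[OF c(1)] by (auto simp: TM_topspace)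
  qed
  moreover have "openin (mtop TM) (fst c \<times> UNIV \<inter> bundle_coord c -` (snd c ` (fst c \<inter> V) \<times> UNIV))" if "c \<in> atlas M" for c
    by (rule TM_basic_open[OF that open_Times[OF chart_image_open[OF that V] open_UNIV]])
  ultimately show "openin (mtop TM) {y \<in> topspace (mtop TM). fst y \<in> V}" by (simp only:) (rule openin_Union, auto)
qed

section \<open>A fibre of the tangent bundle\<close>

lemma fibre_closed:
  assumes "p \<in> points M"
  shows "closedin (mtop TM) (range (fibre_incl p))"
proof -
  have "closedin (mtop M) {p}" using Hausdorff assms by (simp add: closedin_Hausdorff_singleton)
  from closedin_continuous_map_preimage[OF fst_continuous this]
  show ?thesis using assms by (simp add: TM_topspace fibre_incl_def) (rule back_subst[where P="closedin (mtop TM)"], assumption, auto)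
qed

lemma bundle_coord_fibre:
  assumes "p \<in> points M"
  shows "bundle_coord (chart_at M p) (p, \<xi>) = (snd (chart_at M p) p, \<xi>)"
  unfolding bundle_coord_eq using jacobian_self chart_at[OF assms] by simp

lemma fibre_incl_eq_bundle_point:
  assumes "p \<in> points M"
  shows "fibre_incl p \<xi> = bundle_point (chart_at M p) (snd (chart_at M p) p, \<xi>)"
  using bundle_point_left[of "chart_at M p" "(p, \<xi>)"] chart_at[OF assms] bundle_coord_fibre[OF assms]
  by (simp add: fibre_incl_def)

lemma fibre_incl_continuous:
  assumes "p \<in> points M"
  shows "continuous_map euclidean (mtop TM) (fibre_incl p)"
proof -
  let ?c = "chart_at M p"
  have "continuous_map euclidean (top_of_set (snd ?c ` fst ?c \<times> UNIV)) (\<lambda>\<xi>::'e. (snd ?c p, \<xi>))"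
    using chart_at[OF assms] by (auto simp: continuous_map_in_subtopology intro!: continuous_intros)
  from continuous_map_compose[OF this bundle_point_continuous] chart_at[OF assms]
  have "continuous_map euclidean (mtop TM) (bundle_point ?c \<circ> (\<lambda>\<xi>. (snd ?c p, \<xi>)))" by blast
  then show ?thesis by (rule continuous_map_eq) (simp add: fibre_incl_eq_bundle_point[OF assms])
qed

lemma fibre_vimage_compact:
  assumes p: "p \<in> points M" and K: "compactin (mtop TM) K"
  shows "compact (fibre_incl p -` K)"
proof -
  let ?c = "chart_at M p"
  have c: "?c \<in> atlas M" "p \<in> fst ?c" using chart_at[OF p] by auto
  have "compactin (mtop TM) (range (fibre_incl p) \<inter> K)"
    by (rule closed_Int_compactin[OF fibre_closed[OF p] K])
  then have "compactin (subtopology (mtop TM) (fst ?c \<times> UNIV)) (range (fibre_incl p) \<inter> K)"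
    using c(2) by (auto simp: compactin_subtopology fibre_incl_def)
  from image_compactin[OF this bundle_coord_continuous[OF c(1)]]
  have "compact (bundle_coord ?c ` (range (fibre_incl p) \<inter> K))" by simp
  then have "compact (snd ` bundle_coord ?c ` (range (fibre_incl p) \<inter> K))"
    by (intro compact_continuous_image continuous_intros)
  moreover have "snd ` bundle_coord ?c ` (range (fibre_incl p) \<inter> K) = fibre_incl p -` K"
  proof (intro set_eqI iffI)
    fix \<xi> assume "\<xi> \<in> fibre_incl p -` K"
    then have "bundle_coord ?c (fibre_incl p \<xi>) \<in> bundle_coord ?c ` (range (fibre_incl p) \<inter> K)" by blast
    then show "\<xi> \<in> snd ` bundle_coord ?c ` (range (fibre_incl p) \<inter> K)"
      using bundle_coord_fibre[OF p, of \<xi>] by (intro image_eqI[of _ _ "bundle_coord ?c (fibre_incl p \<xi>)"]) (auto simp: fibre_incl_def)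
  qed (use bundle_coord_fibre[OF p] in \<open>auto simp: fibre_incl_def\<close>)
  ultimately show ?thesis by simp
qed

end

lemma vector_mfd_chart: "chart_at vector_mfd x = (UNIV, id)"
  unfolding chart_at_def vector_mfd_def by (rule some_equality) auto

lemma vector_mfd_coord: "coord vector_mfd x = id"
  unfolding coord_def vector_mfd_chart by simp

lemma vector_mfd_top [simp]: "mtop vector_mfd = euclidean"
  by (simp add: vector_mfd_def)

context smooth_mfd
begin

lemma TM_coord:
  assumes "p \<in> points M"
  obtains c where "c \<in> atlas M" "p \<in> fst c" "coord TM (p, \<xi>) = bundle_coord c"
proof -
  have y: "(p, \<xi>) \<in> points TM" using assms by (simp add: TM_topspace)
  have "chart_at TM (p, \<xi>) \<in> tangent_chart M ` atlas M"
    using chart_at_works(1)[OF TM_charted y] by (simp add: tangent_bundle_def)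
  then obtain c where c: "c \<in> atlas M" "chart_at TM (p, \<xi>) = tangent_chart M c" by blast
  then have "p \<in> fst c" using chart_at_works(2)[OF TM_charted y] by simp
  then show thesis using that c unfolding coord_def by simp
qed

text \<open>In a bundle chart the inclusion of the fibre is \<open>\<xi> \<mapsto> (x, J \<xi>)\<close> with an invertible linear map \<open>J\<close>, so a
vertical vector has exactly one preimage under the differential of the inclusion.\<close>

lemma fibre_field_coord:
  assumes p: "p \<in> points M" and c: "c \<in> atlas M" "p \<in> fst c" "coord TM (p, \<xi>) = bundle_coord c"
    and Z: "fst (Z (p, \<xi>)) = 0"
  shows "Z (p, \<xi>) = (0, jacobian (chart_at M p) c p (fibre_field M p Z \<xi>))"
proof -
  let ?a = "chart_at M p"
  let ?J = "jacobian ?a c p"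
  have a: "?a \<in> atlas M" "p \<in> fst ?a" using chart_at[OF p] by auto
  have ci: "chart_inv (UNIV, id) = (id :: 'e \<Rightarrow> 'e)" by (simp add: chart_inv_def inv_id)
  have "((\<lambda>\<xi>'. (snd c p, ?J \<xi>')) has_derivative (\<lambda>\<zeta>. (0, ?J \<zeta>))) (at \<xi>)"
    by (intro has_derivative_Pair has_derivative_const bounded_linear_imp_has_derivative jacobian_linear a c)
  moreover have "coord TM (p, \<xi>) \<circ> fibre_incl p \<circ> id = (\<lambda>\<xi>'. (snd c p, ?J \<xi>'))"
    unfolding c(3) by (rule ext) (simp add: fibre_incl_def bundle_coord_eq)
  ultimately have d: "differential vector_mfd TM (fibre_incl p) \<xi> = (\<lambda>\<zeta>. (0, ?J \<zeta>))"
    unfolding differential_def vector_mfd_chart vector_mfd_coord ci fibre_incl_def[of p \<xi>]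
    using frechet_derivative_at by (metis id_apply)
  have inv: "?J (jacobian c ?a p w) = w" "jacobian c ?a p (?J w) = w" for w
    using jacobian_inverse[OF c(1) a(1) c(2) a(2)] jacobian_inverse[OF a(1) c(1) a(2) c(2)] by auto
  have "(THE \<zeta>. (0, ?J \<zeta>) = Z (p, \<xi>)) = jacobian c ?a p (snd (Z (p, \<xi>)))"
  proof (rule the_equality)
    show "(0, ?J (jacobian c ?a p (snd (Z (p, \<xi>))))) = Z (p, \<xi>)" using Z inv by (simp add: prod_eq_iff)
    show "\<zeta> = jacobian c ?a p (snd (Z (p, \<xi>)))" if "(0, ?J \<zeta>) = Z (p, \<xi>)" for \<zeta>
      using that inv by (metis snd_conv)
  qed
  then have "fibre_field M p Z \<xi> = jacobian c ?a p (snd (Z (p, \<xi>)))"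
    unfolding fibre_field_def d by (simp add: fibre_incl_def)
  then show ?thesis using Z inv by (simp add: prod_eq_iff)
qed

end

locale vertical_action = smooth_mfd M for M :: "('m, 'e::euclidean_space) mfd" +
  fixes \<psi> :: "real^'d::{finite,linorder} \<Rightarrow> 'm \<times> 'e \<Rightarrow> 'm \<times> 'e"
    and X :: "'d \<Rightarrow> ('m \<times> 'e, 'e \<times> 'e) field"
  assumes action: "smooth_action TM \<psi>"
    and vertical: "\<And>v y. y \<in> points TM \<Longrightarrow> fst (\<psi> v y) = fst y"
    and fundamental: "fundamental_fields TM \<psi> X"
    and support_compact: "\<And>i p. p \<in> points M \<Longrightarrow>
      compactin (mtop TM) (field_support TM (X i) \<inter> range (fibre_incl p))"
begin

lemma action_points: "y \<in> points TM \<Longrightarrow> \<psi> v y \<in> points TM"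
  by (rule smooth_action_points[OF action])

lemma action_0: "y \<in> points TM \<Longrightarrow> \<psi> 0 y = y"
  and action_add: "y \<in> points TM \<Longrightarrow> \<psi> (v + w) y = \<psi> v (\<psi> w y)"
  using action unfolding smooth_action_def by auto

lemma action_fibre: "p \<in> points M \<Longrightarrow> (p, snd (\<psi> v (p, \<xi>))) = \<psi> v (p, \<xi>)"
  using vertical[of "(p, \<xi>)" v] by (simp add: TM_topspace prod_eq_iff)

lemma field_vertical:
  assumes "p \<in> points M"
  shows "fst (X i (p, \<xi>)) = 0"
proof -
  have y: "(p, \<xi>) \<in> points TM" using assms by (simp add: TM_topspace)
  obtain c where c: "c \<in> atlas M" "p \<in> fst c" "coord TM (p, \<xi>) = bundle_coord c" by (rule TM_coord[OF assms])
  have "((\<lambda>t. bundle_coord c (\<psi> (t *\<^sub>R axis i 1) (p, \<xi>))) has_vector_derivative X i (p, \<xi>)) (at 0)"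
    using fundamental y unfolding fundamental_fields_def c(3)[symmetric] by blast
  from bounded_linear.has_vector_derivative[OF bounded_linear_fst this]
  have "((\<lambda>t. fst (bundle_coord c (\<psi> (t *\<^sub>R axis i 1) (p, \<xi>)))) has_vector_derivative fst (X i (p, \<xi>))) (at 0)" .
  moreover have "fst (bundle_coord c (\<psi> v (p, \<xi>))) = snd c p" for v
    using vertical[OF y, of v] bundle_coord_eq by (metis fst_conv prod.collapse)
  ultimately have "((\<lambda>t. snd c p) has_vector_derivative fst (X i (p, \<xi>))) (at (0::real))" by simp
  from vector_derivative_unique_at[OF this has_vector_derivative_const] show ?thesis .
qed

text \<open>In a bundle chart both conditions say that \<open>J \<circ> \<eta>\<close> has the derivative prescribed by \<open>X i\<close>, where the
invertible linear map \<open>J\<close> describes the inclusion of the fibre.\<close>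

lemma integral_curve_fibre_iff:
  assumes p: "p \<in> points M"
  shows "integral_curve vector_mfd (fibre_field M p (X i)) \<eta> \<longleftrightarrow> integral_curve TM (X i) (\<lambda>t. (p, \<eta> t))"
proof -
  have der: "((\<lambda>s. coord vector_mfd (\<eta> t) (\<eta> s)) has_vector_derivative fibre_field M p (X i) (\<eta> t)) (at t) \<longleftrightarrow>
     ((\<lambda>s. coord TM (p, \<eta> t) (p, \<eta> s)) has_vector_derivative X i (p, \<eta> t)) (at t)" for t
  proof -
    obtain c where c: "c \<in> atlas M" "p \<in> fst c" "coord TM (p, \<eta> t) = bundle_coord c" by (rule TM_coord[OF p])
    let ?a = "chart_at M p"
    let ?J = "jacobian ?a c p" and ?J' = "jacobian c ?a p"
    have a: "?a \<in> atlas M" "p \<in> fst ?a" using chart_at[OF p] by auto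
    have l: "bounded_linear ?J" "bounded_linear ?J'" using jacobian_linear a c by blast+
    have inv: "?J' (?J w) = w" for w using jacobian_inverse[OF a(1) c(1) a(2) c(2)] .
    have X: "X i (p, \<eta> t) = (0, ?J (fibre_field M p (X i) (\<eta> t)))"
      by (rule fibre_field_coord[where Z="X i", OF p c field_vertical[OF p]])
    show ?thesis unfolding vector_mfd_coord c(3) X bundle_coord_eq id_apply
    proof
      assume "(\<eta> has_vector_derivative fibre_field M p (X i) (\<eta> t)) (at t)"
      from bounded_linear.has_vector_derivative[OF l(1) this]
      show "((\<lambda>s. (snd c p, ?J (\<eta> s))) has_vector_derivative (0, ?J (fibre_field M p (X i) (\<eta> t)))) (at t)"
        by (intro has_vector_derivative_Pair has_vector_derivative_const)
    next
      assume "((\<lambda>s. (snd c p, ?J (\<eta> s))) has_vector_derivative (0, ?J (fibre_field M p (X i) (\<eta> t)))) (at t)"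
      from bounded_linear.has_vector_derivative[OF bounded_linear_compose[OF l(2) bounded_linear_snd] this]
      show "(\<eta> has_vector_derivative fibre_field M p (X i) (\<eta> t)) (at t)" by (simp add: inv)
    qed
  qed
  have "continuous_map euclideanreal (mtop TM) (\<lambda>t. (p, \<eta> t))" if "continuous_map euclideanreal euclidean \<eta>"
    using continuous_map_compose[OF that fibre_incl_continuous[OF p]] by (simp add: o_def fibre_incl_def)
  moreover have "continuous_map euclideanreal euclidean \<eta>"
    if "\<forall>t. ((\<lambda>s. coord vector_mfd (\<eta> t) (\<eta> s)) has_vector_derivative fibre_field M p (X i) (\<eta> t)) (at t)"
  proof -
    have "isCont \<eta> t" for t
      by (rule has_vector_derivative_continuous[OF that[rule_format, of t, unfolded vector_mfd_coord id_apply]])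
    then show ?thesis by (simp add: continuous_on_eq_continuous_at)
  qed
  ultimately show ?thesis unfolding integral_curve_def vector_mfd_top der by blast
qed

lemma flow_fibre:
  assumes p: "p \<in> points M"
  shows "flow vector_mfd (fibre_field M p (X i)) t \<xi> = snd (\<psi> (t *\<^sub>R axis i 1) (p, \<xi>))"
proof -
  have y: "(p, \<xi>) \<in> points TM" using p by (simp add: TM_topspace)
  note split = action_fibre[OF p]
  have "(THE c. integral_curve vector_mfd (fibre_field M p (X i)) c \<and> c 0 = \<xi>) = (\<lambda>t. snd (\<psi> (t *\<^sub>R axis i 1) (p, \<xi>)))"
  proof (rule the_equality)
    show "integral_curve vector_mfd (fibre_field M p (X i)) (\<lambda>t. snd (\<psi> (t *\<^sub>R axis i 1) (p, \<xi>))) \<and>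
       snd (\<psi> (0 *\<^sub>R axis i 1) (p, \<xi>)) = \<xi>"
      unfolding integral_curve_fibre_iff[OF p] split
      using orbit_integral_curve[OF TM_charted action fundamental y] action_0[OF y] by simp
    fix c assume c: "integral_curve vector_mfd (fibre_field M p (X i)) c \<and> c 0 = \<xi>"
    then have "integral_curve TM (X i) (\<lambda>t. (p, c t))" unfolding integral_curve_fibre_iff[OF p] by blast
    from integral_curve_eq_orbit[OF TM_charted action fundamental this] c
    have "(p, c t) = \<psi> (t *\<^sub>R axis i 1) (p, \<xi>)" for t by simp
    then show "c = (\<lambda>t. snd (\<psi> (t *\<^sub>R axis i 1) (p, \<xi>)))" by (metis snd_conv ext)
  qed
  then show ?thesis unfolding flow_def by simp
qed

lemma induced_action_TM: "y \<in> points TM \<Longrightarrow> induced_action TM X v f y = f (\<psi> v y)"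
  by (rule induced_action_eq[OF TM_charted action fundamental])

lemma induced_action_fibre:
  assumes p: "p \<in> points M"
  shows "induced_action vector_mfd (\<lambda>i. fibre_field M p (X i)) v f \<xi> = f (snd (\<psi> v (p, \<xi>)))"
proof -
  have y: "(p, \<xi>) \<in> points TM" using p by (simp add: TM_topspace)
  have "(p, foldr (\<lambda>i. flow vector_mfd (fibre_field M p (X i)) (v $ i)) is \<xi>) =
     foldr (\<lambda>i. \<psi> ((v $ i) *\<^sub>R axis i 1)) is (p, \<xi>)" for "is"
  proof (induction "is")
    case (Cons i "is")
    let ?\<zeta> = "foldr (\<lambda>i. flow vector_mfd (fibre_field M p (X i)) (v $ i)) is \<xi>"
    show ?case using action_fibre[OF p, of "(v $ i) *\<^sub>R axis i 1" ?\<zeta>] Cons.IH by (simp add: flow_fibre[OF p])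
  qed simp
  from this[of "sorted_list_of_set UNIV"] action_of_coordinates[OF action y, of v]
  have "foldr (\<lambda>i. flow vector_mfd (fibre_field M p (X i)) (v $ i)) (sorted_list_of_set UNIV) \<xi> = snd (\<psi> v (p, \<xi>))"
    by (simp add: prod_eq_iff)
  then show ?thesis unfolding induced_action_def by simp
qed

lemma induced_action_equivariant:
  assumes p: "p \<in> points M"
  shows "induced_action vector_mfd (\<lambda>i. fibre_field M p (X i)) v (fibre_restrict p f) =
    fibre_restrict p (induced_action TM X v f)"
proof
  fix \<xi>
  have y: "(p, \<xi>) \<in> points TM" using p by (simp add: TM_topspace)
  show "induced_action vector_mfd (\<lambda>i. fibre_field M p (X i)) v (fibre_restrict p f) \<xi> =
    fibre_restrict p (induced_action TM X v f) \<xi>"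
    by (simp add: induced_action_fibre[OF p] fibre_restrict_def fibre_incl_def induced_action_TM[OF y] action_fibre[OF p])
qed

section \<open>Invariant compact sets\<close>

text \<open>A constant curve is an integral curve of every field that vanishes at its value.\<close>

lemma fixed_point:
  assumes y: "y \<in> points TM" and X0: "\<And>i. X i y = 0"
  shows "\<psi> v y = y"
proof -
  have "\<psi> (t *\<^sub>R axis i 1) y = y" for t i
  proof -
    have "integral_curve TM (X i) (\<lambda>_. y)" unfolding integral_curve_def using y X0 by simp
    from integral_curve_eq_orbit[OF TM_charted action fundamental this] show ?thesis by simp
  qed
  then have "foldr (\<lambda>i. \<psi> ((v $ i) *\<^sub>R axis i 1)) is y = y" for "is" by (induction "is") auto
  then show ?thesis using action_of_coordinates[OF action y, of v] by simp
qed

text \<open>Over \<open>p0\<close> the union \<open>S\<close> of the supports lies inside the ball of radius \<open>R\<close>, so the sphere of radius \<open>R\<close>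
misses \<open>S\<close>. By the tube lemma the same holds over a closed ball around \<open>x0\<close>. Points on these spheres
are fixed points; therefore an orbit that starts inside cannot leave, for by the intermediate value
theorem it would have to pass through a fixed point. So the closed tube itself is invariant.\<close>

lemma invariant_compact_neighbourhood:
  assumes y0: "y0 \<in> points TM"
  shows "\<exists>U K. openin (mtop TM) U \<and> y0 \<in> U \<and> U \<subseteq> K \<and> compactin (mtop TM) K \<and> (\<forall>v. \<forall>y\<in>K. \<psi> v y \<in> K)"
proof -
  obtain p0 \<xi>0 where y0': "y0 = (p0, \<xi>0)" by (cases y0)
  have p0: "p0 \<in> points M" using y0 by (simp add: y0' TM_topspace)
  define c where "c = chart_at M p0"
  define x0 where "x0 = snd c p0"
  have c: "c \<in> atlas M" "p0 \<in> fst c" using chart_at[OF p0] by (auto simp: c_def)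
  have coord_fibre: "bundle_coord c (p0, \<xi>) = (x0, \<xi>)" for \<xi> unfolding c_def x0_def by (rule bundle_coord_fibre[OF p0])
  define S where "S = (\<Union>i. field_support TM (X i))"
  have S: "closedin (mtop TM) S" unfolding S_def field_support_def by (intro closedin_Union) auto
  have "bounded (fibre_incl p0 -` S)"
  proof -
    have "compact (fibre_incl p0 -` (field_support TM (X i) \<inter> range (fibre_incl p0)))" for i
      by (rule fibre_vimage_compact[OF p0 support_compact[OF p0]])
    moreover have "fibre_incl p0 -` (field_support TM (X i) \<inter> range (fibre_incl p0)) = fibre_incl p0 -` field_support TM (X i)" for i
      by auto
    ultimately have "bounded (fibre_incl p0 -` field_support TM (X i))" for i by (simp add: compact_imp_bounded)
    then have "bounded (\<Union>i. fibre_incl p0 -` field_support TM (X i))" by (intro bounded_UN) auto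
    moreover have "fibre_incl p0 -` S = (\<Union>i. fibre_incl p0 -` field_support TM (X i))" by (auto simp: S_def)
    ultimately show ?thesis by simp
  qed
  then obtain R1 where R1: "\<And>\<xi>. \<xi> \<in> fibre_incl p0 -` S \<Longrightarrow> norm \<xi> \<le> R1" unfolding bounded_iff by blast
  \<comment> \<open>The given point has to lie inside the sphere as well.\<close>
  define R where "R = max R1 (norm \<xi>0) + 1"
  have R: "norm \<xi> < R" if "(p0, \<xi>) \<in> S" for \<xi> using R1[of \<xi>] that by (simp add: R_def fibre_incl_def)
  have R0: "norm \<xi>0 < R" by (simp add: R_def)
  define \<Omega> where "\<Omega> = bundle_coord c ` (fst c \<times> UNIV \<inter> (points TM - S))"
  have \<Omega>: "open \<Omega>" unfolding \<Omega>_def by (rule bundle_coord_image_open[OF c(1)]) (use S in auto)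
  have "{x0} \<times> sphere 0 R \<subseteq> \<Omega>"
  proof clarify
    fix \<xi> :: 'e assume "\<xi> \<in> sphere 0 R"
    then have "(p0, \<xi>) \<in> fst c \<times> UNIV \<inter> (points TM - S)" using R[of \<xi>] c p0 by (auto simp: TM_topspace)
    then show "(x0, \<xi>) \<in> \<Omega>" unfolding \<Omega>_def coord_fibre[symmetric] by (rule imageI)
  qed
  from Elementary_Topology.tube_lemma[OF compact_sphere \<Omega> this]
  obtain X0 where "x0 \<in> X0 \<and> open X0 \<and> X0 \<times> sphere 0 R \<subseteq> \<Omega>" ..
  then have X0: "x0 \<in> X0" "open X0" "X0 \<times> sphere 0 R \<subseteq> \<Omega>" by auto
  have "open (X0 \<inter> snd c ` fst c)" using X0(2) chart_props(2)[OF c(1)] by auto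
  moreover have "x0 \<in> X0 \<inter> snd c ` fst c" using X0(1) c by (auto simp: x0_def)
  ultimately obtain r where r: "r > 0" "cball x0 r \<subseteq> X0 \<inter> snd c ` fst c"
    using open_contains_cball by blast
  define B where "B = cball x0 r \<times> cball (0::'e) R"
  define K where "K = bundle_point c ` B"
  define U where "U = fst c \<times> UNIV \<inter> bundle_coord c -` (ball x0 r \<times> ball 0 R)"
  have B: "B \<subseteq> snd c ` fst c \<times> UNIV" using r(2) by (auto simp: B_def)
  have U_open: "openin (mtop TM) U" unfolding U_def by (rule TM_basic_open[OF c(1)]) (auto intro: open_Times)
  have y0U: "y0 \<in> U" unfolding U_def y0' using coord_fibre c r(1) R0 by simp
  have UK: "U \<subseteq> K"
  proof
    fix y assume y: "y \<in> U"
    then have "bundle_coord c y \<in> B" unfolding U_def B_def by (auto simp: mem_Times_iff)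
    moreover have "y = bundle_point c (bundle_coord c y)" using bundle_point_left[OF c(1)] y unfolding U_def by auto
    ultimately show "y \<in> K" unfolding K_def by blast
  qed
  have K: "compactin (mtop TM) K" unfolding K_def
    by (rule bundle_point_compact[OF c(1) _ B]) (auto simp: B_def intro: compact_Times)
  have inv: "\<psi> v y \<in> K" if y: "y \<in> K" for v y
  proof -
    obtain x \<eta> where z: "(x, \<eta>) \<in> B" "y = bundle_point c (x, \<eta>)" using y unfolding K_def by auto
    have ky: "bundle_coord c y = (x, \<eta>)" "y \<in> fst c \<times> UNIV" using bundle_point_right[OF c(1)] z B by auto
    have yp: "y \<in> points TM" using ky(2) chart_props(4)[OF c(1)] by (auto simp: TM_topspace)
    have dom: "\<psi> w y \<in> fst c \<times> UNIV" for w using vertical[OF yp, of w] ky(2) by (auto simp: mem_Times_iff)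
    have fx: "fst (bundle_coord c (\<psi> w y)) = x" for w
    proof -
      have "fst (bundle_coord c (\<psi> w y)) = snd c (fst (\<psi> w y))" using bundle_coord_eq by (metis fst_conv prod.collapse)
      also have "\<dots> = fst (bundle_coord c y)" unfolding vertical[OF yp] using bundle_coord_eq by (metis fst_conv prod.collapse)
      finally show ?thesis using ky by simp
    qed
    have "norm (snd (bundle_coord c (\<psi> v y))) \<le> R"
    proof (rule ccontr)
      assume big: "\<not> norm (snd (bundle_coord c (\<psi> v y))) \<le> R"
      define f where "f t = norm (snd (bundle_coord c (\<psi> (t *\<^sub>R v) y)))" for t
      have "continuous_map euclideanreal (mtop TM) (\<lambda>t. \<psi> (t *\<^sub>R v) y)"
        by (rule smooth_action_continuous[OF action]) (auto intro!: continuous_intros simp: yp)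
      then have "continuous_map euclideanreal (subtopology (mtop TM) (fst c \<times> UNIV)) (\<lambda>t. \<psi> (t *\<^sub>R v) y)"
        using dom by (auto simp: continuous_map_in_subtopology)
      from continuous_map_compose[OF this bundle_coord_continuous[OF c(1)]]
      have "continuous_on UNIV (\<lambda>t. bundle_coord c (\<psi> (t *\<^sub>R v) y))" by (simp add: o_def)
      then have "continuous_on UNIV f" unfolding f_def by (intro continuous_on_norm continuous_on_snd)
      then have fc: "continuous_on {0..1} f" by (rule continuous_on_subset) simp
      have "f 0 \<le> R" using z(1) ky action_0[OF yp] by (simp add: f_def B_def)
      moreover have "R \<le> f 1" using big by (simp add: f_def)
      ultimately obtain t where t: "f t = R" using IVT'[of f 0 R 1] fc by auto
      define y' where "y' = \<psi> (t *\<^sub>R v) y"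
      have y'p: "y' \<in> points TM" unfolding y'_def by (rule action_points[OF yp])
      have "bundle_coord c y' \<in> X0 \<times> sphere 0 R"
        using fx[of "t *\<^sub>R v"] t r(2) z(1) by (auto simp: y'_def f_def mem_Times_iff B_def)
      then have "bundle_coord c y' \<in> \<Omega>" by (rule subsetD[OF X0(3)])
      then obtain y'' where "bundle_coord c y' = bundle_coord c y''" "y'' \<in> fst c \<times> UNIV \<inter> (points TM - S)"
        unfolding \<Omega>_def by (rule imageE)
      then have y'': "y'' \<in> fst c \<times> UNIV" "y'' \<notin> S" "bundle_coord c y' = bundle_coord c y''" by auto
      have "y' = y''" using inj_onD[OF bundle_coord_inj[OF c(1)] y''(3)] y''(1) dom by (simp add: y'_def)
      then have y'S: "y' \<notin> S" using y''(2) by simp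
      have "X i y' = 0" for i
      proof (rule ccontr)
        assume "X i y' \<noteq> 0"
        then have "y' \<in> {x \<in> points TM. X i x \<noteq> 0}" using y'p by simp
        moreover have "{x \<in> points TM. X i x \<noteq> 0} \<subseteq> field_support TM (X i)"
          unfolding field_support_def by (rule closure_of_subset) auto
        ultimately show False using y'S unfolding S_def by blast
      qed
      from fixed_point[OF y'p this] have fixd: "\<psi> w y' = y'" for w .
      have "\<psi> (- (t *\<^sub>R v)) y' = y" unfolding y'_def action_add[OF yp, symmetric] by (simp add: action_0[OF yp])
      \<comment> \<open>A fixed point on the orbit of \<open>y\<close> is \<open>y\<close> itself.\<close>
      then have "y = y'" using fixd by simp
      then have "\<psi> v y = y" using fixd by simp
      then show False using big z(1) ky by (simp add: B_def)
    qed
    then have "bundle_coord c (\<psi> v y) \<in> B" using fx[of v] z(1) by (simp add: B_def mem_Times_iff)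
    then show ?thesis unfolding K_def using bundle_point_left[OF c(1) dom[of v]] by (metis imageI)
  qed
  show ?thesis by (intro exI[of _ U] exI[of _ K] conjI allI ballI U_open y0U UK K inv)
qed

lemma invariant_compact:
  assumes L: "compactin (mtop TM) L"
  shows "\<exists>K. compactin (mtop TM) K \<and> L \<subseteq> K \<and> (\<forall>v. \<forall>y\<in>K. \<psi> v y \<in> K)"
proof -
  let ?P = "\<lambda>U K. U \<subseteq> K \<and> compactin (mtop TM) K \<and> (\<forall>v. \<forall>y\<in>K. \<psi> v y \<in> K)"
  define \<U> where "\<U> = {U. openin (mtop TM) U \<and> (\<exists>K. ?P U K)}"
  have "L \<subseteq> \<Union>\<U>"
  proof
    fix y assume "y \<in> L"
    then have "y \<in> points TM" using L compactin_subset_topspace by blast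
    from invariant_compact_neighbourhood[OF this] show "y \<in> \<Union>\<U>" unfolding \<U>_def by blast
  qed
  moreover have "\<forall>U\<in>\<U>. openin (mtop TM) U" unfolding \<U>_def by blast
  ultimately obtain \<F> where \<F>: "finite \<F>" "\<F> \<subseteq> \<U>" "L \<subseteq> \<Union>\<F>" using L unfolding compactin_def by meson
  have "\<forall>U\<in>\<F>. \<exists>K. ?P U K" using \<F>(2) unfolding \<U>_def by blast
  from bchoice[OF this] obtain K where K: "\<forall>U\<in>\<F>. ?P U (K U)" by blast
  have "compactin (mtop TM) (\<Union>(K ` \<F>))" using \<F>(1) K by (intro compactin_Union) auto
  moreover have "L \<subseteq> \<Union>(K ` \<F>)" using \<F>(3) K by blast
  moreover have "\<psi> v y \<in> \<Union>(K ` \<F>)" if "y \<in> \<Union>(K ` \<F>)" for v y using that K by blast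
  ultimately show ?thesis by blast
qed

end

section \<open>Extending functions off a fibre\<close>

context smooth_mfd
begin

text \<open>In the bundle chart that belongs to \<open>chart_at M p\<close>, the vector component is a retraction \<open>\<rho>\<close> onto the
fibre over \<open>p\<close>; \<open>\<eta>\<close> is a continuous bump function of the base point, supported in a closed coordinate
ball. Since \<open>M\<close> is Hausdorff, this ball is closed in \<open>M\<close>, which makes extension by 0 continuous.\<close>

lemma fibre_retraction:
  assumes p: "p \<in> points M"
  obtains \<eta> :: "'m \<times> 'e \<Rightarrow> real" and \<rho> :: "'m \<times> 'e \<Rightarrow> 'e"
  where "\<And>y. 0 \<le> \<eta> y" "\<And>y. \<eta> y \<le> 1" "\<And>y. y \<notin> points TM \<Longrightarrow> \<eta> y = 0"
    and "\<And>\<xi>. \<eta> (fibre_incl p \<xi>) = 1" "\<And>\<xi>. \<rho> (fibre_incl p \<xi>) = \<xi>"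
    and "\<And>f :: 'e \<Rightarrow> complex. continuous_on UNIV f \<Longrightarrow>
       continuous_map (mtop TM) euclidean (\<lambda>y. complex_of_real (\<eta> y) * f (\<rho> y))"
    and "\<And>L. compactin (mtop TM) L \<Longrightarrow> \<exists>K. compact K \<and> (\<forall>y\<in>L. \<eta> y \<noteq> 0 \<longrightarrow> \<rho> y \<in> K)"
    and "\<And>K. compact K \<Longrightarrow> \<exists>L. compactin (mtop TM) L \<and> (\<forall>y. \<eta> y \<noteq> 0 \<longrightarrow> \<rho> y \<in> K \<longrightarrow> y \<in> L)"
proof -
  define c where "c = chart_at M p"
  define x0 where "x0 = snd c p"
  have c: "c \<in> atlas M" "p \<in> fst c" using chart_at[OF p] by (auto simp: c_def)
  have coord_fibre: "bundle_coord c (p, \<xi>) = (x0, \<xi>)" for \<xi> unfolding c_def x0_def by (rule bundle_coord_fibre[OF p])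
  obtain r where r: "r > 0" "cball x0 r \<subseteq> snd c ` fst c"
    using chart_props(2)[OF c(1)] c(2) open_contains_cball unfolding x0_def by blast
  \<comment> \<open>Continuity of the bump function suffices: smoothness of vectors only concerns the variable of the acting group.\<close>
  define \<beta> where "\<beta> x = max 0 (1 - dist x x0 / r)" for x
  have \<beta>c: "continuous_on UNIV \<beta>" unfolding \<beta>_def using r(1) by (intro continuous_intros) auto
  define \<eta> where "\<eta> y = (if y \<in> fst c \<times> UNIV then \<beta> (snd c (fst y)) else 0)" for y :: "'m \<times> 'e"
  define \<rho> where "\<rho> y = snd (bundle_coord c y)" for y
  define C where "C = fst c \<inter> snd c -` cball x0 r"
  have C: "closedin (mtop M) C"
  proof -
    have "snd c ` C = cball x0 r" using r(2) unfolding C_def by auto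
    then have "compactin (top_of_set (snd c ` fst c)) (snd c ` C)"
      using r(2) by (simp add: compactin_subtopology)
    then have "compactin (subtopology (mtop M) (fst c)) C"
      using homeomorphic_map_compactness[OF chart_props(3)[OF c(1)], of C] chart_props(4)[OF c(1)]
      by (auto simp: C_def)
    then have "compactin (mtop M) C" by (simp add: compactin_subtopology)
    then show ?thesis using Hausdorff compactin_imp_closedin by blast
  qed
  define D where "D = {y \<in> points TM. fst y \<in> C}"
  have D: "closedin (mtop TM) D" unfolding D_def by (rule closedin_continuous_map_preimage[OF fst_continuous C])
  have Dsub: "D \<subseteq> fst c \<times> UNIV" unfolding D_def C_def by auto
  have \<eta>D: "\<eta> y \<noteq> 0 \<Longrightarrow> y \<in> D" for y
    using r(1) chart_props(4)[OF c(1)] unfolding \<eta>_def D_def C_def \<beta>_def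
    by (auto simp: TM_topspace max_def dist_commute field_simps split: if_splits)
  have fk: "fst (bundle_coord c y) = snd c (fst y)" for y using bundle_coord_eq by (metis fst_conv prod.collapse)
  show thesis
  proof (rule that[of \<eta> \<rho>])
    show "0 \<le> \<eta> y" "\<eta> y \<le> 1" for y using r(1) by (auto simp: \<eta>_def \<beta>_def)
    show "\<eta> y = 0" if "y \<notin> points TM" for y using \<eta>D[of y] that unfolding D_def by blast
    show "\<eta> (fibre_incl p \<xi>) = 1" for \<xi> using c by (simp add: \<eta>_def \<beta>_def fibre_incl_def x0_def)
    show "\<rho> (fibre_incl p \<xi>) = \<xi>" for \<xi> by (simp add: \<rho>_def fibre_incl_def coord_fibre)
  next
    fix f :: "'e \<Rightarrow> complex" assume f: "continuous_on UNIV f"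
    let ?g = "\<lambda>y. complex_of_real (\<eta> y) * f (\<rho> y)"
    let ?h = "\<lambda>z. complex_of_real (\<beta> (fst z)) * f (snd z)"
    \<comment> \<open>The function is continuous on the chart domain and 0 on the complement of the closed set \<open>D\<close>; these two open sets cover.\<close>
    let ?O = "\<lambda>b. if b then fst c \<times> UNIV else points TM - D"
    show "continuous_map (mtop TM) euclidean ?g"
    proof (rule pasting_lemma[where T="?O" and I=UNIV and f="\<lambda>_. ?g"])
      show "openin (mtop TM) (?O b)" for b using D TM_chart_domain_open[OF c(1)] by auto
      show "continuous_map (subtopology (mtop TM) (?O b)) euclidean ?g" for b
      proof (cases b)
        case True
        have "continuous_map euclidean euclidean ?h"
          using f \<beta>c by (auto intro!: continuous_intros continuous_on_compose2[OF f] continuous_on_compose2[OF \<beta>c])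
        from continuous_map_compose[OF bundle_coord_continuous[OF c(1)] this]
        have "continuous_map (subtopology (mtop TM) (fst c \<times> UNIV)) euclidean (?h \<circ> bundle_coord c)" .
        then have "continuous_map (subtopology (mtop TM) (fst c \<times> UNIV)) euclidean ?g"
          by (rule continuous_map_eq) (auto simp: \<eta>_def \<rho>_def fk)
        then show ?thesis using True by simp
      next
        case False
        have "continuous_map (subtopology (mtop TM) (points TM - D)) euclidean (\<lambda>_. 0::complex)" by simp
        then have "continuous_map (subtopology (mtop TM) (points TM - D)) euclidean ?g"
          by (rule continuous_map_eq) (use \<eta>D in auto)
        then show ?thesis using False by simp
      qed
      show "\<exists>b. b \<in> UNIV \<and> y \<in> ?O b \<and> ?g y = ?g y" if "y \<in> topspace (mtop TM)" for y
        using that Dsub by (cases "y \<in> D") (auto intro: exI[of _ True] exI[of _ False])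
    qed auto
  next
    fix L assume L: "compactin (mtop TM) L"
    have "compactin (mtop TM) (D \<inter> L)" by (rule closed_Int_compactin[OF D L])
    then have "compactin (subtopology (mtop TM) (fst c \<times> UNIV)) (D \<inter> L)"
      using Dsub by (auto simp: compactin_subtopology)
    from image_compactin[OF this bundle_coord_continuous[OF c(1)]] have "compact (bundle_coord c ` (D \<inter> L))" by simp
    then have "compact (snd ` bundle_coord c ` (D \<inter> L))" by (intro compact_continuous_image continuous_intros)
    then show "\<exists>K. compact K \<and> (\<forall>y\<in>L. \<eta> y \<noteq> 0 \<longrightarrow> \<rho> y \<in> K)"
      using \<eta>D by (intro exI[of _ "snd ` bundle_coord c ` (D \<inter> L)"]) (auto simp: \<rho>_def)
  next
    fix K :: "'e set" assume K: "compact K"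
    let ?L = "bundle_point c ` (cball x0 r \<times> K)"
    have "compactin (mtop TM) ?L"
      by (rule bundle_point_compact[OF c(1)]) (use K r(2) in \<open>auto intro: compact_Times\<close>)
    moreover have "y \<in> ?L" if "\<eta> y \<noteq> 0" "\<rho> y \<in> K" for y
    proof -
      have y: "y \<in> D" using \<eta>D that(1) .
      then have "bundle_coord c y \<in> cball x0 r \<times> K" using that(2) by (auto simp: D_def C_def \<rho>_def mem_Times_iff fk)
      moreover have "bundle_point c (bundle_coord c y) = y" using bundle_point_left[OF c(1)] y Dsub by blast
      ultimately show ?thesis by (metis imageI)
    qed
    ultimately show "\<exists>L. compactin (mtop TM) L \<and> (\<forall>y. \<eta> y \<noteq> 0 \<longrightarrow> \<rho> y \<in> K \<longrightarrow> y \<in> L)" by blast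
  qed
qed

end

section \<open>The algebras of continuous functions\<close>

lemma continuous_map_binop:
  fixes f g :: "'n \<Rightarrow> complex"
  assumes "continuous_map T euclidean f" "continuous_map T euclidean g"
    and "continuous_on UNIV (\<lambda>z. F (fst z) (snd z) :: complex)"
  shows "continuous_map T euclidean (\<lambda>x. F (f x) (g x))"
proof -
  have "continuous_map T (prod_topology euclidean euclidean) (\<lambda>x. (f x, g x))"
    using assms(1,2) by (simp only: continuous_map_paired)
  from continuous_map_compose[OF this, of euclidean "\<lambda>z. F (fst z) (snd z)"] assms(3)
  show ?thesis by (simp add: o_def)
qed

lemma continuous_map_locally_uniform_limit:
  fixes f :: "'n \<Rightarrow> complex"
  assumes "\<And>x \<epsilon>. x \<in> topspace T \<Longrightarrow> \<epsilon> > 0 \<Longrightarrow> \<exists>U g. openin T U \<and> x \<in> U \<and> continuous_map T euclidean g \<and>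
     (\<forall>y\<in>U. norm (f y - g y) \<le> \<epsilon>)"
  shows "continuous_map T euclidean f"
  unfolding continuous_map
proof (intro conjI allI impI)
  fix V :: "complex set" assume V: "openin euclidean V"
  show "openin T {x \<in> topspace T. f x \<in> V}"
  proof (subst openin_subopen, rule ballI)
    fix x assume x: "x \<in> {x \<in> topspace T. f x \<in> V}"
    then obtain e where e: "e > 0" "ball (f x) e \<subseteq> V" using V by (auto simp: open_contains_ball)
    obtain U g where U: "openin T U" "x \<in> U" "continuous_map T euclidean g" "\<forall>y\<in>U. norm (f y - g y) \<le> e/3"
      using assms[of x "e/3"] x e(1) by auto
    define O1 where "O1 = {y \<in> topspace T. g y \<in> ball (g x) (e/3)}"
    have O1: "openin T O1" unfolding O1_def by (rule openin_continuous_map_preimage[OF U(3)]) simp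
    have "f y \<in> V" if y: "y \<in> U \<inter> O1" for y
    proof -
      have 1: "dist (f x) (g x) \<le> e/3" "dist (f y) (g y) \<le> e/3" using U(2,4) y by (auto simp: dist_norm)
      have 2: "dist (g x) (g y) < e/3" using y by (simp add: O1_def)
      have "dist (f x) (f y) \<le> dist (f x) (g x) + dist (g x) (g y) + dist (f y) (g y)"
        using dist_triangle[of "f x" "f y" "g x"] dist_triangle[of "g x" "f y" "g y"]
        by (simp add: dist_commute)
      then have "f y \<in> ball (f x) e" using 1 2 by simp
      then show ?thesis using e(2) by blast
    qed
    moreover have "x \<in> U \<inter> O1" using x U(2) e(1) by (simp add: O1_def)
    ultimately show "\<exists>S. openin T S \<and> x \<in> S \<and> S \<subseteq> {x \<in> topspace T. f x \<in> V}"
      using openin_Int[OF U(1) O1] openin_subset[OF U(1)] by (intro exI[of _ "U \<inter> O1"]) auto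
  qed
qed simp

lemma cfuns_zero: "(\<lambda>_. 0) \<in> cfuns T"
  by (simp add: cfuns_def)

lemma cfuns_binop:
  assumes "f \<in> cfuns T" "g \<in> cfuns T" "continuous_on UNIV (\<lambda>z. F (fst z) (snd z) :: complex)" "F 0 0 = 0"
  shows "(\<lambda>x. F (f x) (g x)) \<in> cfuns T"
  using assms continuous_map_binop[of T f g F] by (simp add: cfuns_def)

lemma cfuns_add: "f \<in> cfuns T \<Longrightarrow> g \<in> cfuns T \<Longrightarrow> (\<lambda>x. f x + g x) \<in> cfuns T"
  by (rule cfuns_binop) (auto intro!: continuous_intros)

lemma cfuns_mult: "f \<in> cfuns T \<Longrightarrow> g \<in> cfuns T \<Longrightarrow> (\<lambda>x. f x * g x) \<in> cfuns T"
  by (rule cfuns_binop) (auto intro!: continuous_intros)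

lemma cfuns_cmult: "f \<in> cfuns T \<Longrightarrow> (\<lambda>x. c * f x) \<in> cfuns T"
  by (rule cfuns_binop[where F="\<lambda>z w. c * z" and g=f]) (auto intro!: continuous_intros)

lemma cfuns_cnj: "f \<in> cfuns T \<Longrightarrow> (\<lambda>x. cnj (f x)) \<in> cfuns T"
  by (rule cfuns_binop[where F="\<lambda>z w. cnj z" and g=f]) (auto intro!: continuous_intros)

lemma cfuns_bounded:
  assumes "f \<in> cfuns T" "compactin T L"
  shows "\<exists>C. \<forall>x\<in>L. norm (f x) \<le> C"
proof -
  have "compactin euclidean (f ` L)" using assms image_compactin[of T L euclidean f] unfolding cfuns_def by auto
  then have "bounded (f ` L)" by (simp add: compact_imp_bounded)
  then show ?thesis by (auto simp: bounded_iff)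
qed

text \<open>Local compactness enters through completeness: a function that is a uniform limit of continuous functions
on each compact set is continuous because every point has a compact neighbourhood.\<close>

lemma sup_algebra_C0:
  assumes lc: "\<And>x. x \<in> topspace T \<Longrightarrow> \<exists>U K. openin T U \<and> x \<in> U \<and> U \<subseteq> K \<and> compactin T K"
  shows "sup_algebra T {L. compactin T L} (C0 T)"
proof
  fix f assume f0: "\<And>x. x \<notin> topspace T \<Longrightarrow> f x = 0"
    and app: "\<And>L \<epsilon>. L \<in> {L. compactin T L} \<Longrightarrow> \<epsilon> > 0 \<Longrightarrow> \<exists>g\<in>elts (C0 T). \<forall>x\<in>L. norm (f x - g x) \<le> \<epsilon>"
  have "continuous_map T euclidean f"
  proof (rule continuous_map_locally_uniform_limit)
    fix x and \<epsilon> :: real assume "x \<in> topspace T" and e: "\<epsilon> > 0"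
    then obtain U K where U: "openin T U" "x \<in> U" "U \<subseteq> K" "compactin T K" using lc by blast
    obtain g where "g \<in> cfuns T" "\<forall>x\<in>K. norm (f x - g x) \<le> \<epsilon>" using app[of K, OF _ e] U(4) by (auto simp: C0_def)
    then show "\<exists>U g. openin T U \<and> x \<in> U \<and> continuous_map T euclidean g \<and> (\<forall>y\<in>U. norm (f y - g y) \<le> \<epsilon>)"
      using U by (intro exI[of _ U] exI[of _ g]) (auto simp: cfuns_def)
  qed
  then show "f \<in> elts (C0 T)" using f0 by (simp add: C0_def cfuns_def)
next
  show "\<exists>L''\<in>{L. compactin T L}. L \<union> L' \<subseteq> L''" if "L \<in> {L. compactin T L}" "L' \<in> {L. compactin T L}" for L L'
    using that compactin_Un by blast
  show "\<exists>C. \<forall>x\<in>L. norm (a x) \<le> C" if "a \<in> elts (C0 T)" "L \<in> {L. compactin T L}" for a L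
    using that cfuns_bounded by (auto simp: C0_def)
  show "\<exists>L\<in>{L. compactin T L}. x \<in> L" if "x \<in> topspace T" for x
    using that by (intro bexI[of _ "{x}"]) auto
  show "L \<subseteq> topspace T" if "L \<in> {L. compactin T L}" for L using that compactin_subset_topspace by blast
  show "{L. compactin T L} \<noteq> {}" by (auto intro: exI[of _ "{}"])
qed (auto simp: C0_def cfuns_zero cfuns_add cfuns_mult cfuns_cmult cfuns_cnj, auto simp: cfuns_def)

lemma cfuns_uniform_limit:
  assumes "\<And>x. x \<notin> topspace T \<Longrightarrow> f x = 0"
    and "\<And>\<epsilon>. \<epsilon> > 0 \<Longrightarrow> \<exists>g\<in>cfuns T. \<forall>x\<in>topspace T. norm (f x - g x) \<le> \<epsilon>"
  shows "f \<in> cfuns T"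
proof -
  have "continuous_map T euclidean f"
  proof (rule continuous_map_locally_uniform_limit)
    fix x and \<epsilon> :: real assume x: "x \<in> topspace T" and e: "\<epsilon> > 0"
    obtain g where "g \<in> cfuns T" "\<forall>x\<in>topspace T. norm (f x - g x) \<le> \<epsilon>" using assms(2)[OF e] by blast
    then show "\<exists>U g. openin T U \<and> x \<in> U \<and> continuous_map T euclidean g \<and> (\<forall>y\<in>U. norm (f y - g y) \<le> \<epsilon>)"
      using x by (intro exI[of _ "topspace T"] exI[of _ g]) (auto simp: cfuns_def)
  qed
  then show ?thesis using assms(1) by (simp add: cfuns_def)
qed

lemma C0b_iff: "f \<in> elts (C0b T) \<longleftrightarrow> f \<in> cfuns T \<and> (\<exists>C. \<forall>x\<in>topspace T. norm (f x) \<le> C)"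
  by (auto simp: C0b_def bounded_iff)

lemma sup_algebra_C0b: "sup_algebra T {topspace T} (C0b T)"
proof
  fix f assume f0: "\<And>x. x \<notin> topspace T \<Longrightarrow> f x = 0"
    and app: "\<And>L \<epsilon>. L \<in> {topspace T} \<Longrightarrow> \<epsilon> > 0 \<Longrightarrow> \<exists>g\<in>elts (C0b T). \<forall>x\<in>L. norm (f x - g x) \<le> \<epsilon>"
  have "f \<in> cfuns T"
  proof (rule cfuns_uniform_limit)
    show "f x = 0" if "x \<notin> topspace T" for x by (rule f0[OF that])
    show "\<exists>g\<in>cfuns T. \<forall>x\<in>topspace T. norm (f x - g x) \<le> \<epsilon>" if e: "\<epsilon> > 0" for \<epsilon>
    proof -
      obtain g where "g \<in> elts (C0b T)" "\<forall>x\<in>topspace T. norm (f x - g x) \<le> \<epsilon>"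
        using app[OF singletonI e] by blast
      then show ?thesis unfolding C0b_iff by blast
    qed
  qed
  moreover have "\<exists>C. \<forall>x\<in>topspace T. norm (f x) \<le> C"
  proof -
    obtain g C where g: "\<forall>x\<in>topspace T. norm (f x - g x) \<le> 1" "\<forall>x\<in>topspace T. norm (g x) \<le> C"
      using app[of "topspace T" 1] C0b_iff by (metis insertI1 zero_less_one)
    have "norm (f x) \<le> 1 + C" if "x \<in> topspace T" for x
      using g that norm_triangle_ineq[of "f x - g x" "g x"] by force
    then show ?thesis by blast
  qed
  ultimately show "f \<in> elts (C0b T)" by (simp add: C0b_iff)
next
  fix a b assume "a \<in> elts (C0b T)" "b \<in> elts (C0b T)"
  then obtain C D where C: "a \<in> cfuns T" "b \<in> cfuns T" "\<forall>x\<in>topspace T. norm (a x) \<le> C" "\<forall>x\<in>topspace T. norm (b x) \<le> D"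
    unfolding C0b_iff by blast
  have "norm (a x + b x) \<le> C + D" if "x \<in> topspace T" for x
    using C(3,4) that norm_triangle_ineq[of "a x" "b x"] by force
  then show "(\<lambda>x. a x + b x) \<in> elts (C0b T)" using C cfuns_add unfolding C0b_iff by blast
  have "norm (a x * b x) \<le> \<bar>C\<bar> * \<bar>D\<bar>" if "x \<in> topspace T" for x
    using C(3,4) that unfolding norm_mult by (intro mult_mono) force+
  then show "(\<lambda>x. a x * b x) \<in> elts (C0b T)" using C cfuns_mult unfolding C0b_iff by blast
next
  fix a c assume "a \<in> elts (C0b T)"
  then obtain C where C: "a \<in> cfuns T" "\<forall>x\<in>topspace T. norm (a x) \<le> C" unfolding C0b_iff by blast
  have "norm (c * a x) \<le> norm c * C" if "x \<in> topspace T" for x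
    using C(2) that by (simp add: norm_mult mult_left_mono)
  then show "(\<lambda>x. c * a x) \<in> elts (C0b T)" using C(1) cfuns_cmult unfolding C0b_iff by blast
  show "(\<lambda>x. cnj (a x)) \<in> elts (C0b T)" using C cfuns_cnj unfolding C0b_iff by auto
qed (auto simp: C0b_iff cfuns_zero, auto simp: C0b_def cfuns_def)

lemma C0inf_iff: "f \<in> elts (C0inf T) \<longleftrightarrow> f \<in> cfuns T \<and>
   (\<forall>\<epsilon>>0. \<exists>K. compactin T K \<and> (\<forall>x\<in>topspace T - K. norm (f x) < \<epsilon>))"
  by (simp add: C0inf_def)

lemma C0inf_bounded:
  assumes "f \<in> elts (C0inf T)"
  shows "\<exists>C. \<forall>x\<in>topspace T. norm (f x) \<le> C"
proof -
  obtain K where K: "compactin T K" "\<forall>x\<in>topspace T - K. norm (f x) < 1"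
    using assms unfolding C0inf_iff by (meson zero_less_one)
  obtain C where "\<forall>x\<in>K. norm (f x) \<le> C" using cfuns_bounded[OF _ K(1)] assms unfolding C0inf_iff by blast
  then have "norm (f x) \<le> max C 1" if "x \<in> topspace T" for x using K(2) that by (cases "x \<in> K") force+
  then show ?thesis by blast
qed

lemma C0infI:
  assumes "g \<in> cfuns T" "f \<in> elts (C0inf T)" "C \<ge> 0" "\<And>x. x \<in> topspace T \<Longrightarrow> norm (g x) \<le> C * norm (f x)"
  shows "g \<in> elts (C0inf T)"
  unfolding C0inf_iff
proof (intro conjI allI impI assms(1))
  fix \<epsilon> :: real assume e: "\<epsilon> > 0"
  then have "\<epsilon> / (C + 1) > 0" using assms(3) by simp
  then obtain K where K: "compactin T K" "\<forall>x\<in>topspace T - K. norm (f x) < \<epsilon> / (C + 1)"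
    using assms(2) unfolding C0inf_iff by blast
  have "norm (g x) < \<epsilon>" if x: "x \<in> topspace T - K" for x
  proof -
    have "norm (g x) \<le> (C + 1) * norm (f x)" using assms(4)[of x] x by (simp add: distrib_right add_increasing2)
    also have "\<dots> < (C + 1) * (\<epsilon> / (C + 1))" using K(2) x assms(3) by (intro mult_strict_left_mono) auto
    finally show ?thesis using assms(3) by simp
  qed
  then show "\<exists>K. compactin T K \<and> (\<forall>x\<in>topspace T - K. norm (g x) < \<epsilon>)" using K(1) by blast
qed

lemma sup_algebra_C0inf: "sup_algebra T {topspace T} (C0inf T)"
proof
  fix f assume f0: "\<And>x. x \<notin> topspace T \<Longrightarrow> f x = 0"
    and app: "\<And>L \<epsilon>. L \<in> {topspace T} \<Longrightarrow> \<epsilon> > 0 \<Longrightarrow> \<exists>g\<in>elts (C0inf T). \<forall>x\<in>L. norm (f x - g x) \<le> \<epsilon>"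
  have "f \<in> cfuns T"
  proof (rule cfuns_uniform_limit)
    show "f x = 0" if "x \<notin> topspace T" for x by (rule f0[OF that])
    show "\<exists>g\<in>cfuns T. \<forall>x\<in>topspace T. norm (f x - g x) \<le> \<epsilon>" if e: "\<epsilon> > 0" for \<epsilon>
    proof -
      obtain g where "g \<in> elts (C0inf T)" "\<forall>x\<in>topspace T. norm (f x - g x) \<le> \<epsilon>"
        using app[OF singletonI e] by blast
      then show ?thesis unfolding C0inf_iff by blast
    qed
  qed
  moreover have "\<exists>K. compactin T K \<and> (\<forall>x\<in>topspace T - K. norm (f x) < \<epsilon>)" if e: "\<epsilon> > 0" for \<epsilon>
  proof -
    obtain g where g: "g \<in> elts (C0inf T)" "\<forall>x\<in>topspace T. norm (f x - g x) \<le> \<epsilon>/2"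
      using app[of "topspace T" "\<epsilon>/2"] e by auto
    obtain K where K: "compactin T K" "\<forall>x\<in>topspace T - K. norm (g x) < \<epsilon>/2"
      using g(1) e unfolding C0inf_iff by (meson half_gt_zero)
    have "norm (f x) < \<epsilon>" if "x \<in> topspace T - K" for x
      using g(2) K(2) that norm_triangle_ineq[of "f x - g x" "g x"] by force
    then show ?thesis using K(1) by blast
  qed
  ultimately show "f \<in> elts (C0inf T)" by (simp add: C0inf_iff)
next
  fix a b assume a: "a \<in> elts (C0inf T)" and b: "b \<in> elts (C0inf T)"
  have "\<exists>K. compactin T K \<and> (\<forall>x\<in>topspace T - K. norm (a x + b x) < \<epsilon>)" if e: "\<epsilon> > 0" for \<epsilon>
  proof -
    obtain K K' where K: "compactin T K" "\<forall>x\<in>topspace T - K. norm (a x) < \<epsilon>/2"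
       "compactin T K'" "\<forall>x\<in>topspace T - K'. norm (b x) < \<epsilon>/2"
      using a b e unfolding C0inf_iff by (meson half_gt_zero)
    have "norm (a x + b x) < \<epsilon>" if "x \<in> topspace T - (K \<union> K')" for x
      using K(2,4) that norm_triangle_ineq[of "a x" "b x"] by force
    then show ?thesis using compactin_Un[OF K(1,3)] by blast
  qed
  then show "(\<lambda>x. a x + b x) \<in> elts (C0inf T)" using a b cfuns_add unfolding C0inf_iff by blast
  obtain C where C: "\<forall>x\<in>topspace T. norm (a x) \<le> C" using C0inf_bounded[OF a] by blast
  show "(\<lambda>x. a x * b x) \<in> elts (C0inf T)"
  proof (rule C0infI[OF _ b, of _ "\<bar>C\<bar>"])
    show "(\<lambda>x. a x * b x) \<in> cfuns T" using a b cfuns_mult unfolding C0inf_iff by blast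
    show "norm (a x * b x) \<le> \<bar>C\<bar> * norm (b x)" if "x \<in> topspace T" for x
      unfolding norm_mult using C that by (intro mult_right_mono) force+
  qed simp
next
  fix a c assume a: "a \<in> elts (C0inf T)"
  have ac: "a \<in> cfuns T" using a unfolding C0inf_iff by blast
  show "(\<lambda>x. c * a x) \<in> elts (C0inf T)" by (rule C0infI[OF cfuns_cmult[OF ac] a, of "norm c"]) (auto simp: norm_mult)
  show "(\<lambda>x. cnj (a x)) \<in> elts (C0inf T)" by (rule C0infI[OF cfuns_cnj[OF ac] a, of 1]) auto
next
  show "\<exists>C. \<forall>x\<in>L. norm (a x) \<le> C" if "a \<in> elts (C0inf T)" "L \<in> {topspace T}" for a L
    using C0inf_bounded that by blast
  show "(\<lambda>_. 0) \<in> elts (C0inf T)" unfolding C0inf_iff using cfuns_zero by (auto intro: exI[of _ "{}"])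
qed (auto simp: C0inf_def cfuns_def)

section \<open>Orbits of smooth vectors are bounded\<close>

text \<open>The derivatives of an orbit map are again orbit maps: \<open>D es v = D es 0 \<circ> \<psi> v\<close> by uniqueness of limits.
Hence they are bounded on an invariant set by the supremum of \<open>D es 0\<close> over this set.\<close>

lemma (in sup_algebra) orbit_smooth_bound:
  fixes \<psi> :: "real^'d \<Rightarrow> 'n \<Rightarrow> 'n"
  assumes \<psi>: "\<And>v n. n \<in> topspace T \<Longrightarrow> \<psi> v n \<in> topspace T"
      "\<And>n. n \<in> topspace T \<Longrightarrow> \<psi> 0 n = n" "\<And>v w n. n \<in> topspace T \<Longrightarrow> \<psi> (v + w) n = \<psi> v (\<psi> w n)"
    and \<alpha>: "\<And>v a n. n \<in> topspace T \<Longrightarrow> \<alpha> v a n = a (\<psi> v n)"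
    and inv: "\<And>L. L \<in> \<L> \<Longrightarrow> \<exists>K\<in>\<L>. L \<subseteq> K \<and> (\<forall>v. \<forall>n\<in>K. \<psi> v n \<in> K)"
    and a: "a \<in> smooth_vectors A \<alpha>"
  shows "smooth_bound (\<lambda>_. 1) (\<lambda>v. \<alpha> v a)"
proof -
  obtain D where D: "derivatives_into A (\<lambda>v. \<alpha> v a) D" using a unfolding smooth_vectors_def smooth_into_def by blast
  have D0: "D [] = (\<lambda>v. \<alpha> v a)" using D unfolding derivatives_into_def by blast
  have m: "D es x \<in> elts A" if "set es \<subseteq> Basis" for es x using D that unfolding derivatives_into_def by blast
  have lim: "((\<lambda>t. (D es (x + t *\<^sub>R b) n - D es x n) / complex_of_real t) \<longlongrightarrow> D (b # es) x n) (at 0)"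
    if es: "set es \<subseteq> Basis" and b: "b \<in> Basis" and n: "n \<in> topspace T" for es b x n
  proof -
    obtain L where L: "L \<in> \<L>" "n \<in> L" using sets_cover[OF n] by blast
    let ?q = "\<lambda>t n. (D es (x + t *\<^sub>R b) n - D es x n) / complex_of_real t - D (b # es) x n"
    have q: "?q t \<in> elts A" for t
    proof -
      have "(\<lambda>n. inverse (complex_of_real t) * (D es (x + t *\<^sub>R b) n - D es x n) - D (b # es) x n) \<in> elts A"
        using es b by (intro elts_diff elts_cmult m) auto
      then show ?thesis by (simp add: field_simps)
    qed
    have "((\<lambda>t. supnorm L (?q t)) \<longlongrightarrow> 0) (at 0)"
      using D es b L unfolding derivatives_into_def snorms_eq by blast
    then have "((\<lambda>t. ?q t n) \<longlongrightarrow> 0) (at 0)"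
      by (rule Lim_null_comparison[rotated]) (use norm_le_snorm[OF q L] in auto)
    then show ?thesis by (simp add: LIM_zero_iff)
  qed
  have eq: "set es \<subseteq> Basis \<Longrightarrow> n \<in> topspace T \<Longrightarrow> D es v n = D es 0 (\<psi> v n)" for es v n
  proof (induction es arbitrary: v n)
    case Nil
    then show ?case unfolding D0 using \<alpha> \<psi> by simp
  next
    case (Cons b es)
    have es: "set es \<subseteq> Basis" and b: "b \<in> Basis" using Cons.prems(1) by auto
    have e: "D es (v + t *\<^sub>R b) n = D es (0 + t *\<^sub>R b) (\<psi> v n)" for t
    proof -
      have "D es (v + t *\<^sub>R b) n = D es 0 (\<psi> (v + t *\<^sub>R b) n)" by (rule Cons.IH[OF es Cons.prems(2)])
      also have "\<psi> (v + t *\<^sub>R b) n = \<psi> (0 + t *\<^sub>R b) (\<psi> v n)"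
        using \<psi>(3)[OF Cons.prems(2), of "t *\<^sub>R b" v] by (simp add: add.commute)
      also have "D es 0 \<dots> = D es (0 + t *\<^sub>R b) (\<psi> v n)"
        by (rule Cons.IH[OF es \<psi>(1)[OF Cons.prems(2)], symmetric])
      finally show ?thesis .
    qed
    have "((\<lambda>t. (D es (v + t *\<^sub>R b) n - D es v n) / complex_of_real t) \<longlongrightarrow> D (b # es) 0 (\<psi> v n)) (at 0)"
      using lim[OF es b \<psi>(1)[OF Cons.prems(2)], of 0 v] unfolding e Cons.IH[OF es Cons.prems(2), of v] .
    with lim[OF es b Cons.prems(2), of v] show ?case by (rule LIM_unique)
  qed
  show ?thesis
  proof (rule derivatives_into_smooth_bound[OF D])
    fix L and es :: "(real^'d) list" assume L: "L \<in> \<L>" and es: "set es \<subseteq> Basis"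
    obtain K where K: "K \<in> \<L>" "L \<subseteq> K" "\<forall>v. \<forall>n\<in>K. \<psi> v n \<in> K" using inv[OF L] by blast
    have "norm (D es v n) \<le> supnorm K (D es 0) * 1" if "n \<in> L" for n v
    proof -
      have n: "n \<in> K" "n \<in> topspace T" using that K(2) sets_subset[OF K(1)] by auto
      show ?thesis unfolding eq[OF es n(2)] using norm_le_snorm[OF m[OF es] K(1)] K(3) n(1) by simp
    qed
    then show "\<exists>C\<ge>0. \<forall>n\<in>L. \<forall>v. norm (D es v n) \<le> C * 1"
      using snorm_nonneg[OF m[OF es] K(1)] by (intro exI[of _ "supnorm K (D es 0)"]) auto
  qed simp
qed

section \<open>Restriction to a fibre\<close>

lemma supnorm_wcomp:
  assumes a: "\<exists>C. \<forall>x\<in>K. norm (a x) \<le> C" and \<kappa>: "\<And>k. k \<in> L \<Longrightarrow> norm (\<kappa> k) \<le> 1"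
    and \<rho>: "\<And>k. k \<in> L \<Longrightarrow> \<kappa> k \<noteq> 0 \<Longrightarrow> \<rho> k \<in> K"
  shows "supnorm L (wcomp \<kappa> \<rho> a) \<le> supnorm K a"
proof (rule supnorm_le[OF _ supnorm_nonneg[OF a]])
  fix k assume k: "k \<in> L"
  show "norm (wcomp \<kappa> \<rho> a k) \<le> supnorm K a"
  proof (cases "\<kappa> k = 0")
    case False
    have "norm (\<kappa> k) * norm (a (\<rho> k)) \<le> 1 * supnorm K a"
      using \<kappa>[OF k] norm_le_supnorm[OF a \<rho>[OF k False]] by (intro mult_mono) auto
    then show ?thesis by (simp add: wcomp_def norm_mult)
  qed (simp add: wcomp_def supnorm_nonneg[OF a])
qed

lemma weighted_compositionI:
  assumes A: "sup_algebra S \<K> A" and B: "sup_algebra T \<L> B"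
    and mem: "\<And>a. a \<in> elts A \<Longrightarrow> wcomp \<kappa> \<rho> a \<in> elts B"
    and \<kappa>: "\<And>k. norm (\<kappa> k) \<le> 1" and \<rho>: "\<And>L. L \<in> \<L> \<Longrightarrow> \<exists>K\<in>\<K>. \<forall>k\<in>L. \<kappa> k \<noteq> 0 \<longrightarrow> \<rho> k \<in> K"
  shows "weighted_composition S \<K> A T \<L> B \<kappa> \<rho>"
proof -
  interpret A: sup_algebra S \<K> A by (rule A)
  interpret B: sup_algebra T \<L> B by (rule B)
  show ?thesis
  proof
    show "wcomp \<kappa> \<rho> a \<in> elts B" if "a \<in> elts A" for a by (rule mem[OF that])
    fix L assume "L \<in> \<L>"
    then obtain K where K: "K \<in> \<K>" "\<forall>k\<in>L. \<kappa> k \<noteq> 0 \<longrightarrow> \<rho> k \<in> K" using \<rho> by blast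
    have "supnorm L (wcomp \<kappa> \<rho> a) \<le> 1 * supnorm K a" if "a \<in> elts A" for a
      using supnorm_wcomp[where L=L and \<rho>=\<rho>, OF A.elts_bounded[OF that K(1)] \<kappa>] K(2) by simp
    then show "\<exists>K\<in>\<K>. \<exists>C\<ge>0. \<forall>a\<in>elts A. supnorm L (wcomp \<kappa> \<rho> a) \<le> C * supnorm K a"
      using K(1) by (intro bexI[of _ K] exI[of _ 1]) auto
  qed
qed

context smooth_mfd
begin

text \<open>What is needed in order that \<open>f \<mapsto> \<eta> \<cdot> (f \<circ> \<rho>)\<close> maps each of the three algebras over the fibre
continuously into the corresponding one over the tangent bundle: the condition on \<open>L\<close> bounds
the suprema over compact sets, and the one on \<open>K\<close> preserves vanishing at infinity.\<close>

definition fibre_cutoff :: "('m \<times> 'e \<Rightarrow> real) \<Rightarrow> ('m \<times> 'e \<Rightarrow> 'e) \<Rightarrow> bool" where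
  "fibre_cutoff \<eta> \<rho> \<longleftrightarrow> (\<forall>y. 0 \<le> \<eta> y \<and> \<eta> y \<le> 1) \<and> (\<forall>y. y \<notin> points TM \<longrightarrow> \<eta> y = 0) \<and>
     (\<forall>f :: 'e \<Rightarrow> complex. continuous_on UNIV f \<longrightarrow>
       continuous_map (mtop TM) euclidean (\<lambda>y. complex_of_real (\<eta> y) * f (\<rho> y))) \<and>
     (\<forall>L. compactin (mtop TM) L \<longrightarrow> (\<exists>K. compact K \<and> (\<forall>y\<in>L. \<eta> y \<noteq> 0 \<longrightarrow> \<rho> y \<in> K))) \<and>
     (\<forall>K. compact K \<longrightarrow> (\<exists>L. compactin (mtop TM) L \<and> (\<forall>y. \<eta> y \<noteq> 0 \<longrightarrow> \<rho> y \<in> K \<longrightarrow> y \<in> L)))"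

lemma fibre_cutoff_range: "fibre_cutoff \<eta> \<rho> \<Longrightarrow> 0 \<le> \<eta> y \<and> \<eta> y \<le> 1"
  unfolding fibre_cutoff_def by blast

lemma fibre_cutoff_square:
  assumes "fibre_cutoff \<eta> \<rho>"
  shows "fibre_cutoff (\<lambda>y. (\<eta> y)\<^sup>2) \<rho>"
proof -
  have "continuous_map (mtop TM) euclidean (\<lambda>y. complex_of_real ((\<eta> y)\<^sup>2) * f (\<rho> y))"
    if "continuous_on UNIV f" for f :: "'e \<Rightarrow> complex"
  proof -
    have 1: "continuous_map (mtop TM) euclidean (\<lambda>y. complex_of_real (\<eta> y) * f (\<rho> y))"
      using assms that unfolding fibre_cutoff_def by blast
    \<comment> \<open>The constant function 1 recovers continuity of \<open>\<eta>\<close>.\<close>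
    have "continuous_on UNIV (\<lambda>_::'e. 1::complex)" by simp
    then have 2: "continuous_map (mtop TM) euclidean (\<lambda>y. complex_of_real (\<eta> y) * 1)"
      using assms unfolding fibre_cutoff_def by blast
    show ?thesis using continuous_map_binop[OF 2 1, of "(*)"]
      by (simp add: power2_eq_square mult.assoc continuous_on_mult continuous_on_fst continuous_on_snd continuous_on_id)
  qed
  then show ?thesis using assms unfolding fibre_cutoff_def by (simp add: power_le_one)
qed

lemma fibre_cutoff_exists:
  assumes "p \<in> points M"
  shows "\<exists>\<eta> \<rho>. fibre_cutoff \<eta> \<rho> \<and> (\<forall>\<xi>. \<eta> (fibre_incl p \<xi>) = 1 \<and> \<rho> (fibre_incl p \<xi>) = \<xi>)"
  by (rule fibre_retraction[OF assms]) (unfold fibre_cutoff_def, blast)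

lemma extension_cfuns:
  assumes "fibre_cutoff \<eta> \<rho>" "f \<in> cfuns (euclidean :: 'e topology)"
  shows "wcomp (\<lambda>y. complex_of_real (\<eta> y)) \<rho> f \<in> cfuns (mtop TM)"
  using assms unfolding fibre_cutoff_def cfuns_def wcomp_def by auto

lemma restriction_cfuns:
  assumes "p \<in> points M" "f \<in> cfuns (mtop TM)"
  shows "wcomp (\<lambda>_. 1) (fibre_incl p) f \<in> cfuns euclidean"
proof -
  have "continuous_map (mtop TM) euclidean f" using assms(2) unfolding cfuns_def by blast
  from continuous_map_compose[OF fibre_incl_continuous[OF assms(1)] this]
  show ?thesis unfolding cfuns_def wcomp_def by (simp add: o_def)
qed

end

lemma sup_algebra_C0_euclidean:
  "sup_algebra euclidean {L. compactin euclidean L} (C0 (euclidean :: 'e::euclidean_space topology))"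
proof (rule sup_algebra_C0)
  fix x :: 'e
  show "\<exists>U K. openin euclidean U \<and> x \<in> U \<and> U \<subseteq> K \<and> compactin euclidean K"
    by (intro exI[of _ "ball x 1"] exI[of _ "cball x 1"]) auto
qed

lemma fibre_restrict_wcomp: "fibre_restrict p = wcomp (\<lambda>_. 1) (fibre_incl p)"
  by (intro ext) (simp add: fibre_restrict_def wcomp_def)

context vertical_action
begin

lemma sup_algebra_C0_TM: "sup_algebra (mtop TM) {L. compactin (mtop TM) L} (C0 (mtop TM))"
proof (rule sup_algebra_C0)
  fix y assume "y \<in> points TM"
  from invariant_compact_neighbourhood[OF this]
  obtain U K where "openin (mtop TM) U" "y \<in> U" "U \<subseteq> K" "compactin (mtop TM) K" by (elim exE conjE)
  then show "\<exists>U K. openin (mtop TM) U \<and> y \<in> U \<and> U \<subseteq> K \<and> compactin (mtop TM) K" by (intro exI conjI)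
qed

text \<open>The hypothesis \<open>inv\<close> bounds the orbit maps. It holds trivially when \<open>\<K>\<close> consists of the whole space, and by
\<open>invariant_compact\<close> when \<open>\<K>\<close> consists of the compact sets.\<close>

lemma equivariant_retract_fibre:
  assumes p: "p \<in> points M" and W: "lattice_partition W \<phi>"
    and res: "weighted_composition (mtop TM) \<K> A euclidean \<L> B (\<lambda>_. 1) (fibre_incl p)"
    and extend: "weighted_composition euclidean \<L> B (mtop TM) \<K> A (\<lambda>y. complex_of_real (\<eta> y)) \<rho>"
      "weighted_composition euclidean \<L> B (mtop TM) \<K> A (\<lambda>y. complex_of_real ((\<eta> y)\<^sup>2)) \<rho>"
    and ret: "\<forall>\<xi>. \<eta> (fibre_incl p \<xi>) = 1 \<and> \<rho> (fibre_incl p \<xi>) = \<xi>"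
    and inv: "\<And>L. L \<in> \<K> \<Longrightarrow> \<exists>K\<in>\<K>. L \<subseteq> K \<and> (\<forall>v. \<forall>n\<in>K. \<psi> v n \<in> K)"
  shows "equivariant_retract (mtop TM) \<K> A euclidean \<L> B (fibre_incl p) W \<phi>
    (induced_action TM X) (induced_action vector_mfd (\<lambda>i. fibre_field M p (X i))) (fibre_restrict p) \<eta> \<rho>"
proof -
  interpret res: weighted_composition "mtop TM" \<K> A euclidean \<L> B "\<lambda>_. 1" "fibre_incl p" by (rule res)
  show ?thesis
  proof (intro equivariant_retract.intro equivariant_restriction.intro equivariant_restriction_axioms.intro
      equivariant_retract_axioms.intro res extend W)
    show "fibre_restrict p = wcomp (\<lambda>_. 1) (fibre_incl p)" by (rule fibre_restrict_wcomp)
    show "induced_action vector_mfd (\<lambda>i. fibre_field M p (X i)) v (fibre_restrict p a) =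
      fibre_restrict p (induced_action TM X v a)" for v a by (rule induced_action_equivariant[OF p])
    show "induced_action TM X v (b - a) = induced_action TM X v b - induced_action TM X v a" for v a b
      by (rule ext) (simp add: induced_action_def fun_diff_def)
    show "res.dom.smooth_bound (\<lambda>_. 1) (\<lambda>v. induced_action TM X v a)" if "a \<in> smooth_vectors A (induced_action TM X)" for a
      by (rule res.dom.orbit_smooth_bound[where \<psi>=\<psi>, OF action_points action_0 action_add induced_action_TM inv that])
  qed (use ret in auto)
qed

lemma C0_restriction:
  assumes p: "p \<in> points M"
  shows "weighted_composition (mtop TM) {L. compactin (mtop TM) L} (C0 (mtop TM))
     euclidean {L. compactin euclidean L} (C0 euclidean) (\<lambda>_. 1) (fibre_incl p)"
proof (rule weighted_compositionI[OF sup_algebra_C0_TM sup_algebra_C0_euclidean])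
  show "wcomp (\<lambda>_. 1) (fibre_incl p) a \<in> elts (C0 euclidean)" if "a \<in> elts (C0 (mtop TM))" for a
    using restriction_cfuns[OF p] that by (simp add: C0_def)
  show "\<exists>K\<in>{L. compactin (mtop TM) L}. \<forall>k\<in>L. (1::complex) \<noteq> 0 \<longrightarrow> fibre_incl p k \<in> K"
    if "L \<in> {L. compactin euclidean L}" for L
    using image_compactin[OF _ fibre_incl_continuous[OF p]] that by (intro bexI[of _ "fibre_incl p ` L"]) auto
qed simp

lemma C0_extension:
  assumes "fibre_cutoff \<eta> \<rho>"
  shows "weighted_composition euclidean {L. compactin euclidean L} (C0 euclidean)
     (mtop TM) {L. compactin (mtop TM) L} (C0 (mtop TM)) (\<lambda>y. complex_of_real (\<eta> y)) \<rho>"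
proof (rule weighted_compositionI[OF sup_algebra_C0_euclidean sup_algebra_C0_TM])
  show "wcomp (\<lambda>y. complex_of_real (\<eta> y)) \<rho> a \<in> elts (C0 (mtop TM))" if "a \<in> elts (C0 euclidean)" for a
    using extension_cfuns[OF assms] that by (simp add: C0_def)
  show "norm (complex_of_real (\<eta> y)) \<le> 1" for y using fibre_cutoff_range[OF assms, of y] by simp
  show "\<exists>K\<in>{L. compactin euclidean L}. \<forall>y\<in>L. complex_of_real (\<eta> y) \<noteq> 0 \<longrightarrow> \<rho> y \<in> K"
    if "L \<in> {L. compactin (mtop TM) L}" for L
  proof -
    obtain K where "compact K" "\<forall>y\<in>L. \<eta> y \<noteq> 0 \<longrightarrow> \<rho> y \<in> K"
      using assms \<open>L \<in> _\<close> unfolding fibre_cutoff_def by blast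
    then show ?thesis by (intro bexI[of _ K]) auto
  qed
qed

lemma C0b_restriction:
  assumes p: "p \<in> points M"
  shows "weighted_composition (mtop TM) {points TM} (C0b (mtop TM)) euclidean {topspace euclidean} (C0b euclidean) (\<lambda>_. 1) (fibre_incl p)"
proof (rule weighted_compositionI[OF sup_algebra_C0b sup_algebra_C0b])
  show "wcomp (\<lambda>_. 1) (fibre_incl p) a \<in> elts (C0b euclidean)" if "a \<in> elts (C0b (mtop TM))" for a
    using restriction_cfuns[OF p] that p unfolding C0b_iff by (auto simp: wcomp_def fibre_incl_def TM_topspace)
qed (use p in \<open>auto simp: fibre_incl_def TM_topspace\<close>)

lemma C0b_extension:
  assumes "fibre_cutoff \<eta> \<rho>"
  shows "weighted_composition euclidean {topspace euclidean} (C0b euclidean) (mtop TM) {points TM} (C0b (mtop TM)) (\<lambda>y. complex_of_real (\<eta> y)) \<rho>"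
proof (rule weighted_compositionI[OF sup_algebra_C0b sup_algebra_C0b])
  have \<eta>: "0 \<le> \<eta> y" "\<eta> y \<le> 1" for y using fibre_cutoff_range[OF assms] by auto
  show "norm (complex_of_real (\<eta> y)) \<le> 1" for y using \<eta> by simp
  fix a assume "a \<in> elts (C0b (euclidean :: 'e topology))"
  then obtain C where a: "a \<in> cfuns euclidean" "\<forall>x. norm (a x) \<le> C" unfolding C0b_iff by auto
  have "norm (wcomp (\<lambda>y. complex_of_real (\<eta> y)) \<rho> a y) \<le> 1 * C" for y
    unfolding wcomp_def norm_mult using \<eta> a(2) by (intro mult_mono) auto
  then show "wcomp (\<lambda>y. complex_of_real (\<eta> y)) \<rho> a \<in> elts (C0b (mtop TM))"
    unfolding C0b_iff using extension_cfuns[OF assms a(1)] by blast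
qed auto

text \<open>Vanishing at infinity survives because the inclusion of the fibre is proper (\<open>fibre_vimage_compact\<close>).\<close>

lemma C0inf_restriction:
  assumes p: "p \<in> points M"
  shows "weighted_composition (mtop TM) {points TM} (C0inf (mtop TM)) euclidean {topspace euclidean} (C0inf euclidean) (\<lambda>_. 1) (fibre_incl p)"
proof (rule weighted_compositionI[OF sup_algebra_C0inf sup_algebra_C0inf])
  fix a assume a: "a \<in> elts (C0inf (mtop TM))"
  show "wcomp (\<lambda>_. 1) (fibre_incl p) a \<in> elts (C0inf euclidean)" unfolding C0inf_iff
  proof (intro conjI allI impI)
    show "wcomp (\<lambda>_. 1) (fibre_incl p) a \<in> cfuns euclidean" using restriction_cfuns[OF p] a unfolding C0inf_iff by blast
    fix \<epsilon> :: real assume "\<epsilon> > 0"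
    then obtain K where K: "compactin (mtop TM) K" "\<forall>x\<in>points TM - K. norm (a x) < \<epsilon>"
      using a unfolding C0inf_iff by blast
    have "norm (wcomp (\<lambda>_. 1) (fibre_incl p) a \<xi>) < \<epsilon>" if "\<xi> \<notin> fibre_incl p -` K" for \<xi>
      using K(2) that p by (auto simp: wcomp_def fibre_incl_def TM_topspace)
    then show "\<exists>K. compactin euclidean K \<and> (\<forall>\<xi>\<in>topspace euclidean - K. norm (wcomp (\<lambda>_. 1) (fibre_incl p) a \<xi>) < \<epsilon>)"
      using fibre_vimage_compact[OF p K(1)] by (intro exI[of _ "fibre_incl p -` K"]) auto
  qed
qed (use p in \<open>auto simp: fibre_incl_def TM_topspace\<close>)

lemma C0inf_extension:
  assumes ex: "fibre_cutoff \<eta> \<rho>"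
  shows "weighted_composition euclidean {topspace euclidean} (C0inf euclidean) (mtop TM) {points TM} (C0inf (mtop TM)) (\<lambda>y. complex_of_real (\<eta> y)) \<rho>"
proof (rule weighted_compositionI[OF sup_algebra_C0inf sup_algebra_C0inf])
  have \<eta>: "0 \<le> \<eta> y" "\<eta> y \<le> 1" for y using fibre_cutoff_range[OF ex] by auto
  show "norm (complex_of_real (\<eta> y)) \<le> 1" for y using \<eta> by simp
  fix a assume a: "a \<in> elts (C0inf (euclidean :: 'e topology))"
  show "wcomp (\<lambda>y. complex_of_real (\<eta> y)) \<rho> a \<in> elts (C0inf (mtop TM))" unfolding C0inf_iff
  proof (intro conjI allI impI)
    show "wcomp (\<lambda>y. complex_of_real (\<eta> y)) \<rho> a \<in> cfuns (mtop TM)"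
      using extension_cfuns[OF ex] a unfolding C0inf_iff by blast
    fix \<epsilon> :: real assume e: "\<epsilon> > 0"
    then obtain K where K: "compact K" "\<forall>x. x \<notin> K \<longrightarrow> norm (a x) < \<epsilon>"
      using a unfolding C0inf_iff by auto
    obtain L where L: "compactin (mtop TM) L" "\<forall>y. \<eta> y \<noteq> 0 \<longrightarrow> \<rho> y \<in> K \<longrightarrow> y \<in> L"
      using ex K(1) unfolding fibre_cutoff_def by blast
    have "norm (wcomp (\<lambda>y. complex_of_real (\<eta> y)) \<rho> a y) < \<epsilon>" if "y \<notin> L" for y
    proof (cases "\<eta> y = 0")
      case False
      then have "norm (a (\<rho> y)) < \<epsilon>" using L(2) that K(2) by blast
      moreover have "\<eta> y * norm (a (\<rho> y)) \<le> 1 * norm (a (\<rho> y))" using \<eta> by (intro mult_right_mono) auto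
      ultimately show ?thesis using \<eta> by (simp add: wcomp_def norm_mult)
    qed (use e in \<open>simp add: wcomp_def\<close>)
    then show "\<exists>K. compactin (mtop TM) K \<and> (\<forall>x\<in>points TM - K. norm (wcomp (\<lambda>y. complex_of_real (\<eta> y)) \<rho> a x) < \<epsilon>)"
      using L(1) by blast
  qed
qed auto

lemma fibre_restriction_morphism:
  assumes p: "p \<in> points M" and W: "lattice_partition W \<phi>"
  defines "\<alpha> \<equiv> induced_action TM X" and "\<alpha>p \<equiv> induced_action vector_mfd (\<lambda>i. fibre_field M p (X i))"
  shows "deformed_star_hom W \<phi> \<Theta> (C0 (mtop TM)) \<alpha> (C0 euclidean) \<alpha>p (fibre_restrict p) \<and>
     continuous_map
       (deformed_topology (C0 (mtop TM)) (cstar_seminorms (C0 (mtop TM))) W \<phi> \<Theta> \<alpha>)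
       (deformed_topology (C0 euclidean) (cstar_seminorms (C0 euclidean)) W \<phi> \<Theta> \<alpha>p)
       (fibre_restrict p)" (is ?C0)
    and "deformed_star_hom W \<phi> \<Theta> (C0b (mtop TM)) \<alpha> (C0b euclidean) \<alpha>p (fibre_restrict p) \<and>
     continuous_map
       (deformed_topology (C0b (mtop TM)) {supnorm (points TM)} W \<phi> \<Theta> \<alpha>)
       (deformed_topology (C0b euclidean) {supnorm UNIV} W \<phi> \<Theta> \<alpha>p)
       (fibre_restrict p)" (is ?C0b)
    and "deformed_star_hom W \<phi> \<Theta> (C0inf (mtop TM)) \<alpha> (C0inf euclidean) \<alpha>p (fibre_restrict p) \<and>
     continuous_map
       (deformed_topology (C0inf (mtop TM)) {supnorm (points TM)} W \<phi> \<Theta> \<alpha>)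
       (deformed_topology (C0inf euclidean) {supnorm UNIV} W \<phi> \<Theta> \<alpha>p)
       (fibre_restrict p)" (is ?C0inf)
proof -
  obtain \<eta> \<rho> where ex: "fibre_cutoff \<eta> \<rho>" and ret: "\<forall>\<xi>. \<eta> (fibre_incl p \<xi>) = 1 \<and> \<rho> (fibre_incl p \<xi>) = \<xi>"
    using fibre_cutoff_exists[OF p] by blast
  note ex2 = fibre_cutoff_square[OF ex]
  have \<eta>1: "norm (complex_of_real ((\<eta> y)\<^sup>2)) \<le> 1" for y
    unfolding norm_of_real using fibre_cutoff_range[OF ex2, of y] by simp
  interpret C0: equivariant_retract "mtop TM" "{L. compactin (mtop TM) L}" "C0 (mtop TM)"
      euclidean "{L. compactin euclidean L}" "C0 euclidean" "fibre_incl p" W \<phi> \<Theta> \<alpha> \<alpha>p "fibre_restrict p" \<eta> \<rho>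
    unfolding \<alpha>_def \<alpha>p_def
  proof (rule equivariant_retract_fibre[OF p W C0_restriction[OF p] C0_extension[OF ex] C0_extension[OF ex2] ret])
    show "\<exists>K\<in>{L. compactin (mtop TM) L}. L \<subseteq> K \<and> (\<forall>v. \<forall>n\<in>K. \<psi> v n \<in> K)" if "L \<in> {L. compactin (mtop TM) L}" for L
      using invariant_compact[of L] that by simp
  qed
  have invTM: "\<exists>K\<in>{points TM}. L \<subseteq> K \<and> (\<forall>v. \<forall>n\<in>K. \<psi> v n \<in> K)" if "L \<in> {points TM}" for L
    using that action_points by simp
  interpret C0b: equivariant_retract "mtop TM" "{points TM}" "C0b (mtop TM)"
      euclidean "{topspace euclidean}" "C0b euclidean" "fibre_incl p" W \<phi> \<Theta> \<alpha> \<alpha>p "fibre_restrict p" \<eta> \<rho>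
    unfolding \<alpha>_def \<alpha>p_def
    by (rule equivariant_retract_fibre[OF p W C0b_restriction[OF p] C0b_extension[OF ex] C0b_extension[OF ex2] ret invTM])
  interpret C0inf: equivariant_retract "mtop TM" "{points TM}" "C0inf (mtop TM)"
      euclidean "{topspace euclidean}" "C0inf euclidean" "fibre_incl p" W \<phi> \<Theta> \<alpha> \<alpha>p "fibre_restrict p" \<eta> \<rho>
    unfolding \<alpha>_def \<alpha>p_def
    by (rule equivariant_retract_fibre[OF p W C0inf_restriction[OF p] C0inf_extension[OF ex] C0inf_extension[OF ex2] ret invTM])
  have sup_res: "supnorm UNIV (fibre_restrict p a) \<le> supnorm (points TM) a" if "\<exists>C. \<forall>x\<in>points TM. norm (a x) \<le> C" for a
    unfolding fibre_restrict_wcomp by (rule supnorm_wcomp[OF that]) (use p in \<open>auto simp: fibre_incl_def TM_topspace\<close>)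
  have sup_ext: "supnorm (points TM) (wcomp (\<lambda>y. complex_of_real ((\<eta> y)\<^sup>2)) \<rho> b) \<le> supnorm UNIV b"
    if "\<exists>C. \<forall>x\<in>UNIV. norm (b x) \<le> C" for b
    by (rule supnorm_wcomp[OF that \<eta>1]) auto
  show ?C0
  proof (intro conjI C0.star_hom C0.continuous_deformed_topology)
    fix q' assume q': "q' \<in> cstar_seminorms (C0 (euclidean :: 'e topology))"
    \<comment> \<open>Both inequalities hold with equality for this seminorm, because restriction undoes extension.\<close>
    let ?q = "\<lambda>a. q' (fibre_restrict p a)"
    have mem: "fibre_restrict p a \<in> elts (C0 euclidean)" if "a \<in> elts (C0 (mtop TM))" for a
      unfolding fibre_restrict_wcomp by (rule C0.res.wcomp_mem[OF that])
    have hom: "fibre_restrict p (a + b) = fibre_restrict p a + fibre_restrict p b"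
      "fibre_restrict p (a * b) = fibre_restrict p a * fibre_restrict p b"
      "fibre_restrict p (\<lambda>x. c * a x) = (\<lambda>x. c * fibre_restrict p a x)"
      "fibre_restrict p (\<lambda>x. cnj (a x) * a x) = (\<lambda>x. cnj (fibre_restrict p a x) * fibre_restrict p a x)" for a b c
      by (auto simp: fibre_restrict_def plus_fun_def times_fun_def)
    have "dominated (C0 (euclidean :: 'e topology)) q'" using q' unfolding cstar_seminorms_def by blast
    from C0.res.dominated_comp[OF this]
    have dom: "dominated (C0 (mtop TM)) ?q" unfolding fibre_restrict_wcomp .
    have "?q \<in> cstar_seminorms (C0 (mtop TM))"
      using q' dom mem unfolding cstar_seminorms_def mem_Collect_eq hom by blast
    moreover have "fibre_restrict p (wcomp (\<lambda>y. complex_of_real ((\<eta> y)\<^sup>2)) \<rho> b) = b" for b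
      using ret by (intro ext) (simp add: fibre_restrict_def wcomp_def)
    ultimately show "\<exists>q\<in>cstar_seminorms (C0 (mtop TM)). (\<forall>a\<in>elts (C0 (mtop TM)). q' (fibre_restrict p a) \<le> q a) \<and>
        (\<forall>b\<in>elts (C0 euclidean). q (wcomp (\<lambda>y. complex_of_real ((\<eta> y)\<^sup>2)) \<rho> b) \<le> q' b)"
      by (intro bexI[of _ ?q]) auto
  qed
  show ?C0b
  proof (intro conjI C0b.star_hom C0b.continuous_deformed_topology)
    fix q' assume "q' \<in> {supnorm (UNIV :: 'e set)}"
    then show "\<exists>q\<in>{supnorm (points TM)}. (\<forall>a\<in>elts (C0b (mtop TM)). q' (fibre_restrict p a) \<le> q a) \<and>
        (\<forall>b\<in>elts (C0b euclidean). q (wcomp (\<lambda>y. complex_of_real ((\<eta> y)\<^sup>2)) \<rho> b) \<le> q' b)"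
      using sup_res sup_ext by (simp add: C0b_iff)
  qed
  show ?C0inf
  proof (intro conjI C0inf.star_hom C0inf.continuous_deformed_topology)
    fix q' assume "q' \<in> {supnorm (UNIV :: 'e set)}"
    then show "\<exists>q\<in>{supnorm (points TM)}. (\<forall>a\<in>elts (C0inf (mtop TM)). q' (fibre_restrict p a) \<le> q a) \<and>
        (\<forall>b\<in>elts (C0inf euclidean). q (wcomp (\<lambda>y. complex_of_real ((\<eta> y)\<^sup>2)) \<rho> b) \<le> q' b)"
      using sup_res sup_ext C0inf_bounded[of _ "mtop TM"] C0inf_bounded[of _ "euclidean :: 'e topology"] by simp
  qed
qed

end

theorem proposition4p4:
  fixes M :: "('m, 'e::euclidean_space) mfd"
    and U :: "('m \<times> 'e) set"
    and \<theta> :: "'m \<times> 'e \<Rightarrow> ('e \<times> 'e) bivector"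
    and \<psi> :: "(real, 'd::{finite,linorder}) vec \<Rightarrow> 'm \<times> 'e \<Rightarrow> 'm \<times> 'e"
    and X :: "'d \<Rightarrow> ('m \<times> 'e, 'e \<times> 'e) field"
    and \<Theta> :: "((real, 'd) vec, 'd) vec"
    and p :: 'm
    and W :: "((real, 'd) vec \<times> (real, 'd) vec) set"
    and \<phi> :: "(real, 'd) vec \<times> (real, 'd) vec \<Rightarrow> real"
  defines "TM \<equiv> tangent_bundle M"
    and "TpM \<equiv> (vector_mfd :: ('e, 'e) mfd)"
    and "\<alpha> \<equiv> induced_action (tangent_bundle M) X"
    and "\<alpha>p \<equiv> induced_action vector_mfd (\<lambda>i. fibre_field M p (X i))"
  assumes "smooth_manifold M"
    and "openin (mtop TM) U" and "\<forall>x\<in>points M. (x, 0) \<in> U"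
    and "vertical_poisson M \<theta>"
    and "admissible_via M U \<theta> \<psi> X \<Theta>"
    and "p \<in> points M"
    and "lattice_partition W \<phi>"
  shows
    "deformed_star_hom W \<phi> \<Theta> (C0 (mtop TM)) \<alpha> (C0 (mtop TpM)) \<alpha>p (fibre_restrict p) \<and>
     continuous_map
       (deformed_topology (C0 (mtop TM)) (cstar_seminorms (C0 (mtop TM))) W \<phi> \<Theta> \<alpha>)
       (deformed_topology (C0 (mtop TpM)) (cstar_seminorms (C0 (mtop TpM))) W \<phi> \<Theta> \<alpha>p)
       (fibre_restrict p) \<and>
     deformed_star_hom W \<phi> \<Theta> (C0b (mtop TM)) \<alpha> (C0b (mtop TpM)) \<alpha>p (fibre_restrict p) \<and>
     continuous_map
       (deformed_topology (C0b (mtop TM)) {supnorm (points TM)} W \<phi> \<Theta> \<alpha>)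
       (deformed_topology (C0b (mtop TpM)) {supnorm (points TpM)} W \<phi> \<Theta> \<alpha>p)
       (fibre_restrict p) \<and>
     deformed_star_hom W \<phi> \<Theta> (C0inf (mtop TM)) \<alpha> (C0inf (mtop TpM)) \<alpha>p (fibre_restrict p) \<and>
     continuous_map
       (deformed_topology (C0inf (mtop TM)) {supnorm (points TM)} W \<phi> \<Theta> \<alpha>)
       (deformed_topology (C0inf (mtop TpM)) {supnorm (points TpM)} W \<phi> \<Theta> \<alpha>p)
       (fibre_restrict p)"
proof -
  have adm: "smooth_action (tangent_bundle M) \<psi>" "\<forall>v. \<forall>y\<in>points (tangent_bundle M). fst (\<psi> v y) = fst y"
    "fundamental_fields (tangent_bundle M) \<psi> X"
    "\<forall>i. \<forall>p\<in>points M. compactin (mtop (tangent_bundle M)) (field_support (tangent_bundle M) (X i) \<inter> range (fibre_incl p))"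
    using \<open>admissible_via M U \<theta> \<psi> X \<Theta>\<close> unfolding admissible_via_def by blast+
  interpret vertical_action M \<psi> X
    by unfold_locales (use \<open>smooth_manifold M\<close> adm in blast)+
  show ?thesis
    using fibre_restriction_morphism[OF \<open>p \<in> points M\<close> \<open>lattice_partition W \<phi>\<close>, of \<Theta>]
    unfolding TM_def TpM_def \<alpha>_def \<alpha>p_def by simp
qed

end
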